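(* Let $k$ be an algebraically closed field of characteristic $p>0$, $G$ a finite diagonalizable group scheme over $k$, and $X$ a $G$-normal curve over $k$ on which $G$ acts faithfully, with quotient $\pi : X \to Y = X/G$. Then the relative canonical sheaf $\omega_{X/Y}$ is equipped with a $G$-linearization and a $G$-invariant global section $s_{X/Y}$ (described in the context) such that $$\mathrm{div}(s_{X/Y}) = \sum \big( \vert \mathrm{Stab}_G(x)\vert - 1 \big)\, G\cdot x,$$ where the sum runs over the $G$-orbits of $k$-rational points $x$ of $X$.
   Context: Schemes are separated and of finite type over $k$; a variety is a geometrically integral scheme, and a curve is a variety of dimension $1$. The order $\vert H\vert$ of a finite group scheme $H$ is $\dim_k \mathcal{O}(H)$. A $G$-variety $X$ is $G$-normal if every finite birational $G$-equivariant morphism of $G$-varieties $X' \to X$ is an isomorphism. The orbit $G\cdot x$ is the smallest closed $G$-stable subscheme of $X$ containing $x$ (the schematic image of $G\times x \to X$); for a $G$-normal curve it is an effective Cartier divisor. Under the hypotheses, $Y$ is a smooth curve and the finite morphism $\pi$ is flat and a local complete intersection; $\omega_{X/Y}$ is invertible and identified with the dualizing sheaf $\omega_\pi$, the $\mathcal{O}_X$-module corresponding to the $\pi_*(\mathcal{O}_X)$-module $\mathcal{H}om_{\mathcal{O}_Y}(\pi_*(\mathcal{O}_X),\mathcal{O}_Y)$, with its natural $G$-linearization (for which evaluation at $1$ is an invariant trace map). The section $s_{X/Y} \in \Gamma(X,\omega_{X/Y}) = \mathrm{Hom}_{\mathcal{O}_Y}(\pi_*(\mathcal{O}_X),\mathcal{O}_Y)$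 is the unique $G$-invariant projection $\pi_*(\mathcal{O}_X)\to \pi_*(\mathcal{O}_X)^G = \mathcal{O}_Y$ (Reynolds operator). *)

theory Defs
  imports
    "HOL-Analysis.Analysis"
    "HOL-Library.Poly_Mapping"
    "HOL-Library.Extended_Nat"
    "HOL-Library.FuncSet"
    "HOL-Computational_Algebra.Computational_Algebra"
begin

section \<open>Ideals and localizations inside an ambient ring\<close>

definition is_subring :: "'a::comm_ring_1 set \<Rightarrow> bool" where
  "is_subring A \<longleftrightarrow> 0 \<in> A \<and> 1 \<in> A \<and> (\<forall>a\<in>A. \<forall>b\<in>A. a - b \<in> A \<and> a * b \<in> A)"

definition subring_gen :: "'a::comm_ring_1 set \<Rightarrow> 'a set" where
  "subring_gen S = \<Inter>{A. is_subring A \<and> S \<subseteq> A}"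

definition is_ideal :: "'a::comm_ring_1 set \<Rightarrow> 'a set \<Rightarrow> bool" where
  "is_ideal A I \<longleftrightarrow> I \<subseteq> A \<and> 0 \<in> I \<and> (\<forall>x\<in>I. \<forall>y\<in>I. x + y \<in> I) \<and> (\<forall>a\<in>A. \<forall>x\<in>I. a * x \<in> I)"

definition ideal_gen :: "'a::comm_ring_1 set \<Rightarrow> 'a set \<Rightarrow> 'a set" where
  "ideal_gen A S = \<Inter>{I. is_ideal A I \<and> S \<subseteq> I}"

definition is_prime_ideal :: "'a::comm_ring_1 set \<Rightarrow> 'a set \<Rightarrow> bool" where
  "is_prime_ideal A P \<longleftrightarrow>
     is_ideal A P \<and> 1 \<notin> P \<and> (\<forall>a\<in>A. \<forall>b\<in>A. a * b \<in> P \<longrightarrow> a \<in> P \<or> b \<in> P)"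

definition localization_at :: "'a::field set \<Rightarrow> 'a set \<Rightarrow> 'a set" where
  "localization_at A P = {a / b | a b. a \<in> A \<and> b \<in> A - P}"

definition finite_over :: "'a::comm_ring_1 set \<Rightarrow> 'a set \<Rightarrow> bool" where
  "finite_over B A \<longleftrightarrow> (\<exists>S. finite S \<and> S \<subseteq> A \<and>
     (\<forall>a\<in>A. \<exists>c. (\<forall>s\<in>S. c s \<in> B) \<and> a = (\<Sum>s\<in>S. c s * s)))"

definition zariski :: "'a::comm_ring_1 set \<Rightarrow> 'a set topology" where
  "zariski A = topology_generated_by {{P. is_prime_ideal A P \<and> f \<notin> P} | f. f \<in> A}"

section \<open>Integral schemes and varieties\<close>

text \<open>
  On an integral scheme all restriction maps between nonempty opens are injective and embed into
  the function field. An integral scheme is therefore presented by its underlying space together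
  with the subrings of sections of its nonempty opens in a fixed ambient field; restriction maps
  are inclusions. The value on the empty open is irrelevant.
\<close>

record ('x, 'f) ischeme =
  topo :: "'x topology"
  sec :: "'x set \<Rightarrow> 'f set"

abbreviation points :: "('x, 'f) ischeme \<Rightarrow> 'x set" where
  "points X \<equiv> topspace (topo X)"

definition nonempty_open :: "('x, 'f) ischeme \<Rightarrow> 'x set \<Rightarrow> bool" where
  "nonempty_open X U \<longleftrightarrow> openin (topo X) U \<and> U \<noteq> {}"

definition stalk :: "('x, 'f) ischeme \<Rightarrow> 'x \<Rightarrow> 'f set" where
  "stalk X x = \<Union>{sec X U | U. openin (topo X) U \<and> x \<in> U}"

definition stalk_units :: "('x, 'f::field) ischeme \<Rightarrow> 'x \<Rightarrow> 'f set" where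
  "stalk_units X x = {f \<in> stalk X x. f \<noteq> 0 \<and> inverse f \<in> stalk X x}"

definition max_ideal_at :: "('x, 'f::field) ischeme \<Rightarrow> 'x \<Rightarrow> 'f set" where
  "max_ideal_at X x = stalk X x - stalk_units X x"

definition function_field :: "('x, 'f) ischeme \<Rightarrow> 'f set" where
  "function_field X = \<Union>{sec X U | U. nonempty_open X U}"

text \<open>
  An open is affine iff the canonical map to the spectrum of its ring of sections is an
  isomorphism of ringed spaces. For a domain \<open>A\<close> the sections of the structure sheaf of the
  spectrum over a nonempty open \<open>V\<close> are the fractions lying in all local rings at points of \<open>V\<close>.
\<close>

definition affine_open :: "('x, 'f::field) ischeme \<Rightarrow> 'x set \<Rightarrow> bool" where
  "affine_open X U \<longleftrightarrow> nonempty_open X U \<and>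
     homeomorphic_map (subtopology (topo X) U) (zariski (sec X U)) (\<lambda>x. sec X U \<inter> max_ideal_at X x) \<and>
     (\<forall>V. nonempty_open X V \<and> V \<subseteq> U \<longrightarrow>
        sec X V = (\<Inter>x\<in>V. localization_at (sec X U) (sec X U \<inter> max_ideal_at X x)))"

definition integral_scheme :: "('x, 'f::field) ischeme \<Rightarrow> bool" where
  "integral_scheme X \<longleftrightarrow>
     points X \<noteq> {} \<and>
     (\<forall>U V. nonempty_open X U \<and> nonempty_open X V \<longrightarrow> U \<inter> V \<noteq> {}) \<and>
     (\<forall>U. nonempty_open X U \<longrightarrow> is_subring (sec X U)) \<and>
     (\<forall>\<U>. \<U> \<noteq> {} \<and> (\<forall>U\<in>\<U>. nonempty_open X U) \<longrightarrow> sec X (\<Union>\<U>) = (\<Inter>U\<in>\<U>. sec X U)) \<and>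
     (\<forall>x\<in>points X. \<exists>U. affine_open X U \<and> x \<in> U)"

definition irreducible_closed :: "'x topology \<Rightarrow> 'x set \<Rightarrow> bool" where
  "irreducible_closed T Z \<longleftrightarrow> closedin T Z \<and> Z \<noteq> {} \<and>
     (\<forall>A B. closedin T A \<and> closedin T B \<and> Z \<subseteq> A \<union> B \<longrightarrow> Z \<subseteq> A \<or> Z \<subseteq> B)"

definition krull_dim :: "'x topology \<Rightarrow> enat" where
  "krull_dim T = Sup {enat n | n. \<exists>Z. (\<forall>i\<le>n. irreducible_closed T (Z i)) \<and> (\<forall>i<n. Z i \<subset> Z (Suc i))}"

definition is_field_hom :: "('k::field \<Rightarrow> 'f::field) \<Rightarrow> bool" where
  "is_field_hom \<iota> \<longleftrightarrow> \<iota> 1 = 1 \<and> (\<forall>a b. \<iota> (a + b) = \<iota> a + \<iota> b \<and> \<iota> (a * b) = \<iota> a * \<iota> b)"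

text \<open>
  \<open>\<iota>\<close> is the embedding of the ground field \<open>k\<close> in the ambient field. The last clause says that
  the diagonal is a closed immersion, tested on the affine opens \<open>U \<times> V\<close> of the product: there it
  is the morphism from \<open>U \<inter> V\<close> given by multiplication of sections.
  Over an algebraically closed field, integral and geometrically integral are the same.
\<close>

definition variety :: "('k::alg_closed_field \<Rightarrow> 'f::field) \<Rightarrow> ('x, 'f) ischeme \<Rightarrow> bool" where
  "variety \<iota> X \<longleftrightarrow> is_field_hom \<iota> \<and> integral_scheme X \<and>
     (\<forall>U. nonempty_open X U \<longrightarrow> range \<iota> \<subseteq> sec X U) \<and>
     (\<exists>\<U>. finite \<U> \<and> \<Union>\<U> = points X \<and>
        (\<forall>U\<in>\<U>. affine_open X U \<and> (\<exists>S. finite S \<and> sec X U = subring_gen (range \<iota> \<union> S)))) \<and>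
     (\<forall>U V. affine_open X U \<and> affine_open X V \<longrightarrow>
        affine_open X (U \<inter> V) \<and> sec X (U \<inter> V) = subring_gen (sec X U \<union> sec X V))"

definition curve :: "('k::alg_closed_field \<Rightarrow> 'f::field) \<Rightarrow> ('x, 'f) ischeme \<Rightarrow> bool" where
  "curve \<iota> X \<longleftrightarrow> variety \<iota> X \<and> krull_dim (topo X) = 1"

definition rational_points :: "('k::alg_closed_field \<Rightarrow> 'f::field) \<Rightarrow> ('x, 'f) ischeme \<Rightarrow> 'x set" where
  "rational_points \<iota> X = {x \<in> points X. \<forall>f\<in>stalk X x. \<exists>c. f - \<iota> c \<in> max_ideal_at X x}"

definition value_at :: "('k::alg_closed_field \<Rightarrow> 'f::field) \<Rightarrow> ('x, 'f) ischeme \<Rightarrow> 'x \<Rightarrow> 'f \<Rightarrow> 'k" where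
  "value_at \<iota> X x f = (THE c. f - \<iota> c \<in> max_ideal_at X x)"

definition preim :: "('x, 'f) ischeme \<Rightarrow> ('x \<Rightarrow> 'y) \<Rightarrow> 'y set \<Rightarrow> 'x set" where
  "preim X \<phi> V = {x \<in> points X. \<phi> x \<in> V}"

text \<open>
  Dominant morphisms of integral schemes; the comorphism is the inclusion of sections inside the
  common ambient field.
\<close>

definition dominant_morphism ::
  "('x, 'f::field) ischeme \<Rightarrow> ('y, 'f) ischeme \<Rightarrow> ('x \<Rightarrow> 'y) \<Rightarrow> bool" where
  "dominant_morphism X Y \<phi> \<longleftrightarrow>
     continuous_map (topo X) (topo Y) \<phi> \<and>
     (\<forall>V. nonempty_open Y V \<longrightarrow> preim X \<phi> V \<noteq> {} \<and> sec Y V \<subseteq> sec X (preim X \<phi> V)) \<and>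
     (\<forall>x\<in>points X. max_ideal_at Y (\<phi> x) \<subseteq> max_ideal_at X x)"

definition finite_morphism ::
  "('x, 'f::field) ischeme \<Rightarrow> ('y, 'f) ischeme \<Rightarrow> ('x \<Rightarrow> 'y) \<Rightarrow> bool" where
  "finite_morphism X Y \<phi> \<longleftrightarrow> dominant_morphism X Y \<phi> \<and>
     (\<forall>V. affine_open Y V \<longrightarrow>
        affine_open X (preim X \<phi> V) \<and> finite_over (sec Y V) (sec X (preim X \<phi> V)))"

definition is_isomorphism ::
  "('x, 'f::field) ischeme \<Rightarrow> ('y, 'f) ischeme \<Rightarrow> ('x \<Rightarrow> 'y) \<Rightarrow> bool" where
  "is_isomorphism X Y \<phi> \<longleftrightarrow> homeomorphic_map (topo X) (topo Y) \<phi> \<and>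
     (\<forall>V. nonempty_open Y V \<longrightarrow> sec X (preim X \<phi> V) = sec Y V)"

section \<open>Actions of finite diagonalizable group schemes\<close>

text \<open>
  Let \<open>M\<close> be a finite abelian group, written additively and given by the type \<open>'m\<close>. The finite
  diagonalizable group scheme \<open>G\<close> with character group \<open>M\<close> is the spectrum of the group algebra
  \<open>k[M] = ('m \<Rightarrow>\<^sub>0 'k)\<close>, with product convolution, counit \<open>single m c \<mapsto> c\<close> and comultiplication
  \<open>single m 1 \<mapsto> single m 1 \<otimes> single m 1\<close>. For a \<open>k\<close>-algebra \<open>A\<close> the tensor product
  \<open>A \<otimes> k[M]\<close> is \<open>('m \<Rightarrow>\<^sub>0 A)\<close>, and \<open>f \<otimes> 1\<close> is \<open>single 0 f\<close>.

  The following predicate says that \<open>\<rho>\<close> is a \<open>k\<close>-algebra homomorphism from the function field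
  \<open>K\<close> to \<open>K \<otimes> k[M]\<close> that satisfies the counit and coassociativity axioms of a \<open>k[M]\<close>-comodule.
\<close>

definition coaction ::
  "('k::alg_closed_field \<Rightarrow> 'f::field) \<Rightarrow> ('f \<Rightarrow> ('m::{ab_group_add,finite} \<Rightarrow>\<^sub>0 'f)) \<Rightarrow> bool" where
  "coaction \<iota> \<rho> \<longleftrightarrow>
     (\<forall>f g. \<rho> (f + g) = \<rho> f + \<rho> g \<and> \<rho> (f * g) = \<rho> f * \<rho> g) \<and>
     (\<forall>c. \<rho> (\<iota> c) = Poly_Mapping.single 0 (\<iota> c)) \<and>
     (\<forall>f. (\<Sum>m\<in>UNIV. Poly_Mapping.lookup (\<rho> f) m) = f) \<and>
     (\<forall>f m. \<rho> (Poly_Mapping.lookup (\<rho> f) m) =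
              Poly_Mapping.single m (Poly_Mapping.lookup (\<rho> f) m))"

definition stable_affine ::
  "('x, 'f::field) ischeme \<Rightarrow> ('f \<Rightarrow> ('m::{ab_group_add,finite} \<Rightarrow>\<^sub>0 'f)) \<Rightarrow> 'x set \<Rightarrow> bool" where
  "stable_affine X \<rho> U \<longleftrightarrow> affine_open X U \<and>
     (\<forall>f\<in>sec X U. \<forall>m. Poly_Mapping.lookup (\<rho> f) m \<in> sec X U)"

text \<open>
  An action of \<open>G\<close> on an affine variety is a comodule algebra structure on its ring of sections,
  and extends uniquely to the function field. Hence an action on a variety covered by
  \<open>G\<close>-stable affine opens, as is needed for the quotient to exist (and always the case for curves),
  is a coaction on the function field that restricts to the sections of each member of such a cover.
\<close>

definition G_variety ::
  "('k::alg_closed_field \<Rightarrow> 'f::field) \<Rightarrow> ('x, 'f) ischeme \<Rightarrow>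
   ('f \<Rightarrow> ('m::{ab_group_add,finite} \<Rightarrow>\<^sub>0 'f)) \<Rightarrow> bool" where
  "G_variety \<iota> X \<rho> \<longleftrightarrow> variety \<iota> X \<and> function_field X = UNIV \<and> coaction \<iota> \<rho> \<and>
     (\<forall>x\<in>points X. \<exists>U. stable_affine X \<rho> U \<and> x \<in> U)"

text \<open>
  The kernel of the action is trivial: a closed subscheme of \<open>G\<close>, with ideal \<open>J\<close>, that acts
  trivially is contained in the neutral element. The ideal generated by the image of \<open>J\<close>
  is \<open>K \<otimes> J\<close>, and acting trivially means that \<open>\<rho> f\<close> and \<open>f \<otimes> 1\<close> agree modulo it.
\<close>

definition faithful_action ::
  "('k::alg_closed_field \<Rightarrow> 'f::field) \<Rightarrow> ('f \<Rightarrow> ('m::{ab_group_add,finite} \<Rightarrow>\<^sub>0 'f)) \<Rightarrow> bool" where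
  "faithful_action \<iota> \<rho> \<longleftrightarrow>
     (\<forall>J :: ('m \<Rightarrow>\<^sub>0 'k) set. is_ideal UNIV J \<and>
        (\<forall>f. \<rho> f - Poly_Mapping.single 0 f \<in> ideal_gen UNIV (Poly_Mapping.map \<iota> ` J)) \<longrightarrow>
        {h. (\<Sum>m\<in>UNIV. Poly_Mapping.lookup h m) = 0} \<subseteq> J)"

text \<open>
  For a birational morphism the function fields are identified, so that equivariance means that
  both coactions on the function field are the same.
\<close>

definition G_normal ::
  "('k::alg_closed_field \<Rightarrow> 'f::field) \<Rightarrow> ('x, 'f) ischeme \<Rightarrow>
   ('f \<Rightarrow> ('m::{ab_group_add,finite} \<Rightarrow>\<^sub>0 'f)) \<Rightarrow> bool" where
  "G_normal \<iota> X \<rho> \<longleftrightarrow>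
     (\<forall>(X' :: ('x, 'f) ischeme) \<phi>. G_variety \<iota> X' \<rho> \<and> finite_morphism X' X \<phi> \<longrightarrow> is_isomorphism X' X \<phi>)"

text \<open>
  \<open>orbit_map \<iota> X \<rho> x\<close> is the comorphism of \<open>G \<rightarrow> X, g \<mapsto> g \<cdot> x\<close> on the sections of a
  \<open>G\<close>-stable affine neighbourhood of the rational point \<open>x\<close>.
\<close>

definition orbit_map ::
  "('k::alg_closed_field \<Rightarrow> 'f::field) \<Rightarrow> ('x, 'f) ischeme \<Rightarrow>
   ('f \<Rightarrow> ('m::{ab_group_add,finite} \<Rightarrow>\<^sub>0 'f)) \<Rightarrow> 'x \<Rightarrow> 'f \<Rightarrow> ('m \<Rightarrow>\<^sub>0 'k)" where
  "orbit_map \<iota> X \<rho> x f = Poly_Mapping.map (value_at \<iota> X x) (\<rho> f)"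

text \<open>
  The stabilizer is the fibre at \<open>x\<close> of the orbit map, and the order of the finite scheme that an
  ideal of \<open>k[M]\<close> defines is the dimension of the quotient.
\<close>

definition stab_ideal ::
  "('k::alg_closed_field \<Rightarrow> 'f::field) \<Rightarrow> ('x, 'f) ischeme \<Rightarrow>
   ('f \<Rightarrow> ('m::{ab_group_add,finite} \<Rightarrow>\<^sub>0 'f)) \<Rightarrow> 'x \<Rightarrow> ('m \<Rightarrow>\<^sub>0 'k) set" where
  "stab_ideal \<iota> X \<rho> x = ideal_gen UNIV
     {orbit_map \<iota> X \<rho> x f | f U. stable_affine X \<rho> U \<and> x \<in> U \<and> f \<in> sec X U \<and> value_at \<iota> X x f = 0}"

definition quotient_dim :: "('m::{ab_group_add,finite} \<Rightarrow>\<^sub>0 'k::field) set \<Rightarrow> nat" where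
  "quotient_dim I =
     vector_space.dim (\<lambda>c h. Poly_Mapping.single 0 c * h) (UNIV :: ('m \<Rightarrow>\<^sub>0 'k) set) -
     vector_space.dim (\<lambda>c h. Poly_Mapping.single 0 c * h) I"

definition stab_order ::
  "('k::alg_closed_field \<Rightarrow> 'f::field) \<Rightarrow> ('x, 'f) ischeme \<Rightarrow>
   ('f \<Rightarrow> ('m::{ab_group_add,finite} \<Rightarrow>\<^sub>0 'f)) \<Rightarrow> 'x \<Rightarrow> nat" where
  "stab_order \<iota> X \<rho> x = quotient_dim (stab_ideal \<iota> X \<rho> x)"

text \<open>
  A \<open>G\<close>-stable closed subscheme is given by its ideals on the \<open>G\<close>-stable affine opens (with a dummy
  value elsewhere). The orbit is the schematic image of the orbit map; a stable open that does not
  contain \<open>x\<close> does not meet the orbit.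
\<close>

definition orbit ::
  "('k::alg_closed_field \<Rightarrow> 'f::field) \<Rightarrow> ('x, 'f) ischeme \<Rightarrow>
   ('f \<Rightarrow> ('m::{ab_group_add,finite} \<Rightarrow>\<^sub>0 'f)) \<Rightarrow> 'x \<Rightarrow> 'x set \<Rightarrow> 'f set" where
  "orbit \<iota> X \<rho> x U =
     (if stable_affine X \<rho> U then {f \<in> sec X U. x \<in> U \<longrightarrow> orbit_map \<iota> X \<rho> x f = 0} else {})"

text \<open>
  The sections of \<open>Y\<close> form a subsheaf of the direct image of the structure sheaf of \<open>X\<close>, namely the
  subsheaf of invariants. That preimages of affine opens are \<open>G\<close>-stable expresses that
  \<open>\<pi>\<close> is invariant.
\<close>

definition is_quotient ::
  "('k::alg_closed_field \<Rightarrow> 'f::field) \<Rightarrow> ('x, 'f) ischeme \<Rightarrow>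
   ('f \<Rightarrow> ('m::{ab_group_add,finite} \<Rightarrow>\<^sub>0 'f)) \<Rightarrow> ('y, 'f) ischeme \<Rightarrow> ('x \<Rightarrow> 'y) \<Rightarrow> bool" where
  "is_quotient \<iota> X \<rho> Y \<pi> \<longleftrightarrow> variety \<iota> Y \<and> finite_morphism X Y \<pi> \<and>
     (\<forall>V. affine_open Y V \<longrightarrow> stable_affine X \<rho> (preim X \<pi> V)) \<and>
     (\<forall>V. nonempty_open Y V \<longrightarrow>
        sec Y V = {f \<in> sec X (preim X \<pi> V). \<rho> f = Poly_Mapping.single 0 f})"

section \<open>Cartier divisors\<close>

text \<open>
  A Cartier divisor is a global section of the sheaf of units of the function field modulo units of
  the structure sheaf, given by its germs: the coset of local equations at each point.
\<close>

definition cartier_divisor :: "('x, 'f::field) ischeme \<Rightarrow> ('x \<Rightarrow> 'f set) \<Rightarrow> bool" where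
  "cartier_divisor X D \<longleftrightarrow>
     (\<forall>x\<in>points X. \<exists>U e. openin (topo X) U \<and> x \<in> U \<and> e \<in> function_field X \<and> e \<noteq> 0 \<and>
        (\<forall>z\<in>U. D z = {e * v | v. v \<in> stalk_units X z}))"

definition effective_cartier_divisor :: "('x, 'f::field) ischeme \<Rightarrow> ('x \<Rightarrow> 'f set) \<Rightarrow> bool" where
  "effective_cartier_divisor X D \<longleftrightarrow> cartier_divisor X D \<and> (\<forall>x\<in>points X. D x \<subseteq> stalk X x)"

definition divisor_sum ::
  "('x, 'f::field) ischeme \<Rightarrow> 'i set \<Rightarrow> ('i \<Rightarrow> nat) \<Rightarrow> ('i \<Rightarrow> 'x \<Rightarrow> 'f set) \<Rightarrow> 'x \<Rightarrow> 'f set" where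
  "divisor_sum X S n D x =
     {v * (\<Prod>i\<in>S. g i ^ n i) | v g. v \<in> stalk_units X x \<and> (\<forall>i\<in>S. g i \<in> D i x)}"

text \<open>The local equations of an orbit, seen as a closed subscheme.\<close>

definition orbit_divisor ::
  "('k::alg_closed_field \<Rightarrow> 'f::field) \<Rightarrow> ('x, 'f) ischeme \<Rightarrow>
   ('f \<Rightarrow> ('m::{ab_group_add,finite} \<Rightarrow>\<^sub>0 'f)) \<Rightarrow> 'x \<Rightarrow> 'x \<Rightarrow> 'f set" where
  "orbit_divisor \<iota> X \<rho> x z = {e. e \<noteq> 0 \<and> (\<exists>U. stable_affine X \<rho> U \<and> z \<in> U \<and>
     ideal_gen (stalk X z) {e} = ideal_gen (stalk X z) (orbit \<iota> X \<rho> x U))}"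

section \<open>The relative canonical sheaf\<close>

text \<open>
  For an affine open \<open>V\<close> of \<open>Y\<close> with preimage \<open>U\<close>, the module of sections of \<open>\<omega>\<^bsub>X/Y\<^esub>\<close> over \<open>U\<close> is
  the module of \<open>O(V)\<close>-linear maps from \<open>O(U)\<close> to \<open>O(V)\<close>, which are represented by functions that
  are undefined outside \<open>O(U)\<close>. The ring \<open>O(U)\<close> acts by \<open>(a \<cdot> w) f = w (a f)\<close>.
\<close>

definition omega ::
  "('x, 'f::field) ischeme \<Rightarrow> ('y, 'f) ischeme \<Rightarrow> ('x \<Rightarrow> 'y) \<Rightarrow> 'y set \<Rightarrow> ('f \<Rightarrow> 'f) set" where
  "omega X Y \<pi> V = {w \<in> sec X (preim X \<pi> V) \<rightarrow>\<^sub>E sec Y V.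
     \<forall>f\<in>sec X (preim X \<pi> V). \<forall>g\<in>sec X (preim X \<pi> V). \<forall>b\<in>sec Y V.
       w (f + g) = w f + w g \<and> w (b * f) = b * w f}"

definition omega_smult ::
  "('x, 'f::field) ischeme \<Rightarrow> ('x \<Rightarrow> 'y) \<Rightarrow> 'y set \<Rightarrow> 'f \<Rightarrow> ('f \<Rightarrow> 'f) \<Rightarrow> ('f \<Rightarrow> 'f)" where
  "omega_smult X \<pi> V a w = (\<lambda>f\<in>sec X (preim X \<pi> V). w (a * f))"

definition omega_add ::
  "('x, 'f::field) ischeme \<Rightarrow> ('x \<Rightarrow> 'y) \<Rightarrow> 'y set \<Rightarrow> ('f \<Rightarrow> 'f) \<Rightarrow> ('f \<Rightarrow> 'f) \<Rightarrow> ('f \<Rightarrow> 'f)" where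
  "omega_add X \<pi> V w w' = (\<lambda>f\<in>sec X (preim X \<pi> V). w f + w' f)"

definition omega_sum ::
  "('x, 'f::field) ischeme \<Rightarrow> ('x \<Rightarrow> 'y) \<Rightarrow> 'y set \<Rightarrow> ('i \<Rightarrow> 'f \<Rightarrow> 'f) \<Rightarrow> 'i set \<Rightarrow> ('f \<Rightarrow> 'f)" where
  "omega_sum X \<pi> V w S = (\<lambda>f\<in>sec X (preim X \<pi> V). \<Sum>i\<in>S. w i f)"

text \<open>
  A global section of \<open>\<omega>\<^bsub>X/Y\<^esub>\<close> is a homomorphism of sheaves from the direct image of the structure
  sheaf of \<open>X\<close> to that of \<open>Y\<close>. As restriction maps are inclusions, it is a single function on the
  function field.
\<close>

definition omega_global_section ::
  "('x, 'f::field) ischeme \<Rightarrow> ('y, 'f) ischeme \<Rightarrow> ('x \<Rightarrow> 'y) \<Rightarrow> ('f \<Rightarrow> 'f) \<Rightarrow> bool" where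
  "omega_global_section X Y \<pi> s \<longleftrightarrow>
     (\<forall>V. affine_open Y V \<longrightarrow> restrict s (sec X (preim X \<pi> V)) \<in> omega X Y \<pi> V)"

text \<open>
  A family \<open>c V w m\<close> stands for the maps \<open>w \<mapsto> \<Sum>m. c V w m \<otimes> single m 1\<close>. It is a
  \<open>G\<close>-linearization iff these are comodule structures, compatible with restriction to smaller opens
  and with the coaction on the structure sheaf.
\<close>

definition omega_linearization ::
  "('x, 'f::field) ischeme \<Rightarrow> ('f \<Rightarrow> ('m::{ab_group_add,finite} \<Rightarrow>\<^sub>0 'f)) \<Rightarrow>
   ('y, 'f) ischeme \<Rightarrow> ('x \<Rightarrow> 'y) \<Rightarrow> ('y set \<Rightarrow> ('f \<Rightarrow> 'f) \<Rightarrow> 'm \<Rightarrow> ('f \<Rightarrow> 'f)) \<Rightarrow> bool" where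
  "omega_linearization X \<rho> Y \<pi> c \<longleftrightarrow>
     (\<forall>V. affine_open Y V \<longrightarrow>
        (\<forall>w\<in>omega X Y \<pi> V. (\<forall>m. c V w m \<in> omega X Y \<pi> V) \<and>
           omega_sum X \<pi> V (c V w) UNIV = w \<and>
           (\<forall>m n. c V (c V w m) n = (if n = m then c V w m else (\<lambda>f\<in>sec X (preim X \<pi> V). 0)))) \<and>
        (\<forall>w w' m. w \<in> omega X Y \<pi> V \<and> w' \<in> omega X Y \<pi> V \<longrightarrow>
           c V (omega_add X \<pi> V w w') m = omega_add X \<pi> V (c V w m) (c V w' m)) \<and>
        (\<forall>w\<in>omega X Y \<pi> V. \<forall>a\<in>sec X (preim X \<pi> V). \<forall>m.
           c V (omega_smult X \<pi> V a w) m =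
           omega_sum X \<pi> V
             (\<lambda>n. omega_smult X \<pi> V (Poly_Mapping.lookup (\<rho> a) n) (c V w (m - n))) UNIV)) \<and>
     (\<forall>V V' w w'. affine_open Y V \<and> affine_open Y V' \<and> V' \<subseteq> V \<and>
        w \<in> omega X Y \<pi> V \<and> w' \<in> omega X Y \<pi> V' \<and>
        restrict w' (sec X (preim X \<pi> V)) = w \<longrightarrow>
        (\<forall>m. restrict (c V' w' m) (sec X (preim X \<pi> V)) = c V w m))"

text \<open>
  The natural linearization, by \<open>(g \<cdot> w) f = w (g\<^sup>-\<^sup>1 \<cdot> f)\<close>: the component of weight \<open>m\<close> of \<open>w\<close> is
  its composition with the projection to the component of weight \<open>-m\<close>.
\<close>

definition omega_coaction ::
  "('x, 'f::field) ischeme \<Rightarrow> ('f \<Rightarrow> ('m::{ab_group_add,finite} \<Rightarrow>\<^sub>0 'f)) \<Rightarrow>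
   ('x \<Rightarrow> 'y) \<Rightarrow> 'y set \<Rightarrow> ('f \<Rightarrow> 'f) \<Rightarrow> 'm \<Rightarrow> ('f \<Rightarrow> 'f)" where
  "omega_coaction X \<rho> \<pi> V w m =
     (\<lambda>f\<in>sec X (preim X \<pi> V). w (Poly_Mapping.lookup (\<rho> f) (- m)))"

text \<open>Evaluation at \<open>1\<close> is invariant for the linearization \<open>c\<close>.\<close>

definition trace_invariant ::
  "('x, 'f::field) ischeme \<Rightarrow> ('y, 'f) ischeme \<Rightarrow> ('x \<Rightarrow> 'y) \<Rightarrow>
   ('y set \<Rightarrow> ('f \<Rightarrow> 'f) \<Rightarrow> 'm::{ab_group_add,finite} \<Rightarrow> ('f \<Rightarrow> 'f)) \<Rightarrow> bool" where
  "trace_invariant X Y \<pi> c \<longleftrightarrow>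
     (\<forall>V m. affine_open Y V \<longrightarrow> (\<forall>w\<in>omega X Y \<pi> V. c V w m 1 = (if m = 0 then w 1 else 0)))"

definition invariant_section ::
  "('x, 'f::field) ischeme \<Rightarrow> ('y, 'f) ischeme \<Rightarrow> ('x \<Rightarrow> 'y) \<Rightarrow>
   ('y set \<Rightarrow> ('f \<Rightarrow> 'f) \<Rightarrow> 'm::{ab_group_add,finite} \<Rightarrow> ('f \<Rightarrow> 'f)) \<Rightarrow> ('f \<Rightarrow> 'f) \<Rightarrow> bool" where
  "invariant_section X Y \<pi> c s \<longleftrightarrow> omega_global_section X Y \<pi> s \<and>
     (\<forall>V m. affine_open Y V \<longrightarrow>
        c V (restrict s (sec X (preim X \<pi> V))) m =
        (\<lambda>f\<in>sec X (preim X \<pi> V). if m = 0 then s f else 0))"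

text \<open>
  A \<open>G\<close>-invariant projection onto the sections of \<open>Y\<close>. Invariance of the map \<open>s\<close> means
  \<open>(s \<otimes> id) (\<rho> f) = s f \<otimes> 1\<close>.
\<close>

definition invariant_projection ::
  "('x, 'f::field) ischeme \<Rightarrow> ('f \<Rightarrow> ('m::{ab_group_add,finite} \<Rightarrow>\<^sub>0 'f)) \<Rightarrow>
   ('y, 'f) ischeme \<Rightarrow> ('x \<Rightarrow> 'y) \<Rightarrow> ('f \<Rightarrow> 'f) \<Rightarrow> bool" where
  "invariant_projection X \<rho> Y \<pi> s \<longleftrightarrow> omega_global_section X Y \<pi> s \<and>
     (\<forall>V. affine_open Y V \<longrightarrow>
        (\<forall>f\<in>sec Y V. s f = f) \<and>
        (\<forall>f\<in>sec X (preim X \<pi> V). \<forall>m. s (Poly_Mapping.lookup (\<rho> f) m) = (if m = 0 then s f else 0)))"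

text \<open>
  \<open>u\<close> freely generates the stalk of \<open>\<omega>\<^bsub>X/Y\<^esub>\<close> at \<open>x\<close>, which is the localization of \<open>omega X Y \<pi> V\<close>
  at the prime ideal of \<open>x\<close> for any affine open \<open>V\<close> around \<open>\<pi> x\<close>.
\<close>

definition omega_generator ::
  "('x, 'f::field) ischeme \<Rightarrow> ('y, 'f) ischeme \<Rightarrow> ('x \<Rightarrow> 'y) \<Rightarrow> 'y set \<Rightarrow> 'x \<Rightarrow> ('f \<Rightarrow> 'f) \<Rightarrow> bool" where
  "omega_generator X Y \<pi> V x u \<longleftrightarrow> affine_open Y V \<and> \<pi> x \<in> V \<and> u \<in> omega X Y \<pi> V \<and>
     (\<forall>a\<in>sec X (preim X \<pi> V). omega_smult X \<pi> V a u = omega_smult X \<pi> V 0 u \<longrightarrow> a = 0) \<and>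
     (\<forall>w\<in>omega X Y \<pi> V. \<exists>a\<in>sec X (preim X \<pi> V). \<exists>b\<in>sec X (preim X \<pi> V) \<inter> stalk_units X x.
        omega_smult X \<pi> V b w = omega_smult X \<pi> V a u)"

definition omega_invertible ::
  "('x, 'f::field) ischeme \<Rightarrow> ('y, 'f) ischeme \<Rightarrow> ('x \<Rightarrow> 'y) \<Rightarrow> bool" where
  "omega_invertible X Y \<pi> \<longleftrightarrow> (\<forall>x\<in>points X. \<exists>V u. omega_generator X Y \<pi> V x u)"

text \<open>The local equations \<open>e\<close> of a section \<open>s = e \<cdot> u\<close>, for local generators \<open>u\<close>.\<close>

definition section_divisor ::
  "('x, 'f::field) ischeme \<Rightarrow> ('y, 'f) ischeme \<Rightarrow> ('x \<Rightarrow> 'y) \<Rightarrow> ('f \<Rightarrow> 'f) \<Rightarrow> 'x \<Rightarrow> 'f set" where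
  "section_divisor X Y \<pi> s x = {a / b * v | a b v V u.
     omega_generator X Y \<pi> V x u \<and> v \<in> stalk_units X x \<and>
     a \<in> sec X (preim X \<pi> V) \<and> b \<in> sec X (preim X \<pi> V) \<inter> stalk_units X x \<and>
     omega_smult X \<pi> V b (restrict s (sec X (preim X \<pi> V))) = omega_smult X \<pi> V a u}"

end

theory Submission
  imports Defs
begin

text \<open>
  The coaction is a grading of the function field \<open>K\<close> of \<open>X\<close> by the characters of \<open>G\<close>, and its
  part of degree \<open>0\<close> is the function field of \<open>Y\<close>; the Reynolds operator is the projection to it.
  For a closed point \<open>x\<close> let \<open>R\<close> be the graded semilocal ring of \<open>X\<close> along the fibre of \<open>\<pi> x\<close>.

  A graded overring of \<open>R\<close> that is finite over \<open>R\<close> gives a finite birational equivariant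
  modification of \<open>X\<close>, so \<open>G\<close>-normality makes \<open>R\<close> equal to the endomorphism ring of the largest
  graded ideal of \<open>R\<close> that vanishes at \<open>x\<close>. As for one-dimensional normal local rings, this
  forces the ideal, which defines the orbit of \<open>x\<close>, to be generated by a homogeneous element \<open>t\<close>,
  and every nonzero homogeneous element of \<open>K\<close> is a power of \<open>t\<close>, of exponent in \<open>\<int>\<close>, times a homogeneous
  unit of \<open>R\<close>. If \<open>H\<close> is the group of the degrees of homogeneous units, the stabilizer of \<open>x\<close>
  is the diagonalizable group with character group \<open>M/H\<close>, and by faithfulness this quotient is
  generated by the degree of \<open>t\<close>. Let \<open>e\<close> be its order.

  Every section of \<open>\<omega>\<close> is of the form \<open>f \<mapsto> (W f)\<^sub>0\<close> with \<open>W \<in> K\<close>. Near \<open>x\<close> the products \<open>W f\<close> have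
  regular parts of degree \<open>0\<close> for all regular \<open>f\<close> iff \<open>W \<in> t\<^sup>1\<^sup>-\<^sup>e R\<close>: the elements of \<open>R\<close> of the
  same degree as \<open>t\<^sup>e\<^sup>-\<^sup>1\<close> are divisible by \<open>t\<^sup>e\<^sup>-\<^sup>1\<close>, and every degree contains some \<open>v t\<^sup>j\<close> with
  \<open>j < e\<close> and \<open>v\<close> a unit. The Reynolds operator, \<open>W = 1\<close>, thus has the local equation \<open>t\<^sup>e\<^sup>-\<^sup>1\<close>.
\<close>

section \<open>Subrings, ideals and primes\<close>

text \<open>\<open>G_normal\<close> is a global condition on schemes, while the argument lives in
  \<open>R\<close>. A graded overring of the ring of one affine preimage has to be extended to a
  whole separated curve of finite type with a finite equivariant map to \<open>X\<close>. This
  globalization, more than the local computation, governs the size of the proof. It is feasible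
  because a curve is known from its local rings inside the ambient field: nonempty opens are
  cofinite sets, and separatedness says that a ring dominates at most one of the local rings.

  \<open>R\<close> may have several maximal ideals and \<open>G\<close> may be nonreduced, so
  conjugates and Galois norms are not at hand. Invariants replace them. The power of a homogeneous
  element with exponent the order of \<open>M\<close> has degree 0; hence a homogeneous element of
  \<open>R\<close> that is nonzero at one point of the fibre is a unit of \<open>R\<close>. For
  arbitrary elements the constant term of a minimal integral equation serves as a norm.

  Values of functions at closed points are constants from \<open>k\<close>, both in the orbit map
  and in the comparison of fibres; this is why Noetherian rings, integrality and a Nullstellensatz
  are developed inside one field.\<close>

lemma is_subringD:
  assumes "is_subring A"
  shows subring_0: "0 \<in> A" and subring_1: "1 \<in> A"
    and subring_diff: "\<And>a b. a \<in> A \<Longrightarrow> b \<in> A \<Longrightarrow> a - b \<in> A"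
    and subring_mult: "\<And>a b. a \<in> A \<Longrightarrow> b \<in> A \<Longrightarrow> a * b \<in> A"
  using assms by (auto simp: is_subring_def)

lemma subring_uminus: "is_subring A \<Longrightarrow> a \<in> A \<Longrightarrow> - a \<in> A"
  using subring_diff[of A 0 a] subring_0 by auto

lemma subring_add: "is_subring A \<Longrightarrow> a \<in> A \<Longrightarrow> b \<in> A \<Longrightarrow> a + b \<in> A"
  using subring_diff[of A a "- b"] subring_uminus by auto

lemma subring_power: "is_subring A \<Longrightarrow> a \<in> A \<Longrightarrow> a ^ n \<in> A"
  by (induction n) (auto intro: subring_1 subring_mult)

lemma subring_sum: "is_subring A \<Longrightarrow> (\<And>i. i \<in> I \<Longrightarrow> f i \<in> A) \<Longrightarrow> sum f I \<in> A"
  by (induction I rule: infinite_finite_induct) (auto intro: subring_0 subring_add)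

lemma subring_prod: "is_subring A \<Longrightarrow> (\<And>i. i \<in> I \<Longrightarrow> f i \<in> A) \<Longrightarrow> prod f I \<in> A"
  by (induction I rule: infinite_finite_induct) (auto intro: subring_1 subring_mult)

lemmas subring_intros = subring_0 subring_1 subring_diff subring_mult subring_uminus
  subring_add subring_power subring_sum subring_prod

lemma is_subring_UNIV: "is_subring UNIV"
  by (simp add: is_subring_def)

lemma is_subring_Inter: "(\<And>A. A \<in> \<A> \<Longrightarrow> is_subring A) \<Longrightarrow> is_subring (\<Inter>\<A>)"
  by (auto simp: is_subring_def)

lemma is_subring_gen: "is_subring (subring_gen S)"
  unfolding subring_gen_def by (rule is_subring_Inter) auto

lemma subring_gen_superset: "S \<subseteq> subring_gen S"
  by (auto simp: subring_gen_def)

lemma subring_gen_least: "is_subring A \<Longrightarrow> S \<subseteq> A \<Longrightarrow> subring_gen S \<subseteq> A"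
  by (auto simp: subring_gen_def)

lemma subring_gen_mono: "S \<subseteq> T \<Longrightarrow> subring_gen S \<subseteq> subring_gen T"
  by (meson is_subring_gen order_trans subring_gen_least subring_gen_superset)

lemma subring_gen_Un_gen: "subring_gen (subring_gen S \<union> T) = subring_gen (S \<union> T)"
proof
  show "subring_gen (subring_gen S \<union> T) \<subseteq> subring_gen (S \<union> T)"
    by (rule subring_gen_least[OF is_subring_gen])
      (meson Un_subset_iff Un_upper1 order_trans subring_gen_mono subring_gen_superset sup_ge2)
  show "subring_gen (S \<union> T) \<subseteq> subring_gen (subring_gen S \<union> T)"
    by (rule subring_gen_mono) (use subring_gen_superset in auto)
qed

lemma is_idealD:
  assumes "is_ideal A I"
  shows ideal_subset: "I \<subseteq> A" and ideal_0: "0 \<in> I"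
    and ideal_add: "\<And>x y. x \<in> I \<Longrightarrow> y \<in> I \<Longrightarrow> x + y \<in> I"
    and ideal_mult: "\<And>a x. a \<in> A \<Longrightarrow> x \<in> I \<Longrightarrow> a * x \<in> I"
  using assms by (auto simp: is_ideal_def)

lemma ideal_mult_right: "is_ideal A I \<Longrightarrow> a \<in> A \<Longrightarrow> x \<in> I \<Longrightarrow> x * a \<in> I"
  using ideal_mult[of A I a x] by (simp add: mult.commute)

lemma ideal_uminus: "is_subring A \<Longrightarrow> is_ideal A I \<Longrightarrow> x \<in> I \<Longrightarrow> - x \<in> I"
  using ideal_mult[of A I "- 1" x] subring_1 subring_uminus by force

lemma ideal_diff: "is_subring A \<Longrightarrow> is_ideal A I \<Longrightarrow> x \<in> I \<Longrightarrow> y \<in> I \<Longrightarrow> x - y \<in> I"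
  using ideal_add[of A I x "- y"] ideal_uminus by force

lemma ideal_sum: "is_ideal A I \<Longrightarrow> (\<And>i. i \<in> J \<Longrightarrow> f i \<in> I) \<Longrightarrow> sum f J \<in> I"
  by (induction J rule: infinite_finite_induct) (auto intro: ideal_0 ideal_add)

lemma ideal_one: "is_ideal A I \<Longrightarrow> 1 \<in> I \<Longrightarrow> I = A"
  using ideal_subset ideal_mult[of A I _ 1] by fastforce

lemma is_idealI:
  assumes "I \<subseteq> A" "0 \<in> I" "\<And>x y. x \<in> I \<Longrightarrow> y \<in> I \<Longrightarrow> x + y \<in> I" "\<And>a x. a \<in> A \<Longrightarrow> x \<in> I \<Longrightarrow> a * x \<in> I"
  shows "is_ideal A I"
  using assms by (auto simp: is_ideal_def)

text \<open>The ideal generated by \<open>I\<close> and \<open>a\<close>, written with explicit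
  elements because the maximality arguments unpack its members.\<close>

definition adjoin :: "'a::comm_ring_1 set \<Rightarrow> 'a set \<Rightarrow> 'a \<Rightarrow> 'a set" where
  "adjoin A I a = {x + a * c | x c. x \<in> I \<and> c \<in> A}"

lemma is_ideal_adjoin:
  assumes A: "is_subring A" and I: "is_ideal A I" and a: "a \<in> A"
  shows "is_ideal A (adjoin A I a)"
  unfolding adjoin_def
proof (rule is_idealI)
  show "{x + a * c | x c. x \<in> I \<and> c \<in> A} \<subseteq> A"
    using ideal_subset[OF I] a A by (auto intro: subring_add subring_mult)
  show "0 \<in> {x + a * c | x c. x \<in> I \<and> c \<in> A}"
    using ideal_0[OF I] subring_0[OF A] by force
next
  fix u v assume "u \<in> {x + a * c | x c. x \<in> I \<and> c \<in> A}" "v \<in> {x + a * c | x c. x \<in> I \<and> c \<in> A}"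
  then obtain x c y d where "u = x + a * c" "v = y + a * d" "x \<in> I" "y \<in> I" "c \<in> A" "d \<in> A" by blast
  then have "u + v = (x + y) + a * (c + d)" "x + y \<in> I" "c + d \<in> A"
    using I A by (auto simp: algebra_simps intro: ideal_add subring_add)
  then show "u + v \<in> {x + a * c | x c. x \<in> I \<and> c \<in> A}" by blast
next
  fix b u assume b: "b \<in> A" and "u \<in> {x + a * c | x c. x \<in> I \<and> c \<in> A}"
  then obtain x c where "u = x + a * c" "x \<in> I" "c \<in> A" by blast
  then have "b * u = b * x + a * (b * c)" "b * x \<in> I" "b * c \<in> A"
    using I A b by (auto simp: algebra_simps intro: ideal_mult subring_mult)
  then show "b * u \<in> {x + a * c | x c. x \<in> I \<and> c \<in> A}" by blast
qed

lemma adjoin_superset: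
  assumes "is_subring A" "is_ideal A I"
  shows "I \<subseteq> adjoin A I a" "a \<in> adjoin A I a"
  unfolding adjoin_def using subring_0[OF assms(1)] subring_1[OF assms(1)] ideal_0[OF assms(2)] by force+

lemma is_prime_idealD:
  assumes "is_prime_ideal A P"
  shows prime_ideal: "is_ideal A P" and prime_one: "1 \<notin> P"
    and prime_mult: "\<And>a b. a \<in> A \<Longrightarrow> b \<in> A \<Longrightarrow> a * b \<in> P \<Longrightarrow> a \<in> P \<or> b \<in> P"
  using assms by (auto simp: is_prime_ideal_def)

lemma prime_power: "is_subring A \<Longrightarrow> is_prime_ideal A P \<Longrightarrow> a \<in> A \<Longrightarrow> a ^ n \<in> P \<Longrightarrow> a \<in> P"
proof (induction n)
  case (Suc n)
  then show ?case using prime_mult[of A P a "a ^ n"] subring_power[of A a n] by auto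
qed (simp add: prime_one)

lemma prime_prod:
  "is_subring A \<Longrightarrow> is_prime_ideal A P \<Longrightarrow> (\<And>i. i \<in> I \<Longrightarrow> f i \<in> A - P) \<Longrightarrow> prod f I \<in> A - P"
proof (induction I rule: infinite_finite_induct)
  case (insert i I)
  then show ?case by (auto intro!: subring_mult dest!: prime_mult[rotated 3])
qed (auto dest: prime_one subring_1)

lemma prime_inter:
  assumes "is_subring B" "B \<subseteq> A" "is_prime_ideal A P"
  shows "is_prime_ideal B (P \<inter> B)"
  unfolding is_prime_ideal_def is_ideal_def
  using prime_ideal[OF assms(3)] prime_mult[OF assms(3)] prime_one[OF assms(3)] assms(1,2)
  by (auto intro: ideal_0 ideal_add ideal_mult subring_0 subring_add subring_mult)

lemma prime_zero: "is_subring (A :: 'a::idom set) \<Longrightarrow> is_prime_ideal A {0}"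
  by (auto simp: is_prime_ideal_def is_ideal_def subring_0)

text \<open>An ideal maximal among those avoiding \<open>S\<close> is prime: for \<open>a\<close>
  and \<open>b\<close> outside it both enlargements meet \<open>S\<close>, and if
  \<open>a * b\<close> lay in it, so would the product of these two members of \<open>S\<close>. All
  arguments with ideals of denominators below rest on this, with \<open>S\<close> a set of powers or
  of elements outside a prime.\<close>

lemma prime_avoiding:
  assumes A: "is_subring A" and I: "is_ideal A I"
    and S: "1 \<in> S" "S \<subseteq> A" "\<And>a b. a \<in> S \<Longrightarrow> b \<in> S \<Longrightarrow> a * b \<in> S" and IS: "I \<inter> S = {}"
  shows "\<exists>P. is_prime_ideal A P \<and> I \<subseteq> P \<and> P \<inter> S = {}"
proof -
  define \<J> where "\<J> = {J. is_ideal A J \<and> I \<subseteq> J \<and> J \<inter> S = {}}"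
  have "\<exists>M\<in>\<J>. \<forall>X\<in>\<J>. M \<subseteq> X \<longrightarrow> X = M"
  proof (rule subset_Zorn_nonempty)
    show "\<J> \<noteq> {}" using I IS by (auto simp: \<J>_def)
    fix \<C> assume C: "\<C> \<noteq> {}" "subset.chain \<J> \<C>"
    then have CJ: "\<And>J. J \<in> \<C> \<Longrightarrow> J \<in> \<J>" and tot: "\<And>J J'. J \<in> \<C> \<Longrightarrow> J' \<in> \<C> \<Longrightarrow> J \<subseteq> J' \<or> J' \<subseteq> J"
      by (auto simp: subset_chain_def)
    have "is_ideal A (\<Union>\<C>)"
    proof (rule is_idealI)
      show "\<Union>\<C> \<subseteq> A" using CJ ideal_subset unfolding \<J>_def by blast
      show "0 \<in> \<Union>\<C>" using C(1) CJ ideal_0 unfolding \<J>_def by blast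
    next
      fix x y assume "x \<in> \<Union>\<C>" "y \<in> \<Union>\<C>"
      then obtain J J' where J: "J \<in> \<C>" "x \<in> J" "J' \<in> \<C>" "y \<in> J'" by blast
      then have "(x \<in> J \<and> y \<in> J) \<or> (x \<in> J' \<and> y \<in> J')" using tot by blast
      then show "x + y \<in> \<Union>\<C>"
        using J(1,3) CJ by (auto simp: \<J>_def intro: ideal_add)
    next
      fix a x assume "a \<in> A" "x \<in> \<Union>\<C>"
      then show "a * x \<in> \<Union>\<C>" using CJ by (auto simp: \<J>_def intro: ideal_mult)
    qed
    then show "\<Union>\<C> \<in> \<J>" using C(1) CJ by (auto simp: \<J>_def)
  qed
  then obtain P where PJ: "P \<in> \<J>" and maxJ: "\<forall>X\<in>\<J>. P \<subseteq> X \<longrightarrow> X = P" by blast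
  have P: "is_ideal A P" "I \<subseteq> P" "P \<inter> S = {}" using PJ by (auto simp: \<J>_def)
  have max: "J = P" if "is_ideal A J" "P \<subseteq> J" "J \<inter> S = {}" for J
    using maxJ that P(2) by (auto simp: \<J>_def)
  have meets: "\<exists>x c. x \<in> P \<and> c \<in> A \<and> x + a * c \<in> S" if "a \<in> A" "a \<notin> P" for a
  proof -
    have "adjoin A P a \<noteq> P"
      using adjoin_superset(2)[OF A P(1), of a] that(2) by auto
    then have "adjoin A P a \<inter> S \<noteq> {}"
      using max[OF is_ideal_adjoin[OF A P(1) that(1)] adjoin_superset(1)[OF A P(1)]] by auto
    then show ?thesis unfolding adjoin_def by blast
  qed
  have "is_prime_ideal A P"
    unfolding is_prime_ideal_def
  proof (intro conjI ballI impI)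
    show "1 \<notin> P" using S(1) P(3) by auto
    fix a b assume a: "a \<in> A" and b: "b \<in> A" and ab: "a * b \<in> P"
    show "a \<in> P \<or> b \<in> P"
    proof (rule ccontr)
      assume "\<not> (a \<in> P \<or> b \<in> P)"
      then obtain x c y d where xc: "x \<in> P" "c \<in> A" "x + a * c \<in> S" and yd: "y \<in> P" "d \<in> A" "y + b * d \<in> S"
        using meets a b by meson
      have "(x + a * c) * (y + b * d) = (y + b * d) * x + (a * c) * y + (c * d) * (a * b)"
        by (simp add: algebra_simps)
      also have "\<dots> \<in> P"
        using xc yd a ab S(2)
        by (intro ideal_add[OF P(1)] ideal_mult[OF P(1) _ xc(1)] ideal_mult[OF P(1) _ yd(1)]
            ideal_mult[OF P(1) _ ab] subring_mult[OF A]) auto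
      finally show False using S(3) xc(3) yd(3) P(3) by blast
    qed
  qed (fact P(1))
  then show ?thesis using P by blast
qed

lemma prime_containing:
  assumes "is_subring A" "is_ideal A I" "1 \<notin> I"
  shows "\<exists>P. is_prime_ideal A P \<and> I \<subseteq> P"
  using prime_avoiding[OF assms(1,2), of "{1}"] assms subring_1 by auto

section \<open>Noetherian rings\<close>

text \<open>Finite generation is tested against the ideals \<open>J\<close> that contain
  \<open>S\<close>, so that no linear combinations have to be written down.\<close>

definition noetherian :: "'a::comm_ring_1 set \<Rightarrow> bool" where
  "noetherian A \<longleftrightarrow> (\<forall>I. is_ideal A I \<longrightarrow>
     (\<exists>S. finite S \<and> S \<subseteq> I \<and> (\<forall>J. is_ideal A J \<longrightarrow> S \<subseteq> J \<longrightarrow> I \<subseteq> J)))"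

text \<open>Zorn applies because the union of a chain is finitely generated: its generators, and
  with them the union, already lie in one member.\<close>

lemma noetherian_maximal:
  assumes N: "noetherian A" and C: "\<C> \<noteq> {}" "\<And>I. I \<in> \<C> \<Longrightarrow> is_ideal A I"
  shows "\<exists>M\<in>\<C>. \<forall>I\<in>\<C>. M \<subseteq> I \<longrightarrow> I = M"
proof (rule subset_Zorn_nonempty[OF C(1)])
  fix \<D> assume D: "\<D> \<noteq> {}" "subset.chain \<C> \<D>"
  then have DC: "\<And>J. J \<in> \<D> \<Longrightarrow> J \<in> \<C>" and tot: "\<And>J J'. J \<in> \<D> \<Longrightarrow> J' \<in> \<D> \<Longrightarrow> J \<subseteq> J' \<or> J' \<subseteq> J"
    by (auto simp: subset_chain_def)
  have "is_ideal A (\<Union>\<D>)"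
  proof (rule is_idealI)
    show "\<Union>\<D> \<subseteq> A" using C(2) DC ideal_subset by blast
    show "0 \<in> \<Union>\<D>" using D(1) C(2) DC ideal_0 by blast
  next
    fix x y assume "x \<in> \<Union>\<D>" "y \<in> \<Union>\<D>"
    then obtain J J' where J: "J \<in> \<D>" "x \<in> J" "J' \<in> \<D>" "y \<in> J'" by blast
    then have "(x \<in> J \<and> y \<in> J) \<or> (x \<in> J' \<and> y \<in> J')" using tot by blast
    then show "x + y \<in> \<Union>\<D>" using J(1,3) C(2) DC ideal_add by blast
  next
    fix a x assume "a \<in> A" "x \<in> \<Union>\<D>"
    then show "a * x \<in> \<Union>\<D>" using C(2) DC ideal_mult by blast
  qed
  then obtain S where S: "finite S" "S \<subseteq> \<Union>\<D>" "\<And>J. is_ideal A J \<Longrightarrow> S \<subseteq> J \<Longrightarrow> \<Union>\<D> \<subseteq> J"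
    using N unfolding noetherian_def by meson
  obtain J where "J \<in> \<D>" "S \<subseteq> J"
    using finite_subset_Union_chain[OF S(1,2) D(1,2)] by blast
  then have "\<Union>\<D> = J" using S(3) C(2) DC by blast
  then show "\<Union>\<D> \<in> \<C>" using \<open>J \<in> \<D>\<close> DC by auto
qed

text \<open>Noetherian induction in place of primary decomposition: a maximal counterexample is not
  prime, and adjoining either factor of a violating product gives two lists whose concatenation
  serves. Lists instead of sets let a prime occur several times.\<close>

lemma noetherian_prime_product:
  assumes A: "is_subring A" and N: "noetherian A" and I: "is_ideal A I"
  shows "\<exists>Ps. (\<forall>P\<in>set Ps. is_prime_ideal A P \<and> I \<subseteq> P) \<and>
    (\<forall>xs. list_all2 (\<in>) xs Ps \<longrightarrow> prod_list xs \<in> I)"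
proof (rule ccontr)
  define good where "good I \<longleftrightarrow> (\<exists>Ps. (\<forall>P\<in>set Ps. is_prime_ideal A P \<and> I \<subseteq> P) \<and>
    (\<forall>xs. list_all2 (\<in>) xs Ps \<longrightarrow> prod_list xs \<in> I))" for I
  assume "\<not> ?thesis"
  then have "{I. is_ideal A I \<and> \<not> good I} \<noteq> {}" using I by (auto simp: good_def)
  then have "\<exists>M\<in>{I. is_ideal A I \<and> \<not> good I}. \<forall>I\<in>{I. is_ideal A I \<and> \<not> good I}. M \<subseteq> I \<longrightarrow> I = M"
    by (rule noetherian_maximal[OF N]) simp
  then obtain M where M: "is_ideal A M" "\<not> good M"
    and max: "\<And>J. is_ideal A J \<Longrightarrow> \<not> good J \<Longrightarrow> M \<subseteq> J \<Longrightarrow> J = M"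
    by blast
  have "1 \<notin> M"
  proof
    assume "1 \<in> M"
    \<comment> \<open>The unit ideal is covered by the empty list, whose product is 1.\<close>
    then have "good M" unfolding good_def by (intro exI[of _ "[]"]) auto
    then show False using M(2) by simp
  qed
  have "\<not> is_prime_ideal A M"
  proof
    assume "is_prime_ideal A M"
    then have "good M" unfolding good_def
      by (intro exI[of _ "[M]"]) (auto simp: list_all2_Cons2)
    then show False using M(2) by simp
  qed
  then obtain a b where ab: "a \<in> A" "b \<in> A" "a * b \<in> M" "a \<notin> M" "b \<notin> M"
    using M(1) \<open>1 \<notin> M\<close> unfolding is_prime_ideal_def by blast
  have "good (adjoin A M c)" if "c \<in> A" "c \<notin> M" for c
    using max[OF is_ideal_adjoin[OF A M(1) that(1)]] adjoin_superset[OF A M(1), of c] that(2) by auto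
  then have "good (adjoin A M a)" "good (adjoin A M b)" using ab by auto
  obtain Ps where Ps: "\<forall>P\<in>set Ps. is_prime_ideal A P \<and> adjoin A M a \<subseteq> P"
      "\<And>xs. list_all2 (\<in>) xs Ps \<Longrightarrow> prod_list xs \<in> adjoin A M a"
    using \<open>good (adjoin A M a)\<close> unfolding good_def by (elim exE conjE) simp
  obtain Qs where Qs: "\<forall>P\<in>set Qs. is_prime_ideal A P \<and> adjoin A M b \<subseteq> P"
      "\<And>xs. list_all2 (\<in>) xs Qs \<Longrightarrow> prod_list xs \<in> adjoin A M b"
    using \<open>good (adjoin A M b)\<close> unfolding good_def by (elim exE conjE) simp
  have "good M" unfolding good_def
  proof (intro exI[of _ "Ps @ Qs"] conjI ballI allI impI)
    fix P assume "P \<in> set (Ps @ Qs)"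
    then show "is_prime_ideal A P" using Ps(1) Qs(1) by auto
    show "M \<subseteq> P"
      using \<open>P \<in> set (Ps @ Qs)\<close> Ps(1) Qs(1) adjoin_superset(1)[OF A M(1)] by fastforce
  next
    fix xs assume "list_all2 (\<in>) xs (Ps @ Qs)"
    then obtain us vs where xs: "xs = us @ vs" "list_all2 (\<in>) us Ps" "list_all2 (\<in>) vs Qs"
      by (auto simp: list_all2_append2)
    obtain x c where xc: "prod_list us = x + a * c" "x \<in> M" "c \<in> A"
      using Ps(2)[OF xs(2)] unfolding adjoin_def by blast
    obtain y d where yd: "prod_list vs = y + b * d" "y \<in> M" "d \<in> A"
      using Qs(2)[OF xs(3)] unfolding adjoin_def by blast
    have "prod_list xs = (y + b * d) * x + (a * c) * y + (c * d) * (a * b)"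
      using xc yd xs by (simp add: algebra_simps)
    also have "\<dots> \<in> M"
      using xc yd ab ideal_subset[OF M(1)]
      by (intro ideal_add[OF M(1)] ideal_mult[OF M(1) _ xc(2)] ideal_mult[OF M(1) _ yd(2)]
          ideal_mult[OF M(1) _ ab(3)] subring_mult[OF A] subring_add[OF A]; blast)
    finally show "prod_list xs \<in> M" .
  qed
  then show False using M(2) by simp
qed

lemma list_all2_choose:
  assumes "\<And>P. P \<in> set Ps \<Longrightarrow> \<exists>x. x \<in> P \<and> R x"
  shows "\<exists>xs. list_all2 (\<in>) xs Ps \<and> (\<forall>x\<in>set xs. R x)"
  using assms
proof (induction Ps)
  case (Cons P Ps)
  then obtain x xs where "x \<in> P" "R x" "list_all2 (\<in>) xs Ps" "\<forall>x\<in>set xs. R x" by (auto; metis)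
  then show ?case by (intro exI[of _ "x # xs"]) auto
qed auto

text \<open>In a domain, where \<open>{0}\<close> is prime, this is Krull dimension at most
  one.\<close>

definition dim_le_1 :: "'a::comm_ring_1 set \<Rightarrow> bool" where
  "dim_le_1 A \<longleftrightarrow> (\<forall>P Q. is_prime_ideal A P \<longrightarrow> is_prime_ideal A Q \<longrightarrow> P \<noteq> {0} \<longrightarrow> P \<subseteq> Q \<longrightarrow> P = Q)"

lemma is_ideal_principal:
  assumes "is_subring A" "g \<in> A"
  shows "is_ideal A {g * c | c. c \<in> A}"
proof -
  have "{g * c | c. c \<in> A} = adjoin A {0} g" by (auto simp: adjoin_def)
  moreover have "is_ideal A {0}" using subring_0[OF assms(1)] by (auto simp: is_ideal_def)
  ultimately show ?thesis using is_ideal_adjoin[OF assms(1) _ assms(2)] by metis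
qed

lemma prod_list_not_in_prime:
  assumes "is_subring A" "is_prime_ideal A P" "\<forall>x\<in>set xs. x \<in> A - P"
  shows "prod_list xs \<in> A - P"
  using assms(3)
proof (induction xs)
  case Nil
  then show ?case using subring_1[OF assms(1)] prime_one[OF assms(2)] by simp
next
  case (Cons x xs)
  then show ?case using prime_mult[OF assms(2), of x "prod_list xs"] subring_mult[OF assms(1)] by auto
qed

text \<open>A prime over \<open>g\<close> outside the list belonging to the ideal of
  \<open>g\<close> would contain none of the listed primes, since these are nonzero and hence
  maximal. Choosing from each of them an element outside the given prime yields a product outside it
  that is nevertheless divisible by \<open>g\<close>.\<close>

lemma finite_primes_containing:
  assumes A: "is_subring A" and N: "noetherian A" and dim: "dim_le_1 A" and g: "g \<in> A" "g \<noteq> 0"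
  shows "finite {P. is_prime_ideal A P \<and> g \<in> P}"
proof -
  obtain Ps where Ps: "\<forall>P\<in>set Ps. is_prime_ideal A P \<and> {g * c | c. c \<in> A} \<subseteq> P"
    "\<And>xs. list_all2 (\<in>) xs Ps \<Longrightarrow> prod_list xs \<in> {g * c | c. c \<in> A}"
    using noetherian_prime_product[OF A N is_ideal_principal[OF A g(1)]] by (elim exE conjE) simp
  have gP: "g \<in> P" if "P \<in> set Ps" for P using Ps(1) that subring_1[OF A] by force
  have "P \<in> set Ps" if P: "is_prime_ideal A P" "g \<in> P" for P
  proof (rule ccontr)
    assume "P \<notin> set Ps"
    have "\<exists>x. x \<in> Q \<and> x \<in> A - P" if "Q \<in> set Ps" for Q
    proof -
      have "Q \<noteq> {0}" using gP[OF that] g(2) by auto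
      then have "\<not> Q \<subseteq> P" using dim P(1) Ps(1) that \<open>P \<notin> set Ps\<close> unfolding dim_le_1_def by blast
      then show ?thesis using Ps(1) that prime_ideal ideal_subset by blast
    qed
    then obtain xs where xs: "list_all2 (\<in>) xs Ps" "\<forall>x\<in>set xs. x \<in> A - P"
      using list_all2_choose[of Ps "\<lambda>x. x \<in> A - P"] by metis
    have "prod_list xs \<in> P"
      using Ps(2)[OF xs(1)] P ideal_mult_right[OF prime_ideal[OF P(1)]] by auto
    then show False using prod_list_not_in_prime[OF A P(1) xs(2)] by simp
  qed
  then show ?thesis by (intro finite_subset[OF _ finite_set[of Ps]]) auto
qed

section \<open>Polynomials with coefficients in a subring\<close>

definition polys :: "'a::comm_ring_1 set \<Rightarrow> 'a poly set" where
  "polys D = {p. \<forall>i. coeff p i \<in> D}"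

lemma is_subring_polys:
  assumes "is_subring D"
  shows "is_subring (polys D)"
  unfolding is_subring_def[of "polys D"] unfolding polys_def
  by (auto simp: coeff_mult coeff_1 intro!: subring_intros[OF assms])

lemma polys_const: "is_subring D \<Longrightarrow> d \<in> D \<Longrightarrow> [:d:] \<in> polys D"
  by (auto simp: polys_def coeff_pCons subring_0 split: nat.splits)

lemma polys_pCons: "d \<in> D \<Longrightarrow> p \<in> polys D \<Longrightarrow> pCons d p \<in> polys D"
  by (auto simp: polys_def coeff_pCons split: nat.splits)

lemma polys_monom: "is_subring D \<Longrightarrow> d \<in> D \<Longrightarrow> monom d n \<in> polys D"
  by (auto simp: polys_def subring_0)

lemma poly_in_subring:
  assumes "is_subring A" "D \<subseteq> A" "x \<in> A" "p \<in> polys D"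
  shows "poly p x \<in> A"
  unfolding poly_altdef using assms by (intro subring_sum subring_mult subring_power) (auto simp: polys_def)

lemma subring_gen_insert:
  assumes D: "is_subring D"
  shows "subring_gen (D \<union> {s}) = (\<lambda>p. poly p s) ` polys D"
proof
  show "(\<lambda>p. poly p s) ` polys D \<subseteq> subring_gen (D \<union> {s})"
    using poly_in_subring[OF is_subring_gen] subring_gen_superset[of "D \<union> {s}"] by auto
  show "subring_gen (D \<union> {s}) \<subseteq> (\<lambda>p. poly p s) ` polys D"
  proof (rule subring_gen_least)
    show "is_subring ((\<lambda>p. poly p s) ` polys D)"
      unfolding is_subring_def
    proof (intro conjI ballI)
      show "0 \<in> (\<lambda>p. poly p s) ` polys D" "1 \<in> (\<lambda>p. poly p s) ` polys D"
        using subring_0[OF is_subring_polys[OF D]] subring_1[OF is_subring_polys[OF D]]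
        by (force intro: image_eqI)+
      fix a b assume "a \<in> (\<lambda>p. poly p s) ` polys D" "b \<in> (\<lambda>p. poly p s) ` polys D"
      then obtain p q where "p \<in> polys D" "q \<in> polys D" "a = poly p s" "b = poly q s" by auto
      then show "a - b \<in> (\<lambda>p. poly p s) ` polys D" "a * b \<in> (\<lambda>p. poly p s) ` polys D"
        using is_subring_polys[OF D]
        by (auto intro!: image_eqI[of "poly p s - poly q s" _ "p - q"]
            image_eqI[of "poly p s * poly q s" _ "p * q"] intro: subring_diff subring_mult)
    qed
    show "D \<union> {s} \<subseteq> (\<lambda>p. poly p s) ` polys D"
    proof -
      have "[:0, 1:] \<in> polys D" using D by (intro polys_pCons polys_const) (auto intro: subring_intros)
      then have "s \<in> (\<lambda>p. poly p s) ` polys D" by (intro image_eqI[of _ _ "[:0, 1:]"]) auto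
      moreover have "d \<in> (\<lambda>p. poly p s) ` polys D" if "d \<in> D" for d
        using polys_const[OF D that] by (intro image_eqI[of _ _ "[:d:]"]) auto
      ultimately show ?thesis by auto
    qed
  qed
qed

text \<open>
  The ideals of leading coefficients of the polynomials of degree at most \<open>n\<close> increase with \<open>n\<close>;
  beyond the index where they become stationary, leading terms are killed by shifting.
\<close>

lemma hilbert_basis:
  assumes D: "is_subring D" and N: "noetherian D"
  shows "noetherian (subring_gen (D \<union> {s}))"
  unfolding noetherian_def
proof (intro allI impI)
  define A where "A = subring_gen (D \<union> {s})"
  have A: "is_subring A" and DA: "D \<subseteq> A" and sA: "s \<in> A"
    using is_subring_gen subring_gen_superset unfolding A_def by blast+
  fix I assume "is_ideal (subring_gen (D \<union> {s})) I"
  then have I: "is_ideal A I" by (simp add: A_def)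
  note PD = is_subring_polys[OF D]
  define L where "L n = {d. \<exists>p\<in>polys D. degree p \<le> n \<and> coeff p n = d \<and> poly p s \<in> I}" for n
  have L_ideal: "is_ideal D (L n)" for n
  proof (rule is_idealI)
    show "L n \<subseteq> D" by (auto simp: L_def polys_def)
    show "0 \<in> L n" unfolding L_def using subring_0[OF PD] ideal_0[OF I] by (intro CollectI bexI[of _ 0]) auto
  next
    fix x y assume "x \<in> L n" "y \<in> L n"
    then obtain p q where "p \<in> polys D" "degree p \<le> n" "coeff p n = x" "poly p s \<in> I"
      "q \<in> polys D" "degree q \<le> n" "coeff q n = y" "poly q s \<in> I" unfolding L_def by blast
    then show "x + y \<in> L n" unfolding L_def
      by (intro CollectI bexI[of _ "p + q"]) (auto intro: degree_add_le ideal_add[OF I] subring_add[OF PD])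
  next
    fix a x assume a: "a \<in> D" and "x \<in> L n"
    then obtain p where "p \<in> polys D" "degree p \<le> n" "coeff p n = x" "poly p s \<in> I" unfolding L_def by blast
    then show "a * x \<in> L n" unfolding L_def
      using a DA by (intro CollectI bexI[of _ "smult a p"])
        (auto intro: ideal_mult[OF I] order_trans[OF degree_smult_le] simp: polys_def
          intro: subring_mult[OF D])
  qed
  have L_mono: "L m \<subseteq> L n" if "m \<le> n" for m n
  proof
    fix d assume "d \<in> L m"
    then obtain p where p: "p \<in> polys D" "degree p \<le> m" "coeff p m = d" "poly p s \<in> I" unfolding L_def by blast
    have "monom 1 (n - m) * p \<in> polys D" by (intro subring_mult[OF PD] polys_monom D subring_1 p)
    moreover have "degree (monom 1 (n - m) * p) \<le> n"
      using degree_mult_le[of "monom 1 (n - m)" p] degree_monom_le[of "1::'a" "n - m"] p(2) that by linarith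
    moreover have "coeff (monom 1 (n - m) * p) n = d" using p(3) that by (simp add: coeff_monom_mult)
    moreover have "poly (monom 1 (n - m) * p) s \<in> I"
      using p(4) by (auto simp: poly_monom intro: ideal_mult[OF I] subring_power[OF A sA])
    ultimately show "d \<in> L n" unfolding L_def by blast
  qed
  obtain m where m: "\<And>n. L n \<subseteq> L m"
  proof -
    have "\<exists>M\<in>range L. \<forall>J\<in>range L. M \<subseteq> J \<longrightarrow> J = M"
      by (rule noetherian_maximal[OF N]) (use L_ideal in auto)
    then obtain M where M: "M \<in> range L" "\<forall>J\<in>range L. M \<subseteq> J \<longrightarrow> J = M" by blast
    then obtain m where "M = L m" by auto
    have "L n \<subseteq> L m" for n
    proof (cases "m \<le> n")
      case True
      then show ?thesis using M(2) L_mono[OF True] \<open>M = L m\<close> by auto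
    qed (use L_mono[of n m] in auto)
    then show ?thesis using that by blast
  qed
  have "\<exists>T. finite T \<and> T \<subseteq> L n \<and> (\<forall>J. is_ideal D J \<longrightarrow> T \<subseteq> J \<longrightarrow> L n \<subseteq> J)" for n
    using N L_ideal unfolding noetherian_def by simp
  then have "\<exists>T. \<forall>n. finite (T n) \<and> T n \<subseteq> L n \<and> (\<forall>J. is_ideal D J \<longrightarrow> T n \<subseteq> J \<longrightarrow> L n \<subseteq> J)"
    by (intro choice allI)
  then obtain T where T0: "\<forall>n. finite (T n) \<and> T n \<subseteq> L n \<and> (\<forall>J. is_ideal D J \<longrightarrow> T n \<subseteq> J \<longrightarrow> L n \<subseteq> J)"
    by (rule exE)
  have T: "finite (T n)" "T n \<subseteq> L n" "is_ideal D J \<Longrightarrow> T n \<subseteq> J \<Longrightarrow> L n \<subseteq> J" for n J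
    using T0[rule_format, of n] by (blast, blast, metis)
  have "\<forall>n d. \<exists>p. n \<le> m \<longrightarrow> d \<in> T n \<longrightarrow> p \<in> polys D \<and> degree p \<le> n \<and> coeff p n = d \<and> poly p s \<in> I"
    using T(2) by (fastforce simp: L_def)
  then obtain p where p: "\<And>n d. n \<le> m \<Longrightarrow> d \<in> T n \<Longrightarrow> p n d \<in> polys D \<and> degree (p n d) \<le> n \<and>
      coeff (p n d) n = d \<and> poly (p n d) s \<in> I" by metis
  define S where "S = (\<Union>n\<le>m. (\<lambda>d. poly (p n d) s) ` T n)"
  have "I \<subseteq> J" if J: "is_ideal A J" "S \<subseteq> J" for J
  proof -
    \<comment> \<open>Leading coefficients realized in both ideals. Membership in \<open>I\<close>
      is recorded as well, so that differences stay in \<open>I\<close> during the final descent on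
      degrees.\<close>
    define L' where "L' n = {d. \<exists>q\<in>polys D. degree q \<le> n \<and> coeff q n = d \<and> poly q s \<in> J \<and> poly q s \<in> I}" for n
    have L'_ideal: "is_ideal D (L' n)" for n
    proof (rule is_idealI)
      show "L' n \<subseteq> D" by (auto simp: L'_def polys_def)
      show "0 \<in> L' n" unfolding L'_def
        using subring_0[OF PD] ideal_0[OF I] ideal_0[OF J(1)] by (intro CollectI bexI[of _ 0]) auto
    next
      fix x y assume "x \<in> L' n" "y \<in> L' n"
      then obtain p q where "p \<in> polys D" "degree p \<le> n" "coeff p n = x" "poly p s \<in> J" "poly p s \<in> I"
        "q \<in> polys D" "degree q \<le> n" "coeff q n = y" "poly q s \<in> J" "poly q s \<in> I" unfolding L'_def by blast
      then show "x + y \<in> L' n" unfolding L'_def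
        by (intro CollectI bexI[of _ "p + q"])
          (auto intro: degree_add_le ideal_add[OF I] ideal_add[OF J(1)] subring_add[OF PD])
    next
      fix a x assume a: "a \<in> D" and "x \<in> L' n"
      then obtain p where "p \<in> polys D" "degree p \<le> n" "coeff p n = x" "poly p s \<in> J" "poly p s \<in> I"
        unfolding L'_def by blast
      then show "a * x \<in> L' n" unfolding L'_def
        using a DA by (intro CollectI bexI[of _ "smult a p"])
          (auto intro: ideal_mult[OF I] ideal_mult[OF J(1)] order_trans[OF degree_smult_le]
            simp: polys_def intro: subring_mult[OF D])
    qed
    have LL': "L n \<subseteq> L' n" for n
    proof (cases "n \<le> m")
      case True
      have "T n \<subseteq> L' n"
      proof
        fix d assume "d \<in> T n"
        then show "d \<in> L' n" unfolding L'_def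
          using p[OF True] J(2) True by (intro CollectI bexI[of _ "p n d"]) (auto simp: S_def)
      qed
      then show ?thesis using T(3)[OF L'_ideal] by blast
    next
      case False
      have "T m \<subseteq> L' n"
      proof
        fix d assume d: "d \<in> T m"
        have q: "monom 1 (n - m) * p m d \<in> polys D"
          using p[OF order_refl d] by (intro subring_mult[OF PD] polys_monom D subring_1) auto
        have deg: "degree (monom 1 (n - m) * p m d) \<le> n"
          using degree_mult_le[of "monom 1 (n - m)" "p m d"] degree_monom_le[of "1::'a" "n - m"]
            p[OF order_refl d] False by linarith
        have "poly (p m d) s \<in> J" using J(2) d by (auto simp: S_def)
        then show "d \<in> L' n" unfolding L'_def
          using q deg p[OF order_refl d] False
          by (intro CollectI bexI[of _ "monom 1 (n - m) * p m d"])
            (auto simp: poly_monom coeff_monom_mult intro: ideal_mult[OF I] ideal_mult[OF J(1)] subring_power[OF A sA])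
      qed
      then show ?thesis using T(3)[OF L'_ideal] m[of n] by blast
    qed
    have "poly q s \<in> J" if "q \<in> polys D" "degree q < n" "poly q s \<in> I" for q n
      using that
    proof (induction n arbitrary: q)
      case (Suc n)
      have "coeff q n \<in> L n" using Suc.prems unfolding L_def by (intro CollectI bexI[of _ q]) auto
      then have "coeff q n \<in> L' n" using LL' by blast
      then obtain r where r: "r \<in> polys D" "degree r \<le> n" "coeff r n = coeff q n" "poly r s \<in> J" "poly r s \<in> I"
        unfolding L'_def by blast
      have deg: "degree (q - r) \<le> n" using Suc.prems(2) r(2) by (intro degree_diff_le) auto
      have cf: "coeff (q - r) n = 0" using r(3) by simp
      have "poly (q - r) s \<in> J"
      \<comment> \<open>The coefficient of degree \<open>n\<close> cancels, so degree
        \<open>n\<close> is left only for the zero polynomial; otherwise the degree drops and the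
        induction hypothesis applies.\<close>
      proof (cases "degree (q - r) = n")
        case True
        then have "q - r = 0" using cf leading_coeff_0_iff by metis
        then show ?thesis using ideal_0[OF J(1)] by simp
      next
        case False
        then show ?thesis
          using Suc.IH[of "q - r"] Suc.prems r deg subring_diff[OF PD] ideal_diff[OF A I] by auto
      qed
      then show ?case using ideal_add[OF J(1) _ r(4), of "poly q s - poly r s"] by simp
    qed auto
    moreover have "\<exists>q\<in>polys D. x = poly q s" if "x \<in> I" for x
      using that ideal_subset[OF I] subring_gen_insert[OF D, of s] by (auto simp: A_def)
    ultimately show ?thesis by blast
  qed
  moreover have "finite S" "S \<subseteq> I" using T(1) p by (auto simp: S_def)
  ultimately show "\<exists>S. finite S \<and> S \<subseteq> I \<and> (\<forall>J. is_ideal (subring_gen (D \<union> {s})) J \<longrightarrow> S \<subseteq> J \<longrightarrow> I \<subseteq> J)"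
    unfolding A_def by blast
qed

lemma is_field_homD:
  assumes "is_field_hom \<iota>"
  shows "\<iota> 1 = 1" "\<iota> (a + b) = \<iota> a + \<iota> b" "\<iota> (a * b) = \<iota> a * \<iota> b" "\<iota> 0 = 0" "\<iota> (- a) = - \<iota> a"
    "\<iota> (a - b) = \<iota> a - \<iota> b" "\<iota> a = 0 \<longleftrightarrow> a = 0" "\<iota> (inverse a) = inverse (\<iota> a)"
proof -
  show 1: "\<iota> 1 = 1" and add: "\<And>a b. \<iota> (a + b) = \<iota> a + \<iota> b" and mult: "\<And>a b. \<iota> (a * b) = \<iota> a * \<iota> b"
    using assms by (auto simp: is_field_hom_def)
  show 0: "\<iota> 0 = 0" using add[of 0 0] by (metis add_0 add_cancel_right_left)
  show m: "\<And>a. \<iota> (- a) = - \<iota> a" using add[of _ "- _"] 0 by (metis add_eq_0_iff add.right_inverse)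
  show "\<iota> (a - b) = \<iota> a - \<iota> b" using add[of a "- b"] m[of b] by simp
  have inv: "\<iota> a * \<iota> (inverse a) = 1" if "a \<noteq> 0" for a using mult[of a "inverse a"] that 1 by simp
  show "\<iota> a = 0 \<longleftrightarrow> a = 0" using inv[of a] 0 by (metis mult_zero_left zero_neq_one)
  show "\<iota> (inverse a) = inverse (\<iota> a)"
    using inv[of a] 0 by (cases "a = 0") (auto simp: inverse_unique)
qed

lemma noetherian_finite_type:
  assumes h: "is_field_hom \<iota>" and S: "finite S"
  shows "noetherian (subring_gen (range \<iota> \<union> S))"
  using S
proof (induction S rule: finite_induct)
  case empty
  have r: "is_subring (range \<iota>)"
    unfolding is_subring_def
    using is_field_homD(1,4)[OF h] is_field_homD(3,6)[OF h, symmetric] by (auto intro: range_eqI[OF sym])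
  then have "subring_gen (range \<iota> \<union> {}) = range \<iota>"
    using subring_gen_least[of "range \<iota>" "range \<iota>"] subring_gen_superset[of "range \<iota>"] by auto
  moreover have "noetherian (range \<iota>)" unfolding noetherian_def
  proof (intro allI impI)
    fix I assume I: "is_ideal (range \<iota>) I"
    show "\<exists>S. finite S \<and> S \<subseteq> I \<and> (\<forall>J. is_ideal (range \<iota>) J \<longrightarrow> S \<subseteq> J \<longrightarrow> I \<subseteq> J)"
    proof (cases "I \<subseteq> {0}")
      case True
      then show ?thesis using ideal_0 by (intro exI[of _ "{}"]) blast
    next
      case False
      then obtain c where c: "\<iota> c \<in> I" "\<iota> c \<noteq> 0" using ideal_subset[OF I] by blast
      have "I \<subseteq> J" if J: "is_ideal (range \<iota>) J" "{\<iota> c} \<subseteq> J" for J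
      proof -
        have "\<iota> (inverse c) * \<iota> c \<in> J" using J ideal_mult by blast
        then have "1 \<in> J" using c is_field_homD(8)[OF h] by simp
        then show ?thesis using ideal_one[OF J(1)] ideal_subset[OF I] by simp
      qed
      then show ?thesis using c by (intro exI[of _ "{\<iota> c}"]) auto
    qed
  qed
  ultimately show ?case by simp
next
  case (insert s S)
  have "subring_gen (range \<iota> \<union> insert s S) = subring_gen (subring_gen (range \<iota> \<union> S) \<union> {s})"
    using subring_gen_Un_gen[of "range \<iota> \<union> S" "{s}"] by simp
  then show ?case using hilbert_basis[OF is_subring_gen insert.IH] by simp
qed

section \<open>Integral elements\<close>

lemma polys_pConsD: "pCons a p \<in> polys D \<Longrightarrow> a \<in> D \<and> p \<in> polys D"
  unfolding polys_def mem_Collect_eq by (metis coeff_pCons_0 coeff_pCons_Suc)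

text \<open>
  The determinant trick without determinants: a linear system whose diagonal entries are monic and
  of larger degree than the other entries in their rows keeps this shape under Gaussian elimination.
\<close>

lemma elimination:
  fixes A :: "'a::idom set" and v :: "nat \<Rightarrow> 'a"
  assumes A: "is_subring A" and D: "is_subring D" "D \<subseteq> A" and P: "is_ideal A P" and x: "x \<in> A"
  assumes "n > 0" "\<And>i. i < n \<Longrightarrow> v i \<in> A"
    and "\<And>i j. i < n \<Longrightarrow> j < n \<Longrightarrow> p i j \<in> polys D"
    and "\<And>i. i < n \<Longrightarrow> lead_coeff (p i i) = 1"
    and "\<And>i j. i < n \<Longrightarrow> j < n \<Longrightarrow> i \<noteq> j \<Longrightarrow> degree (p i j) < degree (p i i)"
    and "\<And>i. i < n \<Longrightarrow> (\<Sum>j<n. poly (p i j) x * v j) \<in> P"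
  shows "\<exists>q\<in>polys D. lead_coeff q = 1 \<and> poly q x * v 0 \<in> P"
  using assms(6-)
proof (induction n arbitrary: p)
  case (Suc k)
  note prems = Suc.prems
  show ?case
  proof (cases "k = 0")
    case True
    then show ?thesis using prems(3)[of 0 0] prems(4)[of 0] prems(6)[of 0] by auto
  next
    case False
    \<comment> \<open>Division-free elimination of the last unknown. The diagonal gains the degree
      of the monic pivot \<open>p k k\<close>, and the subtracted product stays strictly below it
      because both of its factors are dominated by the diagonal entries of their rows.\<close>
    define p' where "p' i j = p k k * p i j - p i k * p k j" for i j
    have p': "p' i j \<in> polys D" if "i < k" "j < k" for i j
      unfolding p'_def using that prems(3)
      by (intro subring_diff subring_mult is_subring_polys D(1)) auto
    have nz: "p i i \<noteq> 0" if "i < Suc k" for i using prems(4)[OF that] by auto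
    have deg0: "degree (p i k * p k j) < degree (p k k) + degree (p i i)" if "i < k" "j < k" for i j
    proof -
      have "degree (p i k * p k j) \<le> degree (p i k) + degree (p k j)" by (rule degree_mult_le)
      then show ?thesis using prems(5)[of i k] prems(5)[of k j] that by auto
    qed
    have lead: "degree (p' i i) = degree (p k k) + degree (p i i) \<and> lead_coeff (p' i i) = 1" if "i < k" for i
    proof -
      have d: "degree (p k k * p i i) = degree (p k k) + degree (p i i)"
        using nz[of k] nz[of i] that by (simp add: degree_mult_eq)
      have "degree (p' i i) = degree (p k k * p i i)"
        using degree_add_eq_left[of "- (p i k * p k i)" "p k k * p i i"] deg0[OF that that] d by (simp add: p'_def)
      moreover have "coeff (p' i i) (degree (p k k * p i i)) = 1"
        using deg0[OF that that] d prems(4)[of k] prems(4)[of i] that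
        by (simp add: p'_def coeff_eq_0 coeff_mult_degree_sum)
      ultimately show ?thesis using d by simp
    qed
    have deg': "degree (p' i j) < degree (p' i i)" if "i < k" "j < k" "i \<noteq> j" for i j
    proof -
      have "degree (p k k * p i j) \<le> degree (p k k) + degree (p i j)" by (rule degree_mult_le)
      then have "degree (p k k * p i j) < degree (p k k) + degree (p i i)" using prems(5)[of i j] that by auto
      then have "degree (p' i j) < degree (p k k) + degree (p i i)"
        unfolding p'_def using deg0[OF that(1,2)] by (intro degree_diff_less) auto
      then show ?thesis using lead[OF that(1)] by simp
    qed
    have sum': "(\<Sum>j<k. poly (p' i j) x * v j) \<in> P" if "i < k" for i
    proof -
      let ?R = "\<lambda>i. \<Sum>j<Suc k. poly (p i j) x * v j"
      have "(\<Sum>j<k. poly (p' i j) x * v j) =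
          poly (p k k) x * (\<Sum>j<k. poly (p i j) x * v j) - poly (p i k) x * (\<Sum>j<k. poly (p k j) x * v j)"
        by (simp add: p'_def sum_distrib_left sum_subtractf algebra_simps)
      also have "\<dots> = poly (p k k) x * ?R i - poly (p i k) x * ?R k" by (simp add: algebra_simps)
      also have "\<dots> \<in> P"
        using that by (intro ideal_diff[OF A P] ideal_mult[OF P] prems(6) poly_in_subring[OF A D(2) x] prems(3)) auto
      finally show ?thesis .
    qed
    have lc: "lead_coeff (p' i i) = 1" if "i < k" for i using lead[OF that] by blast
    have "k > 0" using False by simp
    then show ?thesis by (rule Suc.IH[OF _ prems(2)[OF less_SucI] p' lc deg' sum'])
  qed
qed auto

text \<open>The relations say that \<open>x\<close> acts on the vector \<open>v\<close> by the
  matrix \<open>c\<close> modulo \<open>P\<close>, so the system with \<open>x - c i i\<close> on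
  the diagonal is eliminated. As \<open>v 0 = 1\<close>, the resulting \<open>q\<close> satisfies
  \<open>poly q x \<in> P\<close>. Congruences modulo \<open>P\<close> replace the quotient ring,
  which would be a new type.\<close>

lemma integral_mod:
  fixes A :: "'a::idom set" and v :: "nat \<Rightarrow> 'a"
  assumes A: "is_subring A" and D: "is_subring D" "D \<subseteq> A" and P: "is_ideal A P" and x: "x \<in> A"
    and n: "n > 0" and v: "\<And>i. i < n \<Longrightarrow> v i \<in> A" "v 0 = 1"
    and c: "\<And>i j. i < n \<Longrightarrow> j < n \<Longrightarrow> c i j \<in> D"
    and xv: "\<And>i. i < n \<Longrightarrow> x * v i - (\<Sum>j<n. c i j * v j) \<in> P"
  shows "\<exists>q\<in>polys D. lead_coeff q = 1 \<and> poly q x \<in> P"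
proof -
  define p where "p i j = (if i = j then [:- c i i, 1:] else [:- c i j:])" for i j
  have "\<exists>q\<in>polys D. lead_coeff q = 1 \<and> poly q x * v 0 \<in> P"
  proof (rule elimination[where p = p and v = v and n = n, OF A D P x])
    show "p i j \<in> polys D" if "i < n" "j < n" for i j
      using c[OF that] subring_uminus[OF D(1)] polys_const[OF D(1)] subring_1[OF D(1)] subring_0[OF is_subring_polys[OF D(1)]]
      by (cases "i = j") (auto simp: p_def intro!: polys_pCons)
    show "(\<Sum>j<n. poly (p i j) x * v j) \<in> P" if "i < n" for i
    proof -
      have "(\<Sum>j<n. poly (p i j) x * v j) = (\<Sum>j<n. (if j = i then x * v i else 0) - c i j * v j)"
        by (intro sum.cong) (auto simp: p_def algebra_simps)
      also have "\<dots> = x * v i - (\<Sum>j<n. c i j * v j)" using that by (simp add: sum_subtractf)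
      finally show ?thesis using xv[OF that] by simp
    qed
  qed (use n v in \<open>auto simp: p_def\<close>)
  then show ?thesis using v(2) by simp
qed

lemma finite_over_integral:
  fixes A :: "'a::idom set"
  assumes A: "is_subring A" and D: "is_subring D" "D \<subseteq> A" and fin: "finite_over D A" and x: "x \<in> A"
  shows "\<exists>q\<in>polys D. lead_coeff q = 1 \<and> poly q x = 0"
proof -
  obtain S where S: "finite S" "S \<subseteq> A" "\<And>a. a \<in> A \<Longrightarrow> \<exists>c. (\<forall>s\<in>S. c s \<in> D) \<and> a = (\<Sum>s\<in>S. c s * s)"
    using fin unfolding finite_over_def by auto
  obtain C where C: "\<And>a s. a \<in> A \<Longrightarrow> s \<in> S \<Longrightarrow> C a s \<in> D" "\<And>a. a \<in> A \<Longrightarrow> a = (\<Sum>s\<in>S. C a s * s)"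
  proof -
    have "\<forall>a. \<exists>c. a \<in> A \<longrightarrow> (\<forall>s\<in>S. c s \<in> D) \<and> a = (\<Sum>s\<in>S. c s * s)" using S(3) by auto
    then obtain C where "\<forall>a. a \<in> A \<longrightarrow> (\<forall>s\<in>S. C a s \<in> D) \<and> a = (\<Sum>s\<in>S. C a s * s)" using choice by metis
    then show ?thesis using that by blast
  qed
  obtain f where f: "bij_betw f {..<card S} S" using S(1) by (metis bij_betw_from_nat_into_finite bij_betw_cong ex_bij_betw_nat_finite atLeast0LessThan)
  \<comment> \<open>The vector starts with 1, as \<open>integral_mod\<close> requires. Since 1 need
    not be one of the chosen generators, its column in \<open>c\<close> is zero.\<close>
  define v where "v i = (case i of 0 \<Rightarrow> 1 | Suc i \<Rightarrow> f i)" for i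
  define c where "c i j = (case j of 0 \<Rightarrow> 0 | Suc j \<Rightarrow> C (x * v i) (f j))" for i j
  have vA: "v i \<in> A" if "i < Suc (card S)" for i
    using that f S(2) subring_1[OF A] by (auto simp: v_def split: nat.splits dest: bij_betwE)
  have eq: "x * v i = (\<Sum>j<Suc (card S). c i j * v j)" if "i < Suc (card S)" for i
  proof -
    have "(\<Sum>j<Suc (card S). c i j * v j) = (\<Sum>j<card S. C (x * v i) (f j) * f j)"
      by (simp add: sum.lessThan_Suc_shift c_def v_def del: sum.lessThan_Suc)
    also have "\<dots> = (\<Sum>s\<in>S. C (x * v i) s * s)" using f by (rule sum.reindex_bij_betw)
    also have "\<dots> = x * v i" using C(2)[of "x * v i"] x vA[OF that] subring_mult[OF A] by simp
    finally show ?thesis by simp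
  qed
  have "is_ideal A {0}" using subring_0[OF A] by (auto simp: is_ideal_def)
  then have "\<exists>q\<in>polys D. lead_coeff q = 1 \<and> poly q x \<in> {0}"
  proof (rule integral_mod[OF A D _ x, where n = "Suc (card S)" and v = v and c = c])
    show "c i j \<in> D" if "i < Suc (card S)" "j < Suc (card S)" for i j
      using that C(1)[of "x * v i"] subring_mult[OF A x vA[OF that(1)]] f subring_0[OF D(1)]
      by (auto simp: c_def split: nat.splits dest: bij_betwE)
    show "x * v i - (\<Sum>j<Suc (card S). c i j * v j) \<in> {0}" if "i < Suc (card S)" for i
      using eq[OF that] by simp
  qed (use vA in \<open>auto simp: v_def\<close>)
  then show ?thesis by simp
qed

section \<open>The Nullstellensatz\<close>

text \<open>The quotient of \<open>D\<close> by \<open>P\<close> becomes a field after inverting one element.\<close>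

definition goldman :: "'a::comm_ring_1 set \<Rightarrow> 'a set \<Rightarrow> bool" where
  "goldman D P \<longleftrightarrow> (\<exists>a\<in>D - P. \<forall>d\<in>D - P. \<exists>e\<in>D. \<exists>m. d * e - a ^ m \<in> P)"

lemma power_cong_ideal:
  assumes A: "is_subring A" and P: "is_ideal A P" and "u \<in> A" "w \<in> A" "u - w \<in> P"
  shows "u ^ i - w ^ i \<in> P"
proof (induction i)
  case (Suc i)
  have "u ^ Suc i - w ^ Suc i = u * (u ^ i - w ^ i) + w ^ i * (u - w)" by (simp add: algebra_simps)
  then show ?case
    using Suc assms by (auto intro!: ideal_add[OF P] ideal_mult[OF P] subring_power)
qed (simp add: ideal_0[OF P])

text \<open>Modulo \<open>P\<close>, \<open>h\<close> is the quotient of \<open>y\<close> by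
  \<open>d\<close>. Multiplying its integral equation by \<open>d ^ degree q\<close> turns
  \<open>d * h\<close> into \<open>y\<close> everywhere, and all terms except the leading one keep a
  factor \<open>d\<close>. So \<open>d\<close> divides a power of \<open>y\<close> within
  \<open>D\<close>.\<close>

lemma homogenize:
  fixes A :: "'a::idom set"
  assumes A: "is_subring A" and D: "is_subring D" "D \<subseteq> A" and P: "is_ideal A P"
    and d: "d \<in> D" and y: "y \<in> D" and h: "h \<in> A" and dh: "d * h - y \<in> P"
    and q: "q \<in> polys D" "lead_coeff q = 1" "poly q h \<in> P"
  shows "\<exists>e\<in>D. d * e - y ^ degree q \<in> P"
proof -
  define N where "N = degree q"
  have cf: "coeff q i \<in> D" for i using q(1) by (auto simp: polys_def)
  have dA: "d \<in> A" "y \<in> A" "coeff q i \<in> A" for i using d y cf D(2) by auto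
  define e where "e = - (\<Sum>i<N. coeff q i * d ^ (N - i - 1) * y ^ i)"
  have "e \<in> D" unfolding e_def by (intro subring_intros(5)[OF D(1)] subring_intros(8)[OF D(1)] subring_mult[OF D(1)] subring_power[OF D(1)] cf d y)
  have "d ^ N * poly q h = (\<Sum>i\<le>N. coeff q i * d ^ (N - i) * (d * h) ^ i)"
    unfolding poly_altdef N_def sum_distrib_left
  proof (intro sum.cong refl)
    fix i assume "i \<in> {..degree q}"
    then have "d ^ degree q = d ^ (degree q - i) * d ^ i" by (simp flip: power_add)
    then show "d ^ degree q * (coeff q i * h ^ i) = coeff q i * d ^ (degree q - i) * (d * h) ^ i"
      by (simp add: power_mult_distrib mult_ac)
  qed
  moreover have "d ^ N * poly q h \<in> P" using q(3) dA by (intro ideal_mult[OF P] subring_power[OF A])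
  moreover have "(\<Sum>i\<le>N. coeff q i * d ^ (N - i) * ((d * h) ^ i - y ^ i)) \<in> P"
    using dA h by (intro ideal_sum[OF P] ideal_mult[OF P] power_cong_ideal[OF A P] dh)
      (auto intro!: subring_mult[OF A] subring_power[OF A])
  moreover have "(\<Sum>i\<le>N. coeff q i * d ^ (N - i) * ((d * h) ^ i - y ^ i)) =
     (\<Sum>i\<le>N. coeff q i * d ^ (N - i) * (d * h) ^ i) - (\<Sum>i\<le>N. coeff q i * d ^ (N - i) * y ^ i)"
    by (simp add: sum_subtractf algebra_simps)
  moreover have "(\<Sum>i\<le>N. coeff q i * d ^ (N - i) * y ^ i) = y ^ N - d * e"
  proof -
    have "(\<Sum>i<N. coeff q i * d ^ (N - i) * y ^ i) = (\<Sum>i<N. d * (coeff q i * d ^ (N - i - 1) * y ^ i))"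
    proof (intro sum.cong refl)
      fix i assume "i \<in> {..<N}"
      then have "N - i = Suc (N - i - 1)" by simp
      then have "d ^ (N - i) = d * d ^ (N - i - 1)" by (metis power_Suc)
      then show "coeff q i * d ^ (N - i) * y ^ i = d * (coeff q i * d ^ (N - i - 1) * y ^ i)" by simp
    qed
    then show ?thesis using q(2)
      by (simp add: e_def sum_distrib_left lessThan_Suc_atMost[symmetric] N_def)
  qed
  ultimately have "(y ^ N - d * e) \<in> P" using ideal_diff[OF A P] by (metis diff_diff_eq2 add_diff_cancel_left')
  then have "d * e - y ^ N \<in> P" using ideal_uminus[OF A P] by fastforce
  then show ?thesis using \<open>e \<in> D\<close> N_def by blast
qed

section \<open>Descent of Goldman's condition along one generator\<close>

context
  fixes A D P :: "'a::idom set" and s :: 'a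
  assumes D: "is_subring D" and Adef: "A = subring_gen (D \<union> {s})" and P: "is_prime_ideal A P"
begin

private lemma A: "is_subring A" and DA: "D \<subseteq> A" and sA: "s \<in> A"
  unfolding Adef using is_subring_gen subring_gen_superset by blast+

private lemmas PI = prime_ideal[OF P]

private lemma AE: "a \<in> A \<Longrightarrow> \<exists>p\<in>polys D. a = poly p s"
  unfolding Adef subring_gen_insert[OF D] by auto

private lemma polyA: "p \<in> polys D \<Longrightarrow> poly p s \<in> A"
  using poly_in_subring[OF A DA sA] .

private lemma poly_in_P: "p \<in> polys D \<Longrightarrow> (\<And>i. coeff p i \<in> P) \<Longrightarrow> poly p s \<in> P"
  unfolding poly_altdef
  by (intro ideal_sum[OF PI] ideal_mult_right[OF PI] subring_power[OF A sA])

text \<open>Finds the degree of \<open>p\<close> modulo \<open>P\<close>, which can be smaller than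
  \<open>degree p\<close>.\<close>

private lemma Max_coeff:
  assumes "p \<in> polys D" "coeff p i \<notin> P"
  shows "\<exists>j. coeff p j \<notin> P \<and> (\<forall>k>j. coeff p k \<in> P) \<and> i \<le> j"
proof -
  have fin: "finite {j. coeff p j \<notin> P}"
  proof (rule finite_subset)
    show "{j. coeff p j \<notin> P} \<subseteq> {..degree p}"
      using ideal_0[OF PI] by (auto simp: not_less[symmetric] coeff_eq_0 intro: ccontr)
  qed simp
  define j where "j = Max {j. coeff p j \<notin> P}"
  have "coeff p j \<notin> P" unfolding j_def using Max_in[OF fin] assms(2) by auto
  moreover have "coeff p k \<in> P" if "k > j" for k
    using Max_ge[OF fin, of k] that unfolding j_def by fastforce
  moreover have "i \<le> j" using Max_ge[OF fin, of i] assms(2) unfolding j_def by simp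
  ultimately show ?thesis by blast
qed

text \<open>Modulo \<open>P\<close> the ring \<open>A\<close> is a polynomial ring over
  \<open>D\<close>. There \<open>1 + s * b\<close> divides a power of \<open>b\<close> although it
  is coprime to \<open>b\<close>, so it would be a unit of positive degree.\<close>

private lemma transcendental_case:
  assumes G: "goldman A P" and tr: "\<And>p i. p \<in> polys D \<Longrightarrow> poly p s \<in> P \<Longrightarrow> coeff p i \<in> P"
  shows False
proof -
  note PD = is_subring_polys[OF D]
  obtain b where b: "b \<in> A" "b \<notin> P" "\<And>d. d \<in> A - P \<Longrightarrow> \<exists>e\<in>A. \<exists>m. d * e - b ^ m \<in> P"
    using G unfolding goldman_def by blast
  obtain \<beta> where \<beta>: "\<beta> \<in> polys D" "b = poly \<beta> s" using AE[OF b(1)] by blast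
  define q where "q = pCons 1 \<beta>"
  have q: "q \<in> polys D" unfolding q_def using \<beta>(1) subring_1[OF D] by (rule polys_pCons[rotated])
  have q0: "coeff q 0 \<notin> P" using prime_one[OF P] by (simp add: q_def)
  then have "poly q s \<in> A - P" using tr[OF q] polyA[OF q] by blast
  then obtain g m where g: "g \<in> A" "poly q s * g - b ^ m \<in> P" using b(3) by blast
  define y where "y = s * b"
  have y: "y \<in> A" "poly q s = 1 + y" using sA b(1) A by (auto simp: y_def q_def \<beta>(2) intro: subring_mult)
  \<comment> \<open>Inverse of \<open>1 + y\<close> modulo \<open>P\<close>: the geometric sum
    leaves the error \<open>(- y) ^ m\<close>, which is \<open>(- s) ^ m * b ^ m\<close>, and
    \<open>b ^ m\<close> is congruent to \<open>(1 + y) * g\<close>.\<close>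
  define r0 where "r0 = (\<Sum>i<m. (- y) ^ i) + (- s) ^ m * g"
  have "r0 \<in> A" unfolding r0_def using y sA g A
    by (auto intro!: subring_add subring_sum subring_power subring_uminus subring_mult)
  then obtain r where r: "r \<in> polys D" "r0 = poly r s" using AE by blast
  have "1 - poly q s * r0 = - ((- s) ^ m * (poly q s * g - b ^ m))"
  proof -
    have "1 - (- y) ^ m = poly q s * (\<Sum>i<m. (- y) ^ i)"
      using one_diff_power_eq[of "- y" m] y(2) by simp
    moreover have "(- y) ^ m = (- s) ^ m * b ^ m" unfolding y_def by (metis mult_minus_left power_mult_distrib)
    ultimately show ?thesis by (simp add: r0_def algebra_simps)
  qed
  also have "\<dots> \<in> P" using g(2) sA by (intro ideal_uminus[OF A PI] ideal_mult[OF PI] subring_power[OF A] subring_uminus[OF A])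
  finally have "poly (1 - q * r) s \<in> P" using r(2) by simp
  then have cf: "coeff (1 - q * r) i \<in> P" for i
    using tr[of "1 - q * r"] q r(1) subring_diff[OF PD subring_1[OF PD] subring_mult[OF PD]] by blast
  have qD: "coeff q i \<in> A" "coeff r i \<in> A" for i using q r(1) DA by (auto simp: polys_def)
  have "\<exists>i. coeff \<beta> i \<notin> P" using b(2) poly_in_P[OF \<beta>(1)] \<beta>(2) by blast
  then obtain i where "coeff q (Suc i) \<notin> P" by (auto simp: q_def)
  then obtain j where j: "coeff q j \<notin> P" "\<And>k. k > j \<Longrightarrow> coeff q k \<in> P" "j \<ge> 1"
    using Max_coeff[OF q] by (metis Suc_leD Suc_le_eq le_trans One_nat_def le_zero_eq not_less_eq_eq)
  have "coeff r 0 \<notin> P"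
  proof
    assume "coeff r 0 \<in> P"
    then have "coeff (1 - q * r) 0 + coeff q 0 * coeff r 0 \<in> P"
      using cf qD by (intro ideal_add[OF PI] ideal_mult[OF PI])
    then show False using prime_one[OF P] by (simp add: coeff_mult)
  qed
  then obtain l where l: "coeff r l \<notin> P" "\<And>k. k > l \<Longrightarrow> coeff r k \<in> P" using Max_coeff[OF r(1)] by blast
  \<comment> \<open>The top coefficients of \<open>q\<close> and \<open>r\<close> modulo
    \<open>P\<close> survive in degree \<open>j + l\<close>, which is positive; this contradicts
    \<open>q * r = 1\<close> modulo \<open>P\<close>.\<close>
  have "coeff (q * r) (j + l) = (\<Sum>i\<in>{..j+l} - {j}. coeff q i * coeff r (j + l - i)) + coeff q j * coeff r l"
    by (simp add: coeff_mult sum.remove[of "{..j+l}" j] add.commute)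
  moreover have "(\<Sum>i\<in>{..j+l} - {j}. coeff q i * coeff r (j + l - i)) \<in> P"
  proof (rule ideal_sum[OF PI])
    fix i assume i: "i \<in> {..j+l} - {j}"
    show "coeff q i * coeff r (j + l - i) \<in> P"
    proof (cases "i > j")
      case True
      then show ?thesis using j(2) qD by (intro ideal_mult_right[OF PI])
    next
      case False
      then have "j + l - i > l" using i by auto
      then show ?thesis using l(2) qD by (intro ideal_mult[OF PI])
    qed
  qed
  moreover have "coeff (q * r) (j + l) \<in> P"
    using ideal_uminus[OF A PI cf[of "j + l"]] j(3) by (simp add: coeff_1)
  ultimately have "coeff q j * coeff r l \<in> P" using ideal_diff[OF A PI] by (metis add_diff_cancel_left')
  then show False using prime_mult[OF P] qD j(1) l(1) by blast
qed

text \<open>Inverting the top coefficient \<open>c\<close> of a relation for \<open>s\<close> makes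
  \<open>s\<close> integral over \<open>D\<close> modulo \<open>P\<close>, so every element of
  \<open>A\<close> becomes integral after multiplication by a power of \<open>c\<close>. Integral
  equations then bring the witness \<open>b\<close>, and the quotients of its powers by elements of
  \<open>D\<close>, down to \<open>D\<close>.\<close>

private lemma algebraic_case:
  assumes G: "goldman A P" and p: "p \<in> polys D" "poly p s \<in> P" "coeff p i \<notin> P"
  shows "goldman D P"
proof -
  obtain n where n: "coeff p n \<notin> P" "\<And>k. k > n \<Longrightarrow> coeff p k \<in> P" using Max_coeff[OF p(1,3)] by blast
  define c where "c = coeff p n"
  have cfD: "coeff p i \<in> D" for i using p(1) by (auto simp: polys_def)
  have cD: "c \<in> D" and cP: "c \<notin> P" and cA: "c \<in> A" using cfD n(1) DA by (auto simp: c_def)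
  have rel: "(\<Sum>i\<le>n. coeff p i * s ^ i) \<in> P"
  proof -
    have "poly p s = (\<Sum>i\<le>n + degree p. coeff p i * s ^ i)"
      unfolding poly_altdef by (rule sum.mono_neutral_left) (auto simp: coeff_eq_0)
    also have "\<dots> = (\<Sum>i\<le>n. coeff p i * s ^ i) + (\<Sum>i\<in>{..n + degree p} - {..n}. coeff p i * s ^ i)"
      by (subst sum.subset_diff[of "{..n}"]) (auto simp: add.commute)
    finally have "(\<Sum>i\<le>n. coeff p i * s ^ i) = poly p s - (\<Sum>i\<in>{..n + degree p} - {..n}. coeff p i * s ^ i)"
      by simp
    also have "\<dots> \<in> P" using p(2) n(2)
      by (intro ideal_diff[OF A PI] ideal_sum[OF PI] ideal_mult_right[OF PI] subring_power[OF A sA]) auto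
    finally show ?thesis .
  qed
  have npos: "n > 0" using rel n(1) by (cases n) auto
  \<comment> \<open>Modulo \<open>P\<close> this is the \<open>D\<close>-span of the first
    \<open>n\<close> powers of \<open>s\<close>. Stability is available for \<open>c * s\<close>
    only, because the relation expresses \<open>c * s ^ n\<close>, and not \<open>s ^ n\<close>, by
    lower powers.\<close>
  define E where "E = {u \<in> A. \<exists>g. (\<forall>i. g i \<in> D) \<and> u - (\<Sum>i<n. g i * s ^ i) \<in> P}"
  have E_add: "u + w \<in> E" if "u \<in> E" "w \<in> E" for u w
  proof -
    obtain g h where gh: "\<forall>i. g i \<in> D" "u - (\<Sum>i<n. g i * s ^ i) \<in> P" "\<forall>i. h i \<in> D" "w - (\<Sum>i<n. h i * s ^ i) \<in> P"
      using \<open>u \<in> E\<close> \<open>w \<in> E\<close> unfolding E_def by blast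
    have "u + w - (\<Sum>i<n. (g i + h i) * s ^ i) = (u - (\<Sum>i<n. g i * s ^ i)) + (w - (\<Sum>i<n. h i * s ^ i))"
      by (simp add: sum.distrib algebra_simps)
    also have "\<dots> \<in> P" using gh by (intro ideal_add[OF PI])
    finally have "\<exists>g. (\<forall>i. g i \<in> D) \<and> u + w - (\<Sum>i<n. g i * s ^ i) \<in> P"
      using gh subring_add[OF D] by (intro exI[of _ "\<lambda>i. g i + h i"]) auto
    then show ?thesis using that subring_add[OF A] unfolding E_def by blast
  qed
  have E_mult: "d * u \<in> E" if "u \<in> E" "d \<in> D" for u d
  proof -
    obtain g where g: "\<forall>i. g i \<in> D" "u - (\<Sum>i<n. g i * s ^ i) \<in> P" using \<open>u \<in> E\<close> unfolding E_def by blast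
    have "d * u - (\<Sum>i<n. (d * g i) * s ^ i) = d * (u - (\<Sum>i<n. g i * s ^ i))"
      by (simp add: sum_distrib_left algebra_simps)
    also have "\<dots> \<in> P" using g that DA by (intro ideal_mult[OF PI]) auto
    finally have "\<exists>g. (\<forall>i. g i \<in> D) \<and> d * u - (\<Sum>i<n. g i * s ^ i) \<in> P"
      using g that subring_mult[OF D] by (intro exI[of _ "\<lambda>i. d * g i"]) auto
    then show ?thesis using that subring_mult[OF A] DA unfolding E_def by blast
  qed
  have E_P: "u \<in> E" if "u \<in> P" for u
    using that ideal_subset[OF PI] subring_0[OF D] unfolding E_def by (auto intro!: exI[of _ "\<lambda>_. 0"])
  have E_s: "s ^ i \<in> E" if "i < n" for i
  proof -
    have "s ^ i - (\<Sum>j<n. (if j = i then 1 else 0) * s ^ j) = 0" using that by (simp add: if_distrib[of "\<lambda>x. x * _"] cong: if_cong)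
    then have "s ^ i - (\<Sum>j<n. (if j = i then 1 else 0) * s ^ j) \<in> P" using ideal_0[OF PI] by (rule ssubst)
    moreover have "\<forall>j. (if j = i then 1 else 0) \<in> D" using subring_0[OF D] subring_1[OF D] by auto
    ultimately have "\<exists>g. (\<forall>j. g j \<in> D) \<and> s ^ i - (\<Sum>j<n. g j * s ^ j) \<in> P"
      by (intro exI[of _ "\<lambda>j. if j = i then 1 else 0"] conjI)
    then show ?thesis unfolding E_def using subring_power[OF A sA] by blast
  qed
  have E_sum: "(\<Sum>i\<in>I. f i) \<in> E" if "\<And>i. i \<in> I \<Longrightarrow> f i \<in> E" for I :: "nat set" and f
    using that by (induction I rule: infinite_finite_induct) (auto intro: E_add E_P[OF ideal_0[OF PI]])
  have cs: "c * s * u \<in> E" if u: "u \<in> E" for u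
  proof -
    obtain g where g: "\<forall>i. g i \<in> D" "u - (\<Sum>i<n. g i * s ^ i) \<in> P" using u unfolding E_def by blast
    have sn: "c * s ^ n \<in> E"
    proof -
      have "c * s ^ n = (\<Sum>i\<le>n. coeff p i * s ^ i) + (\<Sum>i<n. (- coeff p i) * s ^ i)"
        by (simp add: c_def sum_negf lessThan_Suc_atMost[symmetric])
      also have "\<dots> \<in> E" using cfD subring_uminus[OF D] by (intro E_add E_P rel E_sum E_mult E_s) auto
      finally show ?thesis .
    qed
    have "c * s ^ Suc i \<in> E" if "i < n" for i
    proof (cases "Suc i < n")
      case True
      then show ?thesis by (rule E_mult[OF E_s cD])
    next
      case False
      then have "Suc i = n" using that by simp
      then show ?thesis using sn by simp
    qed
    then have "g i * (c * s ^ Suc i) \<in> E" if "i < n" for i using E_mult g(1) that by blast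
    then have "(\<Sum>i<n. g i * (c * s ^ Suc i)) \<in> E" by (intro E_sum) (auto simp del: power_Suc)
    moreover have "c * s * (u - (\<Sum>i<n. g i * s ^ i)) \<in> E"
      using g cA sA by (intro E_P ideal_mult[OF PI] subring_mult[OF A]) auto
    moreover have "c * s * u = c * s * (u - (\<Sum>i<n. g i * s ^ i)) + (\<Sum>i<n. g i * (c * s ^ Suc i))"
      by (simp add: algebra_simps sum_distrib_left)
    ultimately show ?thesis using E_add by metis
  qed
  have E_1: "1 \<in> E" using E_s[OF npos] by simp
  have pow: "\<exists>r. c ^ r * poly q s \<in> E" if "q \<in> polys D" for q
    using that
  proof (induction q)
    case 0
    then show ?case using E_P[OF ideal_0[OF PI]] by simp
  next
    case (pCons a q)
    have "a \<in> D" "q \<in> polys D" using polys_pConsD[OF pCons.prems] by auto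
    then obtain r where r: "c ^ r * poly q s \<in> E" using pCons.IH by blast
    have "c ^ Suc r * poly (pCons a q) s = (c ^ Suc r * a) * 1 + c * s * (c ^ r * poly q s)" by (simp add: algebra_simps)
    also have "\<dots> \<in> E"
      by (rule E_add[OF E_mult[OF E_1 subring_mult[OF D subring_power[OF D cD] \<open>a \<in> D\<close>]] cs[OF r]])
    finally show ?case by blast
  qed
  have integral: "\<exists>r. \<exists>q\<in>polys D. lead_coeff q = 1 \<and> poly q (c ^ r * h) \<in> P" if h: "h \<in> A" for h
  proof -
    have "\<forall>i. \<exists>r. c ^ r * (h * s ^ i) \<in> E"
      using pow AE subring_mult[OF A h subring_power[OF A sA]] by metis
    then obtain r where r: "\<And>i. c ^ r i * (h * s ^ i) \<in> E" by metis
    define R where "R = (\<Sum>i<n. r i)"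
    have "c ^ R * (h * s ^ i) \<in> E" if "i < n" for i
    proof -
      have "r i \<le> R" unfolding R_def using that by (intro member_le_sum) auto
      then have "c ^ R * (h * s ^ i) = c ^ (R - r i) * (c ^ r i * (h * s ^ i))"
        by (simp flip: power_add mult.assoc)
      then show ?thesis using E_mult[OF r subring_power[OF D cD]] by metis
    qed
    then have "\<forall>i. \<exists>g. i < n \<longrightarrow> (\<forall>j. g j \<in> D) \<and> c ^ R * (h * s ^ i) - (\<Sum>j<n. g j * s ^ j) \<in> P"
      unfolding E_def by blast
    then obtain g where g: "\<And>i j. i < n \<Longrightarrow> g i j \<in> D" "\<And>i. i < n \<Longrightarrow> c ^ R * (h * s ^ i) - (\<Sum>j<n. g i j * s ^ j) \<in> P"
      by metis
    have "\<exists>q\<in>polys D. lead_coeff q = 1 \<and> poly q (c ^ R * h) \<in> P"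
      by (rule integral_mod[OF A D DA PI, where n = n and v = "\<lambda>i. s ^ i" and c = g])
        (use g npos h cA sA in \<open>auto simp: mult.assoc intro!: subring_mult[OF A] subring_power[OF A]\<close>)
    then show ?thesis by blast
  qed
  obtain b where b: "b \<in> A" "b \<notin> P" "\<And>d. d \<in> A - P \<Longrightarrow> \<exists>e\<in>A. \<exists>m. d * e - b ^ m \<in> P"
    using G unfolding goldman_def by blast
  \<comment> \<open>A multiple of \<open>b\<close> that is congruent to an element of
    \<open>D\<close>: the constant term of a monic relation for \<open>c ^ r * b\<close>. Minimal
    degree keeps it outside \<open>P\<close>, since otherwise a factor \<open>x\<close> could be
    cancelled.\<close>
  obtain c0 b' where c0: "c0 \<in> D" "c0 \<notin> P" "b' \<in> A" "b * b' - c0 \<in> P"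
  proof -
    obtain r where r: "\<exists>q. q \<in> polys D \<and> lead_coeff q = 1 \<and> poly q (c ^ r * b) \<in> P" using integral[OF b(1)] by blast
    define x where "x = c ^ r * b"
    have x: "x \<in> A" "x \<notin> P"
      using b cA cP prime_mult[OF P, of "c ^ r" b] prime_power[OF A P] subring_power[OF A] subring_mult[OF A]
      unfolding x_def by blast+
    obtain q where q: "q \<in> polys D" "lead_coeff q = 1" "poly q x \<in> P"
      and min: "\<And>q'. q' \<in> polys D \<Longrightarrow> lead_coeff q' = 1 \<Longrightarrow> poly q' x \<in> P \<Longrightarrow> degree q \<le> degree q'"
      using r ex_has_least_nat[of "\<lambda>q. q \<in> polys D \<and> lead_coeff q = 1 \<and> poly q x \<in> P" _ degree]
      unfolding x_def by blast
    obtain q0 q' where qq: "q = pCons q0 q'" by (cases q)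
    have q0: "q0 \<in> D" and q': "q' \<in> polys D" using polys_pConsD[OF q(1)[unfolded qq]] by auto
    have qx: "poly q' x \<in> A" using poly_in_subring[OF A DA x(1) q'] .
    have "q0 \<notin> P"
    proof
      assume "q0 \<in> P"
      show False
      proof (cases "q' = 0")
        case True
        then show False using q(2) \<open>q0 \<in> P\<close> prime_one[OF P] by (auto simp: qq split: if_splits)
      next
        case False
        have "x * poly q' x = poly q x - q0" by (simp add: qq)
        then have "x * poly q' x \<in> P" using ideal_diff[OF A PI q(3) \<open>q0 \<in> P\<close>] by simp
        then have "poly q' x \<in> P" using prime_mult[OF P x(1) qx] x(2) by blast
        then have "degree q \<le> degree q'" using min[OF q'] q(2) False by (simp add: qq)
        then show False using False by (simp add: qq)
      qed
    qed
    moreover have "b * (- (c ^ r * poly q' x)) - q0 = - poly q x" by (simp add: qq x_def algebra_simps)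
    then have "b * (- (c ^ r * poly q' x)) - q0 \<in> P" using ideal_uminus[OF A PI q(3)] by simp
    moreover have "- (c ^ r * poly q' x) \<in> A"
      using qx cA by (intro subring_uminus[OF A] subring_mult[OF A] subring_power[OF A])
    ultimately show ?thesis using that q0 by blast
  qed
  have c0A: "c0 \<in> A" using c0(1) DA by auto
  have "\<exists>e\<in>D. \<exists>m. d * e - (c * c0) ^ m \<in> P" if d: "d \<in> D - P" for d
  proof -
    have dA: "d \<in> A" using d DA by auto
    obtain e m where e: "e \<in> A" "d * e - b ^ m \<in> P" using b(3)[of d] d DA by blast
    define h where "h = e * b' ^ m"
    have h: "h \<in> A" unfolding h_def using e c0 A by (auto intro: subring_mult subring_power)
    have "d * h - c0 ^ m = b' ^ m * (d * e - b ^ m) + ((b * b') ^ m - c0 ^ m)"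
      by (simp add: h_def algebra_simps power_mult_distrib)
    also have "\<dots> \<in> P" using e c0 b(1) c0A
      by (intro ideal_add[OF PI] ideal_mult[OF PI] power_cong_ideal[OF A PI] subring_power[OF A] subring_mult[OF A]) auto
    finally have dh: "d * h - c0 ^ m \<in> P" .
    obtain r q where q: "q \<in> polys D" "lead_coeff q = 1" "poly q (c ^ r * h) \<in> P" using integral[OF h] by blast
    define N where "N = degree q"
    have "d * (c ^ r * h) - c ^ r * c0 ^ m = c ^ r * (d * h - c0 ^ m)" by (simp add: algebra_simps)
    then have "d * (c ^ r * h) - c ^ r * c0 ^ m \<in> P" using dh ideal_mult[OF PI subring_power[OF A cA]] by metis
    then obtain e' where e': "e' \<in> D" "d * e' - (c ^ r * c0 ^ m) ^ N \<in> P"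
      using homogenize[OF A D DA PI _ _ _ _ q, of d "c ^ r * c0 ^ m"] d cD c0(1) h cA D A unfolding N_def
      by (auto intro: subring_mult subring_power)
    \<comment> \<open>Balances the exponents so that the right-hand side becomes a power of the
      single element \<open>c * c0\<close>.\<close>
    define w where "w = c ^ (m * N) * c0 ^ (r * N)"
    have w: "w \<in> D" unfolding w_def using cD c0(1) D by (intro subring_mult subring_power)
    have "d * (e' * w) - (c * c0) ^ ((r + m) * N) = w * (d * e' - (c ^ r * c0 ^ m) ^ N)"
      by (simp add: w_def algebra_simps power_mult_distrib power_add flip: power_mult)
    also have "\<dots> \<in> P" using w DA e' by (intro ideal_mult[OF PI]) auto
    finally show ?thesis using subring_mult[OF D e'(1) w] by blast
  qed
  moreover have "c * c0 \<in> D - P" using cD cP c0 c0A cA prime_mult[OF P] subring_mult[OF D] by blast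
  ultimately show ?thesis unfolding goldman_def by blast
qed

lemma goldman_step: "goldman A P \<Longrightarrow> goldman D P"
  using transcendental_case algebraic_case by blast

end

text \<open>Generators are removed one at a time. Each time the prime is intersected with the
  smaller ring, which leaves Goldman's condition for that ring unchanged.\<close>

lemma goldman_finite:
  fixes P :: "'a::idom set"
  assumes T: "finite T" and B: "is_subring B"
    and "is_prime_ideal (subring_gen (B \<union> T)) P" "goldman (subring_gen (B \<union> T)) P"
  shows "goldman B P"
  using T assms(3-)
proof (induction T arbitrary: P rule: finite_induct)
  case empty
  have "subring_gen B = B" using subring_gen_least[OF B order_refl] subring_gen_superset[of B] by auto
  then show ?case using empty by simp
next
  case (insert s T)
  let ?D = "subring_gen (B \<union> T)"
  have eq: "subring_gen (B \<union> insert s T) = subring_gen (?D \<union> {s})"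
    using subring_gen_Un_gen[of "B \<union> T" "{s}"] by simp
  have "goldman ?D P" by (rule goldman_step[OF is_subring_gen eq insert.prems(1,2)])
  have sub: "?D \<subseteq> subring_gen (B \<union> insert s T)" by (rule subring_gen_mono) auto
  have "is_prime_ideal ?D (P \<inter> ?D)" using prime_inter[OF is_subring_gen sub insert.prems(1)] .
  moreover have "goldman ?D (P \<inter> ?D)"
    using \<open>goldman ?D P\<close> is_subring_gen[of "B \<union> T"] unfolding goldman_def
    by (fastforce intro: subring_diff subring_mult subring_power)
  ultimately have "goldman B (P \<inter> ?D)" by (rule insert.IH)
  then show ?case
    using subring_gen_superset[of "B \<union> T"] unfolding goldman_def by blast
qed

definition ev :: "('k::comm_ring_1 \<Rightarrow> 'f::comm_ring_1) \<Rightarrow> 'f \<Rightarrow> 'k poly \<Rightarrow> 'f" where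
  "ev \<iota> f p = poly (map_poly \<iota> p) f"

context
  fixes \<iota> :: "'k::field \<Rightarrow> 'f::field" assumes h: "is_field_hom \<iota>"
begin

lemma ev_pCons: "ev \<iota> f (pCons a p) = \<iota> a + f * ev \<iota> f p"
  by (simp add: ev_def map_poly_pCons is_field_homD[OF h])

lemma ev_0: "ev \<iota> f 0 = 0" by (simp add: ev_def)

lemma ev_1: "ev \<iota> f 1 = 1" by (simp add: one_pCons ev_pCons ev_0 is_field_homD[OF h])

lemma ev_add: "ev \<iota> f (p + q) = ev \<iota> f p + ev \<iota> f q"
proof -
  have "map_poly \<iota> (p + q) = map_poly \<iota> p + map_poly \<iota> q"
    by (intro poly_eqI) (simp add: coeff_map_poly is_field_homD[OF h])
  then show ?thesis by (simp add: ev_def)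
qed

lemma ev_diff: "ev \<iota> f (p - q) = ev \<iota> f p - ev \<iota> f q"
  using ev_add[of f "p - q" q] by simp

lemma ev_smult: "ev \<iota> f (smult a p) = \<iota> a * ev \<iota> f p"
proof -
  have "map_poly \<iota> (smult a p) = smult (\<iota> a) (map_poly \<iota> p)"
    by (intro poly_eqI) (simp add: coeff_map_poly is_field_homD[OF h])
  then show ?thesis by (simp add: ev_def)
qed

lemma ev_mult: "ev \<iota> f (p * q) = ev \<iota> f p * ev \<iota> f q"
  by (induction p) (simp_all add: ev_0 ev_pCons ev_add ev_smult algebra_simps is_field_homD[OF h])

lemma ev_power: "ev \<iota> f (p ^ m) = ev \<iota> f p ^ m"
  by (induction m) (simp_all add: ev_1 ev_mult)

lemma is_subring_range: "is_subring (range \<iota>)"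
  unfolding is_subring_def
  using is_field_homD(1,4)[OF h] is_field_homD(3,6)[OF h, symmetric] by (auto intro: range_eqI[OF sym])

lemma ev_range: "a \<in> subring_gen (range \<iota> \<union> {f}) \<Longrightarrow> \<exists>p. a = ev \<iota> f p"
proof -
  assume "a \<in> subring_gen (range \<iota> \<union> {f})"
  then obtain p where p: "p \<in> polys (range \<iota>)" "a = poly p f"
    using subring_gen_insert[OF is_subring_range] by auto
  have "\<exists>p'. poly p f = ev \<iota> f p'" if "p \<in> polys (range \<iota>)" for p
    using that
  proof (induction p)
    case 0
    then show ?case by (intro exI[of _ 0]) (simp add: ev_0)
  next
    case (pCons a p)
    obtain p' where "poly p f = ev \<iota> f p'" using pCons.IH polys_pConsD[OF pCons.prems] by blast
    moreover obtain a' where "a = \<iota> a'" using polys_pConsD[OF pCons.prems] by blast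
    ultimately show ?case by (intro exI[of _ "pCons a' p'"]) (simp add: ev_pCons)
  qed
  then show ?thesis using p by blast
qed

end

text \<open>Over the algebraically closed field \<open>\<delta>\<close> splits into linear factors,
  and a prime that contains a product contains a factor; the leading constant is invertible and is
  excluded.\<close>

lemma prime_contains_linear:
  fixes \<iota> :: "'k::alg_closed_field \<Rightarrow> 'f::field"
  assumes h: "is_field_hom \<iota>" and A: "is_subring A" and P: "is_prime_ideal A P" and r: "range \<iota> \<subseteq> A" and f: "f \<in> A"
    and "\<delta> \<noteq> 0" "ev \<iota> f \<delta> \<in> P"
  shows "\<exists>c. f - \<iota> c \<in> P"
  using assms(6-)
proof (induction "degree \<delta>" arbitrary: \<delta>)
  case 0
  then obtain a where a: "\<delta> = [:a:]" "a \<noteq> 0" by (metis degree_eq_zeroE pCons_0_0)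
  then have "\<iota> a \<in> P" using 0 by (simp add: ev_pCons[OF h] ev_0[OF h])
  then have "\<iota> (inverse a) * \<iota> a \<in> P" using r ideal_mult[OF prime_ideal[OF P]] by auto
  then show ?case using a prime_one[OF P] by (simp add: is_field_homD[OF h])
next
  case (Suc n)
  obtain c where "poly \<delta> c = 0" using alg_closed_imp_poly_has_root[of \<delta>] Suc by auto
  then obtain \<delta>' where d: "\<delta> = [:-c, 1:] * \<delta>'" by (auto simp: poly_eq_0_iff_dvd dvd_def)
  have "ev \<iota> f \<delta> = (f - \<iota> c) * ev \<iota> f \<delta>'"
    unfolding d ev_mult[OF h] by (simp add: ev_pCons[OF h] ev_0[OF h] is_field_homD[OF h] algebra_simps)
  moreover have "f - \<iota> c \<in> A" using f r A by (auto intro: subring_diff)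
  moreover have "ev \<iota> f \<delta>' \<in> A"
    unfolding ev_def by (rule poly_in_subring[OF A r f]) (auto simp: polys_def coeff_map_poly is_field_homD[OF h])
  ultimately have "f - \<iota> c \<in> P \<or> ev \<iota> f \<delta>' \<in> P" using Suc.prems prime_mult[OF P] by metis
  moreover have nz: "\<delta>' \<noteq> 0" using d Suc.prems(1) by auto
  moreover have "degree \<delta>' = n"
  proof -
    have "degree \<delta> = degree [:-c, 1:] + degree \<delta>'" unfolding d by (rule degree_mult_eq) (use nz in auto)
    then show ?thesis using Suc.hyps(2) by simp
  qed
  ultimately show ?case using Suc.hyps(1) by blast
qed

text \<open>Goldman's condition descends to the subring generated over \<open>k\<close> by the
  single element \<open>f\<close>. If \<open>P\<close> contained no \<open>f - \<iota> c\<close>,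
  then each such element would divide a power of the witness modulo \<open>P\<close>, and this
  divisibility is a nontrivial polynomial relation for \<open>f\<close>.\<close>

lemma nullstellensatz_goldman:
  fixes \<iota> :: "'k::alg_closed_field \<Rightarrow> 'f::field"
  assumes h: "is_field_hom \<iota>" and S: "finite S" and P: "is_prime_ideal (subring_gen (range \<iota> \<union> S)) P"
    and G: "goldman (subring_gen (range \<iota> \<union> S)) P" and f: "f \<in> subring_gen (range \<iota> \<union> S)"
  shows "\<exists>c. f - \<iota> c \<in> P"
proof (rule ccontr)
  assume no: "\<not> ?thesis"
  let ?A = "subring_gen (range \<iota> \<union> S)" and ?B = "subring_gen (range \<iota> \<union> {f})"
  have BA: "?B \<subseteq> ?A" using subring_gen_least[OF is_subring_gen] f subring_gen_superset[of "range \<iota> \<union> S"]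
    by (metis Un_insert_right insert_subset le_sup_iff sup_bot_right)
  have "?A = subring_gen (?B \<union> S)"
  proof
    show "?A \<subseteq> subring_gen (?B \<union> S)"
      using subring_gen_superset[of "range \<iota> \<union> {f}"] by (intro subring_gen_mono) auto
    show "subring_gen (?B \<union> S) \<subseteq> ?A"
      using subring_gen_superset[of "range \<iota> \<union> S"] BA by (intro subring_gen_least[OF is_subring_gen]) auto
  qed
  then have "goldman ?B P" using goldman_finite[OF S is_subring_gen[of "range \<iota> \<union> {f}"]] P G by metis
  then obtain a where a: "a \<in> ?B" "a \<notin> P" "\<And>d. d \<in> ?B - P \<Longrightarrow> \<exists>e\<in>?B. \<exists>m. d * e - a ^ m \<in> P"
    unfolding goldman_def by blast
  obtain \<alpha> where \<alpha>: "a = ev \<iota> f \<alpha>" using ev_range[OF h a(1)] by blast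
  have "\<alpha> \<noteq> 0" using \<alpha> a(2) ideal_0[OF prime_ideal[OF P]] by (auto simp: ev_0[OF h])
  \<comment> \<open>A constant at which \<open>\<alpha>\<close> does not vanish: anything if
    \<open>\<alpha>\<close> is constant, otherwise a root of \<open>\<alpha> - 1\<close>.\<close>
  obtain c where c: "poly \<alpha> c \<noteq> 0"
  proof (cases "degree \<alpha> = 0")
    case True
    then show ?thesis using that[of 0] \<open>\<alpha> \<noteq> 0\<close> by (auto elim!: degree_eq_zeroE)
  next
    case False
    have "degree (\<alpha> - 1) = degree \<alpha>" using False degree_add_eq_left[of "-1" \<alpha>] by simp
    then obtain c where "poly (\<alpha> - 1) c = 0" using alg_closed_imp_poly_has_root[of "\<alpha> - 1"] False by auto
    then show ?thesis using that[of c] by simp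
  qed
  have "f - \<iota> c \<in> ?B - P"
    using no subring_diff[OF is_subring_gen, of f "range \<iota> \<union> {f}" "\<iota> c"] subring_gen_superset[of "range \<iota> \<union> {f}"] by auto
  then obtain e m where e: "e \<in> ?B" "(f - \<iota> c) * e - a ^ m \<in> P" using a(3) by blast
  obtain \<epsilon> where \<epsilon>: "e = ev \<iota> f \<epsilon>" using ev_range[OF h e(1)] by blast
  \<comment> \<open>The first summand vanishes at \<open>c\<close> and the second does not, so this
    polynomial is nonzero, while its value at \<open>f\<close> lies in \<open>P\<close>.\<close>
  define \<delta> where "\<delta> = [:-c, 1:] * \<epsilon> - \<alpha> ^ m"
  have "poly \<delta> c \<noteq> 0" using c by (simp add: \<delta>_def)
  then have "\<delta> \<noteq> 0" by auto
  moreover have "ev \<iota> f \<delta> = (f - \<iota> c) * e - a ^ m"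
    unfolding \<delta>_def ev_diff[OF h] ev_mult[OF h] ev_power[OF h] \<alpha> \<epsilon>
    by (simp add: ev_pCons[OF h] ev_0[OF h] is_field_homD[OF h] algebra_simps)
  moreover have "range \<iota> \<subseteq> ?A" using subring_gen_superset[of "range \<iota> \<union> S"] by blast
  ultimately show False
    using prime_contains_linear[OF h is_subring_gen P _ f, of \<delta>] e(2) no by metis
qed

text \<open>The quotient by a maximal prime is a field, so 1 is a witness for Goldman's
  condition.\<close>

lemma nullstellensatz:
  fixes \<iota> :: "'k::alg_closed_field \<Rightarrow> 'f::field"
  assumes h: "is_field_hom \<iota>" and S: "finite S" and Adef: "A = subring_gen (range \<iota> \<union> S)"
    and P: "is_prime_ideal A P" and max: "\<And>Q. is_prime_ideal A Q \<Longrightarrow> P \<subseteq> Q \<Longrightarrow> Q = P" and f: "f \<in> A"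
  shows "\<exists>c. f - \<iota> c \<in> P"
proof -
  have A: "is_subring A" unfolding Adef by (rule is_subring_gen)
  have "\<exists>e\<in>A. d * e - 1 \<in> P" if d: "d \<in> A - P" for d
  proof (rule ccontr)
    assume no: "\<not> ?thesis"
    have "1 \<notin> adjoin A P d"
    proof
      assume "1 \<in> adjoin A P d"
      then obtain x c where "x \<in> P" "c \<in> A" "1 = x + d * c" unfolding adjoin_def by blast
      then have "d * c - 1 = - x" by (simp add: algebra_simps)
      then show False using no \<open>c \<in> A\<close> ideal_uminus[OF A prime_ideal[OF P] \<open>x \<in> P\<close>] by auto
    qed
    then obtain Q where "is_prime_ideal A Q" "adjoin A P d \<subseteq> Q"
      using prime_containing[OF A is_ideal_adjoin[OF A prime_ideal[OF P]]] d by blast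
    then show False using max adjoin_superset[OF A prime_ideal[OF P], of d] d by blast
  qed
  then have "goldman A P"
    unfolding goldman_def using subring_1[OF A] prime_one[OF P] by (intro bexI[of _ 1]) auto
  then show ?thesis using nullstellensatz_goldman[OF h S] P f Adef by blast
qed

section \<open>Local rings\<close>

definition lunits :: "'f::field set \<Rightarrow> 'f set" where
  "lunits L = {f \<in> L. f \<noteq> 0 \<and> inverse f \<in> L}"

definition lmax :: "'f::field set \<Rightarrow> 'f set" where
  "lmax L = L - lunits L"

text \<open>The sum of two nonunits is the only point where the ideal property can fail;
  \<open>lmax_prime\<close> derives the rest.\<close>

definition local_ring :: "'f::field set \<Rightarrow> bool" where
  "local_ring L \<longleftrightarrow> is_subring L \<and> (\<forall>f\<in>lmax L. \<forall>g\<in>lmax L. f + g \<in> lmax L)"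

lemma stalk_units_eq: "stalk_units X x = lunits (stalk X x)"
  by (simp add: stalk_units_def lunits_def)

lemma max_ideal_at_eq: "max_ideal_at X x = lmax (stalk X x)"
  by (simp add: max_ideal_at_def lmax_def stalk_units_eq)

lemma lunits_mult: "is_subring L \<Longrightarrow> f \<in> lunits L \<Longrightarrow> g \<in> lunits L \<Longrightarrow> f * g \<in> lunits L"
  by (auto simp: lunits_def intro: subring_mult)

lemma lunits_inverse: "f \<in> lunits L \<Longrightarrow> inverse f \<in> lunits L"
  by (auto simp: lunits_def)

lemma lunits_1: "is_subring L \<Longrightarrow> 1 \<in> lunits L"
  by (auto simp: lunits_def subring_1)

lemma lunits_power: "is_subring L \<Longrightarrow> f \<in> lunits L \<Longrightarrow> f ^ n \<in> lunits L"
  by (induction n) (auto intro: lunits_1 lunits_mult)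

lemma lunits_of_mult:
  assumes "is_subring L" "f \<in> L" "g \<in> L" "f * g \<in> lunits L"
  shows "f \<in> lunits L"
proof -
  have "inverse f = g * inverse (f * g)" using assms(4) by (auto simp: lunits_def)
  moreover have "g * inverse (f * g) \<in> L" using assms unfolding lunits_def by (intro subring_mult) auto
  ultimately have "inverse f \<in> L" by (rule ssubst)
  then show ?thesis using assms by (auto simp: lunits_def)
qed

lemma lunits_mono: "L \<subseteq> L' \<Longrightarrow> lunits L \<subseteq> lunits L'"
  by (auto simp: lunits_def)

lemma lmax_prime:
  assumes "local_ring L"
  shows "is_prime_ideal L (lmax L)"
proof -
  have L: "is_subring L" and add: "\<And>f g. f \<in> lmax L \<Longrightarrow> g \<in> lmax L \<Longrightarrow> f + g \<in> lmax L"
    using assms by (auto simp: local_ring_def)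
  show ?thesis unfolding is_prime_ideal_def
  proof (intro conjI ballI impI is_idealI)
    show "0 \<in> lmax L" using subring_0[OF L] by (auto simp: lmax_def lunits_def)
    fix a x assume "a \<in> L" "x \<in> lmax L"
    then show "a * x \<in> lmax L"
      using lunits_of_mult[OF L, of x a] subring_mult[OF L] by (auto simp: lmax_def mult.commute)
  next
    fix a b assume "a \<in> L" "b \<in> L" "a * b \<in> lmax L"
    then show "a \<in> lmax L \<or> b \<in> lmax L" using lunits_mult[OF L] by (auto simp: lmax_def)
  qed (use add lunits_1[OF L] in \<open>auto simp: lmax_def\<close>)
qed

lemma lmax_subset: "lmax L \<subseteq> L"
  by (auto simp: lmax_def)

lemma lmax_UNIV: "lmax UNIV = {0}"
  by (auto simp: lmax_def lunits_def)

context
  fixes A P :: "'f::field set"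
  assumes A: "is_subring A" and P: "is_prime_ideal A P"
begin

lemma loc_I: "a \<in> A \<Longrightarrow> b \<in> A \<Longrightarrow> b \<notin> P \<Longrightarrow> a / b \<in> localization_at A P"
  unfolding localization_at_def by blast

lemma loc_E:
  assumes "f \<in> localization_at A P"
  obtains a b where "a \<in> A" "b \<in> A" "b \<notin> P" "b \<noteq> 0" "f = a / b" "b * f = a"
proof -
  obtain a b where ab: "a \<in> A" "b \<in> A" "b \<notin> P" "f = a / b" using assms unfolding localization_at_def by blast
  then have "b \<noteq> 0" using ideal_0[OF prime_ideal[OF P]] by auto
  then show ?thesis using that ab by simp
qed

lemma loc_I': "b \<in> A \<Longrightarrow> b \<notin> P \<Longrightarrow> b * f \<in> A \<Longrightarrow> f \<in> localization_at A P"
  using loc_I[of "b * f" b] ideal_0[OF prime_ideal[OF P]] by (cases "b = 0") auto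

lemma loc_superset: "A \<subseteq> localization_at A P"
  using loc_I[of _ 1] subring_1[OF A] prime_one[OF P] by auto

lemma is_subring_loc: "is_subring (localization_at A P)"
  unfolding is_subring_def
proof (intro conjI ballI)
  show "0 \<in> localization_at A P" "1 \<in> localization_at A P"
    using loc_superset subring_0[OF A] subring_1[OF A] by auto
  fix f g assume f: "f \<in> localization_at A P" and g: "g \<in> localization_at A P"
  obtain a b where ab: "a \<in> A" "b \<in> A" "b \<notin> P" "b * f = a" using f by (rule loc_E)
  obtain c d where cd: "c \<in> A" "d \<in> A" "d \<notin> P" "d * g = c" using g by (rule loc_E)
  have bd: "b * d \<in> A" "b * d \<notin> P" using ab cd prime_mult[OF P] subring_mult[OF A] by auto
  have "b * d * (f - g) = d * a - b * c" "b * d * (f * g) = a * c"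
    using ab(4) cd(4) by (auto simp: algebra_simps)
  then have "b * d * (f - g) \<in> A" "b * d * (f * g) \<in> A" using ab cd A by (auto intro: subring_mult subring_diff)
  then show "f - g \<in> localization_at A P" "f * g \<in> localization_at A P" using loc_I'[OF bd] by auto
qed

lemma loc_unit_iff:
  assumes "a \<in> A" "b \<in> A" "b \<notin> P"
  shows "a / b \<in> lunits (localization_at A P) \<longleftrightarrow> a \<notin> P"
proof
  assume "a / b \<in> lunits (localization_at A P)"
  then have nz: "a / b \<noteq> 0" and "inverse (a / b) \<in> localization_at A P" by (auto simp: lunits_def)
  then obtain c d where cd: "c \<in> A" "d \<in> A" "d \<notin> P" "d * inverse (a / b) = c" by (auto elim: loc_E)
  have "d * b = a * c" using cd(4) nz by (auto simp: field_simps)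
  moreover have "d * b \<notin> P" using cd assms prime_mult[OF P] by auto
  ultimately show "a \<notin> P" using ideal_mult_right[OF prime_ideal[OF P] cd(1)] by metis
next
  assume a: "a \<notin> P"
  then have "a \<noteq> 0" "b \<noteq> 0" using assms(3) ideal_0[OF prime_ideal[OF P]] by auto
  then show "a / b \<in> lunits (localization_at A P)"
    using loc_I[OF assms] loc_I[OF assms(2,1) a] by (auto simp: lunits_def)
qed

lemma loc_max_iff:
  assumes "a \<in> A" "b \<in> A" "b \<notin> P"
  shows "a / b \<in> lmax (localization_at A P) \<longleftrightarrow> a \<in> P"
  using loc_unit_iff[OF assms] loc_I[OF assms] by (auto simp: lmax_def)

lemma loc_max_inter: "lmax (localization_at A P) \<inter> A = P"
  using loc_max_iff[of _ 1] subring_1[OF A] prime_one[OF P] ideal_subset[OF prime_ideal[OF P]] by auto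

lemma local_ring_loc: "local_ring (localization_at A P)"
  unfolding local_ring_def
proof (intro conjI ballI is_subring_loc)
  fix f g assume f: "f \<in> lmax (localization_at A P)" and g: "g \<in> lmax (localization_at A P)"
  obtain a b where ab: "a \<in> A" "b \<in> A" "b \<notin> P" "b \<noteq> 0" "f = a / b" using f lmax_subset by (blast elim: loc_E)
  obtain c d where cd: "c \<in> A" "d \<in> A" "d \<notin> P" "d \<noteq> 0" "g = c / d" using g lmax_subset by (blast elim: loc_E)
  have "a \<in> P" "c \<in> P" using f g loc_max_iff ab cd by auto
  then have "d * a + b * c \<in> P" using ab cd prime_ideal[OF P] by (intro ideal_add[of A] ideal_mult[of A]) auto
  moreover have bd: "b * d \<in> A" "b * d \<notin> P" using ab cd prime_mult[OF P] subring_mult[OF A] by auto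
  moreover have "f + g = (d * a + b * c) / (b * d)" using ab cd by (auto simp: field_simps)
  moreover have "d * a + b * c \<in> A" using ab cd A by (auto intro: subring_add subring_mult)
  ultimately show "f + g \<in> lmax (localization_at A P)" using loc_max_iff by metis
qed

end

text \<open>A localization at a prime dominates the localization at the contraction of that prime.
  Points of schemes and of the modification are compared through this relation.\<close>

lemma loc_mono:
  assumes A: "is_subring A" and B: "is_subring B" "A \<subseteq> B" and n: "is_prime_ideal B n"
  shows "localization_at A (n \<inter> A) \<subseteq> localization_at B n"
    and "lmax (localization_at B n) \<inter> localization_at A (n \<inter> A) = lmax (localization_at A (n \<inter> A))"
proof -
  note nA = prime_inter[OF A B(2) n]
  show sub: "localization_at A (n \<inter> A) \<subseteq> localization_at B n"
    using B(2) unfolding localization_at_def by blast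
  show "lmax (localization_at B n) \<inter> localization_at A (n \<inter> A) = lmax (localization_at A (n \<inter> A))"
  proof (intro set_eqI iffI)
    fix f assume f: "f \<in> lmax (localization_at B n) \<inter> localization_at A (n \<inter> A)"
    then have "f \<in> localization_at A (n \<inter> A)" by simp
    then obtain a b where ab: "a \<in> A" "b \<in> A" "b \<notin> n \<inter> A" "f = a / b" by (rule loc_E[OF A nA])
    then have "a \<in> n" using f loc_max_iff[OF B(1) n, of a b] B(2) by auto
    then show "f \<in> lmax (localization_at A (n \<inter> A))" using loc_max_iff[OF A nA ab(1-3)] ab by simp
  next
    fix f assume f: "f \<in> lmax (localization_at A (n \<inter> A))"
    then have f': "f \<in> localization_at A (n \<inter> A)" using lmax_subset by auto
    then obtain a b where ab: "a \<in> A" "b \<in> A" "b \<notin> n \<inter> A" "f = a / b" by (rule loc_E[OF A nA])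
    then have "a \<in> n" using f loc_max_iff[OF A nA ab(1-3)] by simp
    then show "f \<in> lmax (localization_at B n) \<inter> localization_at A (n \<inter> A)"
      using loc_max_iff[OF B(1) n, of a b] ab B(2) f' by auto
  qed
qed

section \<open>Integral schemes\<close>

lemma topspace_zariski: "is_subring A \<Longrightarrow> topspace (zariski A) = {P. is_prime_ideal A P}"
  unfolding zariski_def topology_generated_by_topspace using subring_1 prime_one by blast

lemma zariski_open_basic: "f \<in> A \<Longrightarrow> openin (zariski A) {P. is_prime_ideal A P \<and> f \<notin> P}"
  unfolding zariski_def by (rule topology_generated_by_Basis) blast

lemma zariski_basis:
  assumes A: "is_subring A" and Op: "openin (zariski A) Op" and P: "P \<in> Op"
  shows "\<exists>g\<in>A. g \<notin> P \<and> {Q. is_prime_ideal A Q \<and> g \<notin> Q} \<subseteq> Op"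
proof -
  have prime: "is_prime_ideal A P" using openin_subset[OF Op] P topspace_zariski[OF A] by auto
  have "generate_topology_on {{P. is_prime_ideal A P \<and> f \<notin> P} | f. f \<in> A} Op"
    using Op unfolding zariski_def by (simp add: openin_topology_generated_by_iff)
  then show ?thesis using P
  proof (induction Op rule: generate_topology_on.induct)
    case (Int a b)
    then obtain g h where gh: "g \<in> A" "g \<notin> P" "{Q. is_prime_ideal A Q \<and> g \<notin> Q} \<subseteq> a"
      "h \<in> A" "h \<notin> P" "{Q. is_prime_ideal A Q \<and> h \<notin> Q} \<subseteq> b" by blast
    have "{Q. is_prime_ideal A Q \<and> g * h \<notin> Q} \<subseteq> a \<inter> b"
      using gh ideal_mult[OF prime_ideal] ideal_mult_right[OF prime_ideal] by blast
    moreover have "g * h \<in> A" "g * h \<notin> P" using gh A prime_mult[OF prime] subring_mult by auto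
    ultimately show ?case by blast
  next
    case (UN K)
    then obtain k where "k \<in> K" "P \<in> k" by blast
    then show ?case using UN.IH[of k] by blast
  qed auto
qed

text \<open>Isolates what the affineness criterion needs, because for a glued curve this criterion
  is applied before the curve is known to be an integral scheme.\<close>

locale local_ringed =
  fixes X :: "('x, 'f::field) ischeme"
  assumes stalk_local: "x \<in> points X \<Longrightarrow> local_ring (stalk X x)"
    and sec_stalks: "nonempty_open X W \<Longrightarrow> sec X W = (\<Inter>x\<in>W. stalk X x)"
    and open_in_stalk: "openin (topo X) {x \<in> points X. f \<in> stalk X x}"
begin

lemma stalk_subring: "x \<in> points X \<Longrightarrow> is_subring (stalk X x)"
  using stalk_local by (simp add: local_ring_def)

lemma mx_prime: "x \<in> points X \<Longrightarrow> is_prime_ideal (stalk X x) (lmax (stalk X x))"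
  using stalk_local lmax_prime by auto

lemmas mx_ideal = prime_ideal[OF mx_prime]

lemma open_points: "nonempty_open X U \<Longrightarrow> U \<subseteq> points X"
  using openin_subset by (auto simp: nonempty_open_def)

lemma sec_subring: "nonempty_open X U \<Longrightarrow> is_subring (sec X U)"
proof -
  assume U: "nonempty_open X U"
  show ?thesis unfolding sec_stalks[OF U]
    using open_points[OF U] stalk_subring by (intro is_subring_Inter) blast
qed

lemma sec_stalk: "openin (topo X) U \<Longrightarrow> x \<in> U \<Longrightarrow> sec X U \<subseteq> stalk X x"
  unfolding stalk_def by blast

lemma open_unit: "openin (topo X) {x \<in> points X. f \<in> lunits (stalk X x)}"
proof (cases "f = 0")
  case False
  then have "{x \<in> points X. f \<in> lunits (stalk X x)} = {x \<in> points X. f \<in> stalk X x} \<inter> {x \<in> points X. inverse f \<in> stalk X x}"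
    by (auto simp: lunits_def)
  then show ?thesis using openin_Int[OF open_in_stalk[of f] open_in_stalk[of "inverse f"]] by simp
qed (simp add: lunits_def)

lemma open_notin_max: "openin (topo X) U \<Longrightarrow> (\<And>x. x \<in> U \<Longrightarrow> g \<in> stalk X x) \<Longrightarrow> openin (topo X) {x \<in> U. g \<notin> lmax (stalk X x)}"
proof -
  assume U: "openin (topo X) U" "\<And>x. x \<in> U \<Longrightarrow> g \<in> stalk X x"
  then have "{x \<in> U. g \<notin> lmax (stalk X x)} = U \<inter> {x \<in> points X. g \<in> lunits (stalk X x)}"
    using openin_subset[OF U(1)] by (auto simp: lmax_def lunits_def)
  then show ?thesis using openin_Int[OF U(1) open_unit[of g]] by simp
qed

text \<open>The inclusion \<open>loc\<close> yields equality with the localization, since a section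
  outside the maximal ideal is invertible in the stalk. Continuity of the map to the spectrum
  follows from openness of the loci of units; \<open>basis\<close> makes the map open.\<close>

lemma affine_openI:
  assumes W: "nonempty_open X W"
    and surj: "\<And>n. is_prime_ideal (sec X W) n \<Longrightarrow> \<exists>x\<in>W. sec X W \<inter> lmax (stalk X x) = n"
    and inj: "\<And>x y. x \<in> W \<Longrightarrow> y \<in> W \<Longrightarrow> sec X W \<inter> lmax (stalk X x) = sec X W \<inter> lmax (stalk X y) \<Longrightarrow> x = y"
    and loc: "\<And>x. x \<in> W \<Longrightarrow> stalk X x \<subseteq> localization_at (sec X W) (sec X W \<inter> lmax (stalk X x))"
    and basis: "\<And>Op x. openin (topo X) Op \<Longrightarrow> Op \<subseteq> W \<Longrightarrow> x \<in> Op \<Longrightarrow>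
       \<exists>g\<in>sec X W. g \<notin> lmax (stalk X x) \<and> {z \<in> W. g \<notin> lmax (stalk X z)} \<subseteq> Op"
  shows "affine_open X W"
proof -
  let ?C = "sec X W" and ?\<phi> = "\<lambda>x. sec X W \<inter> lmax (stalk X x)"
  note C = sec_subring[OF W]
  have WX: "W \<subseteq> points X" using open_points[OF W] .
  have oW: "openin (topo X) W" using W by (simp add: nonempty_open_def)
  have Cst: "?C \<subseteq> stalk X x" if "x \<in> W" for x using sec_stalk[OF oW that] .
  have prime: "is_prime_ideal ?C (?\<phi> x)" if "x \<in> W" for x
    using prime_inter[OF C Cst[OF that] mx_prime] that WX by (auto simp: Int_commute)
  have loc_eq: "stalk X x = localization_at ?C (?\<phi> x)" if x: "x \<in> W" for x
  proof
    show "localization_at ?C (?\<phi> x) \<subseteq> stalk X x"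
    proof
      fix f assume "f \<in> localization_at ?C (?\<phi> x)"
      then obtain a b where ab: "a \<in> ?C" "b \<in> ?C" "b \<notin> ?\<phi> x" "f = a / b" by (rule loc_E[OF C prime[OF x]])
      have "a \<in> stalk X x" "b \<in> stalk X x" using ab Cst[OF x] by auto
      then have "inverse b \<in> stalk X x" using ab by (auto simp: lmax_def lunits_def)
      then show "f \<in> stalk X x" using \<open>a \<in> stalk X x\<close> ab stalk_subring[of x] x WX by (auto simp: divide_inverse intro: subring_mult)
    qed
  qed (rule loc[OF x])
  have top: "topspace (subtopology (topo X) W) = W" using WX by auto
  have img: "?\<phi> ` W = {P. is_prime_ideal ?C P}" using surj prime by blast
  have Dg: "?\<phi> ` {z \<in> W. g \<notin> lmax (stalk X z)} = {Q. is_prime_ideal ?C Q \<and> g \<notin> Q}" if "g \<in> ?C" for g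
  proof (intro set_eqI iffI)
    fix Q assume "Q \<in> {Q. is_prime_ideal ?C Q \<and> g \<notin> Q}"
    then obtain x where "x \<in> W" "?\<phi> x = Q" "g \<notin> Q" using surj by blast
    then show "Q \<in> ?\<phi> ` {z \<in> W. g \<notin> lmax (stalk X z)}" using that by blast
  qed (use prime in auto)
  have "homeomorphic_map (subtopology (topo X) W) (zariski ?C) ?\<phi>"
  proof (rule bijective_open_imp_homeomorphic_map)
    show "continuous_map (subtopology (topo X) W) (zariski ?C) ?\<phi>"
      unfolding zariski_def
    proof (rule continuous_on_generated_topo)
      fix V assume "V \<in> {{P. is_prime_ideal ?C P \<and> f \<notin> P} | f. f \<in> ?C}"
      then obtain f where f: "f \<in> ?C" "V = {P. is_prime_ideal ?C P \<and> f \<notin> P}" by blast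
      have "?\<phi> -` V \<inter> topspace (subtopology (topo X) W) = {x \<in> W. f \<notin> lmax (stalk X x)}"
        using f prime WX by auto
      moreover have "openin (topo X) {x \<in> W. f \<notin> lmax (stalk X x)}" using open_notin_max[OF oW] Cst f by blast
      ultimately show "openin (subtopology (topo X) W) (?\<phi> -` V \<inter> topspace (subtopology (topo X) W))"
        using oW by (auto simp: openin_open_subtopology)
    next
      have "\<Union>{{P. is_prime_ideal ?C P \<and> f \<notin> P} | f. f \<in> ?C} = {P. is_prime_ideal ?C P}"
        using subring_1[OF C] prime_one by blast
      then show "?\<phi> ` topspace (subtopology (topo X) W) \<subseteq> \<Union>{{P. is_prime_ideal ?C P \<and> f \<notin> P} | f. f \<in> ?C}"
        using prime top by auto
    qed
    show "open_map (subtopology (topo X) W) (zariski ?C) ?\<phi>"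
      unfolding open_map_def
    proof (intro allI impI)
      fix Op assume "openin (subtopology (topo X) W) Op"
      then have Op: "openin (topo X) Op" "Op \<subseteq> W" using oW by (auto simp: openin_open_subtopology)
      show "openin (zariski ?C) (?\<phi> ` Op)"
      proof (subst openin_subopen, intro ballI)
        fix P assume "P \<in> ?\<phi> ` Op"
        then obtain x where x: "x \<in> Op" "P = ?\<phi> x" by blast
        obtain g where g: "g \<in> ?C" "g \<notin> lmax (stalk X x)" "{z \<in> W. g \<notin> lmax (stalk X z)} \<subseteq> Op" using basis[OF Op x(1)] by blast
        show "\<exists>T. openin (zariski ?C) T \<and> P \<in> T \<and> T \<subseteq> ?\<phi> ` Op"
        proof (intro exI[of _ "{Q. is_prime_ideal ?C Q \<and> g \<notin> Q}"] conjI)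
          show "P \<in> {Q. is_prime_ideal ?C Q \<and> g \<notin> Q}" using prime[of x] x Op(2) g(2) by auto
          show "{Q. is_prime_ideal ?C Q \<and> g \<notin> Q} \<subseteq> ?\<phi> ` Op"
            unfolding Dg[OF g(1), symmetric] by (rule image_mono[OF g(3)])
        qed (rule zariski_open_basic[OF g(1)])
      qed
    qed
    show "?\<phi> ` topspace (subtopology (topo X) W) = topspace (zariski ?C)"
      using img top topspace_zariski[OF C] by simp
    show "inj_on ?\<phi> (topspace (subtopology (topo X) W))" using inj top by (auto simp: inj_on_def)
  qed
  moreover have "sec X V = (\<Inter>x\<in>V. localization_at ?C (?\<phi> x))" if "nonempty_open X V" "V \<subseteq> W" for V
    unfolding sec_stalks[OF that(1)] by (rule INF_cong[OF refl loc_eq]) (use that in blast)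
  ultimately show ?thesis using W unfolding affine_open_def max_ideal_at_eq by blast
qed

end

locale int_scheme =
  fixes X :: "('x, 'f::field) ischeme"
  assumes integral: "integral_scheme X"
begin

abbreviation "st \<equiv> stalk X"
abbreviation "mx x \<equiv> lmax (stalk X x)"

lemma open_Int: "nonempty_open X U \<Longrightarrow> nonempty_open X V \<Longrightarrow> nonempty_open X (U \<inter> V)"
  using integral by (auto simp: integral_scheme_def nonempty_open_def)

lemma sec_subring': "nonempty_open X U \<Longrightarrow> is_subring (sec X U)"
  using integral by (auto simp: integral_scheme_def)

lemma sec_Union: "\<U> \<noteq> {} \<Longrightarrow> (\<And>U. U \<in> \<U> \<Longrightarrow> nonempty_open X U) \<Longrightarrow> sec X (\<Union>\<U>) = (\<Inter>U\<in>\<U>. sec X U)"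
  using integral by (auto simp: integral_scheme_def)

lemma sec_mono:
  assumes "nonempty_open X U" "nonempty_open X W" "W \<subseteq> U"
  shows "sec X U \<subseteq> sec X W"
  using sec_Union[of "{U, W}"] assms by (auto simp: Un_absorb2)

lemma affine_nonempty: "affine_open X U \<Longrightarrow> nonempty_open X U"
  by (simp add: affine_open_def)

lemma affine_cover: "x \<in> points X \<Longrightarrow> \<exists>U. affine_open X U \<and> x \<in> U"
  using integral by (auto simp: integral_scheme_def)

lemma affine_points: "affine_open X U \<Longrightarrow> U \<subseteq> points X"
  using openin_subset by (auto simp: affine_open_def nonempty_open_def)

lemma affine_subring: "affine_open X U \<Longrightarrow> is_subring (sec X U)"
  using affine_nonempty sec_subring' by auto

lemma open_points': "nonempty_open X U \<Longrightarrow> U \<subseteq> points X"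
  using openin_subset by (auto simp: nonempty_open_def)

lemma sec_stalk': "openin (topo X) U \<Longrightarrow> x \<in> U \<Longrightarrow> sec X U \<subseteq> st x"
  unfolding stalk_def by blast

lemma nonempty_openI: "openin (topo X) U \<Longrightarrow> x \<in> U \<Longrightarrow> nonempty_open X U"
  by (auto simp: nonempty_open_def)

lemma affine_openin: "affine_open X U \<Longrightarrow> openin (topo X) U"
  by (simp add: affine_open_def nonempty_open_def)

lemma stalk_subring':
  assumes "x \<in> points X"
  shows "is_subring (st x)"
proof -
  obtain U where U: "openin (topo X) U" "x \<in> U" using affine_cover[OF assms] affine_openin by blast
  have dir: "\<exists>W. openin (topo X) W \<and> x \<in> W \<and> f \<in> sec X W \<and> g \<in> sec X W" if fg: "f \<in> st x" "g \<in> st x" for f g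
  proof -
    obtain V V' where V: "openin (topo X) V" "x \<in> V" "f \<in> sec X V" "openin (topo X) V'" "x \<in> V'" "g \<in> sec X V'"
      using fg unfolding stalk_def by blast
    then have "nonempty_open X V" "nonempty_open X V'" "nonempty_open X (V \<inter> V')"
      using nonempty_openI openin_Int by blast+
    then have "f \<in> sec X (V \<inter> V')" "g \<in> sec X (V \<inter> V')"
      using V sec_mono[of V "V \<inter> V'"] sec_mono[of V' "V \<inter> V'"] by auto
    then show ?thesis using V by (intro exI[of _ "V \<inter> V'"]) auto
  qed
  show ?thesis unfolding is_subring_def
  proof (intro conjI ballI)
    show "0 \<in> st x" "1 \<in> st x"
      using sec_stalk'[OF U] subring_0[OF sec_subring'[OF nonempty_openI[OF U]]]
        subring_1[OF sec_subring'[OF nonempty_openI[OF U]]] by auto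
    fix f g assume "f \<in> st x" "g \<in> st x"
    then obtain W where W: "openin (topo X) W" "x \<in> W" "f \<in> sec X W" "g \<in> sec X W" using dir by blast
    then have "f - g \<in> sec X W" "f * g \<in> sec X W"
      using sec_subring'[OF nonempty_openI[OF W(1,2)]] by (auto intro: subring_diff subring_mult)
    then show "f - g \<in> st x" "f * g \<in> st x" using sec_stalk'[OF W(1,2)] by auto
  qed
qed

lemma affine_homeo:
  "affine_open X U \<Longrightarrow> homeomorphic_map (subtopology (topo X) U) (zariski (sec X U)) (\<lambda>x. sec X U \<inter> mx x)"
  unfolding affine_open_def max_ideal_at_eq by (elim conjE)

lemma affine_bij:
  assumes "affine_open X U"
  shows "bij_betw (\<lambda>x. sec X U \<inter> mx x) U {P. is_prime_ideal (sec X U) P}"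
proof -
  have "bij_betw (\<lambda>x. sec X U \<inter> mx x) (topspace (subtopology (topo X) U)) (topspace (zariski (sec X U)))"
    using homeomorphic_imp_surjective_map[OF affine_homeo[OF assms]]
      homeomorphic_imp_injective_map[OF affine_homeo[OF assms]] unfolding bij_betw_def by simp
  moreover have "points X \<inter> U = U" using affine_points[OF assms] by auto
  ultimately show ?thesis using topspace_zariski[OF affine_subring[OF assms]] by simp
qed

lemma affine_prime:
  "affine_open X U \<Longrightarrow> x \<in> U \<Longrightarrow> is_prime_ideal (sec X U) (sec X U \<inter> mx x)"
  using affine_bij by (auto simp: bij_betw_def)

lemma affine_point:
  "affine_open X U \<Longrightarrow> is_prime_ideal (sec X U) P \<Longrightarrow> \<exists>x\<in>U. sec X U \<inter> mx x = P"
  using affine_bij[of U] unfolding bij_betw_def by (metis (no_types, lifting) imageE mem_Collect_eq)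

lemma affine_inj:
  "affine_open X U \<Longrightarrow> x \<in> U \<Longrightarrow> y \<in> U \<Longrightarrow> sec X U \<inter> mx x = sec X U \<inter> mx y \<Longrightarrow> x = y"
  using affine_bij[of U] unfolding bij_betw_def inj_on_def by blast

lemma affine_sec:
  "affine_open X U \<Longrightarrow> nonempty_open X V \<Longrightarrow> V \<subseteq> U \<Longrightarrow>
     sec X V = (\<Inter>x\<in>V. localization_at (sec X U) (sec X U \<inter> mx x))"
  unfolding affine_open_def max_ideal_at_eq by (elim conjE allE) (erule mp, intro conjI)

lemma affine_stalk:
  assumes U: "affine_open X U" and x: "x \<in> U"
  shows "st x = localization_at (sec X U) (sec X U \<inter> mx x)"
proof
  note A = affine_subring[OF U] and P = affine_prime[OF U x]
  have xX: "x \<in> points X" using affine_points[OF U] x by auto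
  show "st x \<subseteq> localization_at (sec X U) (sec X U \<inter> mx x)"
  proof
    fix f assume "f \<in> st x"
    then obtain W where W: "openin (topo X) W" "x \<in> W" "f \<in> sec X W" unfolding stalk_def by blast
    have ne: "nonempty_open X W" "nonempty_open X (W \<inter> U)"
      using W x affine_openin[OF U] by (auto intro: nonempty_openI)
    have "f \<in> sec X (W \<inter> U)" using sec_mono[OF ne] W(3) by auto
    then show "f \<in> localization_at (sec X U) (sec X U \<inter> mx x)"
      using affine_sec[OF U ne(2)] W(2) x by auto
  qed
  show "localization_at (sec X U) (sec X U \<inter> mx x) \<subseteq> st x"
  proof
    fix f assume "f \<in> localization_at (sec X U) (sec X U \<inter> mx x)"
    then obtain a b where ab: "a \<in> sec X U" "b \<in> sec X U" "b \<notin> sec X U \<inter> mx x" "f = a / b"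
      by (rule loc_E[OF A P])
    have "a \<in> st x" "b \<in> st x" using ab sec_stalk'[OF affine_openin[OF U] x] by auto
    then have "inverse b \<in> st x" using ab by (auto simp: lmax_def lunits_def)
    then show "f \<in> st x" using \<open>a \<in> st x\<close> ab subring_mult[OF stalk_subring'[OF xX]] by (auto simp: divide_inverse)
  qed
qed

lemma affine_sec_stalk: "affine_open X U \<Longrightarrow> x \<in> U \<Longrightarrow> sec X U \<subseteq> st x"
  using sec_stalk' affine_openin by blast

lemma affine_stalkE:
  assumes "affine_open X U" "x \<in> U" "f \<in> st x"
  obtains a b where "a \<in> sec X U" "b \<in> sec X U" "b \<notin> mx x" "b \<noteq> 0" "f = a / b" "b * f = a"
proof -
  have "f \<in> localization_at (sec X U) (sec X U \<inter> mx x)"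
    by (rule subsetD[OF equalityD1[OF affine_stalk[OF assms(1,2)]] assms(3)])
  then obtain a b where "a \<in> sec X U" "b \<in> sec X U" "b \<notin> sec X U \<inter> mx x" "b \<noteq> 0" "f = a / b" "b * f = a"
    by (rule loc_E[OF affine_subring[OF assms(1)] affine_prime[OF assms(1,2)]])
  then show ?thesis using that by simp
qed

lemma affine_max_iff:
  assumes "affine_open X U" "x \<in> U" "a \<in> sec X U" "b \<in> sec X U" "b \<notin> mx x"
  shows "a / b \<in> mx x \<longleftrightarrow> a \<in> mx x"
proof -
  have "a / b \<in> lmax (localization_at (sec X U) (sec X U \<inter> mx x)) \<longleftrightarrow> a \<in> sec X U \<inter> mx x"
    by (rule loc_max_iff[OF affine_subring[OF assms(1)] affine_prime[OF assms(1,2)] assms(3,4)]) (use assms in simp)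
  then show ?thesis by (subst affine_stalk[OF assms(1,2)]) (simp add: assms(3))
qed

lemma stalk_local': "x \<in> points X \<Longrightarrow> local_ring (st x)"
proof -
  assume "x \<in> points X"
  then obtain U where U: "affine_open X U" "x \<in> U" using affine_cover by blast
  show ?thesis by (subst affine_stalk[OF U]) (rule local_ring_loc[OF affine_subring[OF U(1)] affine_prime[OF U]])
qed

lemma sec_stalks':
  assumes W: "nonempty_open X W"
  shows "sec X W = (\<Inter>x\<in>W. st x)"
proof
  show "sec X W \<subseteq> (\<Inter>x\<in>W. st x)" using W sec_stalk' by (auto simp: nonempty_open_def)
  define \<U> where "\<U> = {W \<inter> U | U. affine_open X U \<and> W \<inter> U \<noteq> {}}"
  have ne: "\<And>V. V \<in> \<U> \<Longrightarrow> nonempty_open X V"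
    using W affine_openin by (auto simp: \<U>_def nonempty_open_def)
  have "\<Union>\<U> = W"
  proof
    show "W \<subseteq> \<Union>\<U>"
    proof
      fix x assume x: "x \<in> W"
      then obtain U where "affine_open X U" "x \<in> U" using affine_cover open_points'[OF W] by blast
      then have "W \<inter> U \<in> \<U>" "x \<in> W \<inter> U" using x by (auto simp: \<U>_def)
      then show "x \<in> \<Union>\<U>" by blast
    qed
  qed (auto simp: \<U>_def)
  moreover have "\<U> \<noteq> {}" using \<open>\<Union>\<U> = W\<close> W by (auto simp: nonempty_open_def)
  ultimately have *: "sec X W = (\<Inter>V\<in>\<U>. sec X V)" using sec_Union[OF _ ne] by metis
  show "(\<Inter>x\<in>W. st x) \<subseteq> sec X W"
    unfolding *
  proof (intro subsetI INT_I)
    fix f V assume f: "f \<in> (\<Inter>x\<in>W. st x)" and V: "V \<in> \<U>"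
    then obtain U where U: "affine_open X U" "V = W \<inter> U" by (auto simp: \<U>_def)
    have "f \<in> localization_at (sec X U) (sec X U \<inter> mx x)" if "x \<in> V" for x
      by (rule subsetD[OF equalityD1[OF affine_stalk[OF U(1)]]]) (use that U(2) f in auto)
    then show "f \<in> sec X V" using affine_sec[OF U(1) ne[OF V]] U(2) by simp
  qed
qed

lemma open_in_stalk': "openin (topo X) {x \<in> points X. f \<in> st x}"
proof -
  have "{x \<in> points X. f \<in> st x} = \<Union>{U. openin (topo X) U \<and> f \<in> sec X U}"
    unfolding stalk_def using openin_subset by blast
  then show ?thesis by auto
qed

sublocale local_ringed X
  using stalk_local' sec_stalks' open_in_stalk' by unfold_locales

lemma affine_basis:
  assumes U: "affine_open X U" and x: "x \<in> U" and Op: "openin (topo X) Op" "x \<in> Op"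
  shows "\<exists>g\<in>sec X U. g \<notin> mx x \<and> {z \<in> U. g \<notin> mx z} \<subseteq> Op"
proof -
  let ?\<phi> = "\<lambda>x. sec X U \<inter> mx x"
  have "openin (subtopology (topo X) U) (U \<inter> Op)" using Op(1) by (auto simp: openin_subtopology)
  then have "openin (zariski (sec X U)) (?\<phi> ` (U \<inter> Op))"
    using homeomorphic_imp_open_map[OF affine_homeo[OF U]] unfolding open_map_def by blast
  then obtain g where g: "g \<in> sec X U" "g \<notin> ?\<phi> x" "{Q. is_prime_ideal (sec X U) Q \<and> g \<notin> Q} \<subseteq> ?\<phi> ` (U \<inter> Op)"
    using zariski_basis[OF affine_subring[OF U]] x Op(2) by blast
  have "z \<in> Op" if z: "z \<in> U" "g \<notin> mx z" for z
  proof -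
    have "?\<phi> z \<in> ?\<phi> ` (U \<inter> Op)" using g(3) affine_prime[OF U z(1)] z(2) by blast
    then show ?thesis using affine_inj[OF U z(1)] by blast
  qed
  then show ?thesis using g by blast
qed

text \<open>If no power of \<open>g\<close> were a denominator of \<open>f\<close>, some prime would
  contain all denominators and avoid these powers. It belongs to a point where \<open>g\<close> does
  not vanish, and there \<open>f\<close> is regular, so it has a denominator outside the
  prime.\<close>

lemma affine_principal:
  assumes U: "affine_open X U" and g: "g \<in> sec X U" and f: "\<And>z. z \<in> U \<Longrightarrow> g \<notin> mx z \<Longrightarrow> f \<in> st z"
  shows "\<exists>n. g ^ n * f \<in> sec X U"
proof (rule ccontr)
  assume no: "\<not> ?thesis"
  let ?A = "sec X U"
  note A = affine_subring[OF U]
  define I where "I = {a \<in> ?A. a * f \<in> ?A}"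
  have I: "is_ideal ?A I"
    unfolding I_def by (rule is_idealI) (auto simp: distrib_right mult.assoc intro: subring_0[OF A] subring_add[OF A] subring_mult[OF A])
  have "\<exists>P. is_prime_ideal ?A P \<and> I \<subseteq> P \<and> P \<inter> range (\<lambda>n. g ^ n) = {}"
  proof (rule prime_avoiding[OF A I])
    show "1 \<in> range (\<lambda>n. g ^ n)" by (rule range_eqI[of _ _ 0]) simp
    show "I \<inter> range (\<lambda>n. g ^ n) = {}" using no by (auto simp: I_def)
    fix a b assume "a \<in> range (\<lambda>n. g ^ n)" "b \<in> range (\<lambda>n. g ^ n)"
    then show "a * b \<in> range (\<lambda>n. g ^ n)" by (auto simp flip: power_add)
  qed (use g subring_power[OF A] in auto)
  then obtain P where P: "is_prime_ideal ?A P" "I \<subseteq> P" "P \<inter> range (\<lambda>n. g ^ n) = {}" by blast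
  obtain z where z: "z \<in> U" "?A \<inter> mx z = P" using affine_point[OF U P(1)] by blast
  have "g \<notin> P" using P(3) by (metis disjoint_iff power_one_right rangeI)
  then have "f \<in> st z" using f z g by blast
  then obtain a b where ab: "a \<in> ?A" "b \<in> ?A" "b \<notin> mx z" "b * f = a" using affine_stalkE[OF U z(1)] by metis
  then have "b \<in> I" by (auto simp: I_def)
  then show False using P(2) z(2) ab by blast
qed

text \<open>Near a point of \<open>W\<close> a section on \<open>W\<close> is a fraction of sections
  on \<open>U\<close>, so a prime of the larger ring is determined by its contraction. Only the
  existence of a point of \<open>W\<close> for each contraction has to be supplied.\<close>

lemma affine_open_subset:
  assumes U: "affine_open X U" and W: "nonempty_open X W" "W \<subseteq> U"
    and pts: "\<And>n. is_prime_ideal (sec X W) n \<Longrightarrow> \<exists>x\<in>W. sec X U \<inter> mx x = n \<inter> sec X U"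
  shows "affine_open X W"
proof (rule affine_openI[OF W(1)])
  note A = affine_subring[OF U] and C = sec_subring[OF W(1)]
  have AC: "sec X U \<subseteq> sec X W" using sec_mono[OF affine_nonempty[OF U] W] .
  have oW: "openin (topo X) W" using W by (simp add: nonempty_open_def)
  have Cst: "sec X W \<subseteq> st x" if "x \<in> W" for x using sec_stalk[OF oW that] .
  fix n assume n: "is_prime_ideal (sec X W) n"
  then obtain x where x: "x \<in> W" "sec X U \<inter> mx x = n \<inter> sec X U" using pts by blast
  have xU: "x \<in> U" using x W by auto
  have "f \<in> n \<longleftrightarrow> f \<in> mx x" if f: "f \<in> sec X W" for f
  proof -
    obtain a b where ab: "a \<in> sec X U" "b \<in> sec X U" "b \<notin> mx x" "b \<noteq> 0" "f = a / b" "b * f = a"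
      using affine_stalkE[OF U xU] f Cst[OF x(1)] by blast
    have "b \<notin> n" using x(2) ab by blast
    have "f \<in> n \<longleftrightarrow> a \<in> n"
      using ab(6) prime_mult[OF n, of b f] ab AC f \<open>b \<notin> n\<close> ideal_mult[OF prime_ideal[OF n], of b f] by auto
    then show ?thesis using affine_max_iff[OF U xU ab(1-3)] ab(1,5) x(2) by blast
  qed
  then show "\<exists>x\<in>W. sec X W \<inter> mx x = n" using x(1) ideal_subset[OF prime_ideal[OF n]] by blast
next
  fix x y assume "x \<in> W" "y \<in> W" "sec X W \<inter> mx x = sec X W \<inter> mx y"
  then show "x = y" using affine_inj[OF U, of x y] W sec_mono[OF affine_nonempty[OF U] W] by blast
next
  note A = affine_subring[OF U] and C = sec_subring[OF W(1)]
  have AC: "sec X U \<subseteq> sec X W" using sec_mono[OF affine_nonempty[OF U] W] .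
  fix x assume "x \<in> W"
  then show "st x \<subseteq> localization_at (sec X W) (sec X W \<inter> mx x)"
    using equalityD1[OF affine_stalk[OF U, of x]] W AC unfolding localization_at_def by blast
next
  have AC: "sec X U \<subseteq> sec X W" using sec_mono[OF affine_nonempty[OF U] W] .
  fix Op x assume "openin (topo X) Op" "Op \<subseteq> W" "x \<in> Op"
  then show "\<exists>g\<in>sec X W. g \<notin> mx x \<and> {z \<in> W. g \<notin> mx z} \<subseteq> Op"
    using affine_basis[OF U _ _ \<open>x \<in> Op\<close>] W AC by blast
qed

text \<open>The inverse of \<open>c\<close> is a section on the smaller open, so no prime of its
  ring contains \<open>c\<close>.\<close>

lemma affine_basic_open:
  assumes U: "affine_open X U" and c: "c \<in> sec X U" "c \<noteq> 0"
  shows "affine_open X {x \<in> U. c \<notin> mx x}"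
proof -
  let ?W = "{x \<in> U. c \<notin> mx x}"
  note A = affine_subring[OF U]
  have oW: "openin (topo X) ?W" using open_notin_max[OF affine_openin[OF U]] affine_sec_stalk[OF U] c by blast
  obtain z where "z \<in> U" "sec X U \<inter> mx z = {0}" using affine_point[OF U prime_zero[OF A]] by blast
  then have ne: "nonempty_open X ?W" using oW c by (auto simp: nonempty_open_def)
  have AC: "sec X U \<subseteq> sec X ?W" using sec_mono[OF affine_nonempty[OF U] ne] by auto
  have inv: "inverse c \<in> sec X ?W"
    unfolding sec_stalks[OF ne] using c affine_sec_stalk[OF U] by (auto simp: lmax_def lunits_def)
  show ?thesis
  proof (rule affine_open_subset[OF U ne])
    fix n assume n: "is_prime_ideal (sec X ?W) n"
    then obtain x where x: "x \<in> U" "sec X U \<inter> mx x = n \<inter> sec X U"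
      using affine_point[OF U prime_inter[OF A AC n]] by blast
    have "c \<notin> n" using ideal_mult[OF prime_ideal[OF n] inv, of c] prime_one[OF n] c(2) by auto
    then have "x \<in> ?W" using x c by auto
    then show "\<exists>x\<in>?W. sec X U \<inter> mx x = n \<inter> sec X U" using x by blast
  qed auto
qed

text \<open>
  Separatedness in the form of the uniqueness part of the valuative criterion: a prime of a ring
  dominates the stalk of at most one point.
\<close>

definition domination_unique :: bool where
  "domination_unique \<longleftrightarrow> (\<forall>E n u v. is_subring E \<longrightarrow> is_prime_ideal E n \<longrightarrow> u \<in> points X \<longrightarrow> v \<in> points X \<longrightarrow>
     st u \<subseteq> E \<longrightarrow> st v \<subseteq> E \<longrightarrow> n \<inter> st u = mx u \<longrightarrow> n \<inter> st v = mx v \<longrightarrow> u = v)"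

lemma domination_uniqueD:
  "domination_unique \<Longrightarrow> is_subring E \<Longrightarrow> is_prime_ideal E n \<Longrightarrow> u \<in> points X \<Longrightarrow> v \<in> points X \<Longrightarrow>
     st u \<subseteq> E \<Longrightarrow> st v \<subseteq> E \<Longrightarrow> n \<inter> st u = mx u \<Longrightarrow> n \<inter> st v = mx v \<Longrightarrow> u = v"
  unfolding domination_unique_def by blast

text \<open>The ring of \<open>U \<inter> V\<close> is generated by those of \<open>U\<close> and
  \<open>V\<close>, so it lies in \<open>E\<close>. The contraction of \<open>n\<close> to it
  belongs to a point of the intersection, which coincides with \<open>u\<close> inside
  \<open>U\<close> and with \<open>v\<close> inside \<open>V\<close>.\<close>

lemma separated_domination:
  assumes sep: "\<And>U V. affine_open X U \<Longrightarrow> affine_open X V \<Longrightarrow>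
    affine_open X (U \<inter> V) \<and> sec X (U \<inter> V) = subring_gen (sec X U \<union> sec X V)"
  shows domination_unique
  unfolding domination_unique_def
proof (intro allI impI)
  fix E n u v
  assume E: "is_subring E" and n: "is_prime_ideal E n" and u: "u \<in> points X" and v: "v \<in> points X"
    and uE: "st u \<subseteq> E" and vE: "st v \<subseteq> E" and nu: "n \<inter> st u = mx u" and nv: "n \<inter> st v = mx v"
  obtain U where U: "affine_open X U" "u \<in> U" using affine_cover[OF u] by blast
  obtain V where V: "affine_open X V" "v \<in> V" using affine_cover[OF v] by blast
  have W: "affine_open X (U \<inter> V)" "sec X (U \<inter> V) = subring_gen (sec X U \<union> sec X V)"
    using sep[OF U(1) V(1)] by auto
  have sub: "sec X U \<subseteq> st u" "sec X V \<subseteq> st v" using affine_sec_stalk U V by auto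
  have CE: "sec X (U \<inter> V) \<subseteq> E"
    unfolding W(2) using sub uE vE by (intro subring_gen_least[OF E]) auto
  obtain w where w: "w \<in> U \<inter> V" "sec X (U \<inter> V) \<inter> mx w = n \<inter> sec X (U \<inter> V)"
    using affine_point[OF W(1) prime_inter[OF affine_subring[OF W(1)] CE n]] by blast
  have C: "sec X U \<subseteq> sec X (U \<inter> V)" "sec X V \<subseteq> sec X (U \<inter> V)"
    using subring_gen_superset[of "sec X U \<union> sec X V"] W(2) by auto
  have "sec X U \<inter> mx w = sec X U \<inter> mx u" using w(2) C(1) nu sub(1) by blast
  moreover have "sec X V \<inter> mx w = sec X V \<inter> mx v" using w(2) C(2) nv sub(2) by blast
  ultimately show "u = v" using affine_inj[OF U(1), of w u] affine_inj[OF V(1), of w v] w(1) U V by blast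
qed

text \<open>Converse direction, by which the modification is shown to be separated. A prime of the
  ring generated by both sections contracts to a point \<open>u\<close> of \<open>U\<close> and a
  point \<open>v\<close> of \<open>V\<close>, both dominated by the same localization; hence they
  agree, and sections on the intersection have denominators outside every prime of the generated
  ring.\<close>

lemma domination_separated:
  assumes dom: domination_unique and U: "affine_open X U" and V: "affine_open X V"
  shows "affine_open X (U \<inter> V) \<and> sec X (U \<inter> V) = subring_gen (sec X U \<union> sec X V)"
proof -
  let ?W = "U \<inter> V" let ?C = "sec X (U \<inter> V)"
  define B where "B = subring_gen (sec X U \<union> sec X V)"
  have ne: "nonempty_open X ?W" using open_Int[OF affine_nonempty[OF U] affine_nonempty[OF V]] .
  have B: "is_subring B" "sec X U \<subseteq> B" "sec X V \<subseteq> B"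
    using is_subring_gen subring_gen_superset[of "sec X U \<union> sec X V"] by (auto simp: B_def)
  have BC: "B \<subseteq> ?C" unfolding B_def
    using sec_mono[OF affine_nonempty[OF U] ne] sec_mono[OF affine_nonempty[OF V] ne]
    by (intro subring_gen_least[OF sec_subring[OF ne]]) auto
  have key: "\<exists>w\<in>?W. sec X U \<inter> mx w = n \<inter> sec X U \<and> st w \<subseteq> localization_at B n"
    if n: "is_prime_ideal B n" for n
  proof -
    note AU = affine_subring[OF U] and AV = affine_subring[OF V]
    obtain u where u: "u \<in> U" "sec X U \<inter> mx u = n \<inter> sec X U"
      using affine_point[OF U prime_inter[OF AU B(2) n]] by blast
    obtain v where v: "v \<in> V" "sec X V \<inter> mx v = n \<inter> sec X V"
      using affine_point[OF V prime_inter[OF AV B(3) n]] by blast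
    have su: "st u = localization_at (sec X U) (n \<inter> sec X U)" using affine_stalk[OF U u(1)] u(2) by simp
    have sv: "st v = localization_at (sec X V) (n \<inter> sec X V)" using affine_stalk[OF V v(1)] v(2) by simp
    have "u = v"
    proof (rule domination_uniqueD[OF dom is_subring_loc[OF B(1) n] lmax_prime[OF local_ring_loc[OF B(1) n]]])
      show "u \<in> points X" "v \<in> points X" using u v affine_points U V by auto
    qed (use loc_mono[OF AU B(1,2) n] loc_mono[OF AV B(1,3) n] su sv in auto)
    moreover have "st u \<subseteq> localization_at B n" unfolding su by (rule loc_mono(1)[OF AU B(1,2) n])
    ultimately show ?thesis using u v by (intro bexI[of _ u]) auto
  qed
  have "?C \<subseteq> B"
  proof
    fix f assume f: "f \<in> ?C"
    define I where "I = {b \<in> B. b * f \<in> B}"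
    have I: "is_ideal B I"
      unfolding I_def by (rule is_idealI) (auto simp: distrib_right mult.assoc intro: subring_0[OF B(1)] subring_add[OF B(1)] subring_mult[OF B(1)])
    have "1 \<in> I"
    proof (rule ccontr)
      assume "1 \<notin> I"
      then obtain n where n: "is_prime_ideal B n" "I \<subseteq> n" using prime_containing[OF B(1) I] by blast
      obtain w where w: "w \<in> ?W" "st w \<subseteq> localization_at B n" using key[OF n(1)] by blast
      have "f \<in> localization_at B n" using f w sec_stalk[of ?W w] ne by (auto simp: nonempty_open_def)
      then obtain b where "b \<in> B" "b \<notin> n" "b * f \<in> B" by (metis loc_E[OF B(1) n(1)])
      then show False using n(2) by (auto simp: I_def)
    qed
    then show "f \<in> B" by (simp add: I_def)
  qed
  then have eq: "?C = B" using BC by auto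
  moreover have "affine_open X ?W"
  proof (rule affine_open_subset[OF U ne])
    show "\<exists>x\<in>?W. sec X U \<inter> mx x = n \<inter> sec X U" if "is_prime_ideal ?C n" for n
      using key[of n] that eq by blast
  qed auto
  ultimately show ?thesis by (simp add: B_def)
qed

end

section \<open>Curves\<close>

locale int_variety =
  fixes \<iota> :: "'k::alg_closed_field \<Rightarrow> 'f::field" and X :: "('x, 'f) ischeme"
  assumes variety: "variety \<iota> X"
begin

sublocale int_scheme X
  using variety by unfold_locales (simp add: variety_def)

lemma hom: "is_field_hom \<iota>"
  using variety by (simp add: variety_def)

lemma const_sec: "nonempty_open X U \<Longrightarrow> \<iota> c \<in> sec X U"
  using variety unfolding variety_def by blast

lemma const_stalk: "x \<in> points X \<Longrightarrow> \<iota> c \<in> st x"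
proof -
  assume "x \<in> points X"
  then obtain U where "affine_open X U" "x \<in> U" using affine_cover by blast
  then show ?thesis using affine_sec_stalk[of U x] const_sec[OF affine_nonempty] by blast
qed

lemma const_max: "x \<in> points X \<Longrightarrow> \<iota> c \<in> mx x \<longleftrightarrow> c = 0"
proof -
  assume x: "x \<in> points X"
  have "\<iota> c \<in> lunits (st x)" if "c \<noteq> 0"
    using that const_stalk[OF x, of c] const_stalk[OF x, of "inverse c"] is_field_homD[OF hom]
    by (auto simp: lunits_def)
  then show ?thesis using is_field_homD(4)[OF hom] ideal_0[OF mx_ideal[OF x]] by (auto simp: lmax_def)
qed

definition ft_open :: "'x set \<Rightarrow> bool" where
  "ft_open U \<longleftrightarrow> affine_open X U \<and> (\<exists>S. finite S \<and> sec X U = subring_gen (range \<iota> \<union> S))"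

lemma ft_cover: "\<exists>\<U>. finite \<U> \<and> \<Union>\<U> = points X \<and> (\<forall>U\<in>\<U>. ft_open U)"
  using variety unfolding variety_def ft_open_def by (elim conjE)

lemma ft_affine: "ft_open U \<Longrightarrow> affine_open X U"
  by (simp add: ft_open_def)

lemma ft_cover_point: "x \<in> points X \<Longrightarrow> \<exists>U. ft_open U \<and> x \<in> U"
  using ft_cover by blast

lemma ft_noetherian: "ft_open U \<Longrightarrow> noetherian (sec X U)"
  using noetherian_finite_type[OF hom] unfolding ft_open_def by auto

lemma separated:
  "affine_open X U \<Longrightarrow> affine_open X V \<Longrightarrow>
     affine_open X (U \<inter> V) \<and> sec X (U \<inter> V) = subring_gen (sec X U \<union> sec X V)"
  using variety unfolding variety_def by simp

lemma dominated: domination_unique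
  by (rule separated_domination) (use separated in blast)

end

locale int_curve =
  fixes \<iota> :: "'k::alg_closed_field \<Rightarrow> 'f::field" and X :: "('x, 'f) ischeme"
  assumes curve: "curve \<iota> X" and function_field: "function_field X = UNIV"
begin

sublocale int_variety \<iota> X
  using curve by unfold_locales (simp add: curve_def)

lemma krull: "krull_dim (topo X) = 1"
  using curve by (simp add: curve_def)

text \<open>The point of the zero prime. A nonempty open contains the nonvanishing locus of some
  nonzero section of \<open>U\<close>, hence this point; therefore every rational function is
  regular there.\<close>

lemma affine_zero_point:
  assumes U: "affine_open X U"
  shows "\<exists>y\<in>U. st y = UNIV \<and> (\<forall>W. nonempty_open X W \<longrightarrow> y \<in> W)"
proof -
  obtain y where y: "y \<in> U" "sec X U \<inter> mx y = {0}"
    using affine_point[OF U prime_zero[OF affine_subring[OF U]]] by blast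
  have all: "y \<in> W" if W: "nonempty_open X W" for W
  proof -
    obtain x where x: "x \<in> U" "x \<in> W"
      using open_Int[OF affine_nonempty[OF U] W] by (auto simp: nonempty_open_def)
    obtain g where g: "g \<in> sec X U" "g \<notin> mx x" "{z \<in> U. g \<notin> mx z} \<subseteq> W"
      using affine_basis[OF U x(1) _ x(2)] W by (auto simp: nonempty_open_def)
    have "x \<in> points X" using x U affine_points by auto
    then have "g \<noteq> 0" using g(2) ideal_0[OF mx_ideal] by auto
    then show ?thesis using g y by blast
  qed
  have "f \<in> st y" for f
  proof -
    have "f \<in> function_field X" using function_field by simp
    then obtain W where W: "nonempty_open X W" "f \<in> sec X W" unfolding function_field_def by blast
    then show ?thesis using sec_stalk[of W y] all[OF W(1)] by (auto simp: nonempty_open_def)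
  qed
  then show ?thesis using y(1) all by blast
qed

lemma points_nonempty: "points X \<noteq> {}"
  using integral by (simp add: integral_scheme_def)

definition gen :: 'x where
  "gen = (SOME y. y \<in> points X \<and> st y = UNIV \<and> (\<forall>W. nonempty_open X W \<longrightarrow> y \<in> W))"

lemma gen: "gen \<in> points X" "st gen = UNIV" "nonempty_open X W \<Longrightarrow> gen \<in> W"
proof -
  obtain x where "x \<in> points X" using points_nonempty by blast
  then obtain U where U: "affine_open X U" using affine_cover by blast
  then have "\<exists>y. y \<in> points X \<and> st y = UNIV \<and> (\<forall>W. nonempty_open X W \<longrightarrow> y \<in> W)"
    using affine_zero_point[OF U] affine_points[OF U] by blast
  then have *: "gen \<in> points X \<and> st gen = UNIV \<and> (\<forall>W. nonempty_open X W \<longrightarrow> gen \<in> W)"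
    unfolding gen_def by (rule someI_ex)
  then show "gen \<in> points X" "st gen = UNIV" "nonempty_open X W \<Longrightarrow> gen \<in> W" by auto
qed

lemma gen_affine: "affine_open X U \<Longrightarrow> gen \<in> U"
  using gen(3) affine_nonempty by auto

lemma mx_gen: "mx gen = {0}"
  using gen(2) by (simp add: lmax_UNIV)

lemma frac:
  assumes U: "affine_open X U"
  shows "\<exists>a\<in>sec X U. \<exists>b\<in>sec X U. b \<noteq> 0 \<and> f = a / b"
proof -
  have "f \<in> st gen" using gen(2) by simp
  then show ?thesis by (rule affine_stalkE[OF U gen_affine[OF U]]) blast
qed

lemma mx_zero:
  assumes U: "affine_open X U" and x: "x \<in> U" and "sec X U \<inter> mx x = {0}"
  shows "x = gen"
proof (rule affine_inj[OF U x gen_affine[OF U]])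
  show "sec X U \<inter> mx x = sec X U \<inter> mx gen"
    using assms(3) mx_gen subring_0[OF affine_subring[OF U]] by auto
qed

lemma stalk_UNIV: "x \<in> points X \<Longrightarrow> st x = UNIV \<Longrightarrow> x = gen"
proof -
  assume x: "x \<in> points X" "st x = UNIV"
  obtain U where U: "affine_open X U" "x \<in> U" using affine_cover[OF x(1)] by blast
  show ?thesis by (rule mx_zero[OF U]) (use x lmax_UNIV subring_0[OF affine_subring[OF U(1)]] in auto)
qed

definition closed_pts :: "'x set" where
  "closed_pts = points X - {gen}"

lemma closed_ptsD: "x \<in> closed_pts \<Longrightarrow> x \<in> points X"
  by (simp add: closed_pts_def)

lemma prime_nonzero:
  assumes U: "affine_open X U" and x: "x \<in> U" "x \<noteq> gen"
  shows "\<exists>g\<in>sec X U. g \<in> mx x \<and> g \<noteq> 0"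
  using mx_zero[OF U x(1)] x(2) ideal_0[OF prime_ideal[OF affine_prime[OF U x(1)]]] by blast

lemma specialization:
  assumes U: "affine_open X U" and x: "x \<in> U" and y: "y \<in> U" and sub: "sec X U \<inter> mx x \<subseteq> mx y"
  shows "y \<in> topo X closure_of {x}"
  unfolding in_closure_of
proof (intro conjI allI impI)
  show "y \<in> points X" using y affine_points[OF U] by auto
  fix T assume T: "y \<in> T \<and> openin (topo X) T"
  then obtain g where g: "g \<in> sec X U" "g \<notin> mx y" "{z \<in> U. g \<notin> mx z} \<subseteq> T"
    using affine_basis[OF U y, of T] by blast
  then have "g \<notin> mx x" using sub by blast
  then show "\<exists>z. z \<in> {x} \<and> z \<in> T" using g x by blast
qed

lemma not_in_closure:
  assumes U: "affine_open X U" and x: "x \<in> U" and y: "y \<in> U" and sub: "\<not> sec X U \<inter> mx x \<subseteq> mx y"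
  shows "y \<notin> topo X closure_of {x}"
proof
  assume y': "y \<in> topo X closure_of {x}"
  obtain g where g: "g \<in> sec X U" "g \<in> mx x" "g \<notin> mx y" using sub by blast
  have "openin (topo X) {z \<in> U. g \<notin> mx z}"
    using open_notin_max[OF affine_openin[OF U]] affine_sec_stalk[OF U] g(1) by blast
  moreover have "y \<in> {z \<in> U. g \<notin> mx z}" using g y by simp
  ultimately have "\<exists>z. z \<in> {x} \<and> z \<in> {z \<in> U. g \<notin> mx z}"
    using y' unfolding in_closure_of by (elim conjE allE[of _ "{z \<in> U. g \<notin> mx z}"]) simp
  then show False using g by simp
qed

lemma irreducible_closure: "x \<in> points X \<Longrightarrow> irreducible_closed (topo X) (topo X closure_of {x})"
  unfolding irreducible_closed_def
proof (intro conjI allI impI)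
  assume x: "x \<in> points X"
  have xc: "x \<in> topo X closure_of {x}" using closure_of_subset[of "{x}" "topo X"] x by auto
  show "closedin (topo X) (topo X closure_of {x})" by simp
  show "topo X closure_of {x} \<noteq> {}" using xc by auto
  fix A B assume AB: "closedin (topo X) A \<and> closedin (topo X) B \<and> topo X closure_of {x} \<subseteq> A \<union> B"
  then have "x \<in> A \<or> x \<in> B" using xc by auto
  then show "topo X closure_of {x} \<subseteq> A \<or> topo X closure_of {x} \<subseteq> B"
    using AB closure_of_minimal[of "{x}" A "topo X"] closure_of_minimal[of "{x}" B "topo X"] by auto
qed

text \<open>A proper specialization of a point other than \<open>gen\<close> would give three
  irreducible closed sets, the closures of \<open>y\<close>, \<open>x\<close> and
  \<open>gen\<close>, in a strict chain, against dimension one.\<close>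

lemma prime_maximal:
  assumes U: "affine_open X U" and x: "x \<in> U" "x \<noteq> gen" and y: "y \<in> U" and sub: "sec X U \<inter> mx x \<subseteq> mx y"
  shows "x = y"
proof (rule ccontr)
  assume "x \<noteq> y"
  then have "\<not> sec X U \<inter> mx y \<subseteq> mx x" using affine_inj[OF U x(1) y] sub by blast
  then have xy: "x \<notin> topo X closure_of {y}" using not_in_closure[OF U y x(1)] by blast
  obtain g where "g \<in> sec X U" "g \<in> mx x" "g \<noteq> 0" using prime_nonzero[OF U x] by blast
  then have "\<not> sec X U \<inter> mx x \<subseteq> mx gen" using mx_gen by auto
  then have gx: "gen \<notin> topo X closure_of {x}" using not_in_closure[OF U x(1) gen_affine[OF U]] by blast
  have pts: "x \<in> points X" "y \<in> points X" using x y affine_points[OF U] by auto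
  define Z where "Z i = (if i = 0 then topo X closure_of {y} else if i = 1 then topo X closure_of {x}
      else topo X closure_of {gen})" for i :: nat
  have sub0: "Z 0 \<subset> Z 1"
  proof -
    have "topo X closure_of {y} \<subseteq> topo X closure_of {x}"
      by (rule closure_of_minimal) (use specialization[OF U x(1) y sub] in auto)
    moreover have "x \<in> topo X closure_of {x}" using closure_of_subset[of "{x}" "topo X"] pts by auto
    ultimately show ?thesis using xy by (auto simp: Z_def)
  qed
  have sub1: "Z 1 \<subset> Z 2"
  proof -
    have "x \<in> topo X closure_of {gen}"
      using specialization[OF U gen_affine[OF U] x(1)] mx_gen ideal_0[OF mx_ideal[OF pts(1)]] by auto
    then have "topo X closure_of {x} \<subseteq> topo X closure_of {gen}" by (intro closure_of_minimal) auto
    moreover have "gen \<in> topo X closure_of {gen}" using closure_of_subset[of "{gen}" "topo X"] gen by auto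
    ultimately show ?thesis using gx by (auto simp: Z_def)
  qed
  have "\<forall>i\<le>2. irreducible_closed (topo X) (Z i)" using irreducible_closure pts gen by (auto simp: Z_def)
  moreover have "\<forall>i<2. Z i \<subset> Z (Suc i)"
    using sub0 sub1 by (auto simp: less_Suc_eq numeral_2_eq_2)
  ultimately have "enat 2 \<le> krull_dim (topo X)" unfolding krull_dim_def by (intro Sup_upper) blast
  then show False using krull by (simp add: one_enat_def)
qed

lemma dim_affine: "affine_open X U \<Longrightarrow> dim_le_1 (sec X U)"
  unfolding dim_le_1_def
proof (intro allI impI)
  fix P Q assume U: "affine_open X U" and P: "is_prime_ideal (sec X U) P" and Q: "is_prime_ideal (sec X U) Q"
    and "P \<noteq> {0}" "P \<subseteq> Q"
  obtain x where x: "x \<in> U" "sec X U \<inter> mx x = P" using affine_point[OF U P] by blast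
  obtain y where y: "y \<in> U" "sec X U \<inter> mx y = Q" using affine_point[OF U Q] by blast
  have "x \<noteq> gen" using x(2) \<open>P \<noteq> {0}\<close> mx_gen subring_0[OF affine_subring[OF U]] by auto
  then have "x = y" using prime_maximal[OF U x(1) _ y(1)] x y \<open>P \<subseteq> Q\<close> by blast
  then show "P = Q" using x y by simp
qed

text \<open>The Nullstellensatz gives residues in \<open>k\<close> for the sections of a finite-type
  affine neighbourhood. A fraction \<open>a / b\<close> then has the quotient of the two residues as
  its value, since a denominator outside the maximal ideal has nonzero residue.\<close>

lemma residue:
  assumes x: "x \<in> closed_pts" and f: "f \<in> st x"
  shows "\<exists>c. f - \<iota> c \<in> mx x"
proof -
  have xX: "x \<in> points X" "x \<noteq> gen" using x by (auto simp: closed_pts_def)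
  obtain U where U: "ft_open U" "x \<in> U" using ft_cover_point[OF xX(1)] by blast
  have Ua: "affine_open X U" using ft_affine[OF U(1)] .
  obtain S where S: "finite S" "sec X U = subring_gen (range \<iota> \<union> S)" using U(1) unfolding ft_open_def by blast
  note P = affine_prime[OF Ua U(2)]
  obtain g where "g \<in> sec X U" "g \<in> mx x" "g \<noteq> 0" using prime_nonzero[OF Ua U(2) xX(2)] by blast
  then have nz: "sec X U \<inter> mx x \<noteq> {0}" by blast
  have res: "\<exists>c. a - \<iota> c \<in> sec X U \<inter> mx x" if "a \<in> sec X U" for a
  proof (rule nullstellensatz[OF hom S P _ that])
    show "Q = sec X U \<inter> mx x" if "is_prime_ideal (sec X U) Q" "sec X U \<inter> mx x \<subseteq> Q" for Q
      using dim_affine[OF Ua] P nz that unfolding dim_le_1_def by metis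
  qed
  obtain a b where ab: "a \<in> sec X U" "b \<in> sec X U" "b \<notin> mx x" "b \<noteq> 0" "f = a / b" by (rule affine_stalkE[OF Ua U(2) f])
  obtain \<alpha> \<beta> where \<alpha>: "a - \<iota> \<alpha> \<in> mx x" and \<beta>: "b - \<iota> \<beta> \<in> mx x" using res[OF ab(1)] res[OF ab(2)] by blast
  have M: "is_ideal (st x) (mx x)" and L: "is_subring (st x)"
    using mx_ideal[OF xX(1)] stalk_subring[OF xX(1)] .
  have "\<beta> \<noteq> 0"
  proof
    assume "\<beta> = 0"
    then have "b - \<iota> \<beta> = b" using is_field_homD(4)[OF hom] by simp
    then show False using \<beta> ab(3) by simp
  qed
  have "b \<in> lunits (st x)" using ab affine_sec_stalk[OF Ua U(2)] by (auto simp: lmax_def)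
  then have ib: "inverse b \<in> st x" by (simp add: lunits_def)
  have "\<iota> \<beta> \<noteq> 0" using \<open>\<beta> \<noteq> 0\<close> is_field_homD(7)[OF hom] by simp
  then have "f - \<iota> \<alpha> * inverse (\<iota> \<beta>) = (inverse (\<iota> \<beta>) * inverse b) * (\<iota> \<beta> * (a - \<iota> \<alpha>) - \<iota> \<alpha> * (b - \<iota> \<beta>))"
    using ab(4,5) by (simp add: field_simps)
  then have "f - \<iota> (\<alpha> / \<beta>) = (\<iota> (inverse \<beta>) * inverse b) * (\<iota> \<beta> * (a - \<iota> \<alpha>) - \<iota> \<alpha> * (b - \<iota> \<beta>))"
    by (simp only: divide_inverse is_field_homD(3,8)[OF hom])
  also have "\<dots> \<in> mx x"
    by (rule ideal_mult[OF M subring_mult[OF L const_stalk[OF xX(1)] ib] ideal_diff[OF L M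
        ideal_mult[OF M const_stalk[OF xX(1)] \<alpha>] ideal_mult[OF M const_stalk[OF xX(1)] \<beta>]]])
  finally show ?thesis by blast
qed

lemma krull_not_0: "\<exists>x\<in>points X. x \<noteq> gen"
proof (rule ccontr)
  assume "\<not> ?thesis"
  then have pts: "points X = {gen}" using gen(1) by blast
  have irr: "Z = {gen}" if "irreducible_closed (topo X) Z" for Z
    using that closedin_subset[of "topo X" Z] pts unfolding irreducible_closed_def by blast
  have "n = 0" if "\<forall>i\<le>n. irreducible_closed (topo X) (Z i)" "\<forall>i<n. Z i \<subset> Z (Suc i)" for n Z
  proof (rule ccontr)
    assume "n \<noteq> 0"
    then have "Z 0 = {gen}" "Z 1 = {gen}" "Z 0 \<subset> Z 1" using that irr[of "Z 0"] irr[of "Z 1"] by auto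
    then show False by simp
  qed
  then have "krull_dim (topo X) \<le> 0" unfolding krull_dim_def by (intro Sup_least) (auto simp: zero_enat_def)
  then show False using krull by simp
qed

text \<open>If all rational functions were constant, every stalk would be the whole field and every
  point generic. This is what separates rational points from the generic point and what makes the
  set of points infinite.\<close>

lemma nonconstant: "\<exists>f. f \<notin> range \<iota>"
proof (rule ccontr)
  assume "\<not> ?thesis"
  then have all: "f \<in> range \<iota>" for f by blast
  obtain x where x: "x \<in> points X" "x \<noteq> gen" using krull_not_0 by blast
  have "f \<in> st x" for f using const_stalk[OF x(1)] all[of f] by auto
  then have "st x = UNIV" by auto
  then show False using stalk_UNIV x by auto
qed

lemma rational_points_eq: "rational_points \<iota> X = closed_pts"
proof -
  have "gen \<notin> rational_points \<iota> X"
  proof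
    assume "gen \<in> rational_points \<iota> X"
    then have "\<exists>c. f - \<iota> c = 0" for f
      using gen(2) mx_gen unfolding rational_points_def max_ideal_at_eq by auto
    then have "f \<in> range \<iota>" for f by (metis eq_iff_diff_eq_0 rangeI)
    then show False using nonconstant by blast
  qed
  then show ?thesis
    using residue unfolding rational_points_def closed_pts_def max_ideal_at_eq by auto
qed

lemma finite_inverse_image_on: "finite B \<Longrightarrow> inj_on h A \<Longrightarrow> finite {x \<in> A. h x \<in> B}"
  using finite_vimage_IntI[of B h A] by (simp add: vimage_def Int_def conj_commute)

text \<open>With \<open>f = a / b\<close> on a finite-type affine open, a point where
  \<open>f\<close> is not a unit has \<open>a * b\<close> in its prime, and only finitely many
  primes contain this element.\<close>

lemma finite_nonunits:
  assumes f: "f \<noteq> 0"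
  shows "finite {x \<in> points X. f \<notin> lunits (st x)}"
proof -
  obtain \<U> where \<U>: "finite \<U>" "\<Union>\<U> = points X" "\<And>U. U \<in> \<U> \<Longrightarrow> ft_open U" using ft_cover by blast
  have "finite {x \<in> U. f \<notin> lunits (st x)}" if "U \<in> \<U>" for U
  proof -
    have U: "ft_open U" "affine_open X U" using \<U>(3)[OF that] ft_affine by auto
    note A = affine_subring[OF U(2)]
    obtain a b where ab: "a \<in> sec X U" "b \<in> sec X U" "b \<noteq> 0" "f = a / b" using frac[OF U(2)] by blast
    have fin: "finite {P. is_prime_ideal (sec X U) P \<and> a * b \<in> P}"
      using finite_primes_containing[OF A ft_noetherian[OF U(1)] dim_affine[OF U(2)], of "a * b"] ab f subring_mult[OF A] by auto
    have sub: "{x \<in> U. f \<notin> lunits (st x)} \<subseteq> {x \<in> U. sec X U \<inter> mx x \<in> {P. is_prime_ideal (sec X U) P \<and> a * b \<in> P}}"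
    proof
      fix x assume x: "x \<in> {x \<in> U. f \<notin> lunits (st x)}"
      then have xX: "x \<in> points X" using affine_points[OF U(2)] by auto
      have sub: "sec X U \<subseteq> st x" using affine_sec_stalk[OF U(2)] x by auto
      have "a * b \<in> mx x"
      proof (rule ccontr)
        assume "a * b \<notin> mx x"
        then have u: "a * b \<in> lunits (st x)" using ab sub subring_mult[OF A] by (auto simp: lmax_def)
        have "a \<in> lunits (st x)" "b \<in> lunits (st x)"
          using lunits_of_mult[OF stalk_subring[OF xX] _ _ u] lunits_of_mult[OF stalk_subring[OF xX], of b a] u ab sub
          by (auto simp: mult.commute)
        then have "f \<in> lunits (st x)"
          using lunits_mult[OF stalk_subring[OF xX] _ lunits_inverse] ab(4) by (simp add: divide_inverse)
        then show False using x by simp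
      qed
      then show "x \<in> {x \<in> U. sec X U \<inter> mx x \<in> {P. is_prime_ideal (sec X U) P \<and> a * b \<in> P}}"
        using x affine_prime[OF U(2)] ab subring_mult[OF A] by auto
    qed
    have inj: "inj_on (\<lambda>x. sec X U \<inter> mx x) U" using affine_inj[OF U(2)] by (intro inj_onI)
    show ?thesis by (rule finite_subset[OF sub finite_inverse_image_on[OF fin inj]])
  qed
  then have "finite (\<Union>U\<in>\<U>. {x \<in> U. f \<notin> lunits (st x)})" using \<U>(1) by blast
  moreover have "{x \<in> points X. f \<notin> lunits (st x)} = (\<Union>U\<in>\<U>. {x \<in> U. f \<notin> lunits (st x)})" using \<U>(2) by blast
  ultimately show ?thesis by simp
qed

lemma finite_poles: "finite {x \<in> points X. f \<notin> st x}"
proof (cases "f = 0")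
  case True
  then show ?thesis using subring_0[OF stalk_subring] by (auto intro: finite_subset[of _ "{}"])
next
  case False
  show ?thesis by (rule finite_subset[OF _ finite_nonunits[OF False]]) (auto simp: lunits_def)
qed

lemma closed_point_closed: "x \<in> closed_pts \<Longrightarrow> closedin (topo X) {x}"
proof -
  assume x: "x \<in> closed_pts"
  have "topo X closure_of {x} \<subseteq> {x}"
  proof
    fix y assume y: "y \<in> topo X closure_of {x}"
    then have "y \<in> points X" using in_closure_of by fast
    then obtain V where V: "affine_open X V" "y \<in> V" using affine_cover by blast
    have "x \<in> V" using y V affine_openin[OF V(1)] unfolding in_closure_of by blast
    then have "sec X V \<inter> mx x \<subseteq> mx y" using not_in_closure[OF V(1) _ V(2)] y by blast
    then have "x = y" using prime_maximal[OF V(1) \<open>x \<in> V\<close> _ V(2)] x by (auto simp: closed_pts_def)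
    then show "y \<in> {x}" by simp
  qed
  then show ?thesis
    using closure_of_subset[of "{x}" "topo X"] closed_ptsD[OF x]
    by (metis closedin_closure_of subset_antisym empty_subsetI insert_subset)
qed

text \<open>Each finite-type affine open loses only zeros of one nonzero section; conversely,
  finitely many closed points can be removed because each of them is closed.\<close>

lemma open_iff_cofinite:
  assumes "T \<subseteq> points X" "T \<noteq> {}"
  shows "openin (topo X) T \<longleftrightarrow> gen \<in> T \<and> finite (points X - T)"
proof
  assume T: "openin (topo X) T"
  then have ne: "nonempty_open X T" using assms by (simp add: nonempty_open_def)
  then have gT: "gen \<in> T" by (rule gen(3))
  obtain \<U> where \<U>: "finite \<U>" "\<Union>\<U> = points X" "\<And>U. U \<in> \<U> \<Longrightarrow> ft_open U" using ft_cover by blast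
  have "finite (U - T)" if "U \<in> \<U>" for U
  proof -
    have U: "affine_open X U" using \<U>(3)[OF that] ft_affine by auto
    obtain g where g: "g \<in> sec X U" "g \<notin> mx gen" "{z \<in> U. g \<notin> mx z} \<subseteq> T"
      using affine_basis[OF U gen_affine[OF U] T gT] by blast
    have "U - T \<subseteq> {x \<in> points X. g \<notin> lunits (st x)}" using g affine_points[OF U] by (auto simp: lmax_def)
    moreover have "g \<noteq> 0" using g(2) mx_gen by auto
    ultimately show ?thesis using finite_nonunits finite_subset by blast
  qed
  then have "finite (\<Union>U\<in>\<U>. U - T)" using \<U>(1) by blast
  moreover have "points X - T = (\<Union>U\<in>\<U>. U - T)" using \<U>(2) by blast
  ultimately show "gen \<in> T \<and> finite (points X - T)" using gT by simp
next
  assume T: "gen \<in> T \<and> finite (points X - T)"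
  have "closedin (topo X) (\<Union>x\<in>points X - T. {x})"
    using T closed_point_closed by (intro closedin_Union) (auto simp: closed_pts_def)
  then have "closedin (topo X) (points X - T)" by simp
  then show "openin (topo X) T" using assms by (simp add: openin_closedin_eq)
qed

text \<open>If the denominators of \<open>f\<close> avoided all products of a power of
  \<open>a\<close> with an element outside the prime of \<open>x\<close>, a prime \<open>Q\<close>
  would separate the two sets. It is nonzero and contained in the prime of \<open>x\<close>, hence
  equal to it, but then it contains \<open>a\<close>.\<close>

lemma pole_order:
  assumes x: "x \<in> closed_pts" and c: "c \<in> mx x"
  shows "\<exists>r. c ^ r * f \<in> st x"
proof -
  have xX: "x \<in> points X" "x \<noteq> gen" using x by (auto simp: closed_pts_def)
  obtain U where U: "affine_open X U" "x \<in> U" using affine_cover[OF xX(1)] by blast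
  note A = affine_subring[OF U(1)] and P = affine_prime[OF U] and L = stalk_subring[OF xX(1)]
  let ?A = "sec X U"
  have AL: "?A \<subseteq> st x" using affine_sec_stalk[OF U] .
  have "c \<in> st x" using c lmax_subset by auto
  then obtain a b where ab: "a \<in> ?A" "b \<in> ?A" "b \<notin> mx x" "b \<noteq> 0" "c = a / b" "b * c = a" by (rule affine_stalkE[OF U])
  have am: "a \<in> mx x" using affine_max_iff[OF U ab(1-3)] ab(5) c by simp
  define I where "I = {u \<in> ?A. u * f \<in> st x}"
  have I: "is_ideal ?A I"
    unfolding I_def
  proof (rule is_idealI)
    fix u w assume "u \<in> ?A" "w \<in> {u \<in> ?A. u * f \<in> st x}"
    then show "u * w \<in> {u \<in> ?A. u * f \<in> st x}" using AL subring_mult[OF A] subring_mult[OF L] by (auto simp: mult.assoc)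
  qed (auto simp: distrib_right intro: subring_0[OF A] subring_0[OF L] subring_add[OF A] subring_add[OF L])
  define S where "S = {a ^ r * s | r s. s \<in> ?A - mx x}"
  have "I \<inter> S \<noteq> {}"
  proof
    assume IS: "I \<inter> S = {}"
    have "\<exists>Q. is_prime_ideal ?A Q \<and> I \<subseteq> Q \<and> Q \<inter> S = {}"
    proof (rule prime_avoiding[OF A I _ _ _ IS])
      have "1 \<in> ?A - mx x" using subring_1[OF A] prime_one[OF mx_prime[OF xX(1)]] by simp
      then show "1 \<in> S" unfolding S_def by (intro CollectI exI[of _ 0] exI[of _ 1]) simp
      show "S \<subseteq> ?A" unfolding S_def using ab subring_power[OF A] subring_mult[OF A] by auto
      fix u w assume "u \<in> S" "w \<in> S"
      then obtain r s r' s' where "u = a ^ r * s" "w = a ^ r' * s'" "s \<in> ?A - mx x" "s' \<in> ?A - mx x"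
        unfolding S_def by blast
      moreover from this have "s * s' \<in> ?A - mx x"
        using subring_mult[OF A] prime_mult[OF mx_prime[OF xX(1)], of s s'] AL by blast
      ultimately show "u * w \<in> S" unfolding S_def
        by (intro CollectI exI[of _ "r + r'"] exI[of _ "s * s'"]) (simp add: power_add)
    qed
    then obtain Q where Q: "is_prime_ideal ?A Q" "I \<subseteq> Q" "Q \<inter> S = {}" by blast
    obtain u v where uv: "u \<in> ?A" "v \<in> ?A" "v \<noteq> 0" "f = u / v" using frac[OF U(1)] by blast
    then have "v \<in> I" using AL by (auto simp: I_def)
    then have "Q \<noteq> {0}" using Q(2) uv by auto
    moreover have "Q \<subseteq> ?A \<inter> mx x"
    proof
      fix s assume s: "s \<in> Q"
      then have "s \<in> ?A" using ideal_subset[OF prime_ideal[OF Q(1)]] by auto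
      moreover have "s \<in> mx x"
      proof (rule ccontr)
        assume "s \<notin> mx x"
        then have "s \<in> S" unfolding S_def using \<open>s \<in> ?A\<close> by (intro CollectI exI[of _ 0] exI[of _ s]) simp
        then show False using s Q(3) by auto
      qed
      ultimately show "s \<in> ?A \<inter> mx x" by simp
    qed
    ultimately have "Q = ?A \<inter> mx x" using dim_affine[OF U(1)] Q(1) P unfolding dim_le_1_def by blast
    then have "a \<in> Q" using am ab by simp
    moreover have "1 \<in> ?A - mx x" using subring_1[OF A] prime_one[OF mx_prime[OF xX(1)]] by simp
    then have "a \<in> S" unfolding S_def by (intro CollectI exI[of _ 1] exI[of _ 1]) simp
    ultimately show False using Q(3) by auto
  qed
  then obtain r s where rs: "s \<in> ?A - mx x" "a ^ r * s * f \<in> st x" unfolding I_def S_def by blast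
  have "inverse s \<in> st x" "inverse b \<in> st x" "s \<noteq> 0" using rs(1) ab AL by (auto simp: lmax_def lunits_def)
  moreover have "c ^ r * f = inverse b ^ r * (inverse s * (a ^ r * s * f))"
    using ab(5) \<open>s \<noteq> 0\<close> by (simp add: field_simps power_divide power_inverse)
  ultimately have "c ^ r * f \<in> st x" using rs(2) subring_mult[OF L] subring_power[OF L] by presburger
  then show ?thesis by blast
qed

text \<open>With finitely many points, a product of functions vanishing at the closed points is a
  Goldman witness for the zero ideal of an affine ring, which then consists of constants. Infinitude
  is needed for relabelling the points of the modification.\<close>

lemma infinite_points: "infinite (points X)"
proof
  assume fin: "finite (points X)"
  obtain U where U: "ft_open U" "gen \<in> U" using ft_cover_point[OF gen(1)] by blast
  have Ua: "affine_open X U" using ft_affine[OF U(1)] .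
  let ?A = "sec X U"
  note A = affine_subring[OF Ua]
  obtain S where S: "finite S" "?A = subring_gen (range \<iota> \<union> S)" using U(1) unfolding ft_open_def by blast
  have "\<exists>g. g \<in> ?A \<and> g \<in> mx x \<and> g \<noteq> 0" if "x \<in> U - {gen}" for x using prime_nonzero[OF Ua, of x] that by blast
  then obtain g where g: "\<And>x. x \<in> U - {gen} \<Longrightarrow> g x \<in> ?A \<and> g x \<in> mx x \<and> g x \<noteq> 0" by metis
  have finU: "finite (U - {gen})" using fin affine_points[OF Ua] finite_subset by blast
  define a where "a = (\<Prod>x\<in>U - {gen}. g x)"
  have a: "a \<in> ?A" "a \<noteq> 0" unfolding a_def using g finU by (auto intro!: subring_prod[OF A])
  have am: "a \<in> mx x" if x: "x \<in> U - {gen}" for x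
  proof -
    have "x \<in> points X" using x affine_points[OF Ua] by auto
    moreover have "(\<Prod>y\<in>U - {gen} - {x}. g y) \<in> st x"
      using g affine_sec_stalk[OF Ua, of x] x stalk_subring[OF \<open>x \<in> points X\<close>] by (intro subring_prod) auto
    moreover have "a = g x * (\<Prod>y\<in>U - {gen} - {x}. g y)" unfolding a_def by (rule prod.remove[OF finU x])
    ultimately show ?thesis using g[OF x] ideal_mult_right[OF mx_ideal] by metis
  qed
  have "\<exists>e\<in>?A. \<exists>m. d * e - a ^ m \<in> {0}" if d: "d \<in> ?A - {0}" for d
  proof (rule ccontr)
    assume no: "\<not> ?thesis"
    have I: "is_ideal ?A {d * c | c. c \<in> ?A}" using d by (intro is_ideal_principal[OF A]) auto
    have "\<exists>P. is_prime_ideal ?A P \<and> {d * c | c. c \<in> ?A} \<subseteq> P \<and> P \<inter> range (\<lambda>n. a ^ n) = {}"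
    proof (rule prime_avoiding[OF A I])
      show "1 \<in> range (\<lambda>n. a ^ n)" by (rule range_eqI[of _ _ 0]) simp
      show "{d * c | c. c \<in> ?A} \<inter> range (\<lambda>n. a ^ n) = {}" using no by (auto; metis)
      fix u v assume "u \<in> range (\<lambda>n. a ^ n)" "v \<in> range (\<lambda>n. a ^ n)"
      then show "u * v \<in> range (\<lambda>n. a ^ n)" by (auto simp flip: power_add)
    qed (use a subring_power[OF A] in auto)
    then obtain P where P: "is_prime_ideal ?A P" "{d * c | c. c \<in> ?A} \<subseteq> P" "P \<inter> range (\<lambda>n. a ^ n) = {}" by blast
    obtain x where x: "x \<in> U" "?A \<inter> mx x = P" using affine_point[OF Ua P(1)] by blast
    have "d * 1 \<in> P" using P(2) subring_1[OF A] by blast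
    then have "x \<noteq> gen" using x d mx_gen by auto
    then have "a \<in> P" using am[of x] x a by auto
    moreover have "a \<in> range (\<lambda>n. a ^ n)" by (rule range_eqI[of _ _ 1]) simp
    ultimately show False using P(3) by blast
  qed
  then have "goldman ?A {0}" using a unfolding goldman_def by (intro bexI[of _ a]) auto
  then have const: "\<exists>c. f - \<iota> c \<in> {0}" if "f \<in> ?A" for f
    using nullstellensatz_goldman[OF hom S(1)] prime_zero[OF A] that S(2) by metis
  have "f \<in> range \<iota>" for f
  proof -
    obtain u v where "u \<in> ?A" "v \<in> ?A" "v \<noteq> 0" "f = u / v" using frac[OF Ua] by blast
    moreover obtain c d where "u = \<iota> c" "v = \<iota> d" using const[OF \<open>u \<in> ?A\<close>] const[OF \<open>v \<in> ?A\<close>] by auto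
    ultimately have "f = \<iota> (c * inverse d)" by (simp add: is_field_homD[OF hom] divide_inverse)
    then show ?thesis by simp
  qed
  then show False using nonconstant by blast
qed

end

section \<open>Group algebras of finite abelian groups\<close>

abbreviation lk :: "('a \<Rightarrow>\<^sub>0 'b::zero) \<Rightarrow> 'a \<Rightarrow> 'b" where
  "lk \<equiv> Poly_Mapping.lookup"

abbreviation sg :: "'a \<Rightarrow> 'b::zero \<Rightarrow> 'a \<Rightarrow>\<^sub>0 'b" where
  "sg \<equiv> Poly_Mapping.single"

lemma lookup_times_finite:
  fixes f g :: "'m::{ab_group_add,finite} \<Rightarrow>\<^sub>0 'a::comm_ring_1"
  shows "lk (f * g) k = (\<Sum>l\<in>UNIV. lk f l * lk g (k - l))"
proof -
  have eq: "(\<Sum>q\<in>UNIV. lk g q when k = l + q) = lk g (k - l)" for l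
  proof -
    have "(\<Sum>q\<in>UNIV. lk g q when k = l + q) = (\<Sum>q\<in>{k - l}. lk g q when k = l + q)"
      by (rule sum.mono_neutral_right) (auto simp: when_def algebra_simps)
    then show ?thesis by (simp add: when_def)
  qed
  have "lk (f * g) k = (\<Sum>l\<in>UNIV. lk f l * (\<Sum>q\<in>UNIV. lk g q when k = l + q))"
    by (simp add: lookup_mult Sum_any.expand_superset[of UNIV])
  then show ?thesis by (simp add: eq)
qed

lemma inj_single_1: "inj (\<lambda>m. sg m (1::'a::zero_neq_one))"
  by (rule injI) (metis lookup_single_eq lookup_single_not_eq zero_neq_one)

lemma lookup_sum_pm: "lk (\<Sum>i\<in>I. f i) k = (\<Sum>i\<in>I. lk (f i) k)"
  by (induction I rule: infinite_finite_induct) (auto simp: lookup_add)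

lemma single_decomp:
  fixes f :: "'m::finite \<Rightarrow>\<^sub>0 'a::comm_monoid_add"
  shows "f = (\<Sum>m\<in>UNIV. sg m (lk f m))"
proof (rule poly_mapping_eqI)
  fix k
  have "(\<Sum>m\<in>UNIV. lk (sg m (lk f m)) k) = (\<Sum>m\<in>UNIV. if m = k then lk f m else 0)"
    by (intro sum.cong) (auto simp: lookup_single when_def)
  then show "lk f k = lk (\<Sum>m\<in>UNIV. sg m (lk f m)) k" by (simp add: lookup_sum_pm)
qed

primrec nmul :: "nat \<Rightarrow> 'm::ab_group_add \<Rightarrow> 'm" where
  "nmul 0 m = 0"
| "nmul (Suc n) m = m + nmul n m"

lemma nmul_add: "nmul (a + b) m = nmul a m + nmul b m"
  by (induction a) (auto simp: algebra_simps)

lemma nmul_mult: "nmul (a * b) m = nmul a (nmul b m)"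
  by (induction a) (auto simp: nmul_add)

lemma sum_const_nmul: "(\<Sum>x\<in>A. m) = nmul (card A) m"
  by (induction A rule: infinite_finite_induct) auto

text \<open>Lagrange's theorem, by summing all group elements before and after translation by
  \<open>m\<close>.\<close>

lemma nmul_card: "nmul (CARD('m)) m = (0 :: 'm::{ab_group_add,finite})"
proof -
  have "(\<Sum>x\<in>UNIV. x + m) = (\<Sum>x\<in>UNIV. x)"
    by (rule sum.reindex_bij_betw[where h = "\<lambda>x. x + m"])
      (auto simp: bij_betw_def inj_on_def image_iff intro: exI[of _ "_ - m"])
  then show ?thesis by (simp add: sum.distrib sum_const_nmul)
qed

text \<open>Negatives are multiples by natural numbers, so negative exponents of the uniformizer can
  be avoided in degree computations.\<close>

lemma nmul_card_pred: "nmul (CARD('m) - 1) m = - (m :: 'm::{ab_group_add,finite})"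
proof -
  have "Suc (CARD('m) - 1) = CARD('m)" by simp
  then have "m + nmul (CARD('m) - 1) m = 0" using nmul_card[of m] by (metis nmul.simps(2))
  then show ?thesis using minus_unique by metis
qed

text \<open>For a subgroup \<open>H\<close> this is the kernel of the projection from
  \<open>k[M]\<close> to \<open>k[M/H]\<close>: the coefficient sums over all cosets vanish. It
  defines the diagonalizable subgroup with character group \<open>M/H\<close>.\<close>

definition coset_ideal :: "'m::{ab_group_add,finite} set \<Rightarrow> ('m \<Rightarrow>\<^sub>0 'a::comm_ring_1) set" where
  "coset_ideal H = {h. \<forall>r. (\<Sum>m\<in>H. lk h (m + r)) = 0}"

lemma is_ideal_coset: "is_ideal UNIV (coset_ideal H :: ('m::{ab_group_add,finite} \<Rightarrow>\<^sub>0 'a::comm_ring_1) set)"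
proof (rule is_idealI)
  fix a h :: "'m \<Rightarrow>\<^sub>0 'a" assume h: "h \<in> coset_ideal H"
  have "(\<Sum>m\<in>H. lk (a * h) (m + r)) = 0" for r
  proof -
    have "(\<Sum>m\<in>H. lk (a * h) (m + r)) = (\<Sum>m\<in>H. \<Sum>l\<in>UNIV. lk a l * lk h (m + (r - l)))"
      by (simp add: lookup_times_finite algebra_simps)
    also have "\<dots> = (\<Sum>l\<in>UNIV. lk a l * (\<Sum>m\<in>H. lk h (m + (r - l))))"
      by (subst sum.swap) (simp add: sum_distrib_left)
    also have "\<dots> = 0" using h by (simp add: coset_ideal_def)
    finally show ?thesis .
  qed
  then show "a * h \<in> coset_ideal H" by (simp add: coset_ideal_def)
qed (auto simp: coset_ideal_def lookup_add sum.distrib)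

text \<open>Closure under negatives follows from finiteness, see
  \<open>subgrp_uminus\<close>.\<close>

definition subgrp :: "'m::ab_group_add set \<Rightarrow> bool" where
  "subgrp H \<longleftrightarrow> 0 \<in> H \<and> (\<forall>a\<in>H. \<forall>b\<in>H. a + b \<in> H)"

lemma subgrp_nmul: "subgrp H \<Longrightarrow> m \<in> H \<Longrightarrow> nmul n m \<in> H"
  by (induction n) (auto simp: subgrp_def)

lemma subgrp_uminus:
  fixes H :: "'m::{ab_group_add,finite} set"
  assumes "subgrp H" "m \<in> H"
  shows "- m \<in> H"
proof -
  show ?thesis using subgrp_nmul[OF assms, of "CARD('m) - 1"] by (simp only: nmul_card_pred)
qed

lemma subgrp_diff: "subgrp (H :: 'm::{ab_group_add,finite} set) \<Longrightarrow> a \<in> H \<Longrightarrow> b \<in> H \<Longrightarrow> a - b \<in> H"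
  using subgrp_uminus[of H b] unfolding subgrp_def by (metis add.commute uminus_add_conv_diff)

lemma sum_when_shift:
  fixes H :: "'m::{ab_group_add,finite} set"
  shows "(\<Sum>m\<in>H. lk (sg n (1::'a::comm_ring_1)) (m + r)) = (if n - r \<in> H then 1 else 0)"
proof -
  have "(\<Sum>m\<in>H. lk (sg n (1::'a)) (m + r)) = (\<Sum>m\<in>H. if m = n - r then 1 else 0)"
    by (intro sum.cong) (auto simp: lookup_single when_def algebra_simps)
  then show ?thesis by simp
qed

lemma single_diff_coset:
  assumes "subgrp H" "n \<in> H"
  shows "sg n 1 - sg 0 1 \<in> coset_ideal (H :: 'm::{ab_group_add,finite} set)"
proof -
  have "n - r \<in> H \<longleftrightarrow> 0 - r \<in> H" for r
    using subgrp_diff[OF assms(1), of "n - r" n] subgrp_diff[OF assms(1), of n r] assms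
      subgrp_uminus[OF assms(1), of "- r"] unfolding subgrp_def by (auto; metis add.commute uminus_add_conv_diff diff_conv_add_uminus)
  then show ?thesis by (simp add: coset_ideal_def lookup_minus sum_subtractf sum_when_shift del: single_one)
qed

definition transversal :: "'m::ab_group_add set \<Rightarrow> 'm set \<Rightarrow> bool" where
  "transversal H R \<longleftrightarrow> (\<forall>m. \<exists>!r. r \<in> R \<and> m - r \<in> H)"

text \<open>Replacing every \<open>m\<close> by the representative of its coset turns
  \<open>h\<close> into zero, since the coefficients over each coset add up to zero. So
  \<open>h\<close> equals the sum of the replacement errors, and these are multiples of the given
  generators.\<close>

lemma coset_ideal_subset:
  fixes I :: "('m::{ab_group_add,finite} \<Rightarrow>\<^sub>0 'a::comm_ring_1) set"
  assumes H: "subgrp H" and R: "transversal H R" and I: "is_ideal UNIV I" and gens: "\<And>n. n \<in> H \<Longrightarrow> sg n 1 - sg 0 1 \<in> I"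
  shows "coset_ideal H \<subseteq> I"
proof
  fix h :: "'m \<Rightarrow>\<^sub>0 'a" assume h: "h \<in> coset_ideal H"
  obtain rep where rep: "\<And>m. rep m \<in> R" "\<And>m. m - rep m \<in> H" "\<And>m r. r \<in> R \<Longrightarrow> m - r \<in> H \<Longrightarrow> rep m = r"
    using R unfolding transversal_def by metis
  have zero: "(\<Sum>m\<in>UNIV. sg (rep m) (lk h m)) = 0"
  proof (rule poly_mapping_eqI)
    fix k
    have "lk (\<Sum>m\<in>UNIV. sg (rep m) (lk h m)) k = (\<Sum>m\<in>UNIV. if rep m = k then lk h m else 0)"
      unfolding lookup_sum_pm by (intro sum.cong) (auto simp: lookup_single when_def)
    also have "\<dots> = (\<Sum>m\<in>{m. rep m = k}. lk h m)" by (simp add: sum.If_cases)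
    also have "\<dots> = 0"
    proof (cases "k \<in> R")
      case True
      have "{m. rep m = k} = (\<lambda>m. m + k) ` H"
      proof
        show "{m. rep m = k} \<subseteq> (\<lambda>m. m + k) ` H"
        proof
          fix m assume "m \<in> {m. rep m = k}"
          then have "m - k \<in> H" using rep(2)[of m] by simp
          then show "m \<in> (\<lambda>m. m + k) ` H" by (intro image_eqI[of _ _ "m - k"]) auto
        qed
        show "(\<lambda>m. m + k) ` H \<subseteq> {m. rep m = k}" using rep(3)[OF True] by auto
      qed
      then have "(\<Sum>m\<in>{m. rep m = k}. lk h m) = (\<Sum>m\<in>H. lk h (m + k))"
        by (simp add: sum.reindex)
      then show ?thesis using h by (simp add: coset_ideal_def)
    next
      case False
      then have "{m. rep m = k} = {}" using rep(1) by auto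
      then show ?thesis by simp
    qed
    finally show "lk (\<Sum>m\<in>UNIV. sg (rep m) (lk h m)) k = lk 0 k" by simp
  qed
  have "h = (\<Sum>m\<in>UNIV. sg m (lk h m)) - (\<Sum>m\<in>UNIV. sg (rep m) (lk h m))"
    using single_decomp[of h] zero by simp
  also have "\<dots> = (\<Sum>m\<in>UNIV. sg (rep m) (lk h m) * (sg (m - rep m) 1 - sg 0 1))"
    by (simp add: sum_subtractf[symmetric] right_diff_distrib mult_single)
  also have "\<dots> \<in> I" using rep(2) gens by (intro ideal_sum[OF I] ideal_mult[OF I]) auto
  finally show "h \<in> I" .
qed

text \<open>The differences of \<open>m\<close> and its representative, for \<open>m\<close> outside
  \<open>R\<close>, form a basis of the ideal, whose dimension is therefore the order of
  \<open>M\<close> minus the number of cosets.\<close>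

lemma quotient_dim_coset:
  assumes H: "subgrp H" and R: "transversal H R"
  shows "quotient_dim (coset_ideal H :: ('m::{ab_group_add,finite} \<Rightarrow>\<^sub>0 'k::field) set) = card R"
proof -
  let ?s = "\<lambda>(c::'k) (h :: 'm \<Rightarrow>\<^sub>0 'k). sg 0 c * h"
  interpret vs: vector_space ?s
    by unfold_locales (simp_all add: distrib_left distrib_right single_add mult_single mult.assoc[symmetric])
  obtain rep where rep: "\<And>m. rep m \<in> R" "\<And>m. m - rep m \<in> H" "\<And>m r. r \<in> R \<Longrightarrow> m - r \<in> H \<Longrightarrow> rep m = r"
    using R unfolding transversal_def by metis
  have rep_R: "rep r = r" if "r \<in> R" for r using rep(3)[OF that, of r] H by (simp add: subgrp_def)
  have sc: "?s c (sg m 1) = sg m c" for c m by (simp add: mult_single)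
  define b where "b m = (sg m 1 - sg (rep m) 1 :: 'm \<Rightarrow>\<^sub>0 'k)" for m
  have lkb: "lk (b m) k = (if k = m then 1 else 0)" if "k \<notin> R" for m k
    using that rep(1)[of m] by (auto simp: b_def lookup_minus lookup_single when_def)
  have inj: "inj_on b (- R)"
  proof (rule inj_onI)
    fix m m' assume "m \<in> - R" "m' \<in> - R" "b m = b m'"
    then show "m = m'" using lkb[of m m] lkb[of m m'] by (metis ComplD zero_neq_one)
  qed
  have "vs.dim (coset_ideal H) = card (b ` (- R))"
  proof (rule vs.dim_unique[OF _ _ _ refl])
    have "b m \<in> coset_ideal H" for m
    proof -
      have "b m = sg (rep m) 1 * (sg (m - rep m) 1 - sg 0 1)" by (simp add: b_def right_diff_distrib mult_single)
      then show ?thesis using ideal_mult[OF is_ideal_coset _ single_diff_coset[OF H rep(2)]] by simp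
    qed
    then show "b ` (- R) \<subseteq> coset_ideal H" by auto
    show "coset_ideal H \<subseteq> vs.span (b ` (- R))"
    proof
      fix h :: "'m \<Rightarrow>\<^sub>0 'k" assume h: "h \<in> coset_ideal H"
      define h' where "h' = (\<Sum>m\<in>-R. ?s (lk h m) (b m))"
      have h'span: "h' \<in> vs.span (b ` (- R))" unfolding h'_def
        by (intro vs.span_sum vs.span_scale vs.span_base) auto
      have h'J: "h' \<in> coset_ideal H" unfolding h'_def
        using \<open>\<And>m. b m \<in> coset_ideal H\<close> by (intro ideal_sum[OF is_ideal_coset] ideal_mult[OF is_ideal_coset]) auto
      have dJ: "h - h' \<in> coset_ideal H" by (rule ideal_diff[OF is_subring_UNIV is_ideal_coset h h'J])
      have out: "lk (h - h') k = 0" if "k \<notin> R" for k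
      proof -
        have "lk h' k = (\<Sum>m\<in>-R. lk h m * lk (b m) k)"
          unfolding h'_def lookup_sum_pm by (simp add: lookup_times_finite lookup_single when_def if_distrib[of "\<lambda>x. x * _"] sum.If_cases cong: if_cong)
        also have "\<dots> = (\<Sum>m\<in>-R. if m = k then lk h m else 0)"
          using lkb[OF that] by (intro sum.cong) auto
        also have "\<dots> = lk h k" using that by simp
        finally show ?thesis by (simp add: lookup_minus)
      qed
      have "lk (h - h') k = 0" for k
      proof (cases "k \<in> R")
        case True
        \<comment> \<open>After subtraction of \<open>h'\<close> only coefficients at
          representatives are left, one in each coset, so the vanishing coset sums kill them
          individually.\<close>
        have "(\<Sum>m\<in>H. lk (h - h') (m + k)) = (\<Sum>m\<in>{0}. lk (h - h') (m + k))"
        proof (rule sum.mono_neutral_right)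
          show "\<forall>m\<in>H - {0}. lk (h - h') (m + k) = 0"
          proof
            fix m assume m: "m \<in> H - {0}"
            have "m + k \<notin> R"
            proof
              assume mk: "m + k \<in> R"
              then have "rep (m + k) = k" using rep(3)[OF True, of "m + k"] m by simp
              then show False using rep_R[OF mk] m by simp
            qed
            then show "lk (h - h') (m + k) = 0" by (rule out)
          qed
        qed (use H in \<open>auto simp: subgrp_def\<close>)
        then show ?thesis using dJ by (simp add: coset_ideal_def)
      qed (rule out)
      then have "h - h' = 0" by (intro poly_mapping_eqI) simp
      then show "h \<in> vs.span (b ` (- R))" using h'span by simp
    qed
    show "vs.independent (b ` (- R))"
    proof (rule vs.independent_if_scalars_zero)
      fix u x assume u: "(\<Sum>x\<in>b ` (- R). ?s (u x) x) = 0" and x: "x \<in> b ` (- R)"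
      obtain k where k: "k \<notin> R" "x = b k" using x by auto
      have "0 = lk (\<Sum>m\<in>-R. ?s (u (b m)) (b m)) k" using u by (simp add: sum.reindex[OF inj])
      also have "\<dots> = (\<Sum>m\<in>-R. u (b m) * lk (b m) k)"
        unfolding lookup_sum_pm by (simp add: lookup_times_finite lookup_single when_def if_distrib[of "\<lambda>x. x * _"] sum.If_cases cong: if_cong)
      also have "\<dots> = (\<Sum>m\<in>-R. if m = k then u (b m) else 0)"
        using lkb[OF k(1)] by (intro sum.cong) auto
      also have "\<dots> = u x" using k by simp
      finally show "u x = 0" by simp
    qed simp
  qed
  then have dJ: "vs.dim (coset_ideal H) = CARD('m) - card R"
    using card_image[OF inj] by (simp add: Compl_eq_Diff_UNIV card_Diff_subset)
  have "vs.dim (UNIV :: ('m \<Rightarrow>\<^sub>0 'k) set) = card (range (\<lambda>m::'m. sg m (1::'k)))"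
  proof (rule vs.dim_unique[OF _ _ _ refl])
    show "UNIV \<subseteq> vs.span (range (\<lambda>m::'m. sg m (1::'k)))"
    proof
      fix h :: "'m \<Rightarrow>\<^sub>0 'k"
      have "h = (\<Sum>m\<in>UNIV. ?s (lk h m) (sg m 1))" using single_decomp[of h] sc by simp
      also have "\<dots> \<in> vs.span (range (\<lambda>m::'m. sg m (1::'k)))"
        by (intro vs.span_sum vs.span_scale vs.span_base) auto
      finally show "h \<in> vs.span (range (\<lambda>m::'m. sg m (1::'k)))" .
    qed
    show "vs.independent (range (\<lambda>m::'m. sg m (1::'k)))"
    proof (rule vs.independent_if_scalars_zero)
      fix u x assume u: "(\<Sum>x\<in>range (\<lambda>m::'m. sg m (1::'k)). ?s (u x) x) = 0" and x: "x \<in> range (\<lambda>m::'m. sg m (1::'k))"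
      have inj1: "inj (\<lambda>m::'m. sg m (1::'k))" by (rule inj_single_1)
      obtain k where k: "x = sg k 1" using x by auto
      have "0 = lk (\<Sum>m\<in>UNIV. ?s (u (sg m 1)) (sg m 1)) k" using u by (simp add: sum.reindex[OF inj1])
      also have "\<dots> = lk (\<Sum>m\<in>UNIV. sg m (u (sg m 1))) k" unfolding sc ..
      also have "\<dots> = (\<Sum>m\<in>UNIV. if m = k then u (sg m 1) else 0)"
        unfolding lookup_sum_pm by (intro sum.cong) (auto simp: lookup_single when_def)
      also have "\<dots> = u x" using k by simp
      finally show "u x = 0" by simp
    qed simp
  qed auto
  also have "\<dots> = CARD('m)"
    by (rule card_image[OF inj_single_1])
  finally show ?thesis
    unfolding quotient_dim_def dJ using card_mono[of "UNIV :: 'm set" R] by simp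
qed

section \<open>Fields graded by a finite abelian group\<close>

locale graded_field =
  fixes \<iota> :: "'k::alg_closed_field \<Rightarrow> 'f::field" and \<rho> :: "'f \<Rightarrow> ('m::{ab_group_add,finite} \<Rightarrow>\<^sub>0 'f)"
  assumes coaction: "coaction \<iota> \<rho>" and field_hom: "is_field_hom \<iota>"
begin

definition wcomp :: "'m \<Rightarrow> 'f \<Rightarrow> 'f" where
  "wcomp m f = lk (\<rho> f) m"

definition homog :: "'m \<Rightarrow> 'f \<Rightarrow> bool" where
  "homog m f \<longleftrightarrow> wcomp m f = f"

definition graded :: "'f set \<Rightarrow> bool" where
  "graded A \<longleftrightarrow> (\<forall>f\<in>A. \<forall>m. wcomp m f \<in> A)"

lemma rho_add: "\<rho> (f + g) = \<rho> f + \<rho> g" and rho_mult: "\<rho> (f * g) = \<rho> f * \<rho> g"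
  and rho_const: "\<rho> (\<iota> c) = sg 0 (\<iota> c)"
  and comp_sum: "(\<Sum>m\<in>UNIV. wcomp m f) = f"
  and rho_comp: "\<rho> (wcomp m f) = sg m (wcomp m f)"
  using coaction unfolding coaction_def wcomp_def by blast+

lemma comp_add: "wcomp m (f + g) = wcomp m f + wcomp m g"
  by (simp add: wcomp_def rho_add lookup_add)

lemma comp_0 [simp]: "wcomp m 0 = 0"
  using comp_add[of m 0 0] by (metis add_0 add_cancel_right_left)

lemma comp_uminus: "wcomp m (- f) = - wcomp m f"
  using comp_add[of m f "- f"] by (simp add: add_eq_0_iff)

lemma comp_diff: "wcomp m (f - g) = wcomp m f - wcomp m g"
  using comp_add[of m f "- g"] by (simp add: comp_uminus)

lemma comp_sum_distrib: "wcomp m (\<Sum>i\<in>I. f i) = (\<Sum>i\<in>I. wcomp m (f i))"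
  by (induction I rule: infinite_finite_induct) (auto simp: comp_add)

lemma comp_comp: "wcomp n (wcomp m f) = (if n = m then wcomp m f else 0)"
  using rho_comp[of m f] by (simp add: wcomp_def[of n] lookup_single when_def)

lemma homog_comp: "homog m (wcomp m f)"
  by (simp add: homog_def comp_comp)

lemma homog_rho: "homog m f \<longleftrightarrow> \<rho> f = sg m f"
proof
  assume "homog m f"
  then show "\<rho> f = sg m f" using rho_comp[of m f] by (simp add: homog_def)
next
  assume "\<rho> f = sg m f"
  then show "homog m f" by (simp add: homog_def wcomp_def)
qed

lemma comp_homog: "homog m f \<Longrightarrow> wcomp n f = (if n = m then f else 0)"
  using comp_comp[of n m f] by (simp add: homog_def)

lemma homog_0: "homog m 0"
  by (simp add: homog_def)

lemma homog_const: "homog 0 (\<iota> c)"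
  by (simp add: homog_rho rho_const)

lemma homog_1: "homog 0 1"
  using homog_const[of 1] is_field_homD(1)[OF field_hom] by simp

lemma homog_add: "homog m f \<Longrightarrow> homog m g \<Longrightarrow> homog m (f + g)"
  by (simp add: homog_def comp_add)

lemma homog_uminus: "homog m f \<Longrightarrow> homog m (- f)"
  by (simp add: homog_def comp_uminus)

lemma comp_mult: "wcomp r (f * g) = (\<Sum>n\<in>UNIV. wcomp n f * wcomp (r - n) g)"
  by (simp add: wcomp_def rho_mult lookup_times_finite)

lemma comp_mult_homog: "homog m f \<Longrightarrow> wcomp r (f * g) = f * wcomp (r - m) g"
proof -
  assume f: "homog m f"
  have "wcomp r (f * g) = (\<Sum>n\<in>UNIV. if n = m then f * wcomp (r - n) g else 0)"
    unfolding comp_mult using comp_homog[OF f] by (intro sum.cong) auto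
  then show ?thesis by simp
qed

lemma homog_mult: "homog m f \<Longrightarrow> homog n g \<Longrightarrow> homog (m + n) (f * g)"
  using comp_mult_homog[of m f "m + n" g] by (simp add: homog_def)

lemma homog_power: "homog m f \<Longrightarrow> homog (nmul n m) (f ^ n)"
  by (induction n) (auto simp: homog_1 homog_mult)

text \<open>The order of the character group annihilates every degree; this power plays the part of
  a norm for homogeneous elements.\<close>

lemma homog_power_card: "homog m f \<Longrightarrow> homog 0 (f ^ CARD('m))"
  using homog_power[of m f "CARD('m)"] by (simp add: nmul_card)

lemma homog_power_card': "homog m f \<Longrightarrow> homog (- m) (f ^ (CARD('m) - 1))"
  using homog_power[of m f "CARD('m) - 1"] by (simp only: nmul_card_pred)

lemma homog_inverse: "homog m f \<Longrightarrow> homog (- m) (inverse f)"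
proof (cases "f = 0")
  case False
  assume f: "homog m f"
  have "f * wcomp (- m) (inverse f) = wcomp 0 (f * inverse f)" using comp_mult_homog[OF f, of 0 "inverse f"] by simp
  also have "\<dots> = 1" using False homog_1 by (simp add: homog_def)
  finally have "wcomp (- m) (inverse f) = inverse f" using False by (simp add: field_simps)
  then show ?thesis by (simp add: homog_def)
qed (simp add: homog_0)

lemma homog_divide: "homog m f \<Longrightarrow> homog n g \<Longrightarrow> homog (m - n) (f / g)"
  using homog_mult[OF _ homog_inverse, of m f n g] by (simp add: divide_inverse)

lemma gradedD: "graded A \<Longrightarrow> f \<in> A \<Longrightarrow> wcomp m f \<in> A"
  by (simp add: graded_def)

lemma comp_nonzero: "f \<noteq> 0 \<Longrightarrow> \<exists>m. wcomp m f \<noteq> 0"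
  using comp_sum[of f] by (metis sum.neutral)

text \<open>The degrees that occur form a subgroup \<open>H\<close>, and the subgroup scheme with
  ideal \<open>coset_ideal H\<close> acts trivially. Faithfulness puts the augmentation ideal inside
  this ideal; for \<open>m\<close> outside \<open>H\<close> the difference of the characters
  \<open>m\<close> and 0 has sum -1 over \<open>H\<close>, a contradiction.\<close>

lemma degrees_of_faithful:
  assumes faithful: "faithful_action \<iota> \<rho>"
  shows "\<exists>f. f \<noteq> 0 \<and> homog m f"
proof (rule ccontr)
  assume no: "\<not> ?thesis"
  define H where "H = {m. \<exists>f. f \<noteq> 0 \<and> homog m f}"
  have H: "subgrp H" unfolding subgrp_def
  proof (intro conjI ballI)
    show "0 \<in> H" unfolding H_def using homog_1 zero_neq_one by (intro CollectI exI[of _ 1]) auto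
    fix a b assume "a \<in> H" "b \<in> H"
    then obtain f g where "f \<noteq> 0" "homog a f" "g \<noteq> 0" "homog b g" unfolding H_def by blast
    then show "a + b \<in> H" unfolding H_def by (intro CollectI exI[of _ "f * g"]) (auto intro: homog_mult)
  qed
  let ?J = "coset_ideal H :: ('m \<Rightarrow>\<^sub>0 'k) set"
  have "\<rho> f - sg 0 f \<in> ideal_gen UNIV (Poly_Mapping.map \<iota> ` ?J)" for f
  proof -
    have "\<rho> f - sg 0 f = (\<Sum>m\<in>UNIV. sg 0 (wcomp m f) * (sg m 1 - sg 0 1))"
    proof -
      have "\<rho> f = (\<Sum>m\<in>UNIV. sg m (wcomp m f))" using single_decomp[of "\<rho> f"] by (simp add: wcomp_def)
      moreover have "sg 0 f = (\<Sum>m\<in>UNIV. sg (0::'m) (wcomp m f))"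
      proof (rule poly_mapping_eqI)
        fix k
        have "lk (\<Sum>m\<in>UNIV. sg (0::'m) (wcomp m f)) k = ((\<Sum>m\<in>UNIV. wcomp m f) when 0 = k)"
          by (cases "k = 0") (auto simp: lookup_sum_pm lookup_single when_def)
        then show "lk (sg 0 f) k = lk (\<Sum>m\<in>UNIV. sg (0::'m) (wcomp m f)) k"
          by (simp add: comp_sum lookup_single)
      qed
      ultimately show ?thesis by (simp add: sum_subtractf right_diff_distrib mult_single)
    qed
    also have "\<dots> \<in> ideal_gen UNIV (Poly_Mapping.map \<iota> ` ?J)"
      unfolding ideal_gen_def
    proof (rule InterI)
      fix I assume "I \<in> {I. is_ideal UNIV I \<and> Poly_Mapping.map \<iota> ` ?J \<subseteq> I}"
      then have I: "is_ideal UNIV I" "Poly_Mapping.map \<iota> ` ?J \<subseteq> I" by auto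
      show "(\<Sum>m\<in>UNIV. sg 0 (wcomp m f) * (sg m 1 - sg 0 1)) \<in> I"
      proof (rule ideal_sum[OF I(1)])
        fix m
        show "sg 0 (wcomp m f) * (sg m 1 - sg 0 1) \<in> I"
        proof (cases "wcomp m f = 0")
          case True
          then show ?thesis using ideal_0[OF I(1)] by simp
        next
          case False
          then have "m \<in> H" unfolding H_def using homog_comp by blast
          have "sg m 1 - sg 0 1 = Poly_Mapping.map \<iota> (sg m 1 - sg 0 1)"
            by (rule poly_mapping_eqI)
              (auto simp: map.rep_eq lookup_minus lookup_single when_def is_field_homD[OF field_hom] simp del: single_one)
          also have "\<dots> \<in> I" using single_diff_coset[OF H \<open>m \<in> H\<close>] I(2) by blast
          finally show ?thesis by (intro ideal_mult[OF I(1)]) auto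
        qed
      qed
    qed
    finally show ?thesis .
  qed
  then have aug: "{h. (\<Sum>m\<in>UNIV. lk h m) = 0} \<subseteq> ?J"
    using faithful is_ideal_coset[of H] unfolding faithful_action_def by blast
  have mH: "m \<notin> H" using no by (auto simp: H_def)
  have "(\<Sum>k\<in>UNIV. lk (sg m (1::'k) - sg 0 1) k) = 0"
    using sum_when_shift[where 'a = 'k and H = UNIV and n = m and r = 0] sum_when_shift[where 'a = 'k and H = "UNIV::'m set" and n = 0 and r = 0] by (simp add: lookup_minus sum_subtractf del: single_one)
  then have "sg m (1::'k) - sg 0 1 \<in> ?J" using aug by blast
  then have "(\<Sum>k\<in>H. lk (sg m (1::'k) - sg 0 1) (k + 0)) = 0" unfolding coset_ideal_def by blast
  moreover have "(\<Sum>k\<in>H. lk (sg m (1::'k) - sg 0 1) (k + 0)) = 0 - 1"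
    using sum_when_shift[where 'a = 'k and H = H and n = m and r = 0] sum_when_shift[where 'a = 'k and H = H and n = 0 and r = 0] mH H
    by (simp add: lookup_minus sum_subtractf subgrp_def del: single_one)
  ultimately show False by simp
qed

end

section \<open>Curves glued from local rings\<close>

text \<open>
  Nonempty opens of a curve are the cofinite sets that contain the generic point, so a curve is
  determined by its local rings.
\<close>

definition cofinite_top :: "'x set \<Rightarrow> 'x \<Rightarrow> 'x topology" where
  "cofinite_top I g = topology (\<lambda>W. W \<subseteq> I \<and> (W = {} \<or> (g \<in> W \<and> finite (I - W))))"

lemma openin_cofinite:
  "openin (cofinite_top I g) W \<longleftrightarrow> W \<subseteq> I \<and> (W = {} \<or> (g \<in> W \<and> finite (I - W)))"
proof -
  have "istopology (\<lambda>W. W \<subseteq> I \<and> (W = {} \<or> (g \<in> W \<and> finite (I - W))))"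
    unfolding istopology_def
  proof (intro conjI allI impI)
    fix S T assume "S \<subseteq> I \<and> (S = {} \<or> g \<in> S \<and> finite (I - S))" "T \<subseteq> I \<and> (T = {} \<or> g \<in> T \<and> finite (I - T))"
    then show "S \<inter> T \<subseteq> I" "S \<inter> T = {} \<or> g \<in> S \<inter> T \<and> finite (I - S \<inter> T)" by (auto simp: Diff_Int)
  next
    fix \<K> assume K: "\<forall>W\<in>\<K>. W \<subseteq> I \<and> (W = {} \<or> g \<in> W \<and> finite (I - W))"
    then show "\<Union>\<K> \<subseteq> I" by auto
    show "\<Union>\<K> = {} \<or> g \<in> \<Union>\<K> \<and> finite (I - \<Union>\<K>)"
    proof (cases "\<Union>\<K> = {}")
      case False
      then obtain W where W: "W \<in> \<K>" "W \<noteq> {}" by auto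
      then have "g \<in> W" "finite (I - W)" using K by auto
      moreover have "I - \<Union>\<K> \<subseteq> I - W" using W by auto
      ultimately show ?thesis using W(1) finite_subset by blast
    qed simp
  qed
  then show ?thesis unfolding cofinite_top_def by (simp add: topology_inverse')
qed

definition glued :: "'x set \<Rightarrow> 'x \<Rightarrow> ('x \<Rightarrow> 'f set) \<Rightarrow> ('x, 'f) ischeme" where
  "glued I g L = \<lparr>topo = cofinite_top I g, sec = (\<lambda>W. \<Inter>z\<in>W. L z)\<rparr>"

text \<open>By \<open>incomp\<close> one local ring is contained in another only if they belong to
  the same point or the larger one is the field of the generic point. This makes points recoverable
  from the primes of the glued rings; \<open>fin\<close> makes every function regular on a nonempty
  open.\<close>

locale local_family =
  fixes I :: "'x set" and g :: 'x and L :: "'x \<Rightarrow> 'f::field set"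
  assumes gI: "g \<in> I" and Lg: "L g = UNIV"
    and local: "z \<in> I \<Longrightarrow> local_ring (L z)"
    and fin: "finite {z \<in> I. f \<notin> L z}"
    and incomp: "z \<in> I \<Longrightarrow> w \<in> I \<Longrightarrow> L z \<subseteq> L w \<Longrightarrow> w = g \<or> z = w"
begin

abbreviation "Z \<equiv> glued I g L"

lemma open_Z: "openin (topo Z) W \<longleftrightarrow> W \<subseteq> I \<and> (W = {} \<or> (g \<in> W \<and> finite (I - W)))"
  by (simp add: glued_def openin_cofinite)

lemma nonempty_Z: "nonempty_open Z W \<longleftrightarrow> W \<subseteq> I \<and> g \<in> W \<and> finite (I - W)"
  by (auto simp: nonempty_open_def open_Z)

lemma points_Z: "points Z = I"
proof
  show "points Z \<subseteq> I" using open_Z[of "points Z"] by simp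
  have "openin (topo Z) I" using gI by (simp add: open_Z)
  then show "I \<subseteq> points Z" by (rule openin_subset)
qed

lemma sec_Z: "sec Z W = (\<Inter>z\<in>W. L z)"
  by (simp add: glued_def)

lemma stalk_Z: "z \<in> I \<Longrightarrow> stalk Z z = L z"
proof
  assume z: "z \<in> I"
  show "stalk Z z \<subseteq> L z" by (auto simp: stalk_def sec_Z)
  show "L z \<subseteq> stalk Z z"
  proof
    fix f assume f: "f \<in> L z"
    define W where "W = {w \<in> I. f \<in> L w}"
    have "I - W = {w \<in> I. f \<notin> L w}" by (auto simp: W_def)
    then have "openin (topo Z) W" unfolding open_Z using fin[of f] gI Lg by (auto simp: W_def)
    moreover have "z \<in> W" "f \<in> sec Z W" using z f by (auto simp: W_def sec_Z)
    ultimately show "f \<in> stalk Z z" unfolding stalk_def by blast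
  qed
qed

lemma local_ringed_Z: "local_ringed Z"
proof
  fix x assume "x \<in> points Z"
  then show "local_ring (stalk Z x)" using points_Z stalk_Z local by simp
next
  fix W assume "nonempty_open Z W"
  then have "W \<subseteq> I" by (simp add: nonempty_Z)
  then show "sec Z W = (\<Inter>x\<in>W. stalk Z x)" using stalk_Z by (auto simp: sec_Z)
next
  fix f
  have "{x \<in> points Z. f \<in> stalk Z x} = {x \<in> I. f \<in> L x}" using points_Z stalk_Z by auto
  moreover have "I - {x \<in> I. f \<in> L x} = {x \<in> I. f \<notin> L x}" by auto
  ultimately show "openin (topo Z) {x \<in> points Z. f \<in> stalk Z x}" unfolding open_Z using fin[of f] gI Lg by auto
qed

lemma affine_Z:
  assumes W: "W \<subseteq> I" "g \<in> W" "finite (I - W)"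
    and pts: "\<And>n. is_prime_ideal (\<Inter>z\<in>W. L z) n \<Longrightarrow> \<exists>z\<in>W. (\<Inter>z\<in>W. L z) \<inter> lmax (L z) = n"
    and loc: "\<And>z. z \<in> W \<Longrightarrow> L z \<subseteq> localization_at (\<Inter>z\<in>W. L z) ((\<Inter>z\<in>W. L z) \<inter> lmax (L z))"
  shows "affine_open Z W"
proof -
  interpret local_ringed Z by (rule local_ringed_Z)
  define C where "C = (\<Inter>z\<in>W. L z)"
  have ne: "nonempty_open Z W" using W by (simp add: nonempty_Z)
  have secC: "sec Z W = C" by (simp add: sec_Z C_def)
  have C: "is_subring C" using sec_subring[OF ne] secC by simp
  have st: "stalk Z z = L z" if "z \<in> W" for z using that W stalk_Z by auto
  \<comment> \<open>When all functions vanishing at \<open>w\<close> vanish at \<open>z\<close>,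
    denominators allowed at \<open>z\<close> are also allowed at \<open>w\<close>, so the local
    rings are nested and \<open>incomp\<close> applies.\<close>
  have sub: "z = w" if zw: "z \<in> W" "w \<in> W" "C \<inter> lmax (L w) \<subseteq> lmax (L z)" "w \<noteq> g" for z w
  proof -
    have "L z \<subseteq> L w"
    proof
      fix f assume "f \<in> L z"
      then obtain a b where ab: "a \<in> C" "b \<in> C" "b \<notin> C \<inter> lmax (L z)" "f = a / b"
        using loc[OF zw(1)] unfolding localization_at_def C_def by blast
      then have "b \<notin> lmax (L w)" using zw(3) by blast
      moreover have "a \<in> L w" "b \<in> L w" using ab zw(2) by (auto simp: C_def)
      ultimately have "a \<in> L w" "inverse b \<in> L w" by (auto simp: lmax_def lunits_def)
      then show "f \<in> L w" using ab local[of w] zw(2) W subring_mult[of "L w"] unfolding divide_inverse local_ring_def by blast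
    qed
    then show ?thesis using incomp[of z w] zw W by auto
  qed
  show ?thesis
  proof (rule affine_openI[OF ne])
    fix n assume "is_prime_ideal (sec Z W) n"
    then have "is_prime_ideal (\<Inter>z\<in>W. L z) n" by (simp only: sec_Z)
    then obtain z where z: "z \<in> W" "(\<Inter>z\<in>W. L z) \<inter> lmax (L z) = n" using pts[of n] by blast
    show "\<exists>x\<in>W. sec Z W \<inter> lmax (stalk Z x) = n"
      by (rule bexI[OF _ z(1)]) (simp only: sec_Z st[OF z(1)] z(2))
  next
    fix x y assume xy: "x \<in> W" "y \<in> W" "sec Z W \<inter> lmax (stalk Z x) = sec Z W \<inter> lmax (stalk Z y)"
    then have eq: "C \<inter> lmax (L x) = C \<inter> lmax (L y)" using st secC by simp
    show "x = y"
    proof (cases "y = g")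
      case True
      then show ?thesis using sub[of y x] xy eq by blast
    next
      case False
      then show ?thesis using sub[of x y] xy eq by blast
    qed
  next
    fix x assume "x \<in> W"
    then show "stalk Z x \<subseteq> localization_at (sec Z W) (sec Z W \<inter> lmax (stalk Z x))"
      using loc[of x] by (simp only: st sec_Z)
  next
    fix Op x assume Op: "openin (topo Z) Op" "Op \<subseteq> W" and x: "x \<in> Op"
    have xW: "x \<in> W" using Op x by auto
    have gO: "g \<in> Op" "finite (I - Op)" using Op x by (auto simp: open_Z)
    have finO: "finite (W - Op)" using gO(2) W by (auto intro: finite_subset[of "W - Op" "I - Op"])
    \<comment> \<open>Only finitely many points have to be excluded. For each of them there is a
      function that vanishes there and not at \<open>x\<close>; the product \<open>k\<close> cuts
      out a neighbourhood inside \<open>Op\<close>.\<close>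
    have "\<exists>h. h \<in> C \<and> h \<in> lmax (L z) \<and> h \<notin> lmax (L x)" if "z \<in> W - Op" for z
      using sub[OF xW, of z] that x gO by blast
    then obtain h where h: "\<And>z. z \<in> W - Op \<Longrightarrow> h z \<in> C \<and> h z \<in> lmax (L z) \<and> h z \<notin> lmax (L x)" by metis
    define k where "k = (\<Prod>z\<in>W - Op. h z)"
    have kC: "k \<in> C" unfolding k_def using h by (intro subring_prod[OF C]) auto
    have CL: "C \<subseteq> L z" if "z \<in> W" for z using that by (auto simp: C_def)
    have prime: "is_prime_ideal (L z) (lmax (L z))" and Ls: "is_subring (L z)" if "z \<in> W" for z
      using that W local[of z] lmax_prime by (auto simp: local_ring_def)
    have "k \<in> L x - lmax (L x)" unfolding k_def
      using h CL[OF xW] by (intro prime_prod[OF Ls[OF xW] prime[OF xW]]) auto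
    moreover have kz: "k \<in> lmax (L z)" if z: "z \<in> W - Op" for z
    proof -
      have "k = h z * (\<Prod>w\<in>W - Op - {z}. h w)" unfolding k_def by (rule prod.remove[OF finO z])
      moreover have "(\<Prod>w\<in>W - Op - {z}. h w) \<in> L z"
        using h CL[of z] z by (intro subring_prod[OF Ls]) auto
      ultimately show ?thesis using h[OF z] z ideal_mult_right[OF prime_ideal[OF prime]] by auto
    qed
    moreover have "z \<in> Op" if "z \<in> W" "k \<notin> lmax (stalk Z z)" for z
      using kz[of z] st[of z] that by (cases "z \<in> Op") auto
    then have "{z \<in> W. k \<notin> lmax (stalk Z z)} \<subseteq> Op" by blast
    ultimately show "\<exists>g\<in>sec Z W. g \<notin> lmax (stalk Z x) \<and> {z \<in> W. g \<notin> lmax (stalk Z z)} \<subseteq> Op"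
      using kC st[OF xW] secC by (intro bexI[of _ k]) auto
  qed
qed

lemma integral_Z:
  assumes cover: "\<And>z. z \<in> I \<Longrightarrow> \<exists>W. affine_open Z W \<and> z \<in> W"
  shows "integral_scheme Z"
  unfolding integral_scheme_def
proof (intro conjI allI impI ballI)
  interpret local_ringed Z by (rule local_ringed_Z)
  show "points Z \<noteq> {}" using gI points_Z by auto
  show "U \<inter> V \<noteq> {}" if "nonempty_open Z U \<and> nonempty_open Z V" for U V using that by (auto simp: nonempty_Z)
  show "is_subring (sec Z U)" if "nonempty_open Z U" for U using sec_subring that by auto
  show "sec Z (\<Union>\<U>) = (\<Inter>U\<in>\<U>. sec Z U)" for \<U> by (auto simp: sec_Z)
  show "\<exists>U. affine_open Z U \<and> x \<in> U" if "x \<in> points Z" for x using cover that points_Z by auto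
qed

end

section \<open>Quotients of curves by diagonalizable group schemes\<close>

lemma finite_type_finite:
  assumes S: "finite S" and B: "B = subring_gen (R \<union> S)" and A: "is_subring A" "B \<subseteq> A" and fin: "finite_over B A"
  shows "\<exists>T. finite T \<and> A = subring_gen (R \<union> T)"
proof -
  obtain T where T: "finite T" "T \<subseteq> A" "\<forall>a\<in>A. \<exists>c. (\<forall>s\<in>T. c s \<in> B) \<and> a = (\<Sum>s\<in>T. c s * s)"
    using fin unfolding finite_over_def by blast
  let ?C = "subring_gen (R \<union> (S \<union> T))"
  have BC: "B \<subseteq> ?C" unfolding B by (rule subring_gen_mono) auto
  have TC: "T \<subseteq> ?C" using subring_gen_superset[of "R \<union> (S \<union> T)"] by auto
  have "A = ?C"
  proof
    show "?C \<subseteq> A"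
      using subring_gen_superset[of "R \<union> S"] A(2) T(2) unfolding B by (intro subring_gen_least[OF A(1)]) auto
    show "A \<subseteq> ?C"
    proof
      fix a assume "a \<in> A"
      then obtain c where "\<forall>s\<in>T. c s \<in> B" "a = (\<Sum>s\<in>T. c s * s)" using T(3) by blast
      then show "a \<in> ?C" using BC TC by (auto intro!: subring_sum[OF is_subring_gen] subring_mult[OF is_subring_gen])
    qed
  qed
  then show ?thesis using S T(1) by blast
qed

locale quotient_curve =
  fixes \<iota> :: "'k::alg_closed_field \<Rightarrow> 'f::field" and \<rho> :: "'f \<Rightarrow> ('m::{ab_group_add,finite} \<Rightarrow>\<^sub>0 'f)"
    and X :: "('x, 'f) ischeme" and Y :: "('y, 'f) ischeme" and \<pi> :: "'x \<Rightarrow> 'y"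
  assumes curveX: "curve \<iota> X" and G_var: "G_variety \<iota> X \<rho>" and G_norm: "G_normal \<iota> X \<rho>"
    and faithful: "faithful_action \<iota> \<rho>" and quotient: "is_quotient \<iota> X \<rho> Y \<pi>"
begin

sublocale int_curve \<iota> X
  using curveX G_var by unfold_locales (auto simp: G_variety_def)

sublocale Y: int_variety \<iota> Y
  using quotient by unfold_locales (simp add: is_quotient_def)

sublocale graded_field \<iota> \<rho>
  using G_var hom by unfold_locales (auto simp: G_variety_def)

abbreviation "pre V \<equiv> preim X \<pi> V"
abbreviation "orb \<equiv> orbit \<iota> X \<rho>"
abbreviation "orb_div \<equiv> orbit_divisor \<iota> X \<rho>"
abbreviation "stab \<equiv> stab_order \<iota> X \<rho>"
abbreviation "sec_div \<equiv> section_divisor X Y \<pi> (wcomp 0)"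

lemma finite_pi: "finite_morphism X Y \<pi>"
  using quotient by (simp add: is_quotient_def)

lemma dominant_pi: "dominant_morphism X Y \<pi>"
  using finite_pi by (simp add: finite_morphism_def)

lemma continuous_pi: "continuous_map (topo X) (topo Y) \<pi>"
  using dominant_pi by (simp add: dominant_morphism_def)

lemma pi_points: "x \<in> points X \<Longrightarrow> \<pi> x \<in> points Y"
  using continuous_pi by (auto simp: continuous_map_def)

lemma pre_open: "nonempty_open Y V \<Longrightarrow> nonempty_open X (pre V)"
proof -
  assume V: "nonempty_open Y V"
  then have "openin (topo X) (pre V)"
    using continuous_pi unfolding preim_def continuous_map_def nonempty_open_def by blast
  moreover have "pre V \<noteq> {}" using dominant_pi V unfolding dominant_morphism_def by blast
  ultimately show ?thesis by (simp add: nonempty_open_def)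
qed

lemma in_pre: "x \<in> pre V \<longleftrightarrow> x \<in> points X \<and> \<pi> x \<in> V"
  by (simp add: preim_def)

lemma pre_stable: "affine_open Y V \<Longrightarrow> stable_affine X \<rho> (pre V)"
  using quotient unfolding is_quotient_def by simp

lemma pre_affine: "affine_open Y V \<Longrightarrow> affine_open X (pre V)"
  using pre_stable by (simp add: stable_affine_def)

lemma stable_graded: "stable_affine X \<rho> U \<Longrightarrow> graded (sec X U)"
  by (simp add: stable_affine_def graded_def wcomp_def)

lemma pre_graded: "affine_open Y V \<Longrightarrow> graded (sec X (pre V))"
  using pre_stable stable_graded by auto

lemma sec_Y: "nonempty_open Y V \<Longrightarrow> f \<in> sec Y V \<longleftrightarrow> f \<in> sec X (pre V) \<and> homog 0 f"
  using quotient unfolding is_quotient_def homog_rho by auto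

lemma sec_YX: "nonempty_open Y V \<Longrightarrow> sec Y V \<subseteq> sec X (pre V)"
  using sec_Y by auto

lemma pre_finite: "affine_open Y V \<Longrightarrow> finite_over (sec Y V) (sec X (pre V))"
  using finite_pi by (simp add: finite_morphism_def)

lemma stalk_YX: "x \<in> points X \<Longrightarrow> Y.st (\<pi> x) \<subseteq> st x"
proof
  fix f assume x: "x \<in> points X" and "f \<in> Y.st (\<pi> x)"
  then obtain V where V: "openin (topo Y) V" "\<pi> x \<in> V" "f \<in> sec Y V" unfolding stalk_def by blast
  then have ne: "nonempty_open Y V" by (auto simp: nonempty_open_def)
  then have "f \<in> sec X (pre V)" using sec_Y V by auto
  moreover have "openin (topo X) (pre V)" using pre_open[OF ne] by (simp add: nonempty_open_def)
  ultimately show "f \<in> st x" using sec_stalk[of "pre V" x] x V by (auto simp: in_pre)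
qed

lemma stalk_Y_homog: "y \<in> points Y \<Longrightarrow> f \<in> Y.st y \<Longrightarrow> homog 0 f"
proof -
  assume "f \<in> Y.st y"
  then obtain V where "openin (topo Y) V" "y \<in> V" "f \<in> sec Y V" unfolding stalk_def by blast
  then show ?thesis using sec_Y[of V f] by (auto simp: nonempty_open_def)
qed

lemma mx_YX:
  assumes x: "x \<in> points X"
  shows "mx x \<inter> Y.st (\<pi> x) = Y.mx (\<pi> x)"
proof
  show "Y.mx (\<pi> x) \<subseteq> mx x \<inter> Y.st (\<pi> x)"
    using dominant_pi x lmax_subset unfolding dominant_morphism_def max_ideal_at_eq by blast
  show "mx x \<inter> Y.st (\<pi> x) \<subseteq> Y.mx (\<pi> x)"
    using lunits_mono[OF stalk_YX[OF x]] by (auto simp: lmax_def)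
qed

lemma mx_secY:
  assumes V: "affine_open Y V" and x: "x \<in> pre V"
  shows "sec Y V \<inter> Y.mx (\<pi> x) = sec Y V \<inter> mx x"
proof -
  have "sec Y V \<subseteq> Y.st (\<pi> x)" using Y.affine_sec_stalk[OF V] x by (auto simp: in_pre)
  then show ?thesis using mx_YX[of x] x by (auto simp: in_pre)
qed

text \<open>In a monic equation of minimal degree over the invariants the constant term is nonzero,
  as otherwise a factor \<open>f\<close> could be cancelled; up to sign it is the required multiple
  of \<open>f\<close>. No conjugates of \<open>f\<close> enter.\<close>

lemma norm_exists:
  assumes V: "affine_open Y V" and f: "f \<in> sec X (pre V)" "f \<noteq> 0"
  shows "\<exists>g\<in>sec X (pre V). f * g \<in> sec Y V \<and> f * g \<noteq> 0"
proof -
  let ?A = "sec X (pre V)" and ?B = "sec Y V"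
  note A = affine_subring[OF pre_affine[OF V]] and B = Y.affine_subring[OF V]
  have BA: "?B \<subseteq> ?A" using sec_YX[OF Y.affine_nonempty[OF V]] .
  have ex: "\<exists>q. q \<in> polys ?B \<and> lead_coeff q = 1 \<and> poly q f = 0"
    using finite_over_integral[OF A B BA pre_finite[OF V] f(1)] by blast
  obtain q where q: "q \<in> polys ?B" "lead_coeff q = 1" "poly q f = 0"
    and min: "\<And>q'. q' \<in> polys ?B \<Longrightarrow> lead_coeff q' = 1 \<Longrightarrow> poly q' f = 0 \<Longrightarrow> degree q \<le> degree q'"
    using ex ex_has_least_nat[of "\<lambda>q. q \<in> polys ?B \<and> lead_coeff q = 1 \<and> poly q f = 0" _ degree] by blast
  obtain q0 q' where qq: "q = pCons q0 q'" by (cases q)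
  have q0: "q0 \<in> ?B" and q': "q' \<in> polys ?B" using polys_pConsD[OF q(1)[unfolded qq]] by auto
  have rel: "f * poly q' f = - q0" using q(3) by (simp add: qq add_eq_0_iff)
  have "q0 \<noteq> 0"
  proof
    assume z: "q0 = 0"
    show False
    proof (cases "q' = 0")
      case True
      then show False using q(2) z by (simp add: qq)
    next
      case False
      then have "degree q \<le> degree q'" using min[OF q'] q(2) rel z f(2) by (simp add: qq)
      then show False using False by (simp add: qq)
    qed
  qed
  moreover have "poly q' f \<in> ?A" using poly_in_subring[OF A BA f(1) q'] .
  ultimately show ?thesis using rel q0 subring_uminus[OF B q0] by (intro bexI[of _ "poly q' f"]) auto
qed

lemma closed_invariant:
  assumes V: "affine_open Y V" and x: "x \<in> pre V" "x \<in> closed_pts"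
  shows "\<exists>g\<in>sec Y V. g \<in> mx x \<and> g \<noteq> 0"
proof -
  have xg: "x \<noteq> gen" and xX: "x \<in> points X" using x by (auto simp: closed_pts_def)
  obtain f where f: "f \<in> sec X (pre V)" "f \<in> mx x" "f \<noteq> 0" using prime_nonzero[OF pre_affine[OF V] x(1) xg] by blast
  obtain g where g: "g \<in> sec X (pre V)" "f * g \<in> sec Y V" "f * g \<noteq> 0" using norm_exists[OF V f(1,3)] by blast
  have "g \<in> st x" using g(1) affine_sec_stalk[OF pre_affine[OF V] x(1)] by auto
  then show ?thesis using g f ideal_mult_right[OF mx_ideal[OF xX]] by blast
qed

text \<open>One inclusion suffices because the residue field at \<open>x\<close> is
  \<open>k\<close>: an invariant vanishing at \<open>x'\<close> differs by a constant from one
  vanishing at \<open>x\<close>, hence at \<open>x'\<close> too, and this constant must be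
  zero.\<close>

lemma fibre_eqI:
  assumes V: "affine_open Y V" and x: "x \<in> pre V" "x \<in> closed_pts" and x': "x' \<in> pre V"
    and sub: "sec Y V \<inter> mx x \<subseteq> mx x'"
  shows "\<pi> x = \<pi> x'"
proof -
  have pX: "x \<in> points X" "x' \<in> points X" using x x' by (auto simp: in_pre)
  have "f \<in> mx x" if f: "f \<in> sec Y V" "f \<in> mx x'" for f
  proof -
    have "f \<in> sec X (pre V)" using f sec_YX[OF Y.affine_nonempty[OF V]] by auto
    then have "f \<in> st x" using affine_sec_stalk[OF pre_affine[OF V] x(1)] by auto
    then obtain c where c: "f - \<iota> c \<in> mx x" using residue[OF x(2)] by blast
    have "f - \<iota> c \<in> sec Y V"
      using f Y.const_sec[OF Y.affine_nonempty[OF V]] subring_diff[OF Y.affine_subring[OF V]] by auto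
    then have "f - \<iota> c \<in> mx x'" using c sub by auto
    then have "f - (f - \<iota> c) \<in> mx x'"
      by (rule ideal_diff[OF stalk_subring[OF pX(2)] mx_ideal[OF pX(2)] f(2)])
    then have "c = 0" using const_max[OF pX(2)] by simp
    then show ?thesis using c is_field_homD(4)[OF hom] by simp
  qed
  then have "sec Y V \<inter> mx x = sec Y V \<inter> mx x'" using sub by blast
  then have "sec Y V \<inter> Y.mx (\<pi> x) = sec Y V \<inter> Y.mx (\<pi> x')" using mx_secY[OF V] x x' by simp
  then show ?thesis using Y.affine_inj[OF V] x x' by (simp add: in_pre)
qed

lemma fibre_mx:
  assumes "x \<in> points X" "x' \<in> points X" "\<pi> x = \<pi> x'" "f \<in> Y.st (\<pi> x)"
  shows "f \<in> mx x \<longleftrightarrow> f \<in> mx x'"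
  using mx_YX[OF assms(1)] mx_YX[OF assms(2)] assms by auto

lemma fibre_closed:
  assumes x: "x \<in> closed_pts" and x': "x' \<in> points X" and eq: "\<pi> x = \<pi> x'"
  shows "x' \<in> closed_pts"
proof (rule ccontr)
  assume "x' \<notin> closed_pts"
  then have "x' = gen" using x' by (simp add: closed_pts_def)
  have xX: "x \<in> points X" using closed_ptsD[OF x] .
  obtain V where V: "affine_open Y V" "\<pi> x \<in> V" using Y.affine_cover[OF pi_points[OF xX]] by blast
  obtain g where g: "g \<in> sec Y V" "g \<in> mx x" "g \<noteq> 0" using closed_invariant[OF V(1)] x xX V by (auto simp: in_pre)
  have "g \<in> Y.st (\<pi> x)" using Y.affine_sec_stalk[OF V] g by auto
  then have "g \<in> mx gen" using fibre_mx[OF xX x' eq] g \<open>x' = gen\<close> by simp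
  then show False using g mx_gen by simp
qed

end

lemma poly_altdef_le:
  fixes p :: "'a::comm_ring_1 poly"
  assumes "degree p \<le> n"
  shows "poly p x = (\<Sum>i\<le>n. coeff p i * x ^ i)"
  unfolding poly_altdef by (rule sum.mono_neutral_left) (use assms in \<open>auto simp: coeff_eq_0\<close>)

lemma infinite_bij_Un: "finite E \<Longrightarrow> infinite S \<Longrightarrow> \<exists>h. bij_betw h S (S \<union> E)"
proof (induction E rule: finite_induct)
  case empty
  then show ?case using bij_betw_id by auto
next
  case (insert e E)
  obtain h where h: "bij_betw h S (S \<union> E)" using insert by blast
  obtain h' where "bij_betw h' (S \<union> E) ((S \<union> E) \<union> {e})"
    using infinite_imp_bij_betw2[of "S \<union> E" e] insert.prems by auto
  then have "bij_betw (h' \<circ> h) S ((S \<union> E) \<union> {e})" by (rule bij_betw_trans[OF h])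
  then show ?case by (metis Un_insert_right sup_bot_right)
qed

lemma ideal_of_multipliers:
  assumes "is_subring A" "0 \<in> M" "\<And>u v. u \<in> M \<Longrightarrow> v \<in> M \<Longrightarrow> u + v \<in> M" "\<And>a u. a \<in> A \<Longrightarrow> u \<in> M \<Longrightarrow> a * u \<in> M"
  shows "is_ideal A {a \<in> A. a * f \<in> M}"
  using assms by (intro is_idealI) (auto simp: distrib_right mult.assoc intro: subring_0 subring_add subring_mult)

lemma ideal_of_denominators: "is_subring A \<Longrightarrow> is_ideal A {a \<in> A. a * f \<in> A}"
  by (rule ideal_of_multipliers) (auto intro: subring_0 subring_add subring_mult)

text \<open>The span of \<open>T\<close> is replaced by an arbitrary set \<open>M\<close> closed
  under the module operations. Local arguments with the ideal of all \<open>c\<close> such that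
  \<open>c * f \<in> M\<close> then show finiteness without choosing coefficients.\<close>

lemma finite_over_combI:
  assumes "is_subring C" "finite T" "T \<subseteq> D"
    and gen: "\<And>f M. f \<in> D \<Longrightarrow> 0 \<in> M \<Longrightarrow> (\<And>u v. u \<in> M \<Longrightarrow> v \<in> M \<Longrightarrow> u + v \<in> M) \<Longrightarrow>
      (\<And>a u. a \<in> C \<Longrightarrow> u \<in> M \<Longrightarrow> a * u \<in> M) \<Longrightarrow> T \<subseteq> M \<Longrightarrow> f \<in> M"
  shows "finite_over C D"
  unfolding finite_over_def
proof (intro exI[of _ T] conjI ballI assms(2,3))
  fix f assume f: "f \<in> D"
  have "f \<in> {u. \<exists>c. (\<forall>s\<in>T. c s \<in> C) \<and> u = (\<Sum>s\<in>T. c s * s)}"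
  proof (rule gen[OF f])
    show "0 \<in> {u. \<exists>c. (\<forall>s\<in>T. c s \<in> C) \<and> u = (\<Sum>s\<in>T. c s * s)}"
      using subring_0[OF assms(1)] by (intro CollectI exI[of _ "\<lambda>_. 0"]) auto
  next
    fix u v assume "u \<in> {u. \<exists>c. (\<forall>s\<in>T. c s \<in> C) \<and> u = (\<Sum>s\<in>T. c s * s)}" "v \<in> {u. \<exists>c. (\<forall>s\<in>T. c s \<in> C) \<and> u = (\<Sum>s\<in>T. c s * s)}"
    then obtain c d where "\<forall>s\<in>T. c s \<in> C" "u = (\<Sum>s\<in>T. c s * s)" "\<forall>s\<in>T. d s \<in> C" "v = (\<Sum>s\<in>T. d s * s)" by blast
    then show "u + v \<in> {u. \<exists>c. (\<forall>s\<in>T. c s \<in> C) \<and> u = (\<Sum>s\<in>T. c s * s)}"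
      using subring_add[OF assms(1)]
      by (intro CollectI exI[of _ "\<lambda>s. c s + d s"]) (auto simp: distrib_right sum.distrib)
  next
    fix a u assume a: "a \<in> C" and "u \<in> {u. \<exists>c. (\<forall>s\<in>T. c s \<in> C) \<and> u = (\<Sum>s\<in>T. c s * s)}"
    then obtain c where "\<forall>s\<in>T. c s \<in> C" "u = (\<Sum>s\<in>T. c s * s)" by blast
    then show "a * u \<in> {u. \<exists>c. (\<forall>s\<in>T. c s \<in> C) \<and> u = (\<Sum>s\<in>T. c s * s)}"
      using subring_mult[OF assms(1) a]
      by (intro CollectI exI[of _ "\<lambda>s. a * c s"]) (auto simp: sum_distrib_left mult.assoc)
  next
    show "T \<subseteq> {u. \<exists>c. (\<forall>s\<in>T. c s \<in> C) \<and> u = (\<Sum>s\<in>T. c s * s)}"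
    proof
      fix t assume t: "t \<in> T"
      have "(\<Sum>s\<in>T. (if s = t then 1 else 0) * s) = (\<Sum>s\<in>T. if s = t then t else 0)" by (intro sum.cong) auto
      also have "\<dots> = t" using t assms(2) by simp
      finally show "t \<in> {u. \<exists>c. (\<forall>s\<in>T. c s \<in> C) \<and> u = (\<Sum>s\<in>T. c s * s)}"
        using subring_0[OF assms(1)] subring_1[OF assms(1)]
        by (intro CollectI exI[of _ "\<lambda>s. if s = t then 1 else 0"]) auto
    qed
  qed
  then show "\<exists>c. (\<forall>s\<in>T. c s \<in> C) \<and> f = (\<Sum>s\<in>T. c s * s)" by blast
qed

section \<open>Stalks of a curve and their prime ideals\<close>

context int_curve
begin

text \<open>A stalk dominates itself, and separatedness allows it to dominate one point
  only.\<close>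

lemma stalk_inj: "x \<in> points X \<Longrightarrow> y \<in> points X \<Longrightarrow> st x = st y \<Longrightarrow> x = y"
proof -
  assume x: "x \<in> points X" and y: "y \<in> points X" and eq: "st x = st y"
  show ?thesis
    by (rule domination_uniqueD[OF dominated stalk_subring[OF x] mx_prime[OF x] x y])
      (use eq lmax_subset[of "st y"] in \<open>simp_all add: Int_absorb2\<close>)
qed

lemma stalk_dim:
  assumes x: "x \<in> points X" and P: "is_prime_ideal (st x) P" "P \<noteq> {0}"
  shows "P = mx x"
proof -
  obtain U where U: "affine_open X U" "x \<in> U" using affine_cover[OF x] by blast
  let ?A = "sec X U"
  note A = affine_subring[OF U(1)] and AL = affine_sec_stalk[OF U] and PI = prime_ideal[OF P(1)]
  have Pm: "P \<subseteq> mx x"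
  proof
    fix f assume f: "f \<in> P"
    have "f \<notin> lunits (st x)"
    proof
      assume u: "f \<in> lunits (st x)"
      then have inv: "inverse f \<in> st x" and nz: "f \<noteq> 0" by (auto simp: lunits_def)
      have "inverse f * f \<in> P" by (rule ideal_mult[OF PI inv f])
      then have "1 \<in> P" using nz by simp
      then show False using prime_one[OF P(1)] by simp
    qed
    then show "f \<in> mx x" using f ideal_subset[OF PI] by (auto simp: lmax_def)
  qed
  obtain f where f: "f \<in> P" "f \<noteq> 0" using P(2) ideal_0[OF PI] by blast
  have "f \<in> st x" using f ideal_subset[OF PI] by auto
  then obtain a b where ab: "a \<in> ?A" "b \<in> ?A" "b \<notin> mx x" "b \<noteq> 0" "f = a / b" "b * f = a" by (rule affine_stalkE[OF U])
  have "a \<in> P" using ab AL ideal_mult[OF PI _ f(1), of b] by auto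
  moreover have "a \<noteq> 0" using ab f by auto
  ultimately have "P \<inter> ?A \<noteq> {0}" using ab by auto
  then have eq: "P \<inter> ?A = ?A \<inter> mx x"
    using dim_affine[OF U(1)] prime_inter[OF A AL P(1)] affine_prime[OF U] Pm unfolding dim_le_1_def by blast
  have "mx x \<subseteq> P"
  proof
    fix h assume h: "h \<in> mx x"
    then have "h \<in> st x" using lmax_subset by auto
    then obtain a b where ab: "a \<in> ?A" "b \<in> ?A" "b \<notin> mx x" "b \<noteq> 0" "h = a / b" "b * h = a" by (rule affine_stalkE[OF U])
    have "a \<in> mx x" using affine_max_iff[OF U ab(1-3)] ab(5) h by simp
    then have "a \<in> P" using eq ab by blast
    moreover have "inverse b \<in> st x" using ab AL by (auto simp: lmax_def lunits_def)
    ultimately have "inverse b * a \<in> P" using ideal_mult[OF PI] by blast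
    then show "h \<in> P" using ab by (simp add: divide_inverse mult.commute)
  qed
  then show ?thesis using Pm by auto
qed

lemma common_denominator:
  assumes U: "affine_open X U" "x \<in> U" and E: "finite E" "E \<subseteq> st x"
  shows "\<exists>b\<in>sec X U - mx x. \<forall>e\<in>E. b * e \<in> sec X U"
  using E
proof (induction E rule: finite_induct)
  case empty
  have "x \<in> points X" using U affine_points by auto
  then show ?case using subring_1[OF affine_subring[OF U(1)]] prime_one[OF mx_prime] by blast
next
  case (insert e E)
  have xX: "x \<in> points X" using U affine_points by auto
  obtain b where b: "b \<in> sec X U - mx x" "\<forall>e\<in>E. b * e \<in> sec X U" using insert by auto
  have "e \<in> st x" using insert by auto
  then obtain c d where cd: "c \<in> sec X U" "d \<in> sec X U" "d \<notin> mx x" "d \<noteq> 0" "e = c / d" "d * e = c" by (rule affine_stalkE[OF U])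
  note A = affine_subring[OF U(1)]
  have "d * b \<in> sec X U - mx x"
    using b(1) cd prime_mult[OF mx_prime[OF xX], of d b] affine_sec_stalk[OF U] subring_mult[OF A] by blast
  moreover have "d * b * e' \<in> sec X U" if "e' \<in> insert e E" for e'
  proof (cases "e' = e")
    case True
    have "d * b * e' = b * (d * e')" by (simp add: mult_ac)
    also have "d * e' = c" using cd True by simp
    finally have eq: "d * b * e' = b * c" .
    show ?thesis unfolding eq using b cd(1) subring_mult[OF A] by simp
  next
    case False
    then have "b * e' \<in> sec X U" using that b by auto
    then show ?thesis using cd(2) subring_mult[OF A] by (simp add: mult.assoc)
  qed
  ultimately show ?case by blast
qed

end

section \<open>Finite equivariant modifications along one fibre\<close>

text \<open>By \<open>cond\<close> the invariants vanishing at \<open>x0\<close> carry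
  \<open>A1\<close> into the ring of \<open>X\<close>, so the two rings have the same localizations
  away from the fibre and the modification takes place over a single point of
  \<open>Y\<close>.\<close>

locale modification = quotient_curve \<iota> \<rho> X Y \<pi>
  for \<iota> :: "'k::alg_closed_field \<Rightarrow> 'f::field" and \<rho> :: "'f \<Rightarrow> ('m::{ab_group_add,finite} \<Rightarrow>\<^sub>0 'f)"
    and X :: "('x, 'f) ischeme" and Y :: "('y, 'f) ischeme" and \<pi> :: "'x \<Rightarrow> 'y" +
  fixes V :: "'y set" and x0 :: 'x and A1 :: "'f set"
  assumes ftV: "Y.ft_open V" and x0: "x0 \<in> closed_pts" "\<pi> x0 \<in> V"
    and A1: "is_subring A1" and AA1: "sec X (pre V) \<subseteq> A1" and grA1: "graded A1"
    and finA1: "finite_over (sec X (pre V)) A1"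
    and cond: "\<And>g a. g \<in> sec Y V \<Longrightarrow> g \<in> mx x0 \<Longrightarrow> a \<in> A1 \<Longrightarrow> g * a \<in> sec X (pre V)"
begin

abbreviation "A \<equiv> sec X (pre V)"
abbreviation "B \<equiv> sec Y V"
abbreviation "q \<equiv> B \<inter> mx x0"

lemma affV: "affine_open Y V"
  using ftV Y.ft_affine by auto

lemmas affPV = pre_affine[OF affV]

lemma A: "is_subring A" and B: "is_subring B" and BA: "B \<subseteq> A"
  using affine_subring[OF affPV] Y.affine_subring[OF affV] sec_YX[OF Y.affine_nonempty[OF affV]] by auto

definition F :: "'x set" where
  "F = {x \<in> points X. \<pi> x = \<pi> x0}"

lemma F_closed: "x \<in> F \<Longrightarrow> x \<in> closed_pts"
  using fibre_closed[OF x0(1)] by (simp add: F_def)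

lemma F_pre: "x \<in> F \<Longrightarrow> x \<in> pre V"
  using x0 by (simp add: F_def in_pre)

lemma F_points: "x \<in> F \<Longrightarrow> x \<in> points X"
  by (simp add: F_def)

lemma x0_pre: "x0 \<in> pre V"
  using x0 closed_ptsD by (auto simp: F_def in_pre)

lemma F_mx: "x \<in> F \<Longrightarrow> f \<in> B \<Longrightarrow> f \<in> mx x \<longleftrightarrow> f \<in> mx x0"
  using fibre_mx[of x x0 f] Y.affine_sec_stalk[OF affV x0(2)] closed_ptsD[OF x0(1)] by (auto simp: F_def)

lemma q_F: "x \<in> pre V \<Longrightarrow> q \<subseteq> mx x \<longleftrightarrow> x \<in> F"
proof
  assume x: "x \<in> pre V" and "q \<subseteq> mx x"
  then have "\<pi> x0 = \<pi> x" using fibre_eqI[OF affV x0_pre x0(1) x] by blast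
  then show "x \<in> F" using x by (simp add: F_def in_pre)
qed (use F_mx in auto)

lemma g0: "\<exists>g\<in>B. g \<in> mx x0 \<and> g \<noteq> 0"
  using closed_invariant[OF affV x0_pre x0(1)] .

lemma finite_F: "finite F"
proof -
  obtain g where g: "g \<in> B" "g \<in> mx x0" "g \<noteq> 0" using g0 by blast
  have "F \<subseteq> {x \<in> points X. g \<notin> lunits (st x)}" using F_mx[OF _ g(1)] g(2) F_points by (auto simp: lmax_def)
  then show ?thesis using finite_nonunits[OF g(3)] finite_subset by blast
qed

lemma A1_outside: "x \<in> pre V \<Longrightarrow> x \<notin> F \<Longrightarrow> A1 \<subseteq> st x"
proof
  fix a assume x: "x \<in> pre V" "x \<notin> F" and a: "a \<in> A1"
  have xX: "x \<in> points X" using x by (simp add: in_pre)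
  obtain g where g: "g \<in> B" "g \<in> mx x0" "g \<notin> mx x" using q_F[OF x(1)] x(2) by blast
  have Ast: "A \<subseteq> st x" using affine_sec_stalk[OF affPV x(1)] .
  have "g * a \<in> st x" using cond[OF g(1,2) a] Ast by auto
  moreover have "inverse g \<in> st x" "g \<noteq> 0" using g BA Ast by (auto simp: lmax_def lunits_def)
  ultimately have "inverse g * (g * a) \<in> st x" using subring_mult[OF stalk_subring[OF xX]] by blast
  then show "a \<in> st x" using \<open>g \<noteq> 0\<close> by (simp add: mult.assoc[symmetric])
qed

text \<open>A nonzero element of \<open>Q\<close> is moved into \<open>A\<close> by a nonzero
  invariant that vanishes on the fibre, so the contraction of \<open>Q\<close> is nonzero and its
  point is closed.\<close>

lemma prime_meet:
  assumes Q: "is_prime_ideal A1 Q" "Q \<noteq> {0}"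
  shows "\<exists>x\<in>pre V. x \<in> closed_pts \<and> A \<inter> mx x = Q \<inter> A"
proof -
  obtain x where x: "x \<in> pre V" "A \<inter> mx x = Q \<inter> A" using affine_point[OF affPV prime_inter[OF A AA1 Q(1)]] by blast
  obtain f where f: "f \<in> Q" "f \<noteq> 0" using Q(2) ideal_0[OF prime_ideal[OF Q(1)]] by blast
  obtain g where g: "g \<in> B" "g \<in> mx x0" "g \<noteq> 0" using g0 by blast
  have "f \<in> A1" "g \<in> A1" using f g ideal_subset[OF prime_ideal[OF Q(1)]] BA AA1 by auto
  then have "g * f \<in> Q \<inter> A" using cond[OF g(1,2)] ideal_mult[OF prime_ideal[OF Q(1)] _ f(1)] by auto
  then have "g * f \<in> mx x" using x by blast
  moreover have "g * f \<noteq> 0" using f(2) g(3) by simp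
  ultimately have "x \<noteq> gen" using mx_gen by (metis singletonD)
  moreover have "x \<in> points X" using x(1) by (simp add: in_pre)
  ultimately have "x \<in> closed_pts" by (simp add: closed_pts_def)
  then show ?thesis using x by blast
qed

lemma const_A1: "\<iota> c \<in> A1"
  using const_sec[OF affine_nonempty[OF affPV]] AA1 by auto

text \<open>The residue rings of \<open>A1\<close> at nonzero primes are integral over those of \<open>A\<close>, hence equal to \<open>k\<close>.\<close>

lemma A1_residue:
  assumes Q: "is_prime_ideal A1 Q" "Q \<noteq> {0}" and a: "a \<in> A1"
  shows "\<exists>c. a - \<iota> c \<in> Q"
proof -
  note QI = prime_ideal[OF Q(1)]
  obtain x where x: "x \<in> pre V" "x \<in> closed_pts" "A \<inter> mx x = Q \<inter> A" using prime_meet[OF Q] by blast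
  have "\<forall>f. \<exists>c. f \<in> A \<longrightarrow> f - \<iota> c \<in> Q"
  proof (intro allI)
    fix f
    show "\<exists>c. f \<in> A \<longrightarrow> f - \<iota> c \<in> Q"
    proof (cases "f \<in> A")
      case True
      then have "f \<in> st x" using affine_sec_stalk[OF affPV x(1)] by auto
      then obtain c where "f - \<iota> c \<in> mx x" using residue[OF x(2)] by blast
      moreover have "f - \<iota> c \<in> A" using True const_sec[OF affine_nonempty[OF affPV]] subring_diff[OF A] by blast
      ultimately show ?thesis using x(3) by blast
    qed simp
  qed
  then obtain \<gamma> where \<gamma>: "\<And>f. f \<in> A \<Longrightarrow> f - \<iota> (\<gamma> f) \<in> Q" by metis
  \<comment> \<open>\<open>map_poly\<close> respects coefficients only if zero goes to zero, which
    the choice of residues in \<open>\<gamma>\<close> does not guarantee.\<close>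
  define \<gamma>' where "\<gamma>' f = (if f = 0 then 0 else \<gamma> f)" for f
  have \<gamma>': "f - \<iota> (\<gamma>' f) \<in> Q" if "f \<in> A" for f
    using \<gamma>[OF that] ideal_0[OF QI] is_field_homD(4)[OF hom] by (simp add: \<gamma>'_def)
  obtain p where p: "p \<in> polys A" "lead_coeff p = 1" "poly p a = 0"
    using finite_over_integral[OF A1 A AA1 finA1 a] by blast
  define \<delta> where "\<delta> = map_poly \<gamma>' p"
  have cf: "coeff \<delta> i = \<gamma>' (coeff p i)" for i unfolding \<delta>_def by (rule coeff_map_poly) (simp add: \<gamma>'_def)
  have cfA: "coeff p i \<in> A" for i using p(1) by (simp add: polys_def)
  have "\<delta> \<noteq> 0"
  proof
    assume "\<delta> = 0"
    then have "\<gamma>' 1 = 0" using cf[of "degree p"] p(2) by simp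
    then have "1 \<in> Q" using \<gamma>'[OF subring_1[OF A]] is_field_homD(4)[OF hom] by simp
    then show False using prime_one[OF Q(1)] by simp
  qed
  moreover have "ev \<iota> a \<delta> \<in> Q"
  proof -
    have "degree (map_poly \<iota> \<delta>) \<le> degree p"
      by (rule degree_le) (simp add: coeff_map_poly cf coeff_eq_0 is_field_homD(4)[OF hom] \<gamma>'_def)
    then have "ev \<iota> a \<delta> = (\<Sum>i\<le>degree p. \<iota> (\<gamma>' (coeff p i)) * a ^ i)"
      unfolding ev_def by (subst poly_altdef_le) (auto simp: coeff_map_poly cf is_field_homD(4)[OF hom])
    moreover have "0 = (\<Sum>i\<le>degree p. coeff p i * a ^ i)" using p(3) by (simp add: poly_altdef)
    ultimately have "ev \<iota> a \<delta> = (\<Sum>i\<le>degree p. \<iota> (\<gamma>' (coeff p i)) * a ^ i) - (\<Sum>i\<le>degree p. coeff p i * a ^ i)"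
      by simp
    also have "\<dots> = (\<Sum>i\<le>degree p. - (a ^ i) * (coeff p i - \<iota> (\<gamma>' (coeff p i))))"
      by (simp add: sum_subtractf[symmetric] algebra_simps)
    also have "\<dots> \<in> Q"
      by (intro ideal_sum[OF QI] ideal_mult[OF QI _ \<gamma>'[OF cfA]] subring_uminus[OF A1] subring_power[OF A1 a])
    finally show ?thesis .
  qed
  ultimately show ?thesis
    using prime_contains_linear[OF hom A1 Q(1) _ a] const_A1 by blast
qed

text \<open>An element of the larger prime is constant modulo the smaller nonzero one; that constant
  lies in the larger prime and is therefore zero.\<close>

lemma dim_A1: "dim_le_1 A1"
  unfolding dim_le_1_def
proof (intro allI impI)
  fix P Q assume P: "is_prime_ideal A1 P" "P \<noteq> {0}" and Q: "is_prime_ideal A1 Q" and sub: "P \<subseteq> Q"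
  have "Q \<subseteq> P"
  proof
    fix a assume a: "a \<in> Q"
    then have aA: "a \<in> A1" using ideal_subset[OF prime_ideal[OF Q]] by auto
    obtain c where c: "a - \<iota> c \<in> P" using A1_residue[OF P aA] by blast
    have "a - (a - \<iota> c) \<in> Q" by (rule ideal_diff[OF A1 prime_ideal[OF Q] a]) (use c sub in auto)
    then have cQ: "\<iota> c \<in> Q" by simp
    have "c = 0"
    proof (rule ccontr)
      assume "c \<noteq> 0"
      then have "\<iota> (inverse c) * \<iota> c = 1" using is_field_homD(7,8)[OF hom] by simp
      then show False using ideal_mult[OF prime_ideal[OF Q] const_A1 cQ] prime_one[OF Q] by metis
    qed
    then show "a \<in> P" using c is_field_homD(4)[OF hom] by simp
  qed
  then show "P = Q" using sub by auto
qed

section \<open>Primes over the fibre and points of the modification\<close>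

definition N :: "'f set set" where
  "N = {Q. is_prime_ideal A1 Q \<and> q \<subseteq> Q}"

lemma N_prime: "Q \<in> N \<Longrightarrow> is_prime_ideal A1 Q" and N_q: "Q \<in> N \<Longrightarrow> q \<subseteq> Q"
  by (auto simp: N_def)

lemma N_nonzero: "Q \<in> N \<Longrightarrow> Q \<noteq> {0}"
  using g0 N_q by blast

lemma finite_N: "finite N"
proof -
  obtain S where S: "finite S" "B = subring_gen (range \<iota> \<union> S)" using ftV unfolding Y.ft_open_def by blast
  obtain T where T: "finite T" "A = subring_gen (range \<iota> \<union> T)" using finite_type_finite[OF S A BA pre_finite[OF affV]] by blast
  obtain T' where T': "finite T'" "A1 = subring_gen (range \<iota> \<union> T')" using finite_type_finite[OF T A1 AA1 finA1] by blast
  have noeth: "noetherian A1" unfolding T'(2) by (rule noetherian_finite_type[OF hom T'(1)])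
  obtain g where g: "g \<in> B" "g \<in> mx x0" "g \<noteq> 0" using g0 by blast
  have "finite {P. is_prime_ideal A1 P \<and> g \<in> P}"
    by (rule finite_primes_containing[OF A1 noeth dim_A1 _ g(3)]) (use g BA AA1 in auto)
  moreover have "N \<subseteq> {P. is_prime_ideal A1 P \<and> g \<in> P}" using g by (auto simp: N_def)
  ultimately show ?thesis by (rule finite_subset[rotated])
qed

lemma stalk_A: "x \<in> pre V \<Longrightarrow> st x = localization_at A (A \<inter> mx x)"
  using affine_stalk[OF affPV] .

lemma loc_center:
  assumes Q: "is_prime_ideal A1 Q" and x: "x \<in> pre V" "A \<inter> mx x = Q \<inter> A"
  shows "st x \<subseteq> localization_at A1 Q" "lmax (localization_at A1 Q) \<inter> st x = mx x"
proof -
  have eq: "st x = localization_at A (Q \<inter> A)" using stalk_A[OF x(1)] unfolding x(2) .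
  show "st x \<subseteq> localization_at A1 Q" "lmax (localization_at A1 Q) \<inter> st x = mx x"
    unfolding eq by (rule loc_mono[OF A A1 AA1 Q])+
qed

lemma N_center: "Q \<in> N \<Longrightarrow> \<exists>x\<in>F. A \<inter> mx x = Q \<inter> A"
proof -
  assume Q: "Q \<in> N"
  obtain x where x: "x \<in> pre V" "x \<in> closed_pts" "A \<inter> mx x = Q \<inter> A" using prime_meet[OF N_prime[OF Q] N_nonzero[OF Q]] by blast
  have "q \<subseteq> mx x" using N_q[OF Q] x(3) BA by blast
  then have "x \<in> F" using q_F[OF x(1)] by simp
  then show ?thesis using x by blast
qed

text \<open>
  \<open>G_normal\<close> only tests schemes with points of the same type as those of \<open>X\<close>. The points of the
  modification are therefore the points of \<open>X\<close> outside the fibre, relabelled by a bijection that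
  makes room for the finitely many primes of \<open>A1\<close> over the fibre.
\<close>

definition LL :: "'f set set" where
  "LL = st ` (points X - F) \<union> localization_at A1 ` N"

definition I :: "'x set" where
  "I = points X - F"

definition L :: "'x \<Rightarrow> 'f set" where
  "L = (SOME L. bij_betw L I LL)"

lemma L_bij: "bij_betw L I LL"
proof -
  have inf: "infinite I" using infinite_points finite_F by (simp add: I_def)
  have bij: "bij_betw st I (st ` I)" using stalk_inj by (auto simp: bij_betw_def inj_on_def I_def)
  then have inf': "infinite (st ` I)" using inf bij_betw_finite by blast
  have "\<exists>h. bij_betw h (st ` I) (st ` I \<union> localization_at A1 ` N)"
    by (rule infinite_bij_Un) (use finite_N inf' in auto)
  then obtain h where h: "bij_betw h (st ` I) LL" unfolding LL_def I_def by blast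
  have "bij_betw (h \<circ> st) I LL" by (rule bij_betw_trans[OF bij h])
  then show ?thesis unfolding L_def by (rule someI[where P = "\<lambda>L. bij_betw L I LL"])
qed

lemma L_inj: "z \<in> I \<Longrightarrow> w \<in> I \<Longrightarrow> L z = L w \<Longrightarrow> z = w"
  using L_bij by (auto simp: bij_betw_def inj_on_def)

lemma L_cases:
  assumes "z \<in> I"
  obtains x where "x \<in> points X" "x \<notin> F" "L z = st x" | Q where "Q \<in> N" "L z = localization_at A1 Q"
proof -
  have "L z \<in> LL" using L_bij assms by (auto simp: bij_betw_def)
  then show ?thesis using that unfolding LL_def by blast
qed

lemma L_surj: "S \<in> LL \<Longrightarrow> \<exists>z\<in>I. L z = S"
proof -
  assume "S \<in> LL"
  then have "S \<in> L ` I" using bij_betw_imp_surj_on[OF L_bij] by simp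
  then show ?thesis by blast
qed

lemma L_local: "z \<in> I \<Longrightarrow> local_ring (L z)"
  by (erule L_cases) (simp_all add: stalk_local local_ring_loc[OF A1 N_prime])

text \<open>The local ring at \<open>z\<close> dominates that at \<open>x\<close>. This is the graph
  of the projection to \<open>X\<close>, stated without reference to the arbitrary labelling by
  \<open>L\<close>.\<close>

definition over :: "'x \<Rightarrow> 'x \<Rightarrow> bool" where
  "over z x \<longleftrightarrow> z \<in> I \<and> x \<in> points X \<and> st x \<subseteq> L z \<and> lmax (L z) \<inter> st x = mx x"

lemma overD: "over z x \<Longrightarrow> z \<in> I" "over z x \<Longrightarrow> x \<in> points X" "over z x \<Longrightarrow> st x \<subseteq> L z"
  "over z x \<Longrightarrow> lmax (L z) \<inter> st x = mx x"
  by (auto simp: over_def)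

lemma L_prime: "z \<in> I \<Longrightarrow> is_prime_ideal (L z) (lmax (L z))"
  by (rule lmax_prime[OF L_local])

lemma L_subring: "z \<in> I \<Longrightarrow> is_subring (L z)"
  using L_local by (simp add: local_ring_def)

lemma over_unique: "over z x \<Longrightarrow> over z x' \<Longrightarrow> x = x'"
proof -
  assume x: "over z x" and x': "over z x'"
  note z = overD(1)[OF x]
  show ?thesis
    by (rule domination_uniqueD[OF dominated L_subring[OF z] L_prime[OF z] overD(2)[OF x] overD(2)[OF x']
      overD(3)[OF x] overD(3)[OF x'] overD(4)[OF x] overD(4)[OF x']])
qed

lemma over_stalk: "z \<in> I \<Longrightarrow> x \<in> points X \<Longrightarrow> L z = st x \<Longrightarrow> over z x"
  using lmax_subset by (auto simp: over_def)

lemma over_loc: "z \<in> I \<Longrightarrow> Q \<in> N \<Longrightarrow> L z = localization_at A1 Q \<Longrightarrow> x \<in> pre V \<Longrightarrow> A \<inter> mx x = Q \<inter> A \<Longrightarrow> over z x"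
  using loc_center[OF N_prime] by (auto simp: over_def in_pre)

lemma over_ex: "z \<in> I \<Longrightarrow> \<exists>x. over z x"
proof -
  assume z: "z \<in> I"
  show ?thesis
  proof (rule L_cases[OF z])
    fix x assume "x \<in> points X" "L z = st x"
    then show ?thesis using over_stalk[OF z] by blast
  next
    fix Q assume Q: "Q \<in> N" "L z = localization_at A1 Q"
    obtain x where "x \<in> F" "A \<inter> mx x = Q \<inter> A" using N_center[OF Q(1)] by blast
    then show ?thesis using over_loc[OF z Q F_pre] by blast
  qed
qed

lemma over_out: "over z x \<Longrightarrow> x \<notin> F \<Longrightarrow> L z = st x"
proof -
  assume o: "over z x" and x: "x \<notin> F"
  show ?thesis
  proof (rule L_cases[OF overD(1)[OF o]])
    fix x' assume "x' \<in> points X" "L z = st x'"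
    then show ?thesis using over_unique[OF o over_stalk[OF overD(1)[OF o]]] by simp
  next
    fix Q assume *: "Q \<in> N" "L z = localization_at A1 Q"
    obtain x' where "x' \<in> F" "A \<inter> mx x' = Q \<inter> A" using N_center[OF *(1)] by blast
    then show ?thesis using over_unique[OF o over_loc[OF overD(1)[OF o] * F_pre]] x by blast
  qed
qed

lemma over_in: "over z x \<Longrightarrow> x \<in> F \<Longrightarrow> \<exists>Q\<in>N. L z = localization_at A1 Q \<and> Q \<inter> A = A \<inter> mx x"
proof -
  assume o: "over z x" and x: "x \<in> F"
  show ?thesis
  proof (rule L_cases[OF overD(1)[OF o]])
    fix x' assume "x' \<in> points X" "x' \<notin> F" "L z = st x'"
    then show ?thesis using over_unique[OF o over_stalk[OF overD(1)[OF o]]] x by blast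
  next
    fix Q assume *: "Q \<in> N" "L z = localization_at A1 Q"
    obtain x' where x': "x' \<in> F" "A \<inter> mx x' = Q \<inter> A" using N_center[OF *(1)] by blast
    then have "x = x'" using over_unique[OF o over_loc[OF overD(1)[OF o] * F_pre]] by blast
    then show ?thesis using * x' by blast
  qed
qed

lemma over_in_sub: "over z x \<Longrightarrow> x \<in> F \<Longrightarrow> A1 \<subseteq> L z"
  using over_in loc_superset[OF A1 N_prime] by metis

lemma ex_over_out: "x \<in> points X \<Longrightarrow> x \<notin> F \<Longrightarrow> \<exists>z. over z x \<and> L z = st x"
  using L_surj[of "st x"] over_stalk unfolding LL_def by blast

lemma ex_over_in: "Q \<in> N \<Longrightarrow> x \<in> pre V \<Longrightarrow> A \<inter> mx x = Q \<inter> A \<Longrightarrow> \<exists>z. over z x \<and> L z = localization_at A1 Q"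
proof -
  assume Q: "Q \<in> N" and x: "x \<in> pre V" "A \<inter> mx x = Q \<inter> A"
  have "localization_at A1 Q \<in> LL" using Q by (auto simp: LL_def)
  then obtain z where z: "z \<in> I" "L z = localization_at A1 Q" using L_surj by blast
  then show ?thesis using over_loc[OF z(1) Q z(2) x] by blast
qed

lemma gen_notin_F: "gen \<notin> F"
  using F_closed by (auto simp: closed_pts_def)

definition g' :: 'x where
  "g' = (SOME z. over z gen \<and> L z = UNIV)"

lemma g': "over g' gen" "L g' = UNIV"
proof -
  have "\<exists>z. over z gen \<and> L z = UNIV" using ex_over_out[OF gen(1) gen_notin_F] gen(2) by simp
  then have "over g' gen \<and> L g' = UNIV" unfolding g'_def by (rule someI_ex)
  then show "over g' gen" "L g' = UNIV" by auto
qed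

lemma fraction_L: "z \<in> I \<Longrightarrow> \<exists>a\<in>L z. \<exists>b\<in>L z. b \<noteq> 0 \<and> f = a / b"
proof -
  assume z: "z \<in> I"
  obtain x where x: "over z x" using over_ex[OF z] by blast
  obtain U where U: "affine_open X U" "x \<in> U" using affine_cover[OF overD(2)[OF x]] by blast
  obtain a b where "a \<in> sec X U" "b \<in> sec X U" "b \<noteq> 0" "f = a / b" using frac[OF U(1)] by blast
  then show ?thesis using affine_sec_stalk[OF U] overD(3)[OF x] by blast
qed

text \<open>The maximal ideal of \<open>L w\<close> meets \<open>L z\<close> in a nonzero prime,
  since \<open>L w\<close> is not the whole field. This prime meets the stalk of the point under
  \<open>z\<close> in its maximal ideal, so \<open>z\<close> and \<open>w\<close> lie over the same
  point. Outside the fibre they have the same stalk there; in the fibre their primes of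
  \<open>A1\<close> are nested, hence equal.\<close>

lemma L_incomp:
  assumes z: "z \<in> I" and w: "w \<in> I" and sub: "L z \<subseteq> L w" and wg: "w \<noteq> g'"
  shows "z = w"
proof -
  have Lw: "L w \<noteq> UNIV" using L_inj[OF w overD(1)[OF g'(1)]] g'(2) wg by auto
  obtain x where x: "over z x" using over_ex[OF z] by blast
  note xX = overD(2)[OF x]
  define n where "n = lmax (L w) \<inter> L z"
  have n: "is_prime_ideal (L z) n" unfolding n_def by (rule prime_inter[OF L_subring[OF z] sub L_prime[OF w]])
  have "\<exists>f\<in>n. f \<noteq> 0"
  proof (rule ccontr)
    assume no: "\<not> ?thesis"
    have "f \<in> L w" for f
    proof -
      obtain a b where ab: "a \<in> L z" "b \<in> L z" "b \<noteq> 0" "f = a / b" using fraction_L[OF z] by blast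
      have "b \<in> lunits (L w)" using no ab sub unfolding n_def lmax_def by blast
      then have "inverse b \<in> L w" by (simp add: lunits_def)
      then show ?thesis using ab sub subring_mult[OF L_subring[OF w]] by (auto simp: divide_inverse)
    qed
    then show False using Lw by auto
  qed
  then obtain f where f: "f \<in> n" "f \<noteq> 0" by blast
  have "\<exists>h\<in>n \<inter> st x. h \<noteq> 0"
  proof (cases "x \<in> F")
    case False
    then have "n \<subseteq> st x" using over_out[OF x] by (auto simp: n_def)
    then show ?thesis using f by blast
  next
    case True
    then obtain Q where Q: "Q \<in> N" "L z = localization_at A1 Q" using over_in[OF x] by blast
    have "f \<in> localization_at A1 Q" using f Q by (auto simp: n_def)
    then obtain a s where as: "a \<in> A1" "s \<in> A1" "s \<notin> Q" "s \<noteq> 0" "f = a / s" "s * f = a" by (rule loc_E[OF A1 N_prime[OF Q(1)]])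
    \<comment> \<open>The numerator of \<open>f\<close> lies in \<open>A1\<close> only; the factor
      \<open>g\<close> brings it into \<open>A\<close> and so into the stalk of
      \<open>x\<close>.\<close>
    obtain g where g: "g \<in> B" "g \<in> mx x0" "g \<noteq> 0" using g0 by blast
    have subz: "A1 \<subseteq> L z" using over_in_sub[OF x True] .
    have "g \<in> L z" using g BA AA1 subz by blast
    then have "g * s \<in> L z" using as subz subring_mult[OF L_subring[OF z]] by blast
    then have "g * s * f \<in> n" using ideal_mult[OF prime_ideal[OF n]] f by blast
    then have "g * a \<in> n" using as(6) by (simp add: mult.assoc)
    moreover have "g * a \<in> st x" using cond[OF g(1,2) as(1)] affine_sec_stalk[OF affPV F_pre[OF True]] by auto
    moreover have "g * a \<noteq> 0" using g as f by auto
    ultimately show ?thesis by blast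
  qed
  then have "n \<inter> st x \<noteq> {0}" by blast
  then have "n \<inter> st x = mx x" using stalk_dim[OF xX] prime_inter[OF stalk_subring[OF xX] overD(3)[OF x] n] by blast
  then have "lmax (L w) \<inter> st x = mx x" using overD(3)[OF x] by (auto simp: n_def)
  then have xw: "over w x" using w xX overD(3)[OF x] sub by (auto simp: over_def)
  have "L z = L w"
  proof (cases "x \<in> F")
    case False
    then show ?thesis using over_out[OF x] over_out[OF xw] by simp
  next
    case True
    obtain Q where Q: "Q \<in> N" "L z = localization_at A1 Q" using over_in[OF x True] by blast
    obtain Q' where Q': "Q' \<in> N" "L w = localization_at A1 Q'" using over_in[OF xw True] by blast
    have "Q' \<subseteq> Q"
    proof
      fix a assume a: "a \<in> Q'"
      then have aA: "a \<in> A1" using ideal_subset[OF prime_ideal[OF N_prime[OF Q'(1)]]] by auto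
      show "a \<in> Q"
      proof (rule ccontr)
        assume "a \<notin> Q"
        then have "a / 1 \<in> lunits (L z)"
          unfolding Q(2) using loc_unit_iff[OF A1 N_prime[OF Q(1)] aA subring_1[OF A1] prime_one[OF N_prime[OF Q(1)]]] by simp
        then have "a \<in> lunits (L w)" using lunits_mono[OF sub] by auto
        then have "a / 1 \<in> lunits (localization_at A1 Q')" using Q'(2) by simp
        then show False
          using loc_unit_iff[OF A1 N_prime[OF Q'(1)] aA subring_1[OF A1] prime_one[OF N_prime[OF Q'(1)]]] a by simp
      qed
    qed
    then have "Q' = Q" using dim_A1 N_prime[OF Q(1)] N_prime[OF Q'(1)] N_nonzero[OF Q'(1)] unfolding dim_le_1_def by blast
    then show ?thesis using Q Q' by simp
  qed
  then show ?thesis by (rule L_inj[OF z w])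
qed

lemma finite_L_image: "E \<subseteq> I \<Longrightarrow> finite S \<Longrightarrow> L ` E \<subseteq> S \<Longrightarrow> finite E"
  using L_bij by (meson bij_betw_def finite_imageD finite_subset inj_on_subset)

sublocale fam: local_family I g' L
proof
  show "g' \<in> I" using overD(1)[OF g'(1)] .
  show "L g' = UNIV" by (rule g'(2))
  show "local_ring (L z)" if "z \<in> I" for z by (rule L_local[OF that])
  show "finite {z \<in> I. f \<notin> L z}" for f
  proof (rule finite_L_image)
    show "finite (st ` {x \<in> points X. f \<notin> st x} \<union> localization_at A1 ` N)" using finite_poles finite_N by blast
    show "L ` {z \<in> I. f \<notin> L z} \<subseteq> st ` {x \<in> points X. f \<notin> st x} \<union> localization_at A1 ` N"
    proof
      fix S assume "S \<in> L ` {z \<in> I. f \<notin> L z}"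
      then obtain z where z: "z \<in> I" "f \<notin> L z" "S = L z" by blast
      show "S \<in> st ` {x \<in> points X. f \<notin> st x} \<union> localization_at A1 ` N"
        by (rule L_cases[OF z(1)]) (use z in auto)
    qed
  qed auto
  show "w = g' \<or> z = w" if "z \<in> I" "w \<in> I" "L z \<subseteq> L w" for z w using L_incomp[OF that] by blast
qed

section \<open>Projection of the modification and its sections over affine opens of the
  curve\<close>

abbreviation "X' \<equiv> glued I g' L"

definition \<phi> :: "'x \<Rightarrow> 'x" where
  "\<phi> z = (SOME x. over z x)"

lemma over_phi: "z \<in> I \<Longrightarrow> over z (\<phi> z)"
  unfolding \<phi>_def using over_ex by (rule someI_ex)

lemma phi_eq: "over z x \<Longrightarrow> \<phi> z = x"
  using over_phi[OF overD(1)] over_unique by blast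

definition pull :: "'x set \<Rightarrow> 'x set" where
  "pull U = {z \<in> I. \<phi> z \<in> U}"

lemma pull_over: "over z x \<Longrightarrow> z \<in> pull U \<longleftrightarrow> x \<in> U"
  using phi_eq overD(1) by (auto simp: pull_def)

lemma pullD: "z \<in> pull U \<Longrightarrow> \<exists>x\<in>U. over z x"
  using over_phi by (auto simp: pull_def)

lemma preim_pull: "preim X' \<phi> U = pull U"
  by (simp add: preim_def pull_def fam.points_Z)

lemma pull_open: "nonempty_open X U \<Longrightarrow> pull U \<subseteq> I \<and> g' \<in> pull U \<and> finite (I - pull U)"
proof (intro conjI)
  assume U: "nonempty_open X U"
  show "pull U \<subseteq> I" by (auto simp: pull_def)
  show "g' \<in> pull U" using pull_over[OF g'(1)] gen(3)[OF U] by simp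
  show "finite (I - pull U)"
  proof (rule finite_L_image)
    have "openin (topo X) U" "U \<noteq> {}" using U by (auto simp: nonempty_open_def)
    then have "finite (points X - U)" using open_iff_cofinite[OF open_points[OF U]] by simp
    then show "finite (st ` (points X - U) \<union> localization_at A1 ` N)" using finite_N by blast
    show "L ` (I - pull U) \<subseteq> st ` (points X - U) \<union> localization_at A1 ` N"
    proof
      fix S assume "S \<in> L ` (I - pull U)"
      then obtain z where z: "z \<in> I" "z \<notin> pull U" "S = L z" by blast
      obtain x where x: "over z x" using over_ex[OF z(1)] by blast
      have "x \<notin> U" using pull_over[OF x] z(2) by simp
      then show "S \<in> st ` (points X - U) \<union> localization_at A1 ` N"
        using over_out[OF x] over_in[OF x] overD(2)[OF x] z(3) by (cases "x \<in> F") auto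
    qed
  qed auto
qed

definition C' :: "'x set \<Rightarrow> 'f set" where
  "C' U = (\<Inter>z\<in>pull U. L z)"

lemma sec_X': "sec X' (pull U) = C' U"
  by (simp add: C'_def fam.sec_Z)

lemma C'_sub: "over z x \<Longrightarrow> x \<in> U \<Longrightarrow> C' U \<subseteq> L z"
  using pull_over by (auto simp: C'_def)

lemma C'_I: "(\<And>z x. over z x \<Longrightarrow> x \<in> U \<Longrightarrow> f \<in> L z) \<Longrightarrow> f \<in> C' U"
  using pullD by (fastforce simp: C'_def)

lemma C'_subring: "is_subring (C' U)"
  unfolding C'_def using L_subring by (intro is_subring_Inter) (auto simp: pull_def)

text \<open>Over \<open>U\<close> the function \<open>f\<close> fails to be regular above finitely
  many points only, all different from \<open>x\<close>. A section vanishing at such a point but not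
  at \<open>x\<close> removes the pole there after raising it to a power; the product of these
  sections is \<open>b\<close>.\<close>

lemma approximation:
  assumes U: "affine_open X U" and x: "x \<in> U" and f: "\<And>z. over z x \<Longrightarrow> f \<in> L z"
  shows "\<exists>b\<in>sec X U - mx x. b * f \<in> C' U"
proof -
  note AU = affine_subring[OF U]
  have xX: "x \<in> points X" using x affine_points[OF U] by auto
  define E where "E = {x' \<in> U. \<exists>z. over z x' \<and> f \<notin> L z}"
  have finE: "finite E"
  proof (rule finite_subset[OF _ finite_poles[of f]])
    show "E \<subseteq> {x \<in> points X. f \<notin> st x}" using overD(2,3) unfolding E_def by blast
  qed
  have "\<exists>b. b \<in> sec X U \<and> b \<notin> mx x \<and> b * f \<in> st x'" if x': "x' \<in> E" for x'
  proof -
    have x'U: "x' \<in> U" and ne: "x' \<noteq> x" using x' f by (auto simp: E_def)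
    obtain z where z: "over z x'" "f \<notin> L z" using x' by (auto simp: E_def)
    have "x' \<noteq> gen" using z overD(3)[OF z(1)] gen(2) by auto
    then have "\<not> sec X U \<inter> mx x' \<subseteq> mx x" using prime_maximal[OF U x'U _ x] ne by blast
    then obtain c where c: "c \<in> sec X U" "c \<in> mx x'" "c \<notin> mx x" by blast
    have "x' \<in> closed_pts" using \<open>x' \<noteq> gen\<close> overD(2)[OF z(1)] by (simp add: closed_pts_def)
    then obtain r where "c ^ r * f \<in> st x'" using pole_order[OF _ c(2)] by blast
    moreover have "c ^ r \<notin> mx x"
      using prime_power[OF stalk_subring[OF xX] mx_prime[OF xX]] c affine_sec_stalk[OF U x] by blast
    ultimately show ?thesis using subring_power[OF AU c(1)] by blast
  qed
  then obtain b where b: "\<And>x'. x' \<in> E \<Longrightarrow> b x' \<in> sec X U \<and> b x' \<notin> mx x \<and> b x' * f \<in> st x'" by metis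
  define b0 where "b0 = (\<Prod>x'\<in>E. b x')"
  have "b0 \<in> sec X U" unfolding b0_def using b by (intro subring_prod[OF AU]) auto
  moreover have "b0 \<in> st x - mx x" unfolding b0_def
    using b affine_sec_stalk[OF U x] by (intro prime_prod[OF stalk_subring[OF xX] mx_prime[OF xX]]) auto
  moreover have "b0 * f \<in> C' U"
  proof (rule C'_I)
    fix z x'' assume z: "over z x''" "x'' \<in> U"
    have sub: "sec X U \<subseteq> L z" using affine_sec_stalk[OF U z(2)] overD(3)[OF z(1)] by auto
    note Lz = L_subring[OF overD(1)[OF z(1)]]
    show "b0 * f \<in> L z"
    proof (cases "x'' \<in> E")
      case False
      then have "f \<in> L z" using z by (auto simp: E_def)
      then show ?thesis using \<open>b0 \<in> sec X U\<close> sub subring_mult[OF Lz] by blast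
    next
      case True
      have "b0 = b x'' * (\<Prod>x'\<in>E - {x''}. b x')" unfolding b0_def by (rule prod.remove[OF finE True])
      then have eq: "b0 * f = (\<Prod>x'\<in>E - {x''}. b x') * (b x'' * f)" by (simp add: mult_ac)
      have "(\<Prod>x'\<in>E - {x''}. b x') \<in> L z" using b sub by (intro subring_prod[OF Lz]) auto
      moreover have "b x'' * f \<in> L z" using b[OF True] overD(3)[OF z(1)] by auto
      ultimately show ?thesis unfolding eq by (rule subring_mult[OF Lz])
    qed
  qed
  ultimately show ?thesis by blast
qed

lemma sec_C': "affine_open X U \<Longrightarrow> sec X U \<subseteq> C' U"
proof
  fix f assume U: "affine_open X U" and f: "f \<in> sec X U"
  show "f \<in> C' U"
  proof (rule C'_I)
    fix z x assume z: "over z x" "x \<in> U"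
    show "f \<in> L z" using affine_sec_stalk[OF U z(2)] overD(3)[OF z(1)] f by auto
  qed
qed

text \<open>The contraction of \<open>n\<close> to the sections of \<open>U\<close> gives a point
  \<open>x\<close>. Off the fibre its stalk determines \<open>n\<close>. In the fibre
  \<open>n\<close> is transported to a prime of \<open>A1\<close> by clearing denominators that do
  not vanish at \<open>x\<close>, and that prime is one of the new points over
  \<open>x\<close>.\<close>

lemma C'_prime:
  assumes U: "affine_open X U" and n: "is_prime_ideal (C' U) n"
  shows "\<exists>z\<in>pull U. C' U \<inter> lmax (L z) = n"
proof -
  let ?C = "sec X U" and ?C' = "C' U"
  note C' = C'_subring[of U] and CC' = sec_C'[OF U] and AU = affine_subring[OF U] and nI = prime_ideal[OF n]
  obtain x where x: "x \<in> U" "?C \<inter> mx x = n \<inter> ?C" using affine_point[OF U prime_inter[OF AU CC' n]] by blast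
  have xX: "x \<in> points X" using x affine_points[OF U] by auto
  show ?thesis
  proof (cases "x \<in> F")
    case False
    obtain z where z: "over z x" "L z = st x" using ex_over_out[OF xX False] by blast
    have "f \<in> n \<longleftrightarrow> f \<in> mx x" if f: "f \<in> ?C'" for f
    proof -
      have "f \<in> st x" using f C'_sub[OF z(1) x(1)] z(2) by auto
      then obtain a b where ab: "a \<in> ?C" "b \<in> ?C" "b \<notin> mx x" "b \<noteq> 0" "f = a / b" "b * f = a" by (rule affine_stalkE[OF U x(1)])
      have bn: "b \<notin> n" using x(2) ab by blast
      have "f \<in> n \<longleftrightarrow> a \<in> n"
        using ab(6) prime_mult[OF n, of b f] ab(2) CC' f bn ideal_mult[OF nI, of b f] by auto
      then show ?thesis using affine_max_iff[OF U x(1) ab(1-3)] ab(1,5) x(2) by blast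
    qed
    then have "?C' \<inter> lmax (L z) = n" using z(2) ideal_subset[OF nI] by auto
    then show ?thesis using pull_over[OF z(1)] x(1) by blast
  next
    case True
    have xV: "x \<in> pre V" using F_pre[OF True] .
    have AxL: "A \<subseteq> st x" using affine_sec_stalk[OF affPV xV] .
    define S where "S = ?C - mx x"
    have S1: "1 \<in> S" using subring_1[OF AU] prime_one[OF mx_prime[OF xX]] by (simp add: S_def)
    have Smult: "b * c \<in> S" if "b \<in> S" "c \<in> S" for b c
      using that prime_mult[OF mx_prime[OF xX], of b c] affine_sec_stalk[OF U x(1)] subring_mult[OF AU] by (auto simp: S_def)
    have SC': "b \<in> ?C'" "b \<notin> n" if "b \<in> S" for b using that CC' x(2) by (auto simp: S_def)
    have app: "\<exists>b\<in>S. b * a \<in> ?C'" if "a \<in> A1" for a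
      using approximation[OF U x(1), of a] over_in_sub[OF _ True] that unfolding S_def by blast
    \<comment> \<open>Neither of \<open>A1\<close> and \<open>C' U\<close> contains the other, but
      \<open>approximation\<close> moves \<open>A1\<close> into \<open>C' U\<close> by factors from
      \<open>S\<close>. Since these lie outside \<open>n\<close>, the choice of the factor does not
      matter, see \<open>Q_iff\<close>.\<close>
    define Q where "Q = {a \<in> A1. \<exists>b\<in>S. b * a \<in> n}"
    have Q_iff: "a \<in> Q \<longleftrightarrow> b * a \<in> n" if a: "a \<in> A1" and b: "b \<in> S" "b * a \<in> ?C'" for a b
    proof
      assume "a \<in> Q"
      then obtain c where c: "c \<in> S" "c * a \<in> n" by (auto simp: Q_def)
      have eq: "c * (b * a) = b * (c * a)" by (simp add: mult_ac)
      have "c * (b * a) \<in> n" unfolding eq by (rule ideal_mult[OF nI SC'(1)[OF b(1)] c(2)])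
      then show "b * a \<in> n" using prime_mult[OF n SC'(1)[OF c(1)] b(2)] SC'(2)[OF c(1)] by blast
    qed (use a b in \<open>auto simp: Q_def\<close>)
    have Qp: "is_prime_ideal A1 Q"
      unfolding is_prime_ideal_def
    proof (intro conjI ballI impI is_idealI)
      show "Q \<subseteq> A1" by (auto simp: Q_def)
      show "0 \<in> Q" using S1 ideal_0[OF nI] subring_0[OF A1] by (auto simp: Q_def)
      show "1 \<notin> Q" using Q_iff[OF subring_1[OF A1] S1] SC'[OF S1] by simp
    next
      fix a a' assume "a \<in> Q" "a' \<in> Q"
      then obtain b b' where b: "a \<in> A1" "b \<in> S" "b * a \<in> n" "a' \<in> A1" "b' \<in> S" "b' * a' \<in> n" by (auto simp: Q_def)
      have "b * b' * (a + a') = b' * (b * a) + b * (b' * a')" by (simp add: algebra_simps)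
      also have "\<dots> \<in> n"
        by (rule ideal_add[OF nI ideal_mult[OF nI SC'(1)[OF b(5)] b(3)] ideal_mult[OF nI SC'(1)[OF b(2)] b(6)]])
      finally show "a + a' \<in> Q" using Smult[OF b(2,5)] subring_add[OF A1 b(1,4)] by (auto simp: Q_def)
    next
      fix c a assume c: "c \<in> A1" and "a \<in> Q"
      then obtain b where b: "a \<in> A1" "b \<in> S" "b * a \<in> n" by (auto simp: Q_def)
      obtain b' where b': "b' \<in> S" "b' * c \<in> ?C'" using app[OF c] by blast
      have eq: "b' * b * (c * a) = (b' * c) * (b * a)" by (simp add: algebra_simps)
      have "b' * b * (c * a) \<in> n" unfolding eq by (rule ideal_mult[OF nI b'(2) b(3)])
      then show "c * a \<in> Q" using Smult[OF b'(1) b(2)] subring_mult[OF A1 c b(1)] by (auto simp: Q_def)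
    next
      fix a a' assume aa: "a \<in> A1" "a' \<in> A1" "a * a' \<in> Q"
      then obtain c where c: "c \<in> S" "c * (a * a') \<in> n" by (auto simp: Q_def)
      obtain b where b: "b \<in> S" "b * a \<in> ?C'" using app[OF aa(1)] by blast
      obtain b' where b': "b' \<in> S" "b' * a' \<in> ?C'" using app[OF aa(2)] by blast
      have "c * ((b * a) * (b' * a')) = (b * b') * (c * (a * a'))" by (simp add: mult_ac)
      also have "\<dots> \<in> n" using ideal_mult[OF nI subring_mult[OF C' SC'(1)[OF b(1)] SC'(1)[OF b'(1)]] c(2)] .
      finally have "(b * a) * (b' * a') \<in> n"
        using prime_mult[OF n SC'(1)[OF c(1)] subring_mult[OF C' b(2) b'(2)]] SC'(2)[OF c(1)] by blast
      then have "b * a \<in> n \<or> b' * a' \<in> n" by (rule prime_mult[OF n b(2) b'(2)])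
      then show "a \<in> Q \<or> a' \<in> Q" using Q_iff[OF aa(1) b] Q_iff[OF aa(2) b'] by blast
    qed
    have QA: "a \<in> Q \<longleftrightarrow> a \<in> mx x" if a: "a \<in> A" for a
    proof -
      have "a \<in> st x" using a AxL by auto
      then obtain c b where cb: "c \<in> ?C" "b \<in> ?C" "b \<notin> mx x" "b \<noteq> 0" "a = c / b" "b * a = c" by (rule affine_stalkE[OF U x(1)])
      have "a \<in> Q \<longleftrightarrow> c \<in> n" using Q_iff[of a b] a AA1 cb CC' by (auto simp: S_def)
      then show ?thesis using affine_max_iff[OF U x(1) cb(1-3)] cb(1,5) x(2) by blast
    qed
    have AQ: "A \<inter> mx x = Q \<inter> A" using QA by blast
    have "q \<subseteq> Q" using QA F_mx[OF True] BA by blast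
    then have QN: "Q \<in> N" using Qp by (simp add: N_def)
    obtain z where z: "over z x" "L z = localization_at A1 Q" using ex_over_in[OF QN xV AQ] by blast
    have "f \<in> n \<longleftrightarrow> f \<in> lmax (L z)" if f: "f \<in> ?C'" for f
    proof -
      have "f \<in> localization_at A1 Q" using f C'_sub[OF z(1) x(1)] z(2) by auto
      then obtain a s where as: "a \<in> A1" "s \<in> A1" "s \<notin> Q" "s \<noteq> 0" "f = a / s" "s * f = a" by (rule loc_E[OF A1 Qp])
      obtain b where b: "b \<in> S" "b * a \<in> ?C'" using app[OF as(1)] by blast
      obtain b' where b': "b' \<in> S" "b' * s \<in> ?C'" using app[OF as(2)] by blast
      have b's: "b' * s \<notin> n" using Q_iff[OF as(2) b'] as(3) by simp
      have bb: "b * (b' * s) \<in> ?C'" "b * (b' * s) \<notin> n"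
        using subring_mult[OF C' SC'(1)[OF b(1)] b'(2)] prime_mult[OF n SC'(1)[OF b(1)] b'(2)] b's SC'(2)[OF b(1)] by auto
      have eq: "(b * (b' * s)) * f = b' * (b * a)" using as(6) by (simp add: mult_ac)
      have "f \<in> n \<longleftrightarrow> (b * (b' * s)) * f \<in> n"
        using prime_mult[OF n bb(1) f] bb ideal_mult[OF nI bb(1), of f] by blast
      also have "\<dots> \<longleftrightarrow> b * a \<in> n"
        unfolding eq using prime_mult[OF n SC'(1)[OF b'(1)] b(2)] SC'(2)[OF b'(1)] ideal_mult[OF nI SC'(1)[OF b'(1)], of "b * a"] by blast
      also have "\<dots> \<longleftrightarrow> a \<in> Q" using Q_iff[OF as(1) b] by simp
      also have "\<dots> \<longleftrightarrow> f \<in> lmax (L z)" unfolding z(2) as(5) using loc_max_iff[OF A1 Qp as(1-3)] by simp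
      finally show ?thesis .
    qed
    then have "?C' \<inter> lmax (L z) = n" using ideal_subset[OF nI] by blast
    then show ?thesis using pull_over[OF z(1)] x(1) by blast
  qed
qed

lemma C'_loc:
  assumes U: "affine_open X U" and z: "z \<in> pull U"
  shows "L z \<subseteq> localization_at (C' U) (C' U \<inter> lmax (L z))"
proof
  fix f assume f: "f \<in> L z"
  obtain x where x: "x \<in> U" "over z x" using pullD[OF z] by blast
  have xX: "x \<in> points X" using x affine_points[OF U] by auto
  have unit: "b \<notin> lmax (L z)" if "b \<in> sec X U - mx x" for b
    using that overD(4)[OF x(2)] affine_sec_stalk[OF U x(1)] by blast
  show "f \<in> localization_at (C' U) (C' U \<inter> lmax (L z))"
  proof (cases "x \<in> F")
    case False
    then have "f \<in> st x" using f over_out[OF x(2)] by simp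
    then obtain a b where ab: "a \<in> sec X U" "b \<in> sec X U" "b \<notin> mx x" "b \<noteq> 0" "f = a / b" by (rule affine_stalkE[OF U x(1)])
    have "a \<in> C' U" "b \<in> C' U" "b \<notin> lmax (L z)" using ab sec_C'[OF U] unit by auto
    then show ?thesis unfolding localization_at_def ab(5) by blast
  next
    case True
    obtain Q where Q: "Q \<in> N" "L z = localization_at A1 Q" using over_in[OF x(2) True] by blast
    note Qp = N_prime[OF Q(1)]
    have "f \<in> localization_at A1 Q" using f Q by simp
    then obtain a s where as: "a \<in> A1" "s \<in> A1" "s \<notin> Q" "s \<noteq> 0" "f = a / s" by (rule loc_E[OF A1 Qp])
    have app: "\<exists>b\<in>sec X U - mx x. b * a \<in> C' U" if "a \<in> A1" for a
      using approximation[OF U x(1), of a] over_in_sub[OF _ True] that by blast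
    obtain b where b: "b \<in> sec X U - mx x" "b * a \<in> C' U" using app[OF as(1)] by blast
    obtain b' where b': "b' \<in> sec X U - mx x" "b' * s \<in> C' U" using app[OF as(2)] by blast
    have nz: "b \<noteq> 0" "b' \<noteq> 0" using b(1) b'(1) ideal_0[OF mx_ideal[OF xX]] by auto
    have bC: "b \<in> C' U" "b' \<in> C' U" using b b' sec_C'[OF U] by auto
    have CL: "C' U \<subseteq> L z" using C'_sub[OF x(2,1)] .
    have "s / 1 \<notin> lmax (L z)"
      unfolding Q(2) using loc_max_iff[OF A1 Qp as(2) subring_1[OF A1] prime_one[OF Qp]] as(3) by simp
    then have sn: "s \<notin> lmax (L z)" by simp
    have sL: "s \<in> L z" using over_in_sub[OF x(2) True] as(2) by auto
    note Lp = L_prime[OF overD(1)[OF x(2)]] and Ls = L_subring[OF overD(1)[OF x(2)]]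
    have "b * (b' * s) \<notin> lmax (L z)"
      using prime_mult[OF Lp, of b "b' * s"] prime_mult[OF Lp, of b' s] bC CL sL sn unit[OF b(1)] unit[OF b'(1)] subring_mult[OF Ls] by blast
    moreover have "b' * (b * a) \<in> C' U" "b * (b' * s) \<in> C' U" using b b' bC subring_mult[OF C'_subring] by auto
    moreover have "f = (b' * (b * a)) / (b * (b' * s))" using nz as by (simp add: field_simps)
    ultimately show ?thesis unfolding localization_at_def by blast
  qed
qed

text \<open>A prime of \<open>A1\<close> containing all denominators of \<open>f\<close> and
  avoiding \<open>S\<close> is nonzero, because \<open>f\<close> is a fraction of elements of
  \<open>A\<close>. So regularity at the nonzero primes, each lying over a closed point, is
  enough.\<close>

lemma denominators_A1:
  assumes S: "1 \<in> S" "S \<subseteq> A" "\<And>a b. a \<in> S \<Longrightarrow> b \<in> S \<Longrightarrow> a * b \<in> S"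
    and f: "\<And>Q x. is_prime_ideal A1 Q \<Longrightarrow> x \<in> pre V \<Longrightarrow> x \<in> closed_pts \<Longrightarrow> A \<inter> mx x = Q \<inter> A \<Longrightarrow> Q \<inter> S = {} \<Longrightarrow>
      f \<in> localization_at A1 Q"
  shows "\<exists>s\<in>S. s * f \<in> A1"
proof (rule ccontr)
  assume no: "\<not> ?thesis"
  define J where "J = {a \<in> A1. a * f \<in> A1}"
  have J: "is_ideal A1 J" unfolding J_def by (rule ideal_of_denominators[OF A1])
  have "\<exists>Q. is_prime_ideal A1 Q \<and> J \<subseteq> Q \<and> Q \<inter> S = {}"
    by (rule prime_avoiding[OF A1 J S(1) _ S(3)]) (use S(2) AA1 no in \<open>auto simp: J_def\<close>)
  then obtain Q where Q: "is_prime_ideal A1 Q" "J \<subseteq> Q" "Q \<inter> S = {}" by blast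
  obtain u v where uv: "u \<in> A" "v \<in> A" "v \<noteq> 0" "f = u / v" using frac[OF affPV] by blast
  then have "v \<in> J" using AA1 by (auto simp: J_def)
  then have "Q \<noteq> {0}" using Q(2) uv by auto
  then obtain x where x: "x \<in> pre V" "x \<in> closed_pts" "A \<inter> mx x = Q \<inter> A" using prime_meet[OF Q(1)] by blast
  have "f \<in> localization_at A1 Q" using f[OF Q(1) x Q(3)] .
  then obtain a s where as: "a \<in> A1" "s \<in> A1" "s \<notin> Q" "s \<noteq> 0" "f = a / s" "s * f = a" by (rule loc_E[OF A1 Q(1)])
  then have "s \<in> J" by (simp add: J_def)
  then show False using Q(2) as(3) by blast
qed

text \<open>Membership in the span of \<open>T\<close> is checked locally on \<open>U\<close>.
  Outside the fibre the local rings agree with those of \<open>X\<close>, so 1 generates. At a point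
  of the fibre the generators of \<open>A1\<close> over \<open>A\<close> do, once denominators not
  vanishing there are cleared.\<close>

lemma C'_finite:
  assumes U: "affine_open X U"
  shows "finite_over (sec X U) (C' U)"
proof -
  let ?C = "sec X U"
  note AU = affine_subring[OF U]
  obtain E where E: "finite E" "E \<subseteq> A1" "\<And>a. a \<in> A1 \<Longrightarrow> \<exists>c. (\<forall>s\<in>E. c s \<in> A) \<and> a = (\<Sum>s\<in>E. c s * s)"
    using finA1 unfolding finite_over_def by auto
  have "\<exists>b. b \<in> ?C - mx x \<and> b * e \<in> C' U" if "x \<in> F \<inter> U" "e \<in> E" for x e
    using approximation[OF U, of x e] over_in_sub[of _ x] that E(2) by blast
  then obtain b where b: "\<And>x e. x \<in> F \<inter> U \<Longrightarrow> e \<in> E \<Longrightarrow> b x e \<in> ?C - mx x \<and> b x e * e \<in> C' U" by metis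
  \<comment> \<open>The generators \<open>e\<close> of \<open>A1\<close> need not be sections over
    \<open>U\<close>; \<open>approximation\<close> supplies multiples that are, by factors
    invertible at the given point of the fibre.\<close>
  define T where "T = insert 1 (\<Union>x\<in>F \<inter> U. (\<lambda>e. b x e * e) ` E)"
  show ?thesis
  proof (rule finite_over_combI[OF AU])
    show "finite T" unfolding T_def using finite_F E(1) by auto
    show "T \<subseteq> C' U" unfolding T_def using b subring_1[OF C'_subring] by auto
    fix f M assume f: "f \<in> C' U" and M: "0 \<in> M" "\<And>u v. u \<in> M \<Longrightarrow> v \<in> M \<Longrightarrow> u + v \<in> M"
      "\<And>a u. a \<in> ?C \<Longrightarrow> u \<in> M \<Longrightarrow> a * u \<in> M" and TM: "T \<subseteq> M"
    have CM: "?C \<subseteq> M" using M(3)[of _ 1] TM by (auto simp: T_def)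
    have sumM: "sum h K \<in> M" if "\<And>k. k \<in> K \<Longrightarrow> h k \<in> M" for h and K :: "'f set"
      using that by (induction K rule: infinite_finite_induct) (auto intro: M(1,2))
    define J where "J = {c \<in> ?C. c * f \<in> M}"
    have J: "is_ideal ?C J" unfolding J_def by (rule ideal_of_multipliers[OF AU M])
    have "1 \<in> J"
    proof (rule ccontr)
      assume "1 \<notin> J"
      then obtain P where P: "is_prime_ideal ?C P" "J \<subseteq> P" using prime_containing[OF AU J] by blast
      obtain x where x: "x \<in> U" "?C \<inter> mx x = P" using affine_point[OF U P(1)] by blast
      have xX: "x \<in> points X" using x affine_points[OF U] by auto
      have notJ: "c \<in> mx x" if "c \<in> ?C" "c * f \<in> M" for c using that P(2) x(2) by (auto simp: J_def)
      show False
      proof (cases "x \<in> F")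
        case False
        obtain z where z: "over z x" "L z = st x" using ex_over_out[OF xX False] by blast
        have "f \<in> st x" using f C'_sub[OF z(1) x(1)] z(2) by auto
        then obtain c d where cd: "c \<in> ?C" "d \<in> ?C" "d \<notin> mx x" "d \<noteq> 0" "f = c / d" "d * f = c" by (rule affine_stalkE[OF U x(1)])
        then show False using notJ[of d] CM by auto
      next
        case True
        have xV: "x \<in> pre V" using F_pre[OF True] .
        have AxL: "A \<subseteq> st x" using affine_sec_stalk[OF affPV xV] .
        have "\<exists>s\<in>A - mx x. s * f \<in> A1"
        proof (rule denominators_A1)
          show "1 \<in> A - mx x" using subring_1[OF A] prime_one[OF mx_prime[OF xX]] by simp
          fix u v assume "u \<in> A - mx x" "v \<in> A - mx x"
          then show "u * v \<in> A - mx x" using subring_mult[OF A] prime_mult[OF mx_prime[OF xX], of u v] AxL by blast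
        next
          fix Q x' assume Q: "is_prime_ideal A1 Q" and x': "x' \<in> pre V" "x' \<in> closed_pts" "A \<inter> mx x' = Q \<inter> A" and "Q \<inter> (A - mx x) = {}"
          then have "A \<inter> mx x' \<subseteq> mx x" by blast
          then have "x' = x" using prime_maximal[OF affPV x'(1) _ xV] x'(2) by (auto simp: closed_pts_def)
          then have AQ: "A \<inter> mx x = Q \<inter> A" using x'(3) by simp
          have "q \<subseteq> Q" using AQ q_F[OF xV] True BA by blast
          then have "Q \<in> N" using Q by (simp add: N_def)
          then obtain z where z: "over z x" "L z = localization_at A1 Q" using ex_over_in[OF _ xV AQ] by blast
          show "f \<in> localization_at A1 Q" using f C'_sub[OF z(1) x(1)] z(2) by auto
        qed auto
        then obtain s where s: "s \<in> A" "s \<notin> mx x" "s * f \<in> A1" by blast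
        obtain a where a: "\<forall>e\<in>E. a e \<in> A" "s * f = (\<Sum>e\<in>E. a e * e)" using E(3)[OF s(3)] by blast
        have "finite (insert s (a ` E))" "insert s (a ` E) \<subseteq> st x" using E(1) s(1) a(1) AxL by auto
        then obtain d where d: "d \<in> ?C - mx x" "\<forall>e\<in>insert s (a ` E). d * e \<in> ?C"
          using common_denominator[OF U x(1)] by blast
        define c where "c = (\<Prod>e\<in>E. b x e)"
        have c: "c \<in> ?C" "c \<in> st x - mx x"
        proof -
          show "c \<in> ?C" unfolding c_def using b True x(1) by (intro subring_prod[OF AU]) auto
          show "c \<in> st x - mx x" unfolding c_def
            using b True x(1) affine_sec_stalk[OF U x(1)] by (intro prime_prod[OF stalk_subring[OF xX] mx_prime[OF xX]]) auto
        qed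
        have "c * (d * s) * f = (\<Sum>e\<in>E. (d * a e) * (c * e))"
          using a(2) by (simp add: sum_distrib_left mult_ac)
        moreover have "(d * a e) * (c * e) \<in> M" if e: "e \<in> E" for e
        proof -
          have eq: "(d * a e) * (c * e) = (d * a e) * ((\<Prod>e'\<in>E - {e}. b x e') * (b x e * e))"
            unfolding c_def using prod.remove[OF E(1) e, of "b x"] by (simp add: mult_ac)
          have "(\<Prod>e'\<in>E - {e}. b x e') \<in> ?C" using b True x(1) by (intro subring_prod[OF AU]) auto
          moreover have "b x e * e \<in> M" using TM True x(1) e by (auto simp: T_def)
          moreover have "d * a e \<in> ?C" using d(2) e by simp
          ultimately show ?thesis unfolding eq by (metis M(3))
        qed
        ultimately have "c * (d * s) * f \<in> M" using sumM by simp
        moreover have "c * (d * s) \<in> ?C" using c d subring_mult[OF AU] by blast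
        ultimately have "c * (d * s) \<in> mx x" using notJ by blast
        moreover have "d \<in> st x" "s \<in> st x" "d * s \<in> st x"
          using d s affine_sec_stalk[OF U x(1)] AxL by auto
        ultimately show False
          using prime_mult[OF mx_prime[OF xX], of c "d * s"] prime_mult[OF mx_prime[OF xX], of d s] c(2) d(1) s(2) by blast
      qed
    qed
    then show "f \<in> M" by (simp add: J_def)
  qed
qed

section \<open>The modification as a variety with group action, finite over the curve\<close>

lemma pull_affine: "affine_open X U \<Longrightarrow> affine_open X' (pull U)"
proof -
  assume U: "affine_open X U"
  note P = pull_open[OF affine_nonempty[OF U]]
  show ?thesis
  proof (rule fam.affine_Z)
    show "\<exists>z\<in>pull U. (\<Inter>z\<in>pull U. L z) \<inter> lmax (L z) = n" if "is_prime_ideal (\<Inter>z\<in>pull U. L z) n" for n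
      using C'_prime[OF U, of n] that by (simp add: C'_def)
    show "L z \<subseteq> localization_at (\<Inter>z\<in>pull U. L z) ((\<Inter>z\<in>pull U. L z) \<inter> lmax (L z))" if "z \<in> pull U" for z
      using C'_loc[OF U that] by (simp add: C'_def)
  qed (use P in auto)
qed

lemma cover_X': "z \<in> I \<Longrightarrow> \<exists>W. affine_open X' W \<and> z \<in> W"
proof -
  assume "z \<in> I"
  then obtain x where x: "over z x" using over_ex by blast
  obtain U where U: "affine_open X U" "x \<in> U" using affine_cover[OF overD(2)[OF x]] by blast
  then show ?thesis using pull_affine[OF U(1)] pull_over[OF x] by blast
qed

lemma integral_X': "integral_scheme X'"
  by (rule fam.integral_Z[OF cover_X'])

text \<open>Separatedness of \<open>X\<close> identifies the two images. Over a point of the fibre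
  both local rings come from the contraction of \<open>n\<close> to \<open>A1\<close>.\<close>

lemma dominated_X': "int_scheme.domination_unique X'"
proof -
  interpret X': int_scheme X' by unfold_locales (rule integral_X')
  show ?thesis unfolding X'.domination_unique_def
  proof (intro allI impI)
    fix E n u v
    assume E: "is_subring E" and n: "is_prime_ideal E n" and "u \<in> points X'" "v \<in> points X'"
      and sub: "X'.st u \<subseteq> E" "X'.st v \<subseteq> E" and dom: "n \<inter> X'.st u = X'.mx u" "n \<inter> X'.st v = X'.mx v"
    then have I: "u \<in> I" "v \<in> I" by (auto simp: fam.points_Z)
    have subL: "L u \<subseteq> E" "L v \<subseteq> E" and domL: "n \<inter> L u = lmax (L u)" "n \<inter> L v = lmax (L v)"
      using sub dom by (simp_all add: fam.stalk_Z I)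
    obtain x where x: "over u x" using over_ex[OF I(1)] by blast
    obtain x' where x': "over v x'" using over_ex[OF I(2)] by blast
    have "x = x'"
    proof (rule domination_uniqueD[OF dominated E n overD(2)[OF x] overD(2)[OF x']])
      show "st x \<subseteq> E" "st x' \<subseteq> E" using overD(3)[OF x] overD(3)[OF x'] subL by auto
      show "n \<inter> st x = mx x" using overD(3,4)[OF x] domL(1) by blast
      show "n \<inter> st x' = mx x'" using overD(3,4)[OF x'] domL(2) by blast
    qed
    have "L u = L v"
    proof (cases "x \<in> F")
      case False
      then show ?thesis using over_out[OF x] over_out[OF x'] \<open>x = x'\<close> by simp
    next
      case True
      obtain Q where Q: "Q \<in> N" "L u = localization_at A1 Q" using over_in[OF x True] by blast
      obtain Q' where Q': "Q' \<in> N" "L v = localization_at A1 Q'" using over_in[OF x'] True \<open>x = x'\<close> by blast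
      have "Q = n \<inter> A1"
        using loc_max_inter[OF A1 N_prime[OF Q(1)]] domL(1) over_in_sub[OF x True] unfolding Q(2)[symmetric] by blast
      moreover have "Q' = n \<inter> A1"
        using loc_max_inter[OF A1 N_prime[OF Q'(1)]] domL(2) over_in_sub[OF x'] True \<open>x = x'\<close> unfolding Q'(2)[symmetric] by blast
      ultimately show ?thesis using Q(2) Q'(2) by simp
    qed
    then show "u = v" by (rule L_inj[OF I])
  qed
qed

lemma variety_X': "variety \<iota> X'"
proof -
  interpret X': int_scheme X' by unfold_locales (rule integral_X')
  have ft: "\<exists>S. finite S \<and> sec X' (pull U) = subring_gen (range \<iota> \<union> S)" if U: "ft_open U" for U
  proof -
    have Ua: "affine_open X U" using ft_affine[OF U] .
    obtain S where S: "finite S" "sec X U = subring_gen (range \<iota> \<union> S)" using U unfolding ft_open_def by blast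
    show ?thesis unfolding sec_X' by (rule finite_type_finite[OF S C'_subring sec_C'[OF Ua] C'_finite[OF Ua]])
  qed
  show ?thesis unfolding variety_def
  proof (intro conjI allI impI)
    show "is_field_hom \<iota>" by (rule hom)
    show "integral_scheme X'" by (rule integral_X')
  next
    fix W assume W: "nonempty_open X' W"
    show "range \<iota> \<subseteq> sec X' W"
    proof
      fix c assume "c \<in> range \<iota>"
      then obtain c' where c': "c = \<iota> c'" by blast
      have "c \<in> L z" if "z \<in> W" for z
      proof -
        have "z \<in> I" using W that by (auto simp: fam.nonempty_Z)
        then obtain x where x: "over z x" using over_ex by blast
        show ?thesis using const_stalk[OF overD(2)[OF x]] overD(3)[OF x] c' by auto
      qed
      then show "c \<in> sec X' W" by (simp add: fam.sec_Z)
    qed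
  next
    obtain \<U> where \<U>: "finite \<U>" "\<Union>\<U> = points X" "\<And>U. U \<in> \<U> \<Longrightarrow> ft_open U" using ft_cover by blast
    have "\<Union>(pull ` \<U>) = points X'"
    proof
      show "points X' \<subseteq> \<Union>(pull ` \<U>)"
      proof
        fix z assume "z \<in> points X'"
        then have z: "z \<in> I" by (simp add: fam.points_Z)
        then have "\<phi> z \<in> points X" using overD(2)[OF over_phi] by blast
        then show "z \<in> \<Union>(pull ` \<U>)" using \<U>(2) z by (auto simp: pull_def)
      qed
    qed (auto simp: pull_def fam.points_Z)
    then show "\<exists>\<U>. finite \<U> \<and> \<Union>\<U> = points X' \<and>
        (\<forall>U\<in>\<U>. affine_open X' U \<and> (\<exists>S. finite S \<and> sec X' U = subring_gen (range \<iota> \<union> S)))"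
      using \<U>(1,3) ft pull_affine ft_affine by (intro exI[of _ "pull ` \<U>"]) simp
  next
    fix U W assume "affine_open X' U \<and> affine_open X' W"
    then have "affine_open X' (U \<inter> W) \<and> sec X' (U \<inter> W) = subring_gen (sec X' U \<union> sec X' W)"
      using X'.domination_separated[OF dominated_X'] by blast
    then show "affine_open X' (U \<inter> W)" "sec X' (U \<inter> W) = subring_gen (sec X' U \<union> sec X' W)" by auto
  qed
qed

lemma finite_phi: "finite_morphism X' X \<phi>"
  unfolding finite_morphism_def dominant_morphism_def preim_pull
proof (intro conjI allI impI ballI)
  show "continuous_map (topo X') (topo X) \<phi>"
    unfolding continuous_map_def
  proof (intro conjI allI impI)
    show "\<phi> \<in> points X' \<rightarrow> points X" using overD(2)[OF over_phi] by (auto simp: fam.points_Z)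
    fix T assume T: "openin (topo X) T"
    have eq: "{z \<in> points X'. \<phi> z \<in> T} = pull T" by (simp add: pull_def fam.points_Z)
    show "openin (topo X') {z \<in> points X'. \<phi> z \<in> T}"
    proof (cases "T = {}")
      case False
      then have "nonempty_open X T" using T by (simp add: nonempty_open_def)
      then show ?thesis unfolding eq fam.open_Z using pull_open by blast
    qed simp
  qed
  fix U assume U: "nonempty_open X U"
  show "pull U \<noteq> {}" using pull_open[OF U] by blast
  show "sec X U \<subseteq> sec X' (pull U)"
    unfolding sec_X'
  proof
    fix f assume f: "f \<in> sec X U"
    show "f \<in> C' U"
    proof (rule C'_I)
      fix z x assume z: "over z x" "x \<in> U"
      have "openin (topo X) U" using U by (simp add: nonempty_open_def)
      then show "f \<in> L z" using sec_stalk[OF _ z(2)] overD(3)[OF z(1)] f by blast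
    qed
  qed
next
  fix z assume "z \<in> points X'"
  then have z: "z \<in> I" by (simp add: fam.points_Z)
  show "max_ideal_at X (\<phi> z) \<subseteq> max_ideal_at X' z"
    unfolding max_ideal_at_eq fam.stalk_Z[OF z] using overD(4)[OF over_phi[OF z]] by blast
next
  fix U assume U: "affine_open X U"
  show "affine_open X' (pull U)" by (rule pull_affine[OF U])
  show "finite_over (sec X U) (sec X' (pull U))" unfolding sec_X' by (rule C'_finite[OF U])
qed

lemma wcomp_invariant: "homog 0 g \<Longrightarrow> wcomp m (g * f) = g * wcomp m f"
  using comp_mult_homog[of 0 g m f] by simp

text \<open>Denominators of \<open>f\<close> can be chosen invariant, and multiplication by an
  invariant commutes with taking components. So the grading of \<open>A1\<close> is used near the
  fibre and that of the sections of \<open>X\<close> elsewhere.\<close>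

lemma graded_C':
  assumes V': "affine_open Y V'"
  shows "graded (C' (pre V'))"
  unfolding graded_def
proof (intro ballI allI)
  fix f m assume f: "f \<in> C' (pre V')"
  let ?U = "pre V'"
  note U = pre_affine[OF V']
  show "wcomp m f \<in> C' ?U"
  proof (rule C'_I)
    fix w x assume w: "over w x" "x \<in> ?U"
    note xX = overD(2)[OF w(1)]
    show "wcomp m f \<in> L w"
    proof (cases "x \<in> F")
      case False
      \<comment> \<open>An invariant that does not vanish at \<open>x\<close> but vanishes on the
        part of the fibre over \<open>V'\<close>: off its zeros \<open>f\<close> is regular on
        \<open>X\<close> itself, so a power of \<open>g\<close> multiplies \<open>f\<close> into a
        graded ring.\<close>
      have "\<exists>g\<in>sec Y V'. g \<notin> mx x \<and> (\<forall>x'\<in>F \<inter> ?U. g \<in> mx x')"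
      proof (cases "\<pi> x0 \<in> V'")
        case True
        have x0U: "x0 \<in> ?U" using True closed_ptsD[OF x0(1)] by (simp add: in_pre)
        have "\<pi> x0 \<noteq> \<pi> x" using False xX by (auto simp: F_def)
        then obtain g where g: "g \<in> sec Y V'" "g \<in> mx x0" "g \<notin> mx x" using fibre_eqI[OF V' x0U x0(1) w(2)] by blast
        have "g \<in> mx x'" if "x' \<in> F" for x'
          using fibre_mx[of x' x0 g] that g Y.affine_sec_stalk[OF V' True] closed_ptsD[OF x0(1)] by (auto simp: F_def)
        then show ?thesis using g by blast
      next
        case False
        then have "F \<inter> ?U = {}" by (auto simp: F_def in_pre)
        then show ?thesis using subring_1[OF Y.affine_subring[OF V']] prime_one[OF mx_prime[OF xX]] by blast
      qed
      then obtain g where g: "g \<in> sec Y V'" "g \<notin> mx x" "\<And>x'. x' \<in> F \<Longrightarrow> x' \<in> ?U \<Longrightarrow> g \<in> mx x'" by blast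
      have gU: "g \<in> sec X ?U" "homog 0 g" using g(1) sec_Y[OF Y.affine_nonempty[OF V']] by auto
      have "\<exists>n. g ^ n * f \<in> sec X ?U"
      proof (rule affine_principal[OF U gU(1)])
        fix x' assume x': "x' \<in> ?U" "g \<notin> mx x'"
        then have "x' \<notin> F" "x' \<in> points X" using g(3) by (auto simp: in_pre)
        then obtain z where z: "over z x'" "L z = st x'" using ex_over_out by blast
        show "f \<in> st x'" using f C'_sub[OF z(1) x'(1)] z(2) by auto
      qed
      then obtain n where n: "g ^ n * f \<in> sec X ?U" by blast
      have gn: "homog 0 (g ^ n)"
      proof -
        have "nmul n (0::'m) = 0" by (induction n) auto
        then show ?thesis using homog_power[OF gU(2), of n] by simp
      qed
      have "g ^ n * wcomp m f \<in> sec X ?U"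
        using gradedD[OF pre_graded[OF V'] n] wcomp_invariant[OF gn] by simp
      then have gf: "g ^ n * wcomp m f \<in> st x" using affine_sec_stalk[OF U w(2)] by auto
      have "g \<in> lunits (st x)" using g(2) gU(1) affine_sec_stalk[OF U w(2)] by (auto simp: lmax_def)
      then have "g ^ n \<in> lunits (st x)" by (rule lunits_power[OF stalk_subring[OF xX]])
      then have gi: "inverse (g ^ n) \<in> st x" "g ^ n \<noteq> 0" by (simp_all add: lunits_def)
      have "inverse (g ^ n) * (g ^ n * wcomp m f) \<in> st x" by (rule subring_mult[OF stalk_subring[OF xX] gi(1) gf])
      moreover have "inverse (g ^ n) * (g ^ n * wcomp m f) = wcomp m f" using gi(2) by (simp add: mult.assoc[symmetric])
      ultimately have "wcomp m f \<in> st x" by (simp only:)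
      then show ?thesis using over_out[OF w(1) False] by simp
    next
      case True
      obtain Q where Q: "Q \<in> N" "L w = localization_at A1 Q" "Q \<inter> A = A \<inter> mx x" using over_in[OF w(1) True] by blast
      have x0X: "x0 \<in> points X" using closed_ptsD[OF x0(1)] .
      have "\<exists>s\<in>B - mx x0. s * f \<in> A1"
      proof (rule denominators_A1)
        show "1 \<in> B - mx x0" using subring_1[OF B] prime_one[OF mx_prime[OF x0X]] by simp
        show "B - mx x0 \<subseteq> A" using BA by auto
        fix u v assume "u \<in> B - mx x0" "v \<in> B - mx x0"
        then show "u * v \<in> B - mx x0"
          using subring_mult[OF B] prime_mult[OF mx_prime[OF x0X], of u v] BA affine_sec_stalk[OF affPV x0_pre] by blast
      next
        fix Q' x' assume Q': "is_prime_ideal A1 Q'" and x': "x' \<in> pre V" "x' \<in> closed_pts" "A \<inter> mx x' = Q' \<inter> A" and "Q' \<inter> (B - mx x0) = {}"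
        then have "B \<inter> mx x' \<subseteq> mx x0" using BA by blast
        then have "\<pi> x' = \<pi> x0" by (rule fibre_eqI[OF affV x'(1,2) x0_pre])
        then have x'F: "x' \<in> F" using x' by (simp add: F_def in_pre)
        then have "q \<subseteq> Q'" using q_F[OF x'(1)] x'(3) BA by blast
        then have "Q' \<in> N" using Q' by (simp add: N_def)
        then obtain z where z: "over z x'" "L z = localization_at A1 Q'" using ex_over_in[OF _ x'(1,3)] by blast
        have "x' \<in> ?U" using x'F True w(2) by (simp add: F_def in_pre)
        then show "f \<in> localization_at A1 Q'" using f C'_sub[OF z(1)] z(2) by auto
      qed
      then obtain s where s: "s \<in> B" "s \<notin> mx x0" "s * f \<in> A1" by blast
      have "homog 0 s" using s(1) sec_Y[OF Y.affine_nonempty[OF affV]] by auto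
      then have "s * wcomp m f \<in> A1" using gradedD[OF grA1 s(3)] wcomp_invariant by simp
      moreover have "s \<notin> Q" using s F_mx[OF True s(1)] Q(3) BA by blast
      moreover have "s \<in> A1" using s BA AA1 by blast
      ultimately show ?thesis unfolding Q(2) using loc_I'[OF A1 N_prime[OF Q(1)]] by blast
    qed
  qed
qed

lemma G_variety_X': "G_variety \<iota> X' \<rho>"
  unfolding G_variety_def
proof (intro conjI ballI)
  show "variety \<iota> X'" by (rule variety_X')
  show "function_field X' = UNIV"
  proof -
    have "f \<in> function_field X'" for f
    proof -
      define W where "W = {z \<in> I. f \<in> L z}"
      have "I - W = {z \<in> I. f \<notin> L z}" by (auto simp: W_def)
      then have "nonempty_open X' W"
        unfolding fam.nonempty_Z using fam.fin[of f] overD(1)[OF g'(1)] g'(2) by (auto simp: W_def)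
      moreover have "f \<in> sec X' W" by (auto simp: fam.sec_Z W_def)
      ultimately show ?thesis unfolding function_field_def by blast
    qed
    then show ?thesis by auto
  qed
  show "coaction \<iota> \<rho>" by (rule coaction)
  fix z assume "z \<in> points X'"
  then have z: "z \<in> I" by (simp add: fam.points_Z)
  obtain x where x: "over z x" using over_ex[OF z] by blast
  obtain V' where V': "affine_open Y V'" "\<pi> x \<in> V'" using Y.affine_cover[OF pi_points[OF overD(2)[OF x]]] by blast
  have "z \<in> pull (pre V')" using pull_over[OF x] V'(2) overD(2)[OF x] by (simp add: in_pre)
  moreover have "stable_affine X' \<rho> (pull (pre V'))"
    unfolding stable_affine_def
    using pull_affine[OF pre_affine[OF V'(1)]] graded_C'[OF V'(1)] unfolding graded_def wcomp_def sec_X' by blast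
  ultimately show "\<exists>U. stable_affine X' \<rho> U \<and> z \<in> U" by blast
qed

text \<open>\<open>A1\<close> consists of regular functions on the part of the modification over
  \<open>pre V\<close>, and an isomorphism leaves no functions there beyond those of
  \<open>A\<close>.\<close>

lemma modification_trivial: "A1 \<subseteq> A"
proof -
  have "is_isomorphism X' X \<phi>" using G_norm G_variety_X' finite_phi unfolding G_normal_def by blast
  then have "sec X' (preim X' \<phi> (pre V)) = A"
    using affine_nonempty[OF affPV] unfolding is_isomorphism_def by blast
  then have "C' (pre V) = A" by (simp add: preim_pull sec_X')
  moreover have "A1 \<subseteq> C' (pre V)"
  proof
    fix a assume a: "a \<in> A1"
    show "a \<in> C' (pre V)"
    proof (rule C'_I)
      fix z x assume z: "over z x" "x \<in> pre V"
      show "a \<in> L z"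
        using A1_outside[OF z(2)] over_out[OF z(1)] over_in_sub[OF z(1)] a by (cases "x \<in> F") auto
    qed
  qed
  ultimately show ?thesis by simp
qed

end

section \<open>The local structure of the quotient map\<close>

text \<open>Division with remainder by \<open>e\<close>: the quotient of the group by
  \<open>H\<close> is cyclic, generated by the class of \<open>d\<close>, and \<open>e\<close> is
  the order of that class.\<close>

lemma transversal_multiples:
  fixes H :: "'m::{ab_group_add,finite} set"
  assumes H: "subgrp H" and e: "e > 0" "nmul e d \<in> H" "\<And>j. 0 < j \<Longrightarrow> j < e \<Longrightarrow> nmul j d \<notin> H"
    and gen: "\<And>m. \<exists>n. m - nmul n d \<in> H"
  shows "transversal H ((\<lambda>j. nmul j d) ` {..<e})" "inj_on (\<lambda>j. nmul j d) {..<e}"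
proof -
  have diff: "nmul j d - nmul i d = nmul (j - i) d" if "i \<le> j" for i j
    using nmul_add[of "j - i" i d] that by simp
  have uniq: "i = j" if "i < e" "j < e" "nmul j d - nmul i d \<in> H" for i j
  proof (rule ccontr)
    assume "i \<noteq> j"
    have *: "nmul i d - nmul j d \<in> H" using subgrp_uminus[OF H that(3)] by simp
    show False
    proof (cases "i < j")
      case True
      then show False using diff[of i j] that e(3)[of "j - i"] by auto
    next
      case False
      then show False using diff[of j i] * \<open>i \<noteq> j\<close> that e(3)[of "i - j"] by auto
    qed
  qed
  show "inj_on (\<lambda>j. nmul j d) {..<e}"
    using uniq H by (intro inj_onI) (auto simp: subgrp_def)
  show "transversal H ((\<lambda>j. nmul j d) ` {..<e})"
    unfolding transversal_def
  proof
    fix m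
    obtain n where n: "m - nmul n d \<in> H" using gen by blast
    have "nmul n d = nmul (n div e) (nmul e d) + nmul (n mod e) d"
      by (simp flip: nmul_add nmul_mult)
    then have eq: "m - nmul (n mod e) d = (m - nmul n d) + nmul (n div e) (nmul e d)" by (simp add: algebra_simps)
    have "nmul (n div e) (nmul e d) \<in> H" using subgrp_nmul[OF H e(2)] .
    then have ex: "m - nmul (n mod e) d \<in> H" unfolding eq using n H by (simp add: subgrp_def)
    show "\<exists>!r. r \<in> (\<lambda>j. nmul j d) ` {..<e} \<and> m - r \<in> H"
    proof (rule ex1I[of _ "nmul (n mod e) d"])
      show "nmul (n mod e) d \<in> (\<lambda>j. nmul j d) ` {..<e} \<and> m - nmul (n mod e) d \<in> H" using ex e(1) by auto
      fix r assume "r \<in> (\<lambda>j. nmul j d) ` {..<e} \<and> m - r \<in> H"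
      then obtain j where j: "j < e" "r = nmul j d" "m - nmul j d \<in> H" by auto
      have "nmul j d - nmul (n mod e) d = (m - nmul (n mod e) d) - (m - nmul j d)" by simp
      then have "nmul j d - nmul (n mod e) d \<in> H" using subgrp_diff[OF H ex j(3)] by simp
      then have "n mod e = j" using uniq[of "n mod e" j] j(1) e(1) by simp
      then show "r = nmul (n mod e) d" using j by simp
    qed
  qed
qed

section \<open>The graded ring along a fibre of the quotient map\<close>

context quotient_curve
begin

text \<open>The stalk at \<open>y\<close> of the direct image of the structure sheaf of
  \<open>X\<close>.\<close>

definition Ay :: "'y \<Rightarrow> 'f set" where
  "Ay y = \<Union>{sec X (pre V) | V. nonempty_open Y V \<and> y \<in> V}"

lemma Ay_sec: "nonempty_open Y V \<Longrightarrow> y \<in> V \<Longrightarrow> sec X (pre V) \<subseteq> Ay y"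
  unfolding Ay_def by blast

lemma Ay_stalk: "x \<in> points X \<Longrightarrow> Ay (\<pi> x) \<subseteq> st x"
proof
  fix f assume x: "x \<in> points X" and "f \<in> Ay (\<pi> x)"
  then obtain V where V: "nonempty_open Y V" "\<pi> x \<in> V" "f \<in> sec X (pre V)" unfolding Ay_def by blast
  have "openin (topo X) (pre V)" using pre_open[OF V(1)] by (simp add: nonempty_open_def)
  then show "f \<in> st x" using sec_stalk[of "pre V" x] x V by (auto simp: in_pre)
qed

text \<open>Neighbourhoods of the fibre are preimages of neighbourhoods in \<open>Y\<close>, and the
  latter contain nonvanishing loci of invariants; hence invariant denominators suffice.\<close>

lemma Ay_frac:
  assumes V: "affine_open Y V" and x: "x \<in> pre V" and f: "f \<in> Ay (\<pi> x)"
  shows "\<exists>b\<in>sec Y V. b \<notin> mx x \<and> b * f \<in> sec X (pre V)"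
proof -
  have xX: "x \<in> points X" and yV: "\<pi> x \<in> V" using x by (auto simp: in_pre)
  obtain V' where V': "nonempty_open Y V'" "\<pi> x \<in> V'" "f \<in> sec X (pre V')" using f unfolding Ay_def by blast
  have oV': "openin (topo Y) V'" using V'(1) by (simp add: nonempty_open_def)
  obtain g where g: "g \<in> sec Y V" "g \<notin> Y.mx (\<pi> x)" "{v \<in> V. g \<notin> Y.mx v} \<subseteq> V'"
    using Y.affine_basis[OF V yV oV' V'(2)] by blast
  have gmx: "g \<in> mx x' \<longleftrightarrow> g \<in> Y.mx (\<pi> x')" if "x' \<in> pre V" for x' using mx_secY[OF V that] g(1) by blast
  have gA: "g \<in> sec X (pre V)" using g(1) sec_YX[OF Y.affine_nonempty[OF V]] by auto
  have "\<exists>n. g ^ n * f \<in> sec X (pre V)"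
  proof (rule affine_principal[OF pre_affine[OF V] gA])
    fix x' assume x': "x' \<in> pre V" "g \<notin> mx x'"
    then have "\<pi> x' \<in> V'" using g(3) gmx[OF x'(1)] by (auto simp: in_pre)
    then have "x' \<in> pre V'" using x'(1) by (simp add: in_pre)
    moreover have "openin (topo X) (pre V')" using pre_open[OF V'(1)] by (simp add: nonempty_open_def)
    ultimately show "f \<in> st x'" using sec_stalk[of "pre V'" x'] V'(3) by auto
  qed
  then obtain n where n: "g ^ n * f \<in> sec X (pre V)" by blast
  have "g ^ n \<notin> mx x"
    using prime_power[OF stalk_subring[OF xX] mx_prime[OF xX], of g n] gmx[OF x] g(2) gA affine_sec_stalk[OF pre_affine[OF V] x] by blast
  then show ?thesis using n subring_power[OF Y.affine_subring[OF V] g(1)] by blast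
qed

lemma stalkY_Ay: "y \<in> points Y \<Longrightarrow> Y.st y \<subseteq> Ay y"
proof
  fix f assume "f \<in> Y.st y"
  then obtain V where "openin (topo Y) V" "y \<in> V" "f \<in> sec Y V" unfolding stalk_def by blast
  then show "f \<in> Ay y" using Ay_sec[of V y] sec_YX[of V] by (auto simp: nonempty_open_def)
qed

lemma Ay_subring: "x \<in> points X \<Longrightarrow> is_subring (Ay (\<pi> x))"
proof -
  assume x: "x \<in> points X"
  have dir: "\<exists>V. nonempty_open Y V \<and> \<pi> x \<in> V \<and> f \<in> sec X (pre V) \<and> g \<in> sec X (pre V)"
    if "f \<in> Ay (\<pi> x)" "g \<in> Ay (\<pi> x)" for f g
  proof -
    obtain V W where V: "nonempty_open Y V" "\<pi> x \<in> V" "f \<in> sec X (pre V)"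
      and W: "nonempty_open Y W" "\<pi> x \<in> W" "g \<in> sec X (pre W)" using \<open>f \<in> _\<close> \<open>g \<in> _\<close> unfolding Ay_def by blast
    have ne: "nonempty_open Y (V \<inter> W)" using Y.open_Int V W by blast
    have "f \<in> sec X (pre (V \<inter> W))"
      using sec_mono[OF pre_open[OF V(1)] pre_open[OF ne]] V(3) by (auto simp: preim_def)
    moreover have "g \<in> sec X (pre (V \<inter> W))"
      using sec_mono[OF pre_open[OF W(1)] pre_open[OF ne]] W(3) by (auto simp: preim_def)
    ultimately show ?thesis using ne V W by blast
  qed
  have inA: "sec X (pre V) \<subseteq> Ay (\<pi> x)" "is_subring (sec X (pre V))" if "nonempty_open Y V" "\<pi> x \<in> V" for V
    using Ay_sec[OF that] sec_subring[OF pre_open[OF that(1)]] by auto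
  obtain V where V: "affine_open Y V" "\<pi> x \<in> V" using Y.affine_cover[OF pi_points[OF x]] by blast
  show ?thesis unfolding is_subring_def
  proof (intro conjI ballI)
    show "0 \<in> Ay (\<pi> x)" "1 \<in> Ay (\<pi> x)"
      using inA[OF Y.affine_nonempty[OF V(1)] V(2)] subring_0 subring_1 by blast+
    fix f g assume "f \<in> Ay (\<pi> x)" "g \<in> Ay (\<pi> x)"
    then obtain W where W: "nonempty_open Y W" "\<pi> x \<in> W" "f \<in> sec X (pre W)" "g \<in> sec X (pre W)" using dir by blast
    show "f - g \<in> Ay (\<pi> x)" "f * g \<in> Ay (\<pi> x)"
      using inA[OF W(1,2)] W(3,4) subring_diff subring_mult by blast+
  qed
qed

lemma invariant_unit:
  assumes V: "affine_open Y V" and x: "x \<in> pre V" and b: "b \<in> sec Y V" "b \<notin> mx x"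
  shows "b \<noteq> 0" "inverse b \<in> Y.st (\<pi> x)"
proof -
  have xX: "x \<in> points X" and yV: "\<pi> x \<in> V" using x by (auto simp: in_pre)
  have "b \<in> Y.st (\<pi> x)" "b \<notin> Y.mx (\<pi> x)" using b mx_secY[OF V x] Y.affine_sec_stalk[OF V yV] by auto
  then show "b \<noteq> 0" "inverse b \<in> Y.st (\<pi> x)" by (auto simp: lmax_def lunits_def)
qed

lemma Ay_divide:
  assumes V: "affine_open Y V" and x: "x \<in> pre V" and b: "b \<in> sec Y V" "b \<notin> mx x" and bf: "b * f \<in> Ay (\<pi> x)"
  shows "f \<in> Ay (\<pi> x)"
proof -
  have xX: "x \<in> points X" using x by (auto simp: in_pre)
  have "inverse b * (b * f) \<in> Ay (\<pi> x)"
    using invariant_unit(2)[OF V x b] stalkY_Ay[OF pi_points[OF xX]] bf subring_mult[OF Ay_subring[OF xX]] by blast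
  then show ?thesis using invariant_unit(1)[OF V x b] by (simp add: mult.assoc[symmetric])
qed

lemma denominators:
  assumes V: "affine_open Y V" and x: "x \<in> pre V"
  shows "finite E \<Longrightarrow> E \<subseteq> Ay (\<pi> x) \<Longrightarrow> \<exists>b\<in>sec Y V. b \<notin> mx x \<and> (\<forall>e\<in>E. b * e \<in> sec X (pre V))"
proof (induction E rule: finite_induct)
  have xX: "x \<in> points X" using x by (simp add: in_pre)
  note A = affine_subring[OF pre_affine[OF V]] and B = Y.affine_subring[OF V] and BA = sec_YX[OF Y.affine_nonempty[OF V]]
  {
    case empty
    then show ?case using subring_1[OF B] prime_one[OF mx_prime[OF xX]] by blast
  next
    case (insert e E)
    obtain b where b: "b \<in> sec Y V" "b \<notin> mx x" "\<forall>e\<in>E. b * e \<in> sec X (pre V)" using insert by auto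
    obtain c where c: "c \<in> sec Y V" "c \<notin> mx x" "c * e \<in> sec X (pre V)" using Ay_frac[OF V x, of e] insert by auto
    have "b \<in> st x" "c \<in> st x" using b(1) c(1) BA affine_sec_stalk[OF pre_affine[OF V] x] by auto
    then have bc: "b * c \<in> sec Y V" "b * c \<notin> mx x"
      using subring_mult[OF B b(1) c(1)] prime_mult[OF mx_prime[OF xX], of b c] b(2) c(2) by blast+
    moreover have "b * c * e' \<in> sec X (pre V)" if "e' \<in> insert e E" for e'
    proof (cases "e' = e")
      case True
      have "b * (c * e) \<in> sec X (pre V)" using subring_mult[OF A] b(1) BA c(3) by blast
      then show ?thesis using True by (simp add: mult.assoc)
    next
      case False
      then have "c * (b * e') \<in> sec X (pre V)" using that subring_mult[OF A] c(1) BA b(3) by blast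
      then show ?thesis by (simp add: mult_ac)
    qed
    ultimately show ?case by blast
  }
qed

lemma Ay_graded: "x \<in> points X \<Longrightarrow> graded (Ay (\<pi> x))"
  unfolding graded_def
proof (intro ballI allI)
  fix f m assume x: "x \<in> points X" and f: "f \<in> Ay (\<pi> x)"
  obtain V where V: "affine_open Y V" "\<pi> x \<in> V" using Y.affine_cover[OF pi_points[OF x]] by blast
  have xV: "x \<in> pre V" using x V by (simp add: in_pre)
  obtain b where b: "b \<in> sec Y V" "b \<notin> mx x" "b * f \<in> sec X (pre V)" using Ay_frac[OF V(1) xV f] by blast
  have "homog 0 b" using b(1) sec_Y[OF Y.affine_nonempty[OF V(1)]] by auto
  then have "b * wcomp m f \<in> sec X (pre V)"
    using gradedD[OF pre_graded[OF V(1)] b(3), of m] comp_mult_homog[of 0 b m f] by simp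
  then have "b * wcomp m f \<in> Ay (\<pi> x)" using Ay_sec[OF Y.affine_nonempty[OF V(1)] V(2)] by auto
  then show "wcomp m f \<in> Ay (\<pi> x)" by (rule Ay_divide[OF V(1) xV b(1,2)])
qed

lemma Ay_invariant: "x \<in> points X \<Longrightarrow> f \<in> Ay (\<pi> x) \<Longrightarrow> homog 0 f \<Longrightarrow> f \<in> Y.st (\<pi> x)"
proof -
  assume x: "x \<in> points X" and f: "f \<in> Ay (\<pi> x)" "homog 0 f"
  obtain V where V: "nonempty_open Y V" "\<pi> x \<in> V" "f \<in> sec X (pre V)" using f(1) unfolding Ay_def by blast
  then have "f \<in> sec Y V" using sec_Y f(2) by auto
  then show ?thesis using V unfolding stalk_def nonempty_open_def by blast
qed

text \<open>The power by the order of \<open>M\<close> is an invariant that does not vanish at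
  \<open>x\<close>, hence a unit already in the local ring of \<open>Y\<close>. Thus homogeneous
  elements behave as in a local ring although the fibre may have several points.\<close>

lemma Ay_unit:
  assumes x: "x \<in> points X" and f: "f \<in> Ay (\<pi> x)" "homog m f" "f \<notin> mx x"
  shows "f \<in> lunits (Ay (\<pi> x))"
proof -
  let ?N = "CARD('m)"
  note R = Ay_subring[OF x]
  have fN: "f ^ ?N \<in> Y.st (\<pi> x)" by (rule Ay_invariant[OF x subring_power[OF R f(1)] homog_power_card[OF f(2)]])
  have "f ^ ?N \<notin> mx x"
    using prime_power[OF stalk_subring[OF x] mx_prime[OF x], of f ?N] f Ay_stalk[OF x] by blast
  then have "f ^ ?N \<notin> Y.mx (\<pi> x)" using mx_YX[OF x] by blast
  then have inv: "inverse (f ^ ?N) \<in> Ay (\<pi> x)" and nz: "f ^ ?N \<noteq> 0"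
    using fN stalkY_Ay[OF pi_points[OF x]] by (auto simp: lmax_def lunits_def)
  have "f * f ^ (?N - 1) = f ^ ?N" by (simp flip: power_Suc)
  then have "inverse f = f ^ (?N - 1) * inverse (f ^ ?N)" using nz by (simp add: field_simps)
  also have "\<dots> \<in> Ay (\<pi> x)" by (rule subring_mult[OF R subring_power[OF R f(1)] inv])
  finally have "inverse f \<in> Ay (\<pi> x)" .
  moreover have "f \<noteq> 0" using nz by auto
  ultimately show ?thesis using f(1) by (simp add: lunits_def)
qed

lemma Ay_unit_notin: "x \<in> points X \<Longrightarrow> f \<in> lunits (Ay (\<pi> x)) \<Longrightarrow> f \<in> lunits (st x)"
  using lunits_mono[OF Ay_stalk] by auto

lemma Ay_unit_not_mx: "x \<in> points X \<Longrightarrow> f \<in> lunits (Ay (\<pi> x)) \<Longrightarrow> f \<notin> mx x"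
  using Ay_unit_notin by (simp add: lmax_def)

text \<open>A homogeneous element that is nonzero at one point of the fibre is a unit along the
  whole fibre.\<close>

lemma Ay_mx_fibre:
  assumes x: "x \<in> points X" "x' \<in> points X" "\<pi> x' = \<pi> x" and f: "f \<in> Ay (\<pi> x)" "homog m f" "f \<in> mx x"
  shows "f \<in> mx x'"
  using Ay_unit[OF x(2), of f m] Ay_unit_not_mx[OF x(1), of f] x(3) f by auto

lemma ft_pre_noetherian:
  assumes V: "Y.ft_open V"
  shows "noetherian (sec X (pre V))"
proof -
  have Va: "affine_open Y V" using Y.ft_affine[OF V] .
  obtain S where S: "finite S" "sec Y V = subring_gen (range \<iota> \<union> S)" using V unfolding Y.ft_open_def by blast
  obtain T where T: "finite T" "sec X (pre V) = subring_gen (range \<iota> \<union> T)"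
    using finite_type_finite[OF S affine_subring[OF pre_affine[OF Va]] sec_YX[OF Y.affine_nonempty[OF Va]] pre_finite[OF Va]] by blast
  show ?thesis unfolding T(2) by (rule noetherian_finite_type[OF hom T(1)])
qed

end

section \<open>The graded maximal ideal at a closed point and its generator\<close>

locale closed_fibre = quotient_curve \<iota> \<rho> X Y \<pi>
  for \<iota> :: "'k::alg_closed_field \<Rightarrow> 'f::field" and \<rho> :: "'f \<Rightarrow> ('m::{ab_group_add,finite} \<Rightarrow>\<^sub>0 'f)"
    and X :: "('x, 'f) ischeme" and Y :: "('y, 'f) ischeme" and \<pi> :: "'x \<Rightarrow> 'y" +
  fixes V :: "'y set" and x :: 'x
  assumes ftV: "Y.ft_open V" and x: "x \<in> closed_pts" "\<pi> x \<in> V"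
begin

abbreviation "A \<equiv> sec X (pre V)"
abbreviation "B \<equiv> sec Y V"
abbreviation "R \<equiv> Ay (\<pi> x)"

lemma affV: "affine_open Y V"
  using ftV Y.ft_affine by auto

lemmas affPV = pre_affine[OF affV]

lemma A: "is_subring A" and B: "is_subring B" and BA: "B \<subseteq> A"
  using affine_subring[OF affPV] Y.affine_subring[OF affV] sec_YX[OF Y.affine_nonempty[OF affV]] by auto

lemma xX: "x \<in> points X" and xV: "x \<in> pre V"
  using closed_ptsD[OF x(1)] x(2) by (auto simp: in_pre)

lemma R: "is_subring R" and AR: "A \<subseteq> R" and Rst: "R \<subseteq> st x" and AG: "graded A" and RG: "graded R"
  using Ay_subring[OF xX] Ay_sec[OF Y.affine_nonempty[OF affV] x(2)] Ay_stalk[OF xX] pre_graded[OF affV] Ay_graded[OF xX] by auto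

lemmas M = mx_ideal[OF xX]

lemma B_homog: "b \<in> B \<Longrightarrow> homog 0 b"
  using sec_Y[OF Y.affine_nonempty[OF affV]] by auto

text \<open>The largest graded ideal of \<open>A\<close> inside the maximal ideal of
  \<open>x\<close>; it depends only on the fibre, and it is the ideal of the orbit of
  \<open>x\<close> on \<open>pre V\<close>.\<close>

definition PP :: "'f set" where
  "PP = {f \<in> A. \<forall>m. wcomp m f \<in> mx x}"

lemma PP_A: "PP \<subseteq> A"
  by (auto simp: PP_def)

lemma PP_ideal: "is_ideal A PP"
proof (rule is_idealI)
  show "0 \<in> PP" using subring_0[OF A] ideal_0[OF M] by (simp add: PP_def)
  fix f g assume "f \<in> PP" "g \<in> PP"
  then show "f + g \<in> PP" using subring_add[OF A] ideal_add[OF M] by (simp add: PP_def comp_add)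
next
  fix a f assume a: "a \<in> A" and f: "f \<in> PP"
  have "wcomp m (a * f) \<in> mx x" for m
    unfolding comp_mult using f a gradedD[OF AG a] AR Rst
    by (intro ideal_sum[OF M] ideal_mult[OF M]) (auto simp: PP_def)
  then show "a * f \<in> PP" using a f subring_mult[OF A] by (simp add: PP_def)
qed (rule PP_A)

lemma PP_comp: "f \<in> PP \<Longrightarrow> wcomp m f \<in> PP"
  using gradedD[OF AG] ideal_0[OF M] by (auto simp: PP_def comp_comp)

lemma PP_homog: "f \<in> A \<Longrightarrow> homog m f \<Longrightarrow> f \<in> mx x \<Longrightarrow> f \<in> PP"
  using comp_homog ideal_0[OF M] by (auto simp: PP_def)

lemma PP_B: "b \<in> B \<Longrightarrow> b \<in> mx x \<Longrightarrow> b \<in> PP"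
  using PP_homog B_homog BA by blast

text \<open>The condition on invariants places the point of \<open>P\<close> in the fibre of
  \<open>x\<close>, and homogeneous elements vanish at all points of a fibre simultaneously.\<close>

lemma PP_in_prime:
  assumes P: "is_prime_ideal A P" "P \<noteq> {0}" and nob: "\<And>b. b \<in> B \<Longrightarrow> b \<in> P \<Longrightarrow> b \<in> mx x"
  shows "PP \<subseteq> P"
proof -
  obtain x' where x': "x' \<in> pre V" "A \<inter> mx x' = P" using affine_point[OF affPV P(1)] by blast
  have x'X: "x' \<in> points X" using x' by (simp add: in_pre)
  have "x' \<noteq> gen"
  proof
    assume "x' = gen"
    then have "P = A \<inter> {0}" using x'(2) mx_gen by simp
    then show False using P(2) subring_0[OF A] by auto
  qed
  then have x'c: "x' \<in> closed_pts" using x'X by (simp add: closed_pts_def)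
  have "B \<inter> mx x' \<subseteq> mx x" using nob x'(2) BA by blast
  then have eq: "\<pi> x' = \<pi> x" by (rule fibre_eqI[OF affV x'(1) x'c xV])
  show ?thesis
  proof
    fix f assume f: "f \<in> PP"
    have "wcomp m f \<in> mx x'" for m
    proof (rule Ay_mx_fibre[OF xX x'X eq _ homog_comp])
      show "wcomp m f \<in> R" using PP_comp[OF f] PP_A AR by blast
      show "wcomp m f \<in> mx x" using f by (simp add: PP_def)
    qed
    then have "(\<Sum>m\<in>UNIV. wcomp m f) \<in> mx x'" by (intro ideal_sum[OF mx_ideal[OF x'X]]) auto
    then show "f \<in> P" using x'(2) f PP_A comp_sum[of f] by auto
  qed
qed

text \<open>Some power of \<open>PP\<close> becomes divisible by \<open>c\<close> in
  \<open>R\<close>. The ideal of \<open>c\<close> contains a product of primes of \<open>A\<close>.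
  Those not containing \<open>PP\<close> contain an invariant that is a unit along the fibre, so
  only the remaining primes count after localization.\<close>

lemma PP_power:
  assumes c: "c \<in> B" "c \<in> mx x" "c \<noteq> 0"
  shows "\<exists>r::nat. \<forall>h. (\<forall>i<r. h i \<in> PP) \<longrightarrow> (\<exists>w\<in>R. (\<Prod>i<r. h i) = c * w)"
proof -
  have cA: "c \<in> A" using c BA by auto
  obtain Ps where Ps: "\<forall>P\<in>set Ps. is_prime_ideal A P \<and> {c * a | a. a \<in> A} \<subseteq> P"
    "\<forall>xs. list_all2 (\<in>) xs Ps \<longrightarrow> prod_list xs \<in> {c * a | a. a \<in> A}"
    using noetherian_prime_product[OF A ft_pre_noetherian[OF ftV] is_ideal_principal[OF A cA]] by blast
  \<comment> \<open>For these positions the given factor is exchanged for the invariant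
    \<open>b i\<close>; the product \<open>b0\<close> of the exchanged factors is inverted in
    \<open>R\<close> afterwards.\<close>
  define bad where "bad i \<longleftrightarrow> \<not> PP \<subseteq> Ps ! i" for i
  have "\<exists>b. b \<in> B \<and> b \<in> Ps ! i \<and> b \<notin> mx x" if "i < length Ps" "bad i" for i
  proof -
    have P: "is_prime_ideal A (Ps ! i)" "c * 1 \<in> Ps ! i" using Ps(1) that(1) subring_1[OF A] by fastforce+
    then show ?thesis using PP_in_prime[OF P(1)] that(2) c(3) unfolding bad_def by auto
  qed
  then obtain b where b: "\<And>i. i < length Ps \<Longrightarrow> bad i \<Longrightarrow> b i \<in> B \<and> b i \<in> Ps ! i \<and> b i \<notin> mx x" by metis
  show ?thesis
  proof (intro exI[of _ "length Ps"] allI impI)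
    fix h assume h: "\<forall>i<length Ps. h i \<in> PP"
    define k where "k i = (if bad i then b i else h i)" for i
    have "list_all2 (\<in>) (map k [0..<length Ps]) Ps"
      unfolding list_all2_conv_all_nth using b h by (auto simp: k_def bad_def)
    then have "prod_list (map k [0..<length Ps]) \<in> {c * a | a. a \<in> A}" using Ps(2) by blast
    then obtain a where a: "a \<in> A" "prod_list (map k [0..<length Ps]) = c * a" by blast
    have "prod_list (map k [0..<n]) = (\<Prod>i<n. k i)" for n by (induction n) auto
    then have pk: "(\<Prod>i<length Ps. k i) = c * a" using a(2) by simp
    define D where "D = {i. i < length Ps \<and> bad i}"
    have b': "b i \<in> B \<and> b i \<notin> mx x" if "i \<in> D" for i using b that by (auto simp: D_def)
    define b0 where "b0 = (\<Prod>i\<in>D. b i)"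
    have b0: "b0 \<in> B" unfolding b0_def using b' by (intro subring_prod[OF B]) auto
    have b0m: "b0 \<notin> mx x"
    proof -
      have "b0 \<in> st x - mx x" unfolding b0_def
        using b' BA AR Rst by (intro prime_prod[OF stalk_subring[OF xX] mx_prime[OF xX]]) blast
      then show ?thesis by blast
    qed
      have split: "(\<Prod>i<length Ps. u i) = (\<Prod>i\<in>D. u i) * (\<Prod>i\<in>{..<length Ps} - D. u i)" for u :: "nat \<Rightarrow> 'f"
    proof -
      have "D \<subseteq> {..<length Ps}" by (auto simp: D_def)
      then show ?thesis using prod.subset_diff[of D "{..<length Ps}" u] by (simp add: mult.commute)
    qed
    have "b0 * (\<Prod>i<length Ps. h i) = (\<Prod>i\<in>D. h i) * (\<Prod>i<length Ps. k i)"
    proof -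
      have "(\<Prod>i\<in>D. k i) = b0" unfolding b0_def by (rule prod.cong) (auto simp: k_def D_def)
      moreover have "(\<Prod>i\<in>{..<length Ps} - D. k i) = (\<Prod>i\<in>{..<length Ps} - D. h i)"
        by (rule prod.cong) (auto simp: k_def D_def)
      ultimately show ?thesis unfolding split[of h] split[of k] by (simp add: mult_ac)
    qed
    then have eq: "b0 * (\<Prod>i<length Ps. h i) = c * ((\<Prod>i\<in>D. h i) * a)" using pk by (simp add: mult_ac)
    have "(\<Prod>i\<in>D. h i) * a \<in> A"
      using h PP_A a(1) by (intro subring_mult[OF A] subring_prod[OF A]) (auto simp: D_def)
    then have "inverse b0 * ((\<Prod>i\<in>D. h i) * a) \<in> R"
      using invariant_unit(2)[OF affV xV b0 b0m] stalkY_Ay[OF pi_points[OF xX]] AR subring_mult[OF R] by blast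
    moreover have "(\<Prod>i<length Ps. h i) = c * (inverse b0 * ((\<Prod>i\<in>D. h i) * a))"
      using eq invariant_unit(1)[OF affV xV b0 b0m] by (simp add: field_simps)
    ultimately show "\<exists>w\<in>R. (\<Prod>i<length Ps. h i) = c * w" by blast
  qed
qed

lemma one_not_multiple: "p \<in> mx x \<Longrightarrow> w \<in> R \<Longrightarrow> p * w \<noteq> 1"
  using ideal_mult_right[OF M, of w p] Rst prime_one[OF mx_prime[OF xX]] by (metis subsetD)

text \<open>\<open>G\<close>-normality makes the endomorphism ring of the ideal \<open>PP\<close> trivial.\<close>

lemma PP_endo:
  assumes z: "\<And>f. f \<in> PP \<Longrightarrow> z * f \<in> PP"
  shows "z \<in> A"
proof -
  define A1 where "A1 = {z. \<forall>f\<in>PP. z * f \<in> PP}"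
  obtain p where p: "p \<in> B" "p \<in> mx x" "p \<noteq> 0" using closed_invariant[OF affV xV x(1)] by blast
  have pP: "p \<in> PP" using PP_B p by blast
  have sub: "is_subring A1"
    unfolding is_subring_def A1_def
    using ideal_0[OF PP_ideal] ideal_diff[OF A PP_ideal] by (auto simp: left_diff_distrib mult.assoc)
  have "modification \<iota> \<rho> X Y \<pi> V x A1"
  proof (intro modification.intro quotient_curve_axioms modification_axioms.intro)
    show "Y.ft_open V" "x \<in> closed_pts" "\<pi> x \<in> V" by (fact ftV x)+
    show "is_subring A1" by (rule sub)
    show "A \<subseteq> A1" using ideal_mult[OF PP_ideal] by (auto simp: A1_def)
    show "graded A1"
      unfolding graded_def
    proof (intro ballI allI)
      fix u m assume u: "u \<in> A1"
      have "wcomp m u * f \<in> PP" if f: "f \<in> PP" for f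
      proof -
        have "wcomp m u * wcomp j f \<in> PP" for j
        proof -
          have "wcomp (m + j) (wcomp j f * u) = wcomp j f * wcomp m u"
            using comp_mult_homog[OF homog_comp, of "m + j" j f u] by simp
          moreover have "u * wcomp j f \<in> PP" using u PP_comp[OF f] by (simp add: A1_def)
          ultimately show ?thesis using PP_comp[of "u * wcomp j f" "m + j"] by (simp add: mult.commute)
        qed
        then have "(\<Sum>j\<in>UNIV. wcomp m u * wcomp j f) \<in> PP" by (intro ideal_sum[OF PP_ideal]) auto
        then show ?thesis using comp_sum[of f] by (simp add: sum_distrib_left[symmetric])
      qed
      then show "wcomp m u \<in> A1" by (simp add: A1_def)
    qed
    show "g * a \<in> A" if "g \<in> B" "g \<in> mx x" "a \<in> A1" for g a
    proof -
      have "a * g \<in> PP" using that PP_B by (auto simp: A1_def)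
      then show ?thesis using PP_A by (auto simp: mult.commute)
    qed
    show "finite_over A A1"
    proof -
      \<comment> \<open>Multiplication by the invariant \<open>p\<close> embeds \<open>A1\<close> as
        an ideal of \<open>A\<close>, which is finitely generated; dividing its generators by
        \<open>p\<close> gives module generators of \<open>A1\<close>.\<close>
      define J where "J = {p * u | u. u \<in> A1}"
      have JA: "J \<subseteq> A" using pP PP_A by (auto simp: J_def A1_def mult.commute)
      have J: "is_ideal A J"
      proof (rule is_idealI[OF JA])
        show "0 \<in> J" using subring_0[OF sub] by (force simp: J_def)
        fix u v assume "u \<in> J" "v \<in> J"
        then obtain u' v' where "u = p * u'" "v = p * v'" "u' \<in> A1" "v' \<in> A1" by (auto simp: J_def)
        then show "u + v \<in> J" using subring_add[OF sub] unfolding J_def by (intro CollectI exI[of _ "u' + v'"]) (auto simp: distrib_left)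
      next
        fix a u assume a: "a \<in> A" and "u \<in> J"
        then obtain u' where "u = p * u'" "u' \<in> A1" by (auto simp: J_def)
        moreover have "a \<in> A1" using a ideal_mult[OF PP_ideal] by (auto simp: A1_def)
        ultimately show "a * u \<in> J" using subring_mult[OF sub] unfolding J_def
          by (intro CollectI exI[of _ "a * u'"]) (auto simp: mult_ac)
      qed
      obtain S where S: "finite S" "S \<subseteq> J" "\<And>J'. is_ideal A J' \<Longrightarrow> S \<subseteq> J' \<Longrightarrow> J \<subseteq> J'"
        using ft_pre_noetherian[OF ftV] J unfolding noetherian_def by meson
      show ?thesis
      proof (rule finite_over_combI[OF A, of "(\<lambda>s. s * inverse p) ` S"])
        show "finite ((\<lambda>s. s * inverse p) ` S)" using S(1) by simp
        show "(\<lambda>s. s * inverse p) ` S \<subseteq> A1"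
        proof (rule image_subsetI)
          fix s assume "s \<in> S"
          then obtain u where "s = p * u" "u \<in> A1" using S(2) unfolding J_def by blast
          then show "s * inverse p \<in> A1" using p(3) by (simp add: field_simps)
        qed
        fix f N assume f: "f \<in> A1" and N: "0 \<in> N" "\<And>u v. u \<in> N \<Longrightarrow> v \<in> N \<Longrightarrow> u + v \<in> N"
          "\<And>a u. a \<in> A \<Longrightarrow> u \<in> N \<Longrightarrow> a * u \<in> N" and SN: "(\<lambda>s. s * inverse p) ` S \<subseteq> N"
        have "is_ideal A {a \<in> A. a * inverse p \<in> N}" by (rule ideal_of_multipliers[OF A N])
        then have "J \<subseteq> {a \<in> A. a * inverse p \<in> N}" using S(2) JA SN by (intro S(3)) auto
        moreover have "p * f \<in> J" using f by (auto simp: J_def)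
        ultimately have "p * f * inverse p \<in> N" by blast
        then show "f \<in> N" using p(3) by (simp add: field_simps)
      qed
    qed
  qed
  then have "A1 \<subseteq> A" by (rule modification.modification_trivial)
  then show ?thesis using z by (auto simp: A1_def)
qed

text \<open>As for discrete valuation rings: take a product of elements of \<open>PP\<close>, as
  long as possible, that is not divisible by an invariant \<open>p\<close> vanishing at
  \<open>x\<close>, and let \<open>z\<close> be a component of this product divided by
  \<open>p\<close>. Then \<open>z\<close> maps \<open>PP\<close> into \<open>R\<close> without lying
  in \<open>R\<close>. If it mapped \<open>PP\<close> into the maximal ideal, it would be an
  endomorphism up to denominators; so it takes some homogeneous \<open>t\<close> to a unit.\<close>

lemma uniformizer_exists:
  "\<exists>t d. t \<in> A \<and> t \<in> mx x \<and> t \<noteq> 0 \<and> homog d t \<and> (\<forall>f m. f \<in> R \<longrightarrow> homog m f \<longrightarrow> f \<in> mx x \<longrightarrow> f / t \<in> R)"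
proof -
  obtain p where p: "p \<in> B" "p \<in> mx x" "p \<noteq> 0" using closed_invariant[OF affV xV x(1)] by blast
  have pR: "p \<in> R" using p BA AR by blast
  define pR where "pR = {p * w | w. w \<in> R}"
  \<comment> \<open>The least good \<open>r\<close> is positive since 1 is not a multiple of
    \<open>p\<close>, and a failing product of \<open>r - 1\<close> factors yields
    \<open>b\<close>.\<close>
  define good where "good r \<longleftrightarrow> (\<forall>h. (\<forall>i<r. h i \<in> PP) \<longrightarrow> (\<Prod>i<r. h i) \<in> pR)" for r :: nat
  have "\<exists>r. good r" using PP_power[OF p] unfolding good_def pR_def by blast
  then obtain r where r: "good r" "\<And>k. k < r \<Longrightarrow> \<not> good k" using exists_least_iff[of good] by blast
  have "r \<noteq> 0"
  proof
    assume "r = 0"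
    then have "1 \<in> pR" using r(1) by (simp add: good_def)
    then show False using one_not_multiple[OF p(2)] by (auto simp: pR_def)
  qed
  then obtain k where k: "r = Suc k" by (cases r) auto
  then obtain h where h: "\<forall>i<k. h i \<in> PP" "(\<Prod>i<k. h i) \<notin> pR" using r(2)[of k] by (auto simp: good_def)
  define b where "b = (\<Prod>i<k. h i)"
  have bP: "b * f \<in> pR" if f: "f \<in> PP" for f
  proof -
    have "(\<Prod>i<Suc k. (h(k := f)) i) \<in> pR"
      using r(1)[unfolded good_def k, rule_format, of "h(k := f)"] h(1) f by (auto simp del: prod.lessThan_Suc)
    moreover have "(\<Prod>i<Suc k. (h(k := f)) i) = b * f"
      unfolding b_def prod.lessThan_Suc by (intro arg_cong2[where f = "(*)"] prod.cong) auto
    ultimately show ?thesis by (simp only:)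
  qed
  have pR_sum: "sum u J \<in> pR" if "\<And>j. j \<in> J \<Longrightarrow> u j \<in> pR" for u :: "'m \<Rightarrow> 'f" and J
  proof -
    have "is_ideal R pR" unfolding pR_def by (rule is_ideal_principal[OF R \<open>p \<in> R\<close>])
    then show ?thesis using that by (rule ideal_sum)
  qed
  have "\<exists>m. wcomp m b \<notin> pR"
  proof (rule ccontr)
    assume "\<not> ?thesis"
    then have "(\<Sum>m\<in>UNIV. wcomp m b) \<in> pR" by (intro pR_sum) auto
    then show False using comp_sum[of b] h(2) by (simp add: b_def)
  qed
  then obtain m where m: "wcomp m b \<notin> pR" by blast
  define z where "z = wcomp m b / p"
  have ph: "homog 0 p" using B_homog p by auto
  have zh: "homog m z" unfolding z_def using homog_divide[OF homog_comp ph] by simp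
  have zR: "z \<notin> R"
  proof
    assume "z \<in> R"
    moreover have "wcomp m b = p * z" using p(3) by (simp add: z_def)
    ultimately show False using m by (auto simp: pR_def)
  qed
  have zP: "z * f \<in> R" if f: "f \<in> PP" for f
  proof -
    have "z * wcomp j f \<in> R" for j
    proof -
      obtain w where w: "w \<in> R" "b * wcomp j f = p * w" using bP[OF PP_comp[OF f]] by (auto simp: pR_def)
      have "wcomp j f * wcomp m b = wcomp (m + j) (wcomp j f * b)"
        using comp_mult_homog[OF homog_comp, of "m + j" j f b] by simp
      also have "\<dots> = wcomp (m + j) (p * w)" using w(2) by (simp add: mult.commute)
      also have "\<dots> = p * wcomp (m + j) w" using comp_mult_homog[OF ph, of "m + j" w] by simp
      finally have "z * wcomp j f = wcomp (m + j) w" using p(3) by (simp add: z_def field_simps)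
      then show ?thesis using gradedD[OF RG w(1)] by simp
    qed
    then have "(\<Sum>j\<in>UNIV. z * wcomp j f) \<in> R" by (intro subring_sum[OF R])
    then show ?thesis using comp_sum[of f] by (simp add: sum_distrib_left[symmetric])
  qed
  have "\<exists>f j. f \<in> PP \<and> homog j f \<and> z * f \<notin> mx x"
  proof (rule ccontr)
    assume no: "\<not> ?thesis"
    obtain S where S: "finite S" "S \<subseteq> PP" "\<And>J'. is_ideal A J' \<Longrightarrow> S \<subseteq> J' \<Longrightarrow> PP \<subseteq> J'"
      using ft_pre_noetherian[OF ftV] PP_ideal unfolding noetherian_def by meson
    \<comment> \<open>An invariant \<open>g\<close> clears the denominators of \<open>z\<close> on
      finitely many generators of \<open>PP\<close>. Under the assumption to be refuted,
      \<open>g * z\<close> then maps \<open>PP\<close> to itself, hence lies in \<open>A\<close> by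
      \<open>PP_endo\<close>, and \<open>z\<close> would lie in \<open>R\<close>.\<close>
    define E where "E = (\<lambda>(s, j). z * wcomp j s) ` (S \<times> UNIV)"
    have "finite E" "E \<subseteq> R" using S zP PP_comp by (auto simp: E_def)
    then obtain g where g: "g \<in> B" "g \<notin> mx x" "\<forall>e\<in>E. g * e \<in> A" using denominators[OF affV xV] by blast
    have gz: "g * z * wcomp j s \<in> PP" if "s \<in> S" for s j
    proof (rule PP_homog)
      show "homog (0 + m + j) (g * z * wcomp j s)"
        by (intro homog_mult B_homog g(1) zh homog_comp)
      show "g * z * wcomp j s \<in> A" using g(3) that by (auto simp: E_def mult.assoc)
      have zf: "z * wcomp j s \<in> mx x" using no PP_comp that S(2) homog_comp by blast
      show "g * z * wcomp j s \<in> mx x"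
        unfolding mult.assoc by (rule ideal_mult[OF M _ zf]) (use g(1) BA AR Rst in auto)
    qed
    have "g * z * s \<in> PP" if "s \<in> S" for s
    proof -
      have "(\<Sum>j\<in>UNIV. g * z * wcomp j s) \<in> PP" using gz[OF that] by (intro ideal_sum[OF PP_ideal])
      then show ?thesis using comp_sum[of s] by (simp add: sum_distrib_left[symmetric])
    qed
    moreover have "is_ideal A {a \<in> A. a * (g * z) \<in> PP}"
      by (rule ideal_of_multipliers[OF A]) (auto intro: ideal_0[OF PP_ideal] ideal_add[OF PP_ideal] ideal_mult[OF PP_ideal])
    ultimately have "PP \<subseteq> {a \<in> A. a * (g * z) \<in> PP}" using S(2) PP_A by (intro S(3)) (auto simp: mult_ac)
    then have "g * z \<in> A" by (intro PP_endo) (auto simp: mult_ac)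
    then have "g * z \<in> R" using AR by auto
    then show False using Ay_divide[OF affV xV g(1,2)] zR by blast
  qed
  then obtain t d where t: "t \<in> PP" "homog d t" "z * t \<notin> mx x" by blast
  have tA: "t \<in> A" and tm: "t \<in> mx x"
    using t comp_homog[OF t(2), of d] by (auto simp: PP_def dest: spec[of _ d])
  have "t \<noteq> 0" using t(3) ideal_0[OF M] by auto
  have zt: "inverse (z * t) \<in> R" "z * t \<noteq> 0"
    using Ay_unit[OF xX zP[OF t(1)] homog_mult[OF zh t(2)] t(3)] by (auto simp: lunits_def)
  \<comment> \<open>As \<open>z * t\<close> is a unit, division by \<open>t\<close> amounts to
    multiplication by \<open>z\<close> up to that unit, and \<open>z\<close> takes \<open>PP\<close>
    into \<open>R\<close>.\<close>
  have "f / t \<in> R" if f: "f \<in> R" "homog j f" "f \<in> mx x" for f j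
  proof -
    obtain c where c: "c \<in> B" "c \<notin> mx x" "c * f \<in> A" using Ay_frac[OF affV xV f(1)] by blast
    have "c * f \<in> PP"
    proof (rule PP_homog[OF c(3)])
      show "homog (0 + j) (c * f)" by (intro homog_mult B_homog c f)
      show "c * f \<in> mx x" using ideal_mult[OF M _ f(3)] c(1) BA AR Rst by auto
    qed
    then have "z * (c * f) * inverse (z * t) \<in> R" using subring_mult[OF R zP zt(1)] by blast
    moreover have "c * (f / t) = z * (c * f) * inverse (z * t)" using zt(2) by (simp add: field_simps)
    ultimately have "c * (f / t) \<in> R" by simp
    then show ?thesis by (rule Ay_divide[OF affV xV c(1,2)])
  qed
  then show ?thesis using tA tm \<open>t \<noteq> 0\<close> t(2) by blast
qed

end

section \<open>Powers of the uniformizer, degrees of units and the stabilizer\<close>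

context closed_fibre
begin

abbreviation "val \<equiv> value_at \<iota> X x"

definition t :: 'f where
  "t = (SOME t. t \<in> A \<and> t \<in> mx x \<and> t \<noteq> 0 \<and> (\<exists>d. homog d t) \<and>
     (\<forall>f m. f \<in> R \<longrightarrow> homog m f \<longrightarrow> f \<in> mx x \<longrightarrow> f / t \<in> R))"

definition d :: 'm where
  "d = (SOME d. homog d t)"

lemma t: "t \<in> A" "t \<in> mx x" "t \<noteq> 0" "homog d t"
  "f \<in> R \<Longrightarrow> homog m f \<Longrightarrow> f \<in> mx x \<Longrightarrow> f / t \<in> R"
proof -
  have "\<exists>t. t \<in> A \<and> t \<in> mx x \<and> t \<noteq> 0 \<and> (\<exists>d. homog d t) \<and>
     (\<forall>f m. f \<in> R \<longrightarrow> homog m f \<longrightarrow> f \<in> mx x \<longrightarrow> f / t \<in> R)"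
    using uniformizer_exists by blast
  then have *: "t \<in> A \<and> t \<in> mx x \<and> t \<noteq> 0 \<and> (\<exists>d. homog d t) \<and>
     (\<forall>f m. f \<in> R \<longrightarrow> homog m f \<longrightarrow> f \<in> mx x \<longrightarrow> f / t \<in> R)"
    unfolding t_def by (rule someI_ex)
  then show "t \<in> A" "t \<in> mx x" "t \<noteq> 0" by auto
  show "homog d t" unfolding d_def using * by (intro someI_ex[of "\<lambda>d. homog d t"]) blast
  show "f \<in> R \<Longrightarrow> homog m f \<Longrightarrow> f \<in> mx x \<Longrightarrow> f / t \<in> R" using * by blast
qed

abbreviation "U \<equiv> lunits R"

lemma tR: "t \<in> R"
  using t(1) AR by auto

lemma t_power_div: "w \<in> R \<Longrightarrow> t * w \<noteq> 1"
  using one_not_multiple[OF t(2)] .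

text \<open>The factor \<open>t\<close> is split off as long as the quotient stays in
  \<open>R\<close>. At the last step the quotient does not vanish at \<open>x\<close>, since
  homogeneous elements vanishing there are divisible by \<open>t\<close>, so it is a unit. The bound
  on the exponent comes from \<open>PP_power\<close>.\<close>

lemma unit_decomp_R:
  assumes f: "f \<in> R" "homog m f" "f \<noteq> 0"
  shows "\<exists>n. \<exists>v\<in>U. f = v * t ^ n"
proof -
  have "\<exists>n. f / t ^ Suc n \<notin> R"
  proof (cases "f \<in> mx x")
    case False
    then have inv: "inverse f \<in> R" using Ay_unit[OF xX f(1,2)] by (simp add: lunits_def)
    have "f / t ^ Suc 0 \<notin> R"
    proof
      assume "f / t ^ Suc 0 \<in> R"
      then have "f / t \<in> R" by simp
      then have "f / t * inverse f \<in> R" by (rule subring_mult[OF R _ inv])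
      moreover have "t * (f / t * inverse f) = 1" using f(3) t(3) by simp
      ultimately show False using t_power_div by blast
    qed
    then show ?thesis by blast
  next
    case True
    let ?N = "CARD('m)"
    have fNR: "f ^ ?N \<in> R" using subring_power[OF R f(1)] .
    have fN: "f ^ ?N = f ^ (?N - 1) * f" by (metis power_minus_mult zero_less_card_finite)
    have fNm: "f ^ ?N \<in> mx x" unfolding fN
      using ideal_mult[OF M _ True] subring_power[OF R f(1)] Rst by blast
    obtain b where b: "b \<in> B" "b \<notin> mx x" "b * f ^ ?N \<in> A" using Ay_frac[OF affV xV fNR] by blast
    define c where "c = b * f ^ ?N"
    have "homog (0 + 0) c" unfolding c_def by (intro homog_mult B_homog b homog_power_card[OF f(2)])
    then have cB: "c \<in> B" using b(3) sec_Y[OF Y.affine_nonempty[OF affV]] by (simp add: c_def)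
    have cm: "c \<in> mx x" unfolding c_def using ideal_mult[OF M _ fNm] b(1) BA AR Rst by blast
    have c0: "c \<noteq> 0" using invariant_unit(1)[OF affV xV b(1,2)] f(3) by (simp add: c_def)
    obtain r :: nat where r: "\<forall>h. (\<forall>i<r. h i \<in> PP) \<longrightarrow> (\<exists>w\<in>R. (\<Prod>i<r. h i) = c * w)"
      using PP_power[OF cB cm c0] by blast
    have "t \<in> PP" by (rule PP_homog[OF t(1,4,2)])
    then obtain w where w: "w \<in> R" "t ^ r = c * w" using r[rule_format, of "\<lambda>_. t"] by auto
    \<comment> \<open>By the choice of \<open>r\<close>, \<open>t ^ r\<close> is a multiple of
      \<open>c\<close>, hence of \<open>f\<close>. If \<open>t ^ Suc r\<close> divided
      \<open>f\<close>, then \<open>t\<close> would divide 1.\<close>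
    have "f / t ^ Suc r \<notin> R"
    proof
      assume g: "f / t ^ Suc r \<in> R"
      have "b \<in> R" using b(1) BA AR by auto
      then have in_R: "f / t ^ Suc r * (b * f ^ (?N - 1) * w) \<in> R"
        using g w(1) subring_power[OF R f(1)] by (intro subring_mult[OF R])
      have tr: "f * (b * f ^ (?N - 1) * w) = t ^ r" using w(2) fN by (simp add: c_def mult_ac)
      have "t * (f / t ^ Suc r * (b * f ^ (?N - 1) * w)) = f * (b * f ^ (?N - 1) * w) / t ^ r"
        using t(3) by simp
      also have "\<dots> = 1" unfolding tr using t(3) by simp
      finally have "t * (f / t ^ Suc r * (b * f ^ (?N - 1) * w)) = 1" .
      then show False using t_power_div[OF in_R] by simp
    qed
    then show ?thesis by blast
  qed
  then obtain n where n: "f / t ^ Suc n \<notin> R" "\<And>k. k < n \<Longrightarrow> f / t ^ Suc k \<in> R"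
    using exists_least_iff[of "\<lambda>n. f / t ^ Suc n \<notin> R"] by blast
  define v where "v = f / t ^ n"
  have vR: "v \<in> R" unfolding v_def using n(2)[of "n - 1"] f(1) by (cases n) auto
  have vh: "homog (m - nmul n d) v" unfolding v_def by (rule homog_divide[OF f(2) homog_power[OF t(4)]])
  have "v \<notin> mx x"
  proof
    assume "v \<in> mx x"
    then have "v / t \<in> R" by (rule t(5)[OF vR vh])
    then show False using n(1) by (simp add: v_def field_simps)
  qed
  then have "v \<in> U" by (rule Ay_unit[OF xX vR vh])
  moreover have "f = v * t ^ n" using t(3) by (simp add: v_def)
  ultimately show ?thesis by blast
qed

text \<open>A negative exponent appears as \<open>f * t ^ n = v\<close>. The denominator of
  \<open>f\<close> is made invariant by \<open>norm_exists\<close>; then numerator and denominator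
  are homogeneous elements of \<open>R\<close> and are decomposed separately.\<close>

lemma unit_decomp:
  assumes f: "homog m f" "f \<noteq> 0"
  shows "\<exists>n. \<exists>v\<in>U. f = v * t ^ n \<or> f * t ^ n = v"
proof -
  obtain a b where ab: "a \<in> A" "b \<in> A" "b \<noteq> 0" "f = a / b" using frac[OF affPV] by blast
  obtain g where g: "g \<in> A" "b * g \<in> B" "b * g \<noteq> 0" using norm_exists[OF affV ab(2,3)] by blast
  have eq: "f * (b * g) = a * g" using ab by simp
  have bg: "homog 0 (b * g)" using B_homog g(2) by auto
  have h: "homog (m + 0) (f * (b * g))" by (rule homog_mult[OF f(1) bg])
  have "f * (b * g) \<in> R" unfolding eq using subring_mult[OF A ab(1) g(1)] AR by auto
  then obtain n v where nv: "v \<in> U" "f * (b * g) = v * t ^ n" using unit_decomp_R[OF _ h] f(2) g(3) by (metis mult_eq_0_iff)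
  have "b * g \<in> R" using g(2) BA AR by auto
  then obtain l w where lw: "w \<in> U" "b * g = w * t ^ l" using unit_decomp_R[OF _ bg g(3)] by blast
  have w0: "w \<noteq> 0" using lw(1) by (simp add: lunits_def)
  have vw: "v * inverse w \<in> U" using lunits_mult[OF R nv(1) lunits_inverse[OF lw(1)]] .
  have fe: "f * t ^ l = v * inverse w * t ^ n" using nv(2) lw(2) w0 by (simp add: field_simps)
  show ?thesis
  proof (cases "l \<le> n")
    case True
    then have "f * t ^ l = (v * inverse w * t ^ (n - l)) * t ^ l" using fe by (simp flip: power_add add: mult.assoc)
    then have "f = v * inverse w * t ^ (n - l)" using t(3) by simp
    then show ?thesis using vw by blast
  next
    case False
    then have "(f * t ^ (l - n)) * t ^ n = v * inverse w * t ^ n" using fe by (simp flip: power_add add: mult.assoc)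
    then have "f * t ^ (l - n) = v * inverse w" using t(3) by simp
    then show ?thesis using vw by blast
  qed
qed

definition H :: "'m set" where
  "H = {m. \<exists>v\<in>U. homog m v}"

lemma H: "subgrp H"
  unfolding subgrp_def
proof (intro conjI ballI)
  show "0 \<in> H" unfolding H_def using lunits_1[OF R] homog_1 by blast
  fix a b assume "a \<in> H" "b \<in> H"
  then obtain v w where "v \<in> U" "w \<in> U" "homog a v" "homog b w" unfolding H_def by blast
  then show "a + b \<in> H" unfolding H_def using lunits_mult[OF R] homog_mult by blast
qed

lemma unit_degree:
  assumes "homog m f" "f \<noteq> 0" "v \<in> U" "f = v * t ^ n"
  shows "m - nmul n d \<in> H" "homog (m - nmul n d) v"
proof -
  have "v = f / t ^ n" using assms(4) t(3) by simp
  then show "homog (m - nmul n d) v" using homog_divide[OF assms(1) homog_power[OF t(4)]] by simp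
  then show "m - nmul n d \<in> H" using assms(3) by (auto simp: H_def)
qed

lemma degrees_generated: "\<exists>n. m - nmul n d \<in> H"
proof -
  obtain f where f: "f \<noteq> 0" "homog m f" using degrees_of_faithful[OF faithful] by blast
  obtain n v where nv: "v \<in> U" "f = v * t ^ n \<or> f * t ^ n = v" using unit_decomp[OF f(2,1)] by blast
  show ?thesis
  proof (cases "f = v * t ^ n")
    case True
    then show ?thesis using unit_degree(1)[OF f(2,1) nv(1)] by blast
  next
    case False
    then have "f * t ^ n = v" using nv(2) by blast
    then have "homog (m + nmul n d) v" using homog_mult[OF f(2) homog_power[OF t(4)], of n] by simp
    then have "m + nmul n d \<in> H" using nv(1) by (auto simp: H_def)
    \<comment> \<open>Multiples are taken by natural numbers, so the negative of
      \<open>nmul n d\<close> is rewritten as a positive multiple of \<open>d\<close>.\<close>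
    moreover have "nmul (n * (CARD('m) - 1)) d = - nmul n d"
      using nmul_card_pred[of "nmul n d"] nmul_mult[of "CARD('m) - 1" n d] by (simp add: mult.commute)
    ultimately have "m - nmul (n * (CARD('m) - 1)) d \<in> H" by simp
    then show ?thesis by blast
  qed
qed

definition e :: nat where
  "e = (LEAST e. e > 0 \<and> nmul e d \<in> H)"

lemma e: "e > 0" "nmul e d \<in> H" "0 < j \<Longrightarrow> j < e \<Longrightarrow> nmul j d \<notin> H"
proof -
  have "CARD('m) > 0 \<and> nmul (CARD('m)) d \<in> H" using nmul_card[of d] H by (simp add: subgrp_def)
  then have *: "e > 0 \<and> nmul e d \<in> H" unfolding e_def by (rule LeastI)
  then show "e > 0" "nmul e d \<in> H" by auto
  show "0 < j \<Longrightarrow> j < e \<Longrightarrow> nmul j d \<notin> H"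
    using not_less_Least[of j "\<lambda>e. e > 0 \<and> nmul e d \<in> H", folded e_def] by simp
qed

lemmas transversal_H = transversal_multiples[OF H e degrees_generated]

lemma degree_rep: "\<exists>j<e. m - nmul j d \<in> H"
proof -
  have "\<exists>r. r \<in> (\<lambda>j. nmul j d) ` {..<e} \<and> m - r \<in> H"
    using transversal_H(1) unfolding transversal_def by blast
  then show ?thesis by auto
qed

lemma value_at_eq:
  assumes "f \<in> st x"
  shows "f - \<iota> (val f) \<in> mx x"
proof -
  obtain c where c: "f - \<iota> c \<in> mx x" using residue[OF x(1) assms] by blast
  have "c' = c" if "f - \<iota> c' \<in> mx x" for c'
  proof -
    have "(f - \<iota> c') - (f - \<iota> c) \<in> mx x" by (rule ideal_diff[OF stalk_subring[OF xX] M that c])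
    then have "\<iota> (c - c') \<in> mx x" by (simp add: is_field_homD(6)[OF hom])
    then show ?thesis using const_max[OF xX] by auto
  qed
  then have "val f = c" unfolding value_at_def max_ideal_at_eq using c by (intro the_equality)
  then show ?thesis using c by simp
qed

lemma value_unique:
  assumes "f \<in> st x" "f - \<iota> c \<in> mx x"
  shows "val f = c"
proof -
  have "(f - \<iota> c) - (f - \<iota> (val f)) \<in> mx x"
    by (rule ideal_diff[OF stalk_subring[OF xX] M assms(2) value_at_eq[OF assms(1)]])
  then have "\<iota> (val f - c) \<in> mx x" by (simp add: is_field_homD(6)[OF hom])
  then show ?thesis using const_max[OF xX] by auto
qed

lemma value_zero_iff: "f \<in> st x \<Longrightarrow> val f = 0 \<longleftrightarrow> f \<in> mx x"
  using value_at_eq[of f] value_unique[of f 0] is_field_homD(4)[OF hom] by auto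

lemma value_add: "f \<in> st x \<Longrightarrow> g \<in> st x \<Longrightarrow> val (f + g) = val f + val g"
proof (rule value_unique)
  assume f: "f \<in> st x" and g: "g \<in> st x"
  show "f + g \<in> st x" using subring_add[OF stalk_subring[OF xX] f g] .
  have "f + g - \<iota> (val f + val g) = (f - \<iota> (val f)) + (g - \<iota> (val g))"
    by (simp add: is_field_homD(2)[OF hom])
  also have "\<dots> \<in> mx x" by (rule ideal_add[OF M value_at_eq[OF f] value_at_eq[OF g]])
  finally show "f + g - \<iota> (val f + val g) \<in> mx x" .
qed

lemma value_0: "val 0 = 0"
  using value_zero_iff[OF subring_0[OF stalk_subring[OF xX]]] ideal_0[OF M] by simp

lemma value_sum: "(\<And>i. i \<in> I \<Longrightarrow> f i \<in> st x) \<Longrightarrow> val (\<Sum>i\<in>I. f i) = (\<Sum>i\<in>I. val (f i))"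
  by (induction I rule: infinite_finite_induct) (auto simp: value_0 value_add subring_sum[OF stalk_subring[OF xX]])

lemma lookup_orbit_map: "lk (orbit_map \<iota> X \<rho> x f) m = val (wcomp m f)"
  by (simp add: orbit_map_def map.rep_eq wcomp_def value_0 when_def)

text \<open>Negative powers of \<open>t\<close> have a pole at every point of the fibre.\<close>

lemma graded_in_R:
  assumes S: "graded S" and x': "x' \<in> points X" "\<pi> x' = \<pi> x" and sub: "S \<subseteq> st x'"
  shows "S \<subseteq> R"
proof
  fix f assume f: "f \<in> S"
  have "wcomp m f \<in> R" for m
  proof (cases "wcomp m f = 0")
    case True
    then show ?thesis using subring_0[OF R] by simp
  next
    case False
    obtain n v where nv: "v \<in> U" "wcomp m f = v * t ^ n \<or> wcomp m f * t ^ n = v"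
      using unit_decomp[OF homog_comp False] by blast
    have vR: "v \<in> R" using nv(1) by (simp add: lunits_def)
    show ?thesis
    proof (cases "wcomp m f = v * t ^ n")
      case True
      then show ?thesis using subring_mult[OF R vR subring_power[OF R tR]] by simp
    next
      case False
      then have v: "wcomp m f * t ^ n = v" using nv(2) by blast
      have "n = 0"
      proof (rule ccontr)
        assume "n \<noteq> 0"
        have tx': "t \<in> mx x'" by (rule Ay_mx_fibre[OF xX x' tR t(4,2)])
        have "t ^ n = t ^ (n - 1) * t" using \<open>n \<noteq> 0\<close> power_minus_mult[of n t] by simp
        moreover have "t ^ (n - 1) \<in> st x'" using subring_power[OF stalk_subring[OF x'(1)]] tx' lmax_subset by blast
        ultimately have "t ^ n \<in> mx x'" using ideal_mult[OF mx_ideal[OF x'(1)] _ tx'] by simp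
        moreover have "wcomp m f \<in> st x'" using gradedD[OF S f] sub by auto
        ultimately have "v \<in> mx x'" using ideal_mult[OF mx_ideal[OF x'(1)]] v by blast
        moreover have "v \<in> lunits (Ay (\<pi> x'))" using nv(1) x'(2) by simp
        ultimately show False using Ay_unit_not_mx[OF x'(1)] by blast
      qed
      then show ?thesis using v vR by simp
    qed
  qed
  then have "(\<Sum>m\<in>UNIV. wcomp m f) \<in> R" by (intro subring_sum[OF R])
  then show "f \<in> R" by (simp add: comp_sum)
qed

lemma stable_in_R:
  assumes W: "stable_affine X \<rho> W" and x': "x' \<in> W" "\<pi> x' = \<pi> x"
  shows "sec X W \<subseteq> R"
proof -
  have Wa: "affine_open X W" using W by (simp add: stable_affine_def)
  then have x'X: "x' \<in> points X" using x' affine_points by auto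
  show ?thesis by (rule graded_in_R[OF stable_graded[OF W] x'X x'(2) affine_sec_stalk[OF Wa x'(1)]])
qed

text \<open>The sections of \<open>W\<close> lie in \<open>R\<close> and hence in the stalk of
  \<open>x''\<close>. Its maximal ideal contracts to a point of \<open>W\<close> dominated by that
  stalk, which is \<open>x''\<close> by separatedness.\<close>

lemma stable_fibre:
  assumes W: "stable_affine X \<rho> W" and x': "x' \<in> W" "\<pi> x' = \<pi> x" and x'': "x'' \<in> points X" "\<pi> x'' = \<pi> x"
  shows "x'' \<in> W"
proof -
  have Wa: "affine_open X W" using W by (simp add: stable_affine_def)
  have sub: "sec X W \<subseteq> st x''" using stable_in_R[OF W x'] Ay_stalk[OF x''(1)] x''(2) by auto
  note AW = affine_subring[OF Wa]
  obtain w where w: "w \<in> W" "sec X W \<inter> mx w = mx x'' \<inter> sec X W"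
    using affine_point[OF Wa prime_inter[OF AW sub mx_prime[OF x''(1)]]] by blast
  have wX: "w \<in> points X" using w affine_points[OF Wa] by auto
  have L: "localization_at (st x'') (mx x'') \<subseteq> st x''"
  proof
    fix f assume "f \<in> localization_at (st x'') (mx x'')"
    then obtain a b where ab: "a \<in> st x''" "b \<in> st x''" "b \<notin> mx x''" "f = a / b" unfolding localization_at_def by blast
    then have "inverse b \<in> st x''" by (auto simp: lmax_def lunits_def)
    then show "f \<in> st x''" using ab subring_mult[OF stalk_subring[OF x''(1)]] by (simp add: divide_inverse)
  qed
  have stw: "st w = localization_at (sec X W) (mx x'' \<inter> sec X W)"
    using affine_stalk[OF Wa w(1)] unfolding w(2) .
  have lx: "localization_at (st x'') (mx x'') = st x''"
    using L loc_superset[OF stalk_subring[OF x''(1)] mx_prime[OF x''(1)]] by blast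
  note lm = loc_mono[OF AW stalk_subring[OF x''(1)] sub mx_prime[OF x''(1)], folded stw, unfolded lx]
  have "w = x''"
    by (rule domination_uniqueD[OF dominated stalk_subring[OF x''(1)] mx_prime[OF x''(1)] wX x''(1) lm(1) order_refl lm(2)])
      (use lmax_subset[of "st x''"] in blast)
  then show ?thesis using w by simp
qed

text \<open>For a function vanishing at \<open>x\<close>, components with degree outside
  \<open>H\<close> vanish at \<open>x\<close>, and the values of the others add up to zero; so the
  coset sums vanish. Conversely, a homogeneous unit of degree \<open>n\<close> minus its value
  gives, up to a constant, the difference of the characters \<open>n\<close> and 0.\<close>

lemma stab_ideal_eq: "stab_ideal \<iota> X \<rho> x = coset_ideal H"
proof
  let ?gens = "{orbit_map \<iota> X \<rho> x f | f W. stable_affine X \<rho> W \<and> x \<in> W \<and> f \<in> sec X W \<and> val f = 0}"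
  show "stab_ideal \<iota> X \<rho> x \<subseteq> coset_ideal H"
    unfolding stab_ideal_def ideal_gen_def
  proof (rule Inter_lower, intro CollectI conjI is_ideal_coset subsetI)
    fix h assume "h \<in> ?gens"
    then obtain f W where h: "h = orbit_map \<iota> X \<rho> x f" and W: "stable_affine X \<rho> W" "x \<in> W" "f \<in> sec X W" "val f = 0" by blast
    have fR: "wcomp m f \<in> R" for m
      using stable_in_R[OF W(1,2) refl] gradedD[OF stable_graded[OF W(1)] W(3)] by auto
    then have fst: "wcomp m f \<in> st x" for m using Rst by auto
    have zero: "val (wcomp m f) = 0" if "m \<notin> H" for m
      unfolding value_zero_iff[OF fst] using that Ay_unit[OF xX fR homog_comp] homog_comp by (auto simp: H_def)
    have "(\<Sum>m\<in>UNIV. val (wcomp m f)) = 0"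
      using value_sum[of UNIV "\<lambda>m. wcomp m f"] fst W(4) by (simp add: comp_sum)
    moreover have "(\<Sum>m\<in>UNIV. val (wcomp m f)) = (\<Sum>m\<in>H. val (wcomp m f))"
      by (rule sum.mono_neutral_right) (use zero in auto)
    ultimately have tot: "(\<Sum>m\<in>H. val (wcomp m f)) = 0" by simp
    have "(\<Sum>m\<in>H. val (wcomp (m + r) f)) = 0" for r
    proof (cases "r \<in> H")
      case True
      have "bij_betw (\<lambda>m. m + r) H H"
      proof (rule bij_betwI[where g = "\<lambda>m. m - r"])
        show "(\<lambda>m. m + r) \<in> H \<rightarrow> H" using True H by (auto simp: subgrp_def)
        show "(\<lambda>m. m - r) \<in> H \<rightarrow> H" using True subgrp_diff[OF H] by auto
      qed auto
      then show ?thesis using sum.reindex_bij_betw[of "\<lambda>m. m + r" H H "\<lambda>m. val (wcomp m f)"] tot by simp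
    next
      case False
      have "m + r \<notin> H" if "m \<in> H" for m using subgrp_diff[OF H, of "m + r" m] that False by auto
      then show ?thesis using zero by (intro sum.neutral) auto
    qed
    then show "h \<in> coset_ideal H" by (simp add: coset_ideal_def h lookup_orbit_map)
  qed
  show "coset_ideal H \<subseteq> stab_ideal \<iota> X \<rho> x"
    unfolding stab_ideal_def ideal_gen_def
  proof (rule Inter_greatest)
    fix I assume "I \<in> {I. is_ideal UNIV I \<and> ?gens \<subseteq> I}"
    then have I: "is_ideal UNIV I" "?gens \<subseteq> I" by auto
    show "coset_ideal H \<subseteq> I"
    proof (rule coset_ideal_subset[OF H transversal_H(1) I(1)])
      fix n assume "n \<in> H"
      then obtain v0 where v0: "v0 \<in> U" "homog n v0" unfolding H_def by blast
      have "v0 \<in> R" using v0 by (simp add: lunits_def)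
      then obtain b where b: "b \<in> B" "b \<notin> mx x" "b * v0 \<in> A" using Ay_frac[OF affV xV] by blast
      define v where "v = b * v0"
      have vh: "homog n v" unfolding v_def using homog_mult[OF B_homog[OF b(1)] v0(2)] by simp
      have vA: "v \<in> A" using b by (simp add: v_def)
      have vst: "v \<in> st x" using vA AR Rst by auto
      have "v0 \<notin> mx x" "v0 \<in> st x" "b \<in> st x" using Ay_unit_not_mx[OF xX v0(1)] \<open>v0 \<in> R\<close> b(1) BA AR Rst by auto
      then have "v \<notin> mx x" unfolding v_def using prime_mult[OF mx_prime[OF xX]] b(2) by blast
      define c where "c = val v"
      have c0: "c \<noteq> 0" using value_zero_iff[OF vst] \<open>v \<notin> mx x\<close> by (simp add: c_def)
      \<comment> \<open>Vanishes at \<open>x\<close> by the choice of \<open>c\<close>; its only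
        components are \<open>v\<close> in degree \<open>n\<close> and \<open>- \<iota> c\<close> in
        degree 0, combined if \<open>n = 0\<close>.\<close>
      define f where "f = v - \<iota> c"
      have fA: "f \<in> A" unfolding f_def using vA const_sec[OF affine_nonempty[OF affPV]] subring_diff[OF A] by auto
      have "val f = 0"
        unfolding value_zero_iff[OF subsetD[OF Rst subsetD[OF AR fA]]] using value_at_eq[OF vst] by (simp add: f_def c_def)
      then have "orbit_map \<iota> X \<rho> x f \<in> I"
        using I(2) pre_stable[OF affV] xV fA by blast
      moreover have "orbit_map \<iota> X \<rho> x f = sg 0 c * (sg n 1 - sg 0 1)"
      proof (rule poly_mapping_eqI)
        fix k
        have "val (- \<iota> c) = - c"
          using value_unique[of "- \<iota> c" "- c"] subring_uminus[OF stalk_subring[OF xX] const_stalk[OF xX]] ideal_0[OF M]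
          by (simp add: is_field_homD(5)[OF hom])
        moreover have "wcomp k f = (if k = n then v else 0) - (if k = 0 then \<iota> c else 0)"
          unfolding f_def comp_diff using comp_homog[OF vh] comp_homog[OF homog_const] by simp
        moreover have "val (v - \<iota> c) = 0" using \<open>val f = 0\<close> by (simp add: f_def)
        ultimately show "lk (orbit_map \<iota> X \<rho> x f) k = lk (sg 0 c * (sg n 1 - sg 0 1)) k"
          unfolding lookup_orbit_map right_diff_distrib mult_single
          by (auto simp: lookup_minus lookup_single when_def value_0 c_def)
      qed
      ultimately have "sg 0 (inverse c) * (sg 0 c * (sg n 1 - sg 0 1)) \<in> I" using ideal_mult[OF I(1)] by simp
      then show "sg n 1 - sg 0 1 \<in> I" using c0 by (simp add: mult_single mult.assoc[symmetric])
    qed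
  qed
qed

lemma stab_order_eq: "stab x = e"
proof -
  have "stab x = card ((\<lambda>j. nmul j d) ` {..<e})"
    unfolding stab_order_def stab_ideal_eq by (rule quotient_dim_coset[OF H transversal_H(1)])
  also have "\<dots> = e" using card_image[OF transversal_H(2)] by simp
  finally show ?thesis .
qed

end

section \<open>The relative canonical sheaf and the Reynolds operator\<close>

context quotient_curve
begin

lemma A_subring: "affine_open Y V \<Longrightarrow> is_subring (sec X (pre V))"
  by (rule affine_subring[OF pre_affine])

lemma omegaI:
  assumes "\<And>f. f \<in> sec X (pre V) \<Longrightarrow> w f \<in> sec Y V" "\<And>f. f \<notin> sec X (pre V) \<Longrightarrow> w f = undefined"
    "\<And>f g. f \<in> sec X (pre V) \<Longrightarrow> g \<in> sec X (pre V) \<Longrightarrow> w (f + g) = w f + w g"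
    "\<And>b f. b \<in> sec Y V \<Longrightarrow> f \<in> sec X (pre V) \<Longrightarrow> w (b * f) = b * w f"
  shows "w \<in> omega X Y \<pi> V"
  using assms by (simp add: omega_def PiE_iff extensional_def)

lemma omegaD:
  assumes V: "affine_open Y V" and w: "w \<in> omega X Y \<pi> V"
  shows "f \<in> sec X (pre V) \<Longrightarrow> w f \<in> sec Y V" "f \<notin> sec X (pre V) \<Longrightarrow> w f = undefined"
    "f \<in> sec X (pre V) \<Longrightarrow> g \<in> sec X (pre V) \<Longrightarrow> w (f + g) = w f + w g"
    "b \<in> sec Y V \<Longrightarrow> f \<in> sec X (pre V) \<Longrightarrow> w (b * f) = b * w f"
    "w 0 = 0"
proof -
  show lin: "b \<in> sec Y V \<Longrightarrow> f \<in> sec X (pre V) \<Longrightarrow> w (b * f) = b * w f" for b f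
    using w subring_0[OF A_subring[OF V]] by (auto simp: omega_def)
  show "f \<in> sec X (pre V) \<Longrightarrow> g \<in> sec X (pre V) \<Longrightarrow> w (f + g) = w f + w g"
    using w subring_0[OF Y.affine_subring[OF V]] by (auto simp: omega_def)
  show "f \<in> sec X (pre V) \<Longrightarrow> w f \<in> sec Y V" "f \<notin> sec X (pre V) \<Longrightarrow> w f = undefined"
    using w by (auto simp: omega_def PiE_iff extensional_def)
  show "w 0 = 0"
    using lin[OF subring_0[OF Y.affine_subring[OF V]] subring_0[OF A_subring[OF V]]] by simp
qed

lemma omega_sum_arg:
  assumes V: "affine_open Y V" and w: "w \<in> omega X Y \<pi> V" and f: "\<And>i. i \<in> I \<Longrightarrow> f i \<in> sec X (pre V)"
  shows "w (\<Sum>i\<in>I. f i) = (\<Sum>i\<in>I. w (f i))"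
  using f
proof (induction I rule: infinite_finite_induct)
  case (insert i I)
  then show ?case using omegaD(3)[OF V w, of "f i" "sum f I"] subring_sum[OF A_subring[OF V], of I f] by simp
qed (simp_all add: omegaD(5)[OF V w])

lemma omega_comp_sum:
  assumes V: "affine_open Y V" and w: "w \<in> omega X Y \<pi> V" and f: "f \<in> sec X (pre V)"
  shows "(\<Sum>m\<in>UNIV. w (wcomp m f)) = w f"
  using omega_sum_arg[OF V w, of UNIV "\<lambda>m. wcomp m f"] gradedD[OF pre_graded[OF V] f] by (simp add: comp_sum)

lemma coaction_eq: "omega_coaction X \<rho> \<pi> V w m = restrict (\<lambda>f. w (wcomp (- m) f)) (sec X (pre V))"
  by (simp add: omega_coaction_def wcomp_def)

lemma B_homog': "affine_open Y V \<Longrightarrow> b \<in> sec Y V \<Longrightarrow> homog 0 b"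
  using sec_Y[OF Y.affine_nonempty] by auto

lemma coaction_in_omega:
  assumes V: "affine_open Y V" and w: "w \<in> omega X Y \<pi> V"
  shows "omega_coaction X \<rho> \<pi> V w m \<in> omega X Y \<pi> V"
  unfolding coaction_eq
proof (rule omegaI)
  note G = gradedD[OF pre_graded[OF V]]
  show "f \<in> sec X (pre V) \<Longrightarrow> restrict (\<lambda>f. w (wcomp (- m) f)) (sec X (pre V)) f \<in> sec Y V" for f
    using omegaD(1)[OF V w G] by simp
  show "f \<notin> sec X (pre V) \<Longrightarrow> restrict (\<lambda>f. w (wcomp (- m) f)) (sec X (pre V)) f = undefined" for f
    by simp
  show "restrict (\<lambda>f. w (wcomp (- m) f)) (sec X (pre V)) (f + g) =
      restrict (\<lambda>f. w (wcomp (- m) f)) (sec X (pre V)) f + restrict (\<lambda>f. w (wcomp (- m) f)) (sec X (pre V)) g"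
    if "f \<in> sec X (pre V)" "g \<in> sec X (pre V)" for f g
    using that omegaD(3)[OF V w G G] subring_add[OF A_subring[OF V]] by (simp add: comp_add)
  show "restrict (\<lambda>f. w (wcomp (- m) f)) (sec X (pre V)) (b * f) =
      b * restrict (\<lambda>f. w (wcomp (- m) f)) (sec X (pre V)) f"
    if b: "b \<in> sec Y V" and f: "f \<in> sec X (pre V)" for b f
  proof -
    have "b * f \<in> sec X (pre V)"
      using subring_mult[OF A_subring[OF V] _ f] b sec_YX[OF Y.affine_nonempty[OF V]] by blast
    then show ?thesis
      using f omegaD(4)[OF V w b G[OF f]] comp_mult_homog[OF B_homog'[OF V b]] by simp
  qed
qed

lemma linearization: "omega_linearization X \<rho> Y \<pi> (omega_coaction X \<rho> \<pi>)"
  unfolding omega_linearization_def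
proof (intro conjI allI impI ballI)
  fix V w m n assume V: "affine_open Y V" and w: "w \<in> omega X Y \<pi> V"
  note G = gradedD[OF pre_graded[OF V]]
  show "omega_coaction X \<rho> \<pi> V w m \<in> omega X Y \<pi> V" by (rule coaction_in_omega[OF V w])
  show "omega_sum X \<pi> V (omega_coaction X \<rho> \<pi> V w) UNIV = w"
  proof
    fix f
    show "omega_sum X \<pi> V (omega_coaction X \<rho> \<pi> V w) UNIV f = w f"
    proof (cases "f \<in> sec X (pre V)")
      case True
      have "(\<Sum>m\<in>UNIV. w (wcomp (- m) f)) = (\<Sum>m\<in>UNIV. w (wcomp m f))"
        by (rule sum.reindex_bij_witness[where i = uminus and j = uminus]) auto
      then show ?thesis using True omega_comp_sum[OF V w True] by (simp add: omega_sum_def coaction_eq)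
    qed (simp add: omega_sum_def omegaD(2)[OF V w])
  qed
  show "omega_coaction X \<rho> \<pi> V (omega_coaction X \<rho> \<pi> V w m) n =
      (if n = m then omega_coaction X \<rho> \<pi> V w m else (\<lambda>f\<in>sec X (pre V). 0))"
    by (auto simp: coaction_eq comp_comp G omegaD(5)[OF V w] intro!: restrict_ext)
next
  fix V w w' m assume V: "affine_open Y V" and "w \<in> omega X Y \<pi> V \<and> w' \<in> omega X Y \<pi> V"
  then show "omega_coaction X \<rho> \<pi> V (omega_add X \<pi> V w w') m =
      omega_add X \<pi> V (omega_coaction X \<rho> \<pi> V w m) (omega_coaction X \<rho> \<pi> V w' m)"
    by (auto simp: coaction_eq omega_add_def gradedD[OF pre_graded[OF V]] intro!: restrict_ext)
next
  fix V w a m assume V: "affine_open Y V" and w: "w \<in> omega X Y \<pi> V" and a: "a \<in> sec X (pre V)"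
  note G = gradedD[OF pre_graded[OF V]] and mult = subring_mult[OF A_subring[OF V]]
  show "omega_coaction X \<rho> \<pi> V (omega_smult X \<pi> V a w) m =
      omega_sum X \<pi> V (\<lambda>n. omega_smult X \<pi> V (lk (\<rho> a) n) (omega_coaction X \<rho> \<pi> V w (m - n))) UNIV"
    unfolding wcomp_def[symmetric] omega_sum_def coaction_eq
  proof (rule restrict_ext)
    fix f assume f: "f \<in> sec X (pre V)"
    have "omega_smult X \<pi> V a w (wcomp (- m) f) = w ((\<Sum>n\<in>UNIV. wcomp n a) * wcomp (- m) f)"
      using G[OF f] by (simp add: omega_smult_def comp_sum)
    also have "\<dots> = (\<Sum>n\<in>UNIV. w (wcomp n a * wcomp (- m) f))"
      unfolding sum_distrib_right by (rule omega_sum_arg[OF V w mult[OF G[OF a] G[OF f]]])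
    \<comment> \<open>The factor \<open>wcomp n a\<close> has degree \<open>n\<close>, so
      multiplication by it carries the component of \<open>f\<close> in degree \<open>- m\<close> to
      degree \<open>n - m\<close>.\<close>
    also have "\<dots> = (\<Sum>n\<in>UNIV. w (wcomp (- (m - n)) (wcomp n a * f)))"
      by (simp add: comp_mult_homog[OF homog_comp])
    also have "\<dots> = (\<Sum>n\<in>UNIV. omega_smult X \<pi> V (wcomp n a)
        (restrict (\<lambda>f. w (wcomp (- (m - n)) f)) (sec X (pre V))) f)"
      using f mult[OF G[OF a] f] by (simp add: omega_smult_def)
    finally show "omega_smult X \<pi> V a w (wcomp (- m) f) = \<dots>" .
  qed
next
  fix V V' w w' m
  assume *: "affine_open Y V \<and> affine_open Y V' \<and> V' \<subseteq> V \<and> w \<in> omega X Y \<pi> V \<and> w' \<in> omega X Y \<pi> V' \<and>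
    restrict w' (sec X (pre V)) = w"
  then have V: "affine_open Y V" "affine_open Y V'" "V' \<subseteq> V" by auto
  have "pre V' \<subseteq> pre V" using V(3) by (auto simp: preim_def)
  then have "sec X (pre V) \<subseteq> sec X (pre V')"
    using sec_mono[OF affine_nonempty[OF pre_affine[OF V(1)]] affine_nonempty[OF pre_affine[OF V(2)]]] by blast
  moreover have "w' f = w f" if "f \<in> sec X (pre V)" for f using * that by (metis restrict_apply')
  ultimately show "restrict (omega_coaction X \<rho> \<pi> V' w' m) (sec X (pre V)) = omega_coaction X \<rho> \<pi> V w m"
    using gradedD[OF pre_graded[OF V(1)]] by (auto simp: coaction_eq fun_eq_iff restrict_def)
qed

lemma trace: "trace_invariant X Y \<pi> (omega_coaction X \<rho> \<pi>)"
  unfolding trace_invariant_def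
proof (intro allI impI ballI)
  fix V m w assume V: "affine_open Y V" and w: "w \<in> omega X Y \<pi> V"
  show "omega_coaction X \<rho> \<pi> V w m 1 = (if m = 0 then w 1 else 0)"
    using subring_1[OF A_subring[OF V]] omegaD(5)[OF V w] by (simp add: coaction_eq comp_homog[OF homog_1])
qed

section \<open>The dual of the function field and the complementary module\<close>

definition dual_map :: "'y set \<Rightarrow> 'f \<Rightarrow> 'f \<Rightarrow> 'f" where
  "dual_map V W = restrict (\<lambda>f. wcomp 0 (W * f)) (sec X (pre V))"

text \<open>The Reynolds operator generates the dual of the function field; the multiples of it that
  belong to \<open>\<omega>\<close> form the complementary module.\<close>

definition codifferent :: "'y set \<Rightarrow> 'f set" where
  "codifferent V = {W. \<forall>f\<in>sec X (pre V). wcomp 0 (W * f) \<in> sec Y V}"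

lemma dual_map_in_omega:
  assumes V: "affine_open Y V" and W: "W \<in> codifferent V"
  shows "dual_map V W \<in> omega X Y \<pi> V"
proof (rule omegaI)
  show "f \<in> sec X (pre V) \<Longrightarrow> dual_map V W f \<in> sec Y V" for f
    using W by (simp add: dual_map_def codifferent_def)
  show "f \<notin> sec X (pre V) \<Longrightarrow> dual_map V W f = undefined" for f by (simp add: dual_map_def)
  show "f \<in> sec X (pre V) \<Longrightarrow> g \<in> sec X (pre V) \<Longrightarrow> dual_map V W (f + g) = dual_map V W f + dual_map V W g" for f g
    using subring_add[OF A_subring[OF V]] by (simp add: dual_map_def distrib_left comp_add)
  show "dual_map V W (b * f) = b * dual_map V W f" if b: "b \<in> sec Y V" and f: "f \<in> sec X (pre V)" for b f
  proof -
    have "b * f \<in> sec X (pre V)"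
      using subring_mult[OF A_subring[OF V] _ f] b sec_YX[OF Y.affine_nonempty[OF V]] by blast
    then show ?thesis
      using f comp_mult_homog[OF B_homog'[OF V b], of 0 "W * f"] by (simp add: dual_map_def mult.left_commute)
  qed
qed

lemma one_codifferent: "affine_open Y V \<Longrightarrow> 1 \<in> codifferent V"
  using sec_Y[OF Y.affine_nonempty] gradedD[OF pre_graded] homog_comp by (simp add: codifferent_def)

lemma dual_map_1: "dual_map V 1 = restrict (wcomp 0) (sec X (pre V))"
  by (simp add: dual_map_def)

lemma homog_section:
  assumes V: "affine_open Y V"
  shows "\<exists>f\<in>sec X (pre V). f \<noteq> 0 \<and> homog m f"
proof -
  obtain f where f: "f \<noteq> 0" "homog m f" using degrees_of_faithful[OF faithful] by blast
  obtain a b where ab: "a \<in> sec X (pre V)" "b \<in> sec X (pre V)" "b \<noteq> 0" "f = a / b" using frac[OF pre_affine[OF V]] by blast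
  obtain g where g: "g \<in> sec X (pre V)" "b * g \<in> sec Y V" "b * g \<noteq> 0" using norm_exists[OF V ab(2,3)] by blast
  have eq: "b * g * f = a * g" using ab by simp
  have "homog (0 + m) (b * g * f)" by (rule homog_mult[OF B_homog'[OF V g(2)] f(2)])
  then have "homog m (b * g * f)" by simp
  moreover have "b * g * f \<in> sec X (pre V)" unfolding eq by (rule subring_mult[OF A_subring[OF V] ab(1) g(1)])
  moreover have "b * g * f \<noteq> 0" using g(3) f(1) by simp
  ultimately show ?thesis by blast
qed

text \<open>In each degree \<open>w\<close> is multiplication by the constant ratio
  \<open>w (\<tau> m) / \<tau> m\<close>: both \<open>\<tau> m ^ N\<close> and
  \<open>wcomp m f * \<tau> m ^ (N - 1)\<close>, with \<open>N\<close> the order of the group, are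
  invariant, so linearity compares the two values. The ratio has degree \<open>- m\<close>; summing
  over \<open>m\<close> gives a single \<open>W\<close> whose products have the right part of degree
  0.\<close>

lemma omega_dual_map:
  assumes V: "affine_open Y V" and w: "w \<in> omega X Y \<pi> V"
  shows "\<exists>W\<in>codifferent V. w = dual_map V W"
proof -
  note A = A_subring[OF V] and G = gradedD[OF pre_graded[OF V]]
  obtain \<tau> where \<tau>: "\<And>m. \<tau> m \<in> sec X (pre V)" "\<And>m. \<tau> m \<noteq> 0" "\<And>m. homog m (\<tau> m)"
    using homog_section[OF V] by metis
  define W where "W = (\<Sum>m\<in>UNIV. w (\<tau> m) / \<tau> m)"
  have single: "w (wcomp m f) = wcomp 0 (w (\<tau> m) / \<tau> m * f)" if f: "f \<in> sec X (pre V)" for m f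
  proof -
    let ?N = "CARD('m)"
    have N: "\<tau> m ^ ?N = \<tau> m ^ (?N - 1) * \<tau> m" by (metis power_minus_mult zero_less_card_finite)
    have b1: "\<tau> m ^ ?N \<in> sec Y V"
      using sec_Y[OF Y.affine_nonempty[OF V]] subring_power[OF A \<tau>(1)] homog_power_card[OF \<tau>(3)] by simp
    have "homog (m + - m) (wcomp m f * \<tau> m ^ (?N - 1))"
      by (rule homog_mult[OF homog_comp homog_power_card'[OF \<tau>(3)]])
    then have b2: "wcomp m f * \<tau> m ^ (?N - 1) \<in> sec Y V"
      using sec_Y[OF Y.affine_nonempty[OF V]] subring_mult[OF A G[OF f] subring_power[OF A \<tau>(1)]] by simp
    have "\<tau> m ^ ?N * w (wcomp m f) = w (\<tau> m ^ ?N * wcomp m f)" using omegaD(4)[OF V w b1 G[OF f]] by simp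
    also have "\<tau> m ^ ?N * wcomp m f = wcomp m f * \<tau> m ^ (?N - 1) * \<tau> m" unfolding N by (simp only: mult_ac)
    also have "w \<dots> = wcomp m f * \<tau> m ^ (?N - 1) * w (\<tau> m)" by (rule omegaD(4)[OF V w b2 \<tau>(1)])
    finally have "\<tau> m ^ (?N - 1) * (\<tau> m * w (wcomp m f)) = \<tau> m ^ (?N - 1) * (wcomp m f * w (\<tau> m))"
      unfolding N by (simp only: mult_ac)
    then have "\<tau> m * w (wcomp m f) = wcomp m f * w (\<tau> m)" using \<tau>(2)[of m] by (metis mult_cancel_left power_not_zero)
    then have "w (wcomp m f) = w (\<tau> m) / \<tau> m * wcomp m f" using \<tau>(2)[of m] by (simp add: field_simps)
    moreover have "homog (0 - m) (w (\<tau> m) / \<tau> m)"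
      by (rule homog_divide[OF B_homog'[OF V omegaD(1)[OF V w \<tau>(1)]] \<tau>(3)])
    ultimately show ?thesis using comp_mult_homog[of "0 - m" "w (\<tau> m) / \<tau> m" 0 f] by simp
  qed
  have eq: "w f = wcomp 0 (W * f)" if f: "f \<in> sec X (pre V)" for f
    using omega_comp_sum[OF V w f] by (simp add: W_def sum_distrib_right comp_sum_distrib single[OF f])
  then have "w = dual_map V W" using omegaD(2)[OF V w] by (auto simp: dual_map_def)
  moreover have "W \<in> codifferent V" using eq omegaD(1)[OF V w] by (simp add: codifferent_def)
  ultimately show ?thesis by blast
qed

text \<open>The pairing by the part of degree 0 of a product is nondegenerate, because every degree
  contains a nonzero section.\<close>

lemma dual_map_inj:
  assumes V: "affine_open Y V" and eq: "dual_map V W = dual_map V W'"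
  shows "W = W'"
proof (rule ccontr)
  assume "W \<noteq> W'"
  then obtain m where m: "wcomp m (W - W') \<noteq> 0" using comp_nonzero[of "W - W'"] by auto
  obtain f where f: "f \<in> sec X (pre V)" "f \<noteq> 0" "homog (- m) f" using homog_section[OF V] by blast
  have "wcomp 0 (W * f) = wcomp 0 (W' * f)" using fun_cong[OF eq, of f] f(1) by (simp add: dual_map_def)
  then have "wcomp 0 (f * (W - W')) = 0" by (simp add: right_diff_distrib comp_diff mult.commute)
  then show False using comp_mult_homog[OF f(3), of 0 "W - W'"] m f(2) by simp
qed

lemma smult_dual_map:
  assumes "affine_open Y V" "a \<in> sec X (pre V)"
  shows "omega_smult X \<pi> V a (dual_map V W) = dual_map V (a * W)"
  using subring_mult[OF A_subring[OF assms(1)] assms(2)]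
  by (auto simp: omega_smult_def dual_map_def mult.left_commute mult.assoc intro!: restrict_ext)

lemma unit_sec_iff:
  assumes V: "affine_open Y V" and x: "x \<in> pre V"
  shows "b \<in> sec X (pre V) \<inter> stalk_units X x \<longleftrightarrow> b \<in> sec X (pre V) \<and> b \<notin> mx x"
  using affine_sec_stalk[OF pre_affine[OF V] x] by (auto simp: stalk_units_eq lmax_def)

lemma frac_iff:
  assumes V: "affine_open Y V" and x: "x \<in> pre V" and W0: "W0 \<noteq> 0"
  shows "(\<exists>a\<in>sec X (pre V). \<exists>b\<in>sec X (pre V) \<inter> stalk_units X x. b * W = a * W0) \<longleftrightarrow> W / W0 \<in> st x"
proof
  assume "\<exists>a\<in>sec X (pre V). \<exists>b\<in>sec X (pre V) \<inter> stalk_units X x. b * W = a * W0"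
  then obtain a b where ab: "a \<in> sec X (pre V)" "b \<in> stalk_units X x" "b * W = a * W0" by blast
  have "W / W0 = a * inverse b" using ab(2,3) W0 by (simp add: stalk_units_def field_simps)
  moreover have "a \<in> st x" using ab(1) affine_sec_stalk[OF pre_affine[OF V] x] by blast
  ultimately show "W / W0 \<in> st x"
    using ab(2) subring_mult[OF stalk_subring] x by (simp add: stalk_units_def in_pre)
next
  assume "W / W0 \<in> st x"
  then obtain a b where ab: "a \<in> sec X (pre V)" "b \<in> sec X (pre V)" "b \<notin> mx x" "b * (W / W0) = a"
    using affine_stalkE[OF pre_affine[OF V] x] by metis
  then have "b * W = a * W0" using W0 by (simp add: field_simps)
  then show "\<exists>a\<in>sec X (pre V). \<exists>b\<in>sec X (pre V) \<inter> stalk_units X x. b * W = a * W0"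
    using ab unit_sec_iff[OF V x] by blast
qed

text \<open>Translation of \<open>omega_generator\<close> into the function field: \<open>W0\<close>
  freely generates the stalk at \<open>x\<close> of the complementary module.\<close>

definition codifferent_generator :: "'y set \<Rightarrow> 'x \<Rightarrow> 'f \<Rightarrow> bool" where
  "codifferent_generator V x W0 \<longleftrightarrow> affine_open Y V \<and> \<pi> x \<in> V \<and> W0 \<in> codifferent V \<and> W0 \<noteq> 0 \<and>
     (\<forall>W\<in>codifferent V. W / W0 \<in> st x)"

lemma omega_generator_iff:
  assumes x: "x \<in> points X"
  shows "omega_generator X Y \<pi> V x u \<longleftrightarrow> (\<exists>W0. codifferent_generator V x W0 \<and> u = dual_map V W0)"
proof (cases "affine_open Y V \<and> \<pi> x \<in> V")
  case True
  then have V: "affine_open Y V" and xV: "x \<in> pre V" using x by (auto simp: in_pre)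
  note A = A_subring[OF V]
  have *: "omega_generator X Y \<pi> V x (dual_map V W0) \<longleftrightarrow> codifferent_generator V x W0"
    if W0: "W0 \<in> codifferent V" for W0
  proof -
    have z: "(\<forall>a\<in>sec X (pre V). omega_smult X \<pi> V a (dual_map V W0) = omega_smult X \<pi> V 0 (dual_map V W0) \<longrightarrow> a = 0)
      \<longleftrightarrow> W0 \<noteq> 0" (is "?z \<longleftrightarrow> _")
    proof
      assume ?z
      then show "W0 \<noteq> 0" using subring_0[OF A] subring_1[OF A] by (auto simp: smult_dual_map[OF V])
    next
      assume "W0 \<noteq> 0"
      show ?z
      proof (intro ballI impI)
        fix a assume a: "a \<in> sec X (pre V)"
          "omega_smult X \<pi> V a (dual_map V W0) = omega_smult X \<pi> V 0 (dual_map V W0)"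
        then have "dual_map V (a * W0) = dual_map V (0 * W0)"
          using subring_0[OF A] by (simp only: smult_dual_map[OF V])
        then have "a * W0 = 0 * W0" by (rule dual_map_inj[OF V])
        then show "a = 0" using \<open>W0 \<noteq> 0\<close> by simp
      qed
    qed
    have f: "(\<forall>w\<in>omega X Y \<pi> V. \<exists>a\<in>sec X (pre V). \<exists>b\<in>sec X (pre V) \<inter> stalk_units X x.
        omega_smult X \<pi> V b w = omega_smult X \<pi> V a (dual_map V W0))
      \<longleftrightarrow> (\<forall>W\<in>codifferent V. W / W0 \<in> st x)" (is "?l \<longleftrightarrow> ?r") if "W0 \<noteq> 0"
    proof -
      have s: "omega_smult X \<pi> V b (dual_map V W) = omega_smult X \<pi> V a (dual_map V W0) \<longleftrightarrow> b * W = a * W0"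
        if "a \<in> sec X (pre V)" "b \<in> sec X (pre V)" for a b W
        using that dual_map_inj[OF V] by (auto simp: smult_dual_map[OF V])
      have "?l \<longleftrightarrow> (\<forall>W\<in>codifferent V. \<exists>a\<in>sec X (pre V). \<exists>b\<in>sec X (pre V) \<inter> stalk_units X x. b * W = a * W0)"
      proof
        assume l: ?l
        show "\<forall>W\<in>codifferent V. \<exists>a\<in>sec X (pre V). \<exists>b\<in>sec X (pre V) \<inter> stalk_units X x. b * W = a * W0"
        proof
          fix W assume "W \<in> codifferent V"
          then obtain a b where "a \<in> sec X (pre V)" "b \<in> sec X (pre V) \<inter> stalk_units X x"
            "omega_smult X \<pi> V b (dual_map V W) = omega_smult X \<pi> V a (dual_map V W0)"
            using l dual_map_in_omega[OF V] by blast
          then show "\<exists>a\<in>sec X (pre V). \<exists>b\<in>sec X (pre V) \<inter> stalk_units X x. b * W = a * W0"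
            using s by blast
        qed
      next
        assume r: "\<forall>W\<in>codifferent V. \<exists>a\<in>sec X (pre V). \<exists>b\<in>sec X (pre V) \<inter> stalk_units X x. b * W = a * W0"
        show ?l
        proof
          fix w assume "w \<in> omega X Y \<pi> V"
          then obtain W where W: "W \<in> codifferent V" "w = dual_map V W" using omega_dual_map[OF V] by blast
          then obtain a b where "a \<in> sec X (pre V)" "b \<in> sec X (pre V) \<inter> stalk_units X x" "b * W = a * W0"
            using r by blast
          then show "\<exists>a\<in>sec X (pre V). \<exists>b\<in>sec X (pre V) \<inter> stalk_units X x.
              omega_smult X \<pi> V b w = omega_smult X \<pi> V a (dual_map V W0)"
            using s W(2) by blast
        qed
      qed
      then show ?thesis by (simp only: frac_iff[OF V xV that])
    qed
    show ?thesis
      unfolding omega_generator_def codifferent_generator_def z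
      using f True W0 dual_map_in_omega[OF V W0] by blast
  qed
  show ?thesis
  proof
    assume g: "omega_generator X Y \<pi> V x u"
    then have "u \<in> omega X Y \<pi> V" by (simp add: omega_generator_def)
    then obtain W where "W \<in> codifferent V" "u = dual_map V W" using omega_dual_map[OF V] by blast
    then show "\<exists>W0. codifferent_generator V x W0 \<and> u = dual_map V W0" using g * by blast
  next
    assume "\<exists>W0. codifferent_generator V x W0 \<and> u = dual_map V W0"
    then show "omega_generator X Y \<pi> V x u" using * codifferent_generator_def by blast
  qed
qed (auto simp: omega_generator_def codifferent_generator_def)

text \<open>The Reynolds operator corresponds to the element 1, which is \<open>inverse W0\<close>
  times a generator \<open>W0\<close>.\<close>

lemma section_divisor_eq:
  assumes x: "x \<in> points X"
  shows "sec_div x =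
    {inverse W0 * v | V W0 v. codifferent_generator V x W0 \<and> v \<in> stalk_units X x}" (is "?l = ?r")
proof
  show "?l \<subseteq> ?r"
  proof
    fix f assume "f \<in> ?l"
    then obtain a b v V u where *: "f = a / b * v" "omega_generator X Y \<pi> V x u" "v \<in> stalk_units X x"
      "a \<in> sec X (pre V)" "b \<in> sec X (pre V) \<inter> stalk_units X x"
      "omega_smult X \<pi> V b (restrict (wcomp 0) (sec X (pre V))) = omega_smult X \<pi> V a u"
      unfolding section_divisor_def by blast
    obtain W0 where W0: "codifferent_generator V x W0" "u = dual_map V W0"
      using *(2) omega_generator_iff[OF x] by blast
    then have V: "affine_open Y V" by (simp add: codifferent_generator_def)
    have bA: "b \<in> sec X (pre V)" using *(5) by blast
    have "dual_map V (b * 1) = dual_map V (a * W0)"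
      using *(6) unfolding W0(2) dual_map_1[symmetric] smult_dual_map[OF V bA] smult_dual_map[OF V *(4)] .
    then have ba: "b * 1 = a * W0" by (rule dual_map_inj[OF V])
    moreover have "b \<noteq> 0" using *(5) by (simp add: stalk_units_def)
    ultimately have "a / b = inverse W0" by (auto simp: field_simps)
    then show "f \<in> ?r" using *(1,3) W0(1) by auto
  qed
  show "?r \<subseteq> ?l"
  proof
    fix f assume "f \<in> ?r"
    then obtain V W0 v where *: "f = inverse W0 * v" "codifferent_generator V x W0" "v \<in> stalk_units X x" by blast
    then have V: "affine_open Y V" "x \<in> pre V" and W0: "W0 \<noteq> 0" and "1 / W0 \<in> st x"
      using x one_codifferent by (auto simp: codifferent_generator_def in_pre)
    then obtain a b where ab: "a \<in> sec X (pre V)" "b \<in> sec X (pre V) \<inter> stalk_units X x" "b * 1 = a * W0"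
      using frac_iff[OF V W0, of 1] by blast
    have bA: "b \<in> sec X (pre V)" using ab(2) by blast
    have "omega_smult X \<pi> V b (restrict (wcomp 0) (sec X (pre V))) = omega_smult X \<pi> V a (dual_map V W0)"
      unfolding dual_map_1[symmetric] smult_dual_map[OF V(1) bA] smult_dual_map[OF V(1) ab(1)] ab(3) ..
    moreover have "f = a / b * v" using *(1) ab(2,3) W0 by (auto simp: stalk_units_def field_simps)
    moreover have "omega_generator X Y \<pi> V x (dual_map V W0)" using *(2) omega_generator_iff[OF x] by blast
    ultimately show "f \<in> ?l" unfolding section_divisor_def using *(3) ab(1,2) by blast
  qed
qed

lemma projection: "invariant_projection X \<rho> Y \<pi> (wcomp 0)"
  unfolding invariant_projection_def omega_global_section_def
proof (intro conjI allI impI ballI)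
  fix V assume V: "affine_open Y V"
  show "restrict (wcomp 0) (sec X (pre V)) \<in> omega X Y \<pi> V"
    using dual_map_in_omega[OF V one_codifferent[OF V]] by (simp add: dual_map_1)
  show "f \<in> sec Y V \<Longrightarrow> wcomp 0 f = f" for f using B_homog'[OF V] by (simp add: homog_def)
  show "wcomp 0 (lk (\<rho> f) m) = (if m = 0 then wcomp 0 f else 0)" for f m
    using comp_comp[of 0 m f] by (simp add: wcomp_def)
qed

text \<open>Over the locus where the norm of a denominator of \<open>f\<close> does not vanish,
  \<open>f\<close> is regular. A projection is a function on the whole field, so its uniqueness
  requires every element to be a section over some affine open.\<close>

lemma in_affine_pre: "\<exists>V. affine_open Y V \<and> f \<in> sec X (pre V)"
proof -
  obtain V0 where V0: "affine_open Y V0" using Y.affine_cover pi_points[OF gen(1)] by blast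
  note A = A_subring[OF V0]
  obtain a b where ab: "a \<in> sec X (pre V0)" "b \<in> sec X (pre V0)" "b \<noteq> 0" "f = a / b"
    using frac[OF pre_affine[OF V0]] by blast
  obtain g where g: "g \<in> sec X (pre V0)" "b * g \<in> sec Y V0" "b * g \<noteq> 0" using norm_exists[OF V0 ab(2,3)] by blast
  define V where "V = {v \<in> V0. b * g \<notin> Y.mx v}"
  have V: "affine_open Y V" unfolding V_def by (rule Y.affine_basic_open[OF V0 g(2,3)])
  have "f \<in> st x" if x: "x \<in> pre V" for x
  proof -
    have x0: "x \<in> pre V0" and "b * g \<notin> Y.mx (\<pi> x)" using x by (auto simp: V_def in_pre)
    then have "b * g \<notin> mx x" using mx_secY[OF V0 x0] g(2) by blast
    moreover have "b * g \<in> sec X (pre V0)" using g(2) sec_YX[OF Y.affine_nonempty[OF V0]] by blast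
    ultimately have "inverse (b * g) \<in> st x"
      using unit_sec_iff[OF V0 x0, of "b * g"] by (simp add: stalk_units_def)
    moreover have "a * g \<in> st x" using affine_sec_stalk[OF pre_affine[OF V0] x0] subring_mult[OF A ab(1) g(1)] by blast
    ultimately have "a * g * inverse (b * g) \<in> st x" using subring_mult[OF stalk_subring] x by (simp add: in_pre)
    moreover have "a * g * inverse (b * g) = f" using g(3) by (simp add: ab(4) field_simps)
    ultimately show ?thesis by simp
  qed
  then have "f \<in> sec X (pre V)" using sec_stalks[OF affine_nonempty[OF pre_affine[OF V]]] by blast
  then show ?thesis using V by blast
qed

lemma projection_unique:
  assumes s: "invariant_projection X \<rho> Y \<pi> s"
  shows "s = wcomp 0"
proof
  fix f
  obtain V where V: "affine_open Y V" and f: "f \<in> sec X (pre V)" using in_affine_pre by blast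
  have "s (lk (\<rho> f) 0) = s f" using s V f by (simp add: invariant_projection_def)
  moreover have "wcomp 0 f \<in> sec Y V"
    using sec_Y[OF Y.affine_nonempty[OF V]] gradedD[OF pre_graded[OF V] f] homog_comp by simp
  then have "s (wcomp 0 f) = wcomp 0 f" using s V by (simp add: invariant_projection_def)
  ultimately show "s f = wcomp 0 f" by (simp add: wcomp_def)
qed

lemma invariant_proj_section: "invariant_section X Y \<pi> (omega_coaction X \<rho> \<pi>) (wcomp 0)"
  unfolding invariant_section_def
proof (intro conjI allI impI)
  show "omega_global_section X Y \<pi> (wcomp 0)" using projection by (simp add: invariant_projection_def)
  fix V m assume V: "affine_open Y V"
  show "omega_coaction X \<rho> \<pi> V (restrict (wcomp 0) (sec X (pre V))) m =
      (\<lambda>f\<in>sec X (pre V). if m = 0 then wcomp 0 f else 0)"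
    using gradedD[OF pre_graded[OF V]] by (auto simp: coaction_eq comp_comp intro!: restrict_ext)
qed

end

section \<open>Divisors\<close>

lemma ideal_gen_subset: "is_ideal L I \<Longrightarrow> S \<subseteq> I \<Longrightarrow> ideal_gen L S \<subseteq> I"
  unfolding ideal_gen_def by blast

lemma ideal_gen_superset: "S \<subseteq> ideal_gen L S"
  unfolding ideal_gen_def by blast

lemma ideal_gen_mult:
  assumes "a \<in> L" "s \<in> S"
  shows "a * s \<in> ideal_gen L S"
  unfolding ideal_gen_def using assms ideal_mult by blast

lemma ideal_gen_single:
  fixes t :: "'f::field"
  assumes L: "is_subring L" and t: "t \<in> L"
  shows "ideal_gen L {t} = {t * a | a. a \<in> L}"
proof
  have "t \<in> {t * a | a. a \<in> L}" using subring_1[OF L] by (auto intro!: exI[of _ 1])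
  then show "ideal_gen L {t} \<subseteq> {t * a | a. a \<in> L}" by (intro ideal_gen_subset is_ideal_principal[OF L t]) auto
  show "{t * a | a. a \<in> L} \<subseteq> ideal_gen L {t}" using ideal_gen_mult[of _ L t "{t}"] by (auto simp: mult.commute)
qed

lemma ideal_gen_principal:
  fixes t :: "'f::field"
  assumes L: "is_subring L" and t: "t \<in> L" and S: "\<And>s. s \<in> S \<Longrightarrow> \<exists>a\<in>L. s = t * a" and u: "u \<in> lunits L" "t * u \<in> S"
  shows "ideal_gen L S = ideal_gen L {t}"
  unfolding ideal_gen_single[OF L t]
proof
  show "ideal_gen L S \<subseteq> {t * a | a. a \<in> L}" by (rule ideal_gen_subset[OF is_ideal_principal[OF L t]]) (use S in blast)
  show "{t * a | a. a \<in> L} \<subseteq> ideal_gen L S"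
  proof
    fix f assume "f \<in> {t * a | a. a \<in> L}"
    then obtain a where a: "a \<in> L" "f = t * a" by blast
    have "a * inverse u \<in> L" using u(1) subring_mult[OF L a(1)] by (simp add: lunits_def)
    then have "a * inverse u * (t * u) \<in> ideal_gen L S" by (rule ideal_gen_mult[OF _ u(2)])
    then show "f \<in> ideal_gen L S" using u(1) a(2) by (simp add: lunits_def mult_ac)
  qed
qed

lemma ideal_gen_single_eq_iff:
  fixes t :: "'f::field"
  assumes L: "is_subring L" and t: "t \<in> L" "t \<noteq> 0"
  shows "ideal_gen L {f} = ideal_gen L {t} \<and> f \<noteq> 0 \<longleftrightarrow> (\<exists>v\<in>lunits L. f = t * v)"
proof
  assume *: "ideal_gen L {f} = ideal_gen L {t} \<and> f \<noteq> 0"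
  then have "f \<in> ideal_gen L {t}" using ideal_gen_superset[of "{f}" L] by simp
  then obtain a where a: "a \<in> L" "f = t * a" unfolding ideal_gen_single[OF L t(1)] by blast
  then have fL: "f \<in> L" using subring_mult[OF L t(1)] by blast
  have "t \<in> ideal_gen L {f}" using * ideal_gen_superset[of "{t}" L] by simp
  then obtain b where b: "b \<in> L" "t = f * b" unfolding ideal_gen_single[OF L fL] by blast
  have ab: "a * b = 1" using a(2) b(2) t(2) by (metis mult.assoc mult_1_right mult_left_cancel)
  then have "a \<noteq> 0" "inverse a = b" using inverse_unique[OF ab] by auto
  then have "a \<in> lunits L" using a(1) b(1) by (simp add: lunits_def)
  then show "\<exists>v\<in>lunits L. f = t * v" using a(2) by blast
next
  assume "\<exists>v\<in>lunits L. f = t * v"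
  then obtain v where v: "v \<in> lunits L" "f = t * v" by blast
  have "ideal_gen L {f} = ideal_gen L {t}"
    by (rule ideal_gen_principal[OF L t(1) _ v(1)]) (use v in \<open>auto simp: lunits_def\<close>)
  then show "ideal_gen L {f} = ideal_gen L {t} \<and> f \<noteq> 0" using v t(2) by (simp add: lunits_def)
qed

section \<open>Cartier divisors on a curve\<close>

context int_curve
begin

abbreviation "multiples x e \<equiv> {e * v | v. v \<in> stalk_units X x}"

lemma gen_units: "stalk_units X gen = UNIV - {0}"
  by (auto simp: stalk_units_def gen(2))

lemma unit_coset:
  assumes "x \<in> points X" "e \<in> lunits (st x)"
  shows "multiples x e = stalk_units X x"
proof -
  note S = stalk_subring[OF assms(1)]
  have "f \<in> multiples x e" if f: "f \<in> stalk_units X x" for f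
  proof -
    have "inverse e * f \<in> stalk_units X x"
      using lunits_mult[OF S lunits_inverse[OF assms(2)]] f by (simp add: stalk_units_eq)
    moreover have "f = e * (inverse e * f)" using assms(2) by (simp add: lunits_def)
    ultimately show ?thesis by blast
  qed
  then show ?thesis using lunits_mult[OF S assms(2)] by (auto simp: stalk_units_eq)
qed

text \<open>The condition at \<open>gen\<close> makes the divisor trivial there, so discarding
  finitely many closed points leaves a neighbourhood of \<open>x\<close> on which one local equation
  serves.\<close>

lemma cartier_divisorI:
  assumes D: "\<And>x. x \<in> points X \<Longrightarrow> \<exists>e. e \<noteq> 0 \<and> D x = multiples x e"
    and fin: "finite {x \<in> points X. D x \<noteq> stalk_units X x}"
  shows "cartier_divisor X D"
  unfolding cartier_divisor_def
proof
  fix x assume x: "x \<in> points X"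
  obtain e where e: "e \<noteq> 0" "D x = multiples x e" using D[OF x] by blast
  have unit_gen: "f \<in> lunits (st gen)" if "f \<noteq> 0" for f using that by (simp add: lunits_def gen(2))
  have Dg: "D gen = stalk_units X gen"
  proof -
    obtain c where "c \<noteq> 0" "D gen = multiples gen c" using D[OF gen(1)] by blast
    then show ?thesis using unit_coset[OF gen(1) unit_gen] by simp
  qed
  define bad where "bad = {z \<in> points X. D z \<noteq> stalk_units X z} \<union> {z \<in> points X. e \<notin> lunits (st z)}"
  \<comment> \<open>Removes the points where the divisor is nontrivial or \<open>e\<close> is not a
    unit, but keeps \<open>x\<close>, where \<open>e\<close> is the local equation by
    choice.\<close>
  define T where "T = points X - (bad - {x})"
  have fb: "finite bad" using fin finite_nonunits[OF e(1)] by (simp add: bad_def)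
  have "gen \<notin> bad" using Dg unit_gen[OF e(1)] by (simp add: bad_def)
  then have gT: "gen \<in> T" using gen(1) by (simp add: T_def)
  have "points X - T \<subseteq> bad" by (auto simp: T_def)
  then have "openin (topo X) T"
    using open_iff_cofinite[of T] gT finite_subset[OF _ fb] by (auto simp: T_def)
  moreover have "D z = multiples z e" if "z \<in> T" for z
  proof (cases "z = x")
    case False
    then have "z \<in> points X" "z \<notin> bad" using that by (auto simp: T_def)
    then have z: "D z = stalk_units X z" "e \<in> lunits (st z)" by (auto simp: bad_def)
    show ?thesis unfolding z(1) by (rule unit_coset[OF \<open>z \<in> points X\<close> z(2), symmetric])
  qed (simp add: e(2))
  ultimately show "\<exists>U e. openin (topo X) U \<and> x \<in> U \<and> e \<in> function_field X \<and> e \<noteq> 0 \<and>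
      (\<forall>z\<in>U. D z = multiples z e)"
    using x e(1) function_field by (intro exI[of _ T] exI[of _ e]) (auto simp: T_def)
qed

lemma divisor_sum_cosets:
  assumes z: "z \<in> points X" and S: "finite S" and D: "\<And>i. i \<in> S \<Longrightarrow> D i z = multiples z (E i)"
  shows "divisor_sum X S n D z = multiples z (\<Prod>i\<in>S. E i ^ n i)" (is "_ = ?r")
proof
  note Sz = stalk_subring[OF z]
  show "divisor_sum X S n D z \<subseteq> ?r"
  proof
    fix f assume "f \<in> divisor_sum X S n D z"
    then obtain v g where f: "f = v * (\<Prod>i\<in>S. g i ^ n i)" "v \<in> stalk_units X z" "\<And>i. i \<in> S \<Longrightarrow> g i \<in> D i z"
      unfolding divisor_sum_def by blast
    have "\<exists>u. u \<in> lunits (st z) \<and> g i = E i * u" if "i \<in> S" for i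
      using f(3)[OF that] unfolding D[OF that] stalk_units_eq by blast
    then obtain u where u: "\<And>i. i \<in> S \<Longrightarrow> u i \<in> lunits (st z)" "\<And>i. i \<in> S \<Longrightarrow> g i = E i * u i" by metis
    have "(\<Prod>i\<in>S. u i ^ n i) \<in> lunits (st z)"
      using S u(1) by (induction S rule: finite_induct) (auto simp: lunits_1[OF Sz] intro!: lunits_mult[OF Sz] lunits_power[OF Sz])
    then have "v * (\<Prod>i\<in>S. u i ^ n i) \<in> stalk_units X z" using lunits_mult[OF Sz] f(2) by (simp add: stalk_units_eq)
    moreover have "(\<Prod>i\<in>S. g i ^ n i) = (\<Prod>i\<in>S. E i ^ n i) * (\<Prod>i\<in>S. u i ^ n i)"
      using u(2) by (simp add: power_mult_distrib prod.distrib)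
    then have "f = (\<Prod>i\<in>S. E i ^ n i) * (v * (\<Prod>i\<in>S. u i ^ n i))" using f(1) by (simp add: mult_ac)
    ultimately show "f \<in> ?r" by blast
  qed
  show "?r \<subseteq> divisor_sum X S n D z"
  proof
    fix f assume "f \<in> ?r"
    then obtain v where v: "f = v * (\<Prod>i\<in>S. E i ^ n i)" "v \<in> stalk_units X z" by (auto simp: mult.commute)
    have "1 \<in> stalk_units X z" using lunits_1[OF Sz] by (simp add: stalk_units_eq)
    then have "E i \<in> D i z" if "i \<in> S" for i unfolding D[OF that] by (auto intro!: exI[of _ 1])
    then show "f \<in> divisor_sum X S n D z" unfolding divisor_sum_def using v by blast
  qed
qed

end

section \<open>The local equation of the Reynolds operator\<close>

context closed_fibre
begin

text \<open>The component of \<open>W\<close> of degree \<open>m\<close> is tested against an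
  element \<open>v * t ^ j\<close> of degree \<open>- m\<close> with \<open>v\<close> a unit and
  \<open>j < e\<close>. The product is regular, so the pole of this component has order at most
  \<open>j\<close>, hence at most \<open>e - 1\<close>.\<close>

lemma codifferent_pole:
  assumes V': "affine_open Y V'" "\<pi> x \<in> V'" and W: "W \<in> codifferent V'"
  shows "W * t ^ (e - 1) \<in> R"
proof -
  have x': "x \<in> pre V'" using V' xX by (simp add: in_pre)
  have "wcomp m W * t ^ (e - 1) \<in> R" for m
  proof -
    obtain j where j: "j < e" "- m - nmul j d \<in> H" using degree_rep by blast
    then obtain v where v: "v \<in> U" "homog (- m - nmul j d) v" unfolding H_def by blast
    have vR: "v \<in> R" using v(1) by (simp add: lunits_def)
    have f0: "v * t ^ j \<in> R" using subring_mult[OF R vR subring_power[OF R tR]] .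
    have h: "homog (- m) (v * t ^ j)" using homog_mult[OF v(2) homog_power[OF t(4)], of j] by simp
    obtain b where b: "b \<in> sec Y V'" "b \<notin> mx x" "b * (v * t ^ j) \<in> sec X (pre V')"
      using Ay_frac[OF V'(1) x' f0] by blast
    have hb: "homog (- m) (b * (v * t ^ j))" using homog_mult[OF B_homog'[OF V'(1) b(1)] h] by simp
    have "wcomp 0 (b * (v * t ^ j) * W) = b * (v * t ^ j) * wcomp m W"
      using comp_mult_homog[OF hb, of 0 W] by simp
    moreover have "wcomp 0 (W * (b * (v * t ^ j))) \<in> sec Y V'"
      using W b(3) unfolding codifferent_def by blast
    moreover have "W * (b * (v * t ^ j)) = b * (v * t ^ j) * W" by (rule mult.commute)
    ultimately have g: "b * (v * t ^ j) * wcomp m W \<in> R"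
      using sec_YX[OF Y.affine_nonempty[OF V'(1)]] Ay_sec[OF Y.affine_nonempty[OF V'(1)] V'(2)] by auto
    have "b * (v * t ^ j * wcomp m W) \<in> R" using g by (simp only: mult.assoc)
    then have "v * t ^ j * wcomp m W \<in> R" by (rule Ay_divide[OF V'(1) x' b(1,2)])
    moreover have "inverse v \<in> R" "v \<noteq> 0" using v(1) by (auto simp: lunits_def)
    ultimately have "inverse v * (v * t ^ j * wcomp m W) * t ^ (e - 1 - j) \<in> R"
      using subring_mult[OF R] subring_power[OF R tR] by blast
    moreover have "t ^ (e - 1) = t ^ j * t ^ (e - 1 - j)" using j(1) by (simp flip: power_add)
    then have "inverse v * (v * t ^ j * wcomp m W) * t ^ (e - 1 - j) = wcomp m W * t ^ (e - 1)"
      using \<open>v \<noteq> 0\<close> by (simp add: divide_simps)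
    ultimately show ?thesis by (simp only:)
  qed
  then have "(\<Sum>m\<in>UNIV. wcomp m W * t ^ (e - 1)) \<in> R" by (intro subring_sum[OF R])
  then show ?thesis by (simp add: comp_sum flip: sum_distrib_right)
qed

text \<open>Only the component of \<open>f\<close> of the same degree as \<open>t ^ (e - 1)\<close>
  contributes. If its exponent \<open>n\<close> were below \<open>e - 1\<close>, the multiple
  \<open>nmul (e - 1 - n) d\<close> would lie in \<open>H\<close>, against the minimality of
  \<open>e\<close>.\<close>

lemma invariant_pole:
  assumes f: "f \<in> R"
  shows "wcomp 0 (inverse (t ^ (e - 1)) * f) \<in> R"
proof -
  let ?D = "nmul (e - 1) d"
  have "homog (- ?D) (inverse (t ^ (e - 1)))" by (rule homog_inverse[OF homog_power[OF t(4)]])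
  then have eq: "wcomp 0 (inverse (t ^ (e - 1)) * f) = inverse (t ^ (e - 1)) * wcomp ?D f"
    using comp_mult_homog[of "- ?D" _ 0 f] by simp
  show ?thesis
  proof (cases "wcomp ?D f = 0")
    case True
    then show ?thesis unfolding eq using subring_0[OF R] by simp
  next
    case False
    obtain n v where nv: "v \<in> U" "wcomp ?D f = v * t ^ n"
      using unit_decomp_R[OF gradedD[OF RG f] homog_comp False] by blast
    have vR: "v \<in> R" using nv(1) by (simp add: lunits_def)
    have "n \<ge> e - 1"
    proof (rule ccontr)
      assume n: "\<not> n \<ge> e - 1"
      have "?D - nmul n d \<in> H" by (rule unit_degree(1)[OF homog_comp False nv])
      moreover have "?D = nmul (e - 1 - n) d + nmul n d" using n by (simp flip: nmul_add)
      ultimately have "nmul (e - 1 - n) d \<in> H" by simp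
      moreover have "0 < e - 1 - n" "e - 1 - n < e" using n e(1) by arith+
      ultimately show False using e(3) by blast
    qed
    then have "t ^ n = t ^ (n - (e - 1)) * t ^ (e - 1)" by (simp flip: power_add)
    then have "inverse (t ^ (e - 1)) * wcomp ?D f = v * t ^ (n - (e - 1))" using nv(2) t(3) by simp
    then show ?thesis unfolding eq using subring_mult[OF R vR subring_power[OF R tR]] by simp
  qed
qed

text \<open>\<open>inverse (t ^ (e - 1))\<close> satisfies the condition of the complementary module
  near the fibre only. An invariant unit \<open>c\<close> clears the denominators on finitely many
  module generators, and linearity does the rest.\<close>

lemma codifferent_local_generator:
  assumes V': "affine_open Y V'" "\<pi> x \<in> V'"
  shows "\<exists>c\<in>lunits (st x). c * inverse (t ^ (e - 1)) \<in> codifferent V'"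
proof -
  let ?q = "inverse (t ^ (e - 1))"
  have x': "x \<in> pre V'" using V' xX by (simp add: in_pre)
  note nV = Y.affine_nonempty[OF V'(1)]
  have AR': "sec X (pre V') \<subseteq> R" by (rule Ay_sec[OF nV V'(2)])
  note B' = Y.affine_subring[OF V'(1)] and BA' = sec_YX[OF nV]
  obtain S where S: "finite S" "S \<subseteq> sec X (pre V')"
    "\<forall>a\<in>sec X (pre V'). \<exists>c. (\<forall>s\<in>S. c s \<in> sec Y V') \<and> a = (\<Sum>s\<in>S. c s * s)"
    using pre_finite[OF V'(1)] unfolding finite_over_def by blast
  have E: "(\<lambda>s. wcomp 0 (?q * s)) ` S \<subseteq> R"
    by (rule image_subsetI, rule invariant_pole, rule subsetD[OF AR' subsetD[OF S(2)]])
  obtain c where c: "c \<in> sec Y V'" "c \<notin> mx x" "\<forall>s\<in>S. c * wcomp 0 (?q * s) \<in> sec X (pre V')"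
    using denominators[OF V'(1) x' finite_imageI[OF S(1)] E] unfolding ball_simps by (elim bexE conjE)
  have hc: "homog 0 c" by (rule B_homog'[OF V'(1) c(1)])
  have cB: "c * wcomp 0 (?q * s) \<in> sec Y V'" if "s \<in> S" for s
    using sec_Y[OF nV] c(3) that homog_mult[OF hc homog_comp[of 0 "?q * s"]] by simp
  have "c * ?q \<in> codifferent V'"
    unfolding codifferent_def
  proof (intro CollectI ballI)
    fix f assume "f \<in> sec X (pre V')"
    then obtain b where b: "\<And>s. s \<in> S \<Longrightarrow> b s \<in> sec Y V'" "f = (\<Sum>s\<in>S. b s * s)" using S(3) by blast
    have "wcomp 0 (c * ?q * f) = (\<Sum>s\<in>S. wcomp 0 (c * b s * (?q * s)))"
      unfolding b(2) sum_distrib_left comp_sum_distrib by (simp only: mult_ac)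
    also have "\<dots> = (\<Sum>s\<in>S. b s * (c * wcomp 0 (?q * s)))"
    proof (rule sum.cong)
      fix s assume "s \<in> S"
      then have "homog 0 (c * b s)" using homog_mult[OF hc B_homog'[OF V'(1) b(1)]] by simp
      then show "wcomp 0 (c * b s * (?q * s)) = b s * (c * wcomp 0 (?q * s))"
        using comp_mult_homog[of 0 "c * b s" 0 "?q * s"] by (simp add: mult_ac)
    qed simp
    also have "\<dots> \<in> sec Y V'" by (intro subring_sum[OF B'] subring_mult[OF B'] b(1) cB)
    finally show "wcomp 0 (c * ?q * f) \<in> sec Y V'" .
  qed
  moreover have "c \<in> lunits (st x)" using c(1,2) BA' affine_sec_stalk[OF pre_affine[OF V'(1)] x'] by (auto simp: lmax_def)
  ultimately show ?thesis by blast
qed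

text \<open>All elements of the module become regular at \<open>x\<close> after multiplication by
  \<open>t ^ (e - 1)\<close>, and one of them is a unit multiple of its inverse; generators are the
  elements that attain this pole exactly.\<close>

lemma codifferent_generator_iff:
  assumes V': "affine_open Y V'" "\<pi> x \<in> V'" and W: "W \<in> codifferent V'"
  shows "codifferent_generator V' x W \<longleftrightarrow> W * t ^ (e - 1) \<in> lunits (st x)"
proof -
  note S = stalk_subring[OF xX]
  obtain c where c: "c \<in> lunits (st x)" "c * inverse (t ^ (e - 1)) \<in> codifferent V'"
    using codifferent_local_generator[OF V'] by blast
  have c0: "c \<noteq> 0" "inverse c \<in> st x" using c(1) by (auto simp: lunits_def)
  have pole: "W' * t ^ (e - 1) \<in> st x" if "W' \<in> codifferent V'" for W'
    using codifferent_pole[OF V' that] Rst by blast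
  show ?thesis
  proof
    assume g: "codifferent_generator V' x W"
    then have "c * inverse (t ^ (e - 1)) / W \<in> st x" "W \<noteq> 0" using c(2) by (auto simp: codifferent_generator_def)
    then have "inverse c * (c * inverse (t ^ (e - 1)) / W) \<in> st x" using subring_mult[OF S c0(2)] by blast
    moreover have "inverse c * (c * inverse (t ^ (e - 1)) / W) = inverse (W * t ^ (e - 1))"
      using c0(1) by (simp add: divide_inverse)
    ultimately show "W * t ^ (e - 1) \<in> lunits (st x)" using pole[OF W] \<open>W \<noteq> 0\<close> t(3) by (simp add: lunits_def)
  next
    assume u: "W * t ^ (e - 1) \<in> lunits (st x)"
    have "W' / W \<in> st x" if "W' \<in> codifferent V'" for W'
    proof -
      have "W' * t ^ (e - 1) * inverse (W * t ^ (e - 1)) \<in> st x"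
        using subring_mult[OF S pole[OF that]] u by (simp add: lunits_def)
      moreover have "W' * t ^ (e - 1) * inverse (W * t ^ (e - 1)) = W' / W" using t(3) by (simp add: divide_inverse)
      ultimately show ?thesis by simp
    qed
    then show "codifferent_generator V' x W"
      unfolding codifferent_generator_def using V' W u by (auto simp: lunits_def)
  qed
qed

lemma generator_exists: "\<exists>W. codifferent_generator V x W"
proof -
  obtain c where c: "c \<in> lunits (st x)" "c * inverse (t ^ (e - 1)) \<in> codifferent V"
    using codifferent_local_generator[OF affV x(2)] by blast
  have "c * inverse (t ^ (e - 1)) * t ^ (e - 1) = c" using t(3) by (simp add: mult.assoc)
  then have "codifferent_generator V x (c * inverse (t ^ (e - 1)))"
    unfolding codifferent_generator_iff[OF affV x(2) c(2)] using c(1) by (simp only:)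
  then show ?thesis by blast
qed

lemma section_divisor_local:
  "sec_div x = multiples x (t ^ (e - 1))" (is "_ = ?r")
  unfolding section_divisor_eq[OF xX]
proof
  let ?l = "{inverse W0 * v | V W0 v. codifferent_generator V x W0 \<and> v \<in> stalk_units X x}"
  note S = stalk_subring[OF xX]
  have *: "\<exists>u\<in>stalk_units X x. inverse W = t ^ (e - 1) * u" if "codifferent_generator V' x W" for V' W
  proof -
    have "affine_open Y V'" "\<pi> x \<in> V'" "W \<in> codifferent V'" using that by (auto simp: codifferent_generator_def)
    then have "W * t ^ (e - 1) \<in> lunits (st x)" using codifferent_generator_iff that by blast
    then have "inverse (W * t ^ (e - 1)) \<in> stalk_units X x" unfolding stalk_units_eq by (rule lunits_inverse)
    moreover have "inverse W = t ^ (e - 1) * inverse (W * t ^ (e - 1))" using t(3) by simp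
    ultimately show ?thesis by blast
  qed
  show "?l \<subseteq> ?r"
  proof
    fix f assume "f \<in> ?l"
    then obtain V' W v where f: "f = inverse W * v" "codifferent_generator V' x W" "v \<in> stalk_units X x" by blast
    obtain u where u: "u \<in> stalk_units X x" "inverse W = t ^ (e - 1) * u" using *[OF f(2)] by blast
    have "u * v \<in> stalk_units X x" using lunits_mult[OF S] u(1) f(3) by (simp add: stalk_units_eq)
    moreover have "f = t ^ (e - 1) * (u * v)" using f(1) u(2) by simp
    ultimately show "f \<in> ?r" by blast
  qed
  show "?r \<subseteq> ?l"
  proof
    fix f assume "f \<in> ?r"
    then obtain v where f: "f = t ^ (e - 1) * v" "v \<in> stalk_units X x" by blast
    obtain W where W: "codifferent_generator V x W" using generator_exists by blast
    obtain u where u: "u \<in> stalk_units X x" "inverse W = t ^ (e - 1) * u" using *[OF W] by blast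
    have "inverse u * v \<in> stalk_units X x" using lunits_mult[OF S lunits_inverse] u(1) f(2) by (simp add: stalk_units_eq)
    moreover have "f = inverse W * (inverse u * v)" using f(1) u by (simp add: stalk_units_def)
    ultimately show "f \<in> ?l"
      using W by blast
  qed
qed

end

section \<open>Orbits, separating invariants and orbit divisors\<close>

context quotient_curve
begin

lemma stable_affine_open: "stable_affine X \<rho> W \<Longrightarrow> affine_open X W"
  by (simp add: stable_affine_def)

lemma stable_comp_sub:
  assumes W: "stable_affine X \<rho> W" and z: "z \<in> W" and b: "b \<in> sec X W" "b \<notin> mx z"
  shows "\<exists>m. wcomp m b \<notin> mx z"
proof (rule ccontr)
  assume "\<not> ?thesis"
  then have *: "wcomp m b \<in> mx z" for m by blast
  have "z \<in> points X" using z affine_points[OF stable_affine_open[OF W]] by blast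
  then have "(\<Sum>m\<in>UNIV. wcomp m b) \<in> mx z" by (rule ideal_sum[OF mx_ideal *])
  then show False using b(2) by (simp add: comp_sum)
qed

text \<open>Some component of the denominator does not vanish at \<open>x\<close>, and since
  \<open>f\<close> has degree 0 the matching component of the numerator goes with it. Multiplying
  both by a suitable power of that component makes them invariant.\<close>

lemma stalk_Y_stable:
  assumes W: "stable_affine X \<rho> W" and x: "x \<in> W" and f: "f \<in> Y.st (\<pi> x)"
  shows "\<exists>a\<in>sec X W. \<exists>b\<in>sec X W. homog 0 a \<and> homog 0 b \<and> b \<notin> mx x \<and> f = a / b"
proof -
  note Wa = stable_affine_open[OF W]
  note A = affine_subring[OF Wa] and G = gradedD[OF stable_graded[OF W]]
  have xX: "x \<in> points X" using x affine_points[OF Wa] by blast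
  have f0: "homog 0 f" by (rule stalk_Y_homog[OF pi_points[OF xX] f])
  obtain a b where ab: "a \<in> sec X W" "b \<in> sec X W" "b \<notin> mx x" "b * f = a"
    using affine_stalkE[OF Wa x] stalk_YX[OF xX] f by (metis subsetD)
  obtain m where m: "wcomp m b \<notin> mx x" using stable_comp_sub[OF W x ab(2,3)] by blast
  have fb: "f * wcomp m b = wcomp m a"
    using comp_mult_homog[OF f0, of m b] ab(4) by (simp add: mult.commute)
  let ?N = "CARD('m)"
  let ?b = "wcomp m b ^ ?N" and ?a = "wcomp m a * wcomp m b ^ (?N - 1)"
  have N: "wcomp m b * wcomp m b ^ (?N - 1) = ?b" by (metis power_minus_mult zero_less_card_finite mult.commute)
  have "?a = f * (wcomp m b * wcomp m b ^ (?N - 1))" by (simp only: fb[symmetric] mult.assoc)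
  then have afb: "?a = f * ?b" unfolding N .
  have bst: "wcomp m b \<in> st x" using G[OF ab(2)] affine_sec_stalk[OF Wa x] by blast
  have bm: "?b \<notin> mx x" using prime_power[OF stalk_subring[OF xX] mx_prime[OF xX] bst] m by blast
  have hb: "homog 0 ?b" by (rule homog_power_card[OF homog_comp])
  have "homog 0 ?a" using homog_mult[OF f0 hb] unfolding afb by simp
  moreover have "?a \<in> sec X W" by (rule subring_mult[OF A G[OF ab(1)] subring_power[OF A G[OF ab(2)]]])
  moreover have "?b \<in> sec X W" by (rule subring_power[OF A G[OF ab(2)]])
  moreover have "?b \<noteq> 0" using bm ideal_0[OF mx_ideal[OF xX]] by metis
  then have "f = ?a / ?b" unfolding afb by simp
  ultimately show ?thesis using bm hb by blast
qed

lemma closed_fibre_exists: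
  assumes "x \<in> closed_pts"
  shows "\<exists>V. closed_fibre \<iota> \<rho> X Y \<pi> V x"
proof -
  obtain V where "Y.ft_open V" "\<pi> x \<in> V" using Y.ft_cover_point pi_points closed_ptsD[OF assms] by blast
  then show ?thesis
    using assms by (intro exI[of _ V] closed_fibre.intro[OF quotient_curve_axioms] closed_fibre_axioms.intro)
qed

lemma stable_Ay:
  assumes "x \<in> closed_pts" "stable_affine X \<rho> W" "x \<in> W"
  shows "sec X W \<subseteq> Ay (\<pi> x)"
proof -
  obtain V where V: "closed_fibre \<iota> \<rho> X Y \<pi> V x" using closed_fibre_exists[OF assms(1)] by blast
  show ?thesis by (rule closed_fibre.stable_in_R[OF V assms(2,3) refl])
qed

lemma stable_fibre_mem:
  assumes "x \<in> closed_pts" "stable_affine X \<rho> W" "x \<in> W" "x' \<in> points X" "\<pi> x' = \<pi> x"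
  shows "x' \<in> W"
proof -
  obtain V where V: "closed_fibre \<iota> \<rho> X Y \<pi> V x" using closed_fibre_exists[OF assms(1)] by blast
  show ?thesis by (rule closed_fibre.stable_fibre[OF V assms(2,3) refl assms(4,5)])
qed

text \<open>The local ring of \<open>Y\<close> at an image point is the degree zero part of the localization, so if no
  invariant separates two fibres then one of the local rings dominates the other.\<close>

lemma separating_invariant:
  assumes W: "stable_affine X \<rho> W" and x: "x \<in> W" "x \<in> closed_pts" and z: "z \<in> W" and ne: "\<pi> x \<noteq> \<pi> z"
  shows "\<exists>g\<in>sec X W. homog 0 g \<and> g \<in> mx x \<and> g \<notin> mx z"
proof (rule ccontr)
  assume no: "\<not> ?thesis"
  note Wa = stable_affine_open[OF W]
  have xX: "x \<in> points X" and zX: "z \<in> points X" using x(1) z affine_points[OF Wa] by auto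
  have iff: "g \<in> mx x \<longleftrightarrow> g \<in> mx z" if g: "g \<in> sec X W" "homog 0 g" for g
  proof
    show "g \<in> mx x \<Longrightarrow> g \<in> mx z" using no g by blast
    assume gz: "g \<in> mx z"
    have "g \<in> st x" using g(1) affine_sec_stalk[OF Wa x(1)] by blast
    then obtain c where c: "g - \<iota> c \<in> mx x" using residue[OF x(2)] by blast
    have "g - \<iota> c \<in> sec X W" using subring_diff[OF affine_subring[OF Wa] g(1) const_sec[OF affine_nonempty[OF Wa]]] .
    moreover have "homog 0 (g - \<iota> c)" using homog_add[OF g(2) homog_uminus[OF homog_const]] by simp
    ultimately have "g - \<iota> c \<in> mx z" using no c by blast
    then have "g - (g - \<iota> c) \<in> mx z" by (rule ideal_diff[OF stalk_subring[OF zX] mx_ideal[OF zX] gz])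
    then have "c = 0" using const_max[OF zX] by simp
    then show "g \<in> mx x" using c by (simp add: is_field_homD(4)[OF hom])
  qed
  have sub: "f \<in> Y.st (\<pi> x) \<and> (f \<in> mx z \<longleftrightarrow> f \<in> mx x)" if f: "f \<in> Y.st (\<pi> z)" for f
  proof -
    obtain a b where ab: "a \<in> sec X W" "b \<in> sec X W" "homog 0 a" "homog 0 b" "b \<notin> mx z" "f = a / b"
      using stalk_Y_stable[OF W z f] by blast
    have bx: "b \<notin> mx x" using iff[OF ab(2,4)] ab(5) by blast
    have "a \<in> Y.st (\<pi> x)" "b \<in> Y.st (\<pi> x)"
      using Ay_invariant[OF xX] stable_Ay[OF x(2) W x(1)] ab(1-4) by auto
    moreover from this have "inverse b \<in> Y.st (\<pi> x)" using bx mx_YX[OF xX] by (auto simp: lmax_def lunits_def)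
    ultimately have "a * inverse b \<in> Y.st (\<pi> x)" using subring_mult[OF Y.stalk_subring[OF pi_points[OF xX]]] by blast
    then show ?thesis
      unfolding ab(6) affine_max_iff[OF Wa z ab(1,2,5)] affine_max_iff[OF Wa x(1) ab(1,2) bx]
      using iff[OF ab(1,3)] by (simp add: divide_inverse)
  qed
  have "Y.mx (\<pi> x) \<inter> Y.st (\<pi> z) = Y.mx (\<pi> z)"
    using sub mx_YX[OF xX] mx_YX[OF zX] by blast
  moreover have "Y.mx (\<pi> x) \<inter> Y.st (\<pi> x) = Y.mx (\<pi> x)" using lmax_subset by blast
  moreover have "Y.st (\<pi> z) \<subseteq> Y.st (\<pi> x)" using sub by blast
  ultimately have "\<pi> z = \<pi> x"
    using Y.domination_uniqueD[OF Y.dominated Y.stalk_subring[OF pi_points[OF xX]] Y.mx_prime[OF pi_points[OF xX]]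
      pi_points[OF zX] pi_points[OF xX]] by blast
  then show False using ne by simp
qed

end

lemma (in closed_fibre) in_orbit_local:
  assumes W: "stable_affine X \<rho> W" "x \<in> W"
  shows "f \<in> orb x W \<longleftrightarrow> f \<in> sec X W \<and> (\<forall>m. wcomp m f \<in> mx x)"
proof -
  have "orbit_map \<iota> X \<rho> x f = 0 \<longleftrightarrow> (\<forall>m. wcomp m f \<in> mx x)" if f: "f \<in> sec X W"
  proof -
    have "wcomp m f \<in> st x" for m using gradedD[OF stable_graded[OF W(1)] f] stable_in_R[OF W refl] Rst by blast
    then show ?thesis by (auto simp: poly_mapping_eq_iff fun_eq_iff lookup_orbit_map value_zero_iff)
  qed
  then show ?thesis using W by (auto simp: orbit_def)
qed

context quotient_curve
begin

lemma in_orbit: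
  assumes "x \<in> closed_pts" "stable_affine X \<rho> W" "x \<in> W"
  shows "f \<in> orb x W \<longleftrightarrow> f \<in> sec X W \<and> (\<forall>m. wcomp m f \<in> mx x)"
  using closed_fibre_exists[OF assms(1)] closed_fibre.in_orbit_local[OF _ assms(2,3)] by blast

lemma one_in_orbit:
  assumes x: "x \<in> closed_pts" and W: "stable_affine X \<rho> W"
  shows "1 \<in> orb x W \<longleftrightarrow> x \<notin> W"
proof (cases "x \<in> W")
  case True
  have "wcomp 0 1 \<notin> mx x" using prime_one[OF mx_prime[OF closed_ptsD[OF x]]] by (simp add: comp_homog[OF homog_1])
  then show ?thesis using True in_orbit[OF x W True] by blast
next
  case False
  then show ?thesis using W subring_1[OF affine_subring[OF stable_affine_open[OF W]]] by (simp add: orbit_def)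
qed

lemma invariant_in_orbit:
  assumes x: "x \<in> closed_pts" "stable_affine X \<rho> W" "x \<in> W" and g: "g \<in> sec X W" "homog 0 g"
  shows "g \<in> orb x W \<longleftrightarrow> g \<in> mx x"
  unfolding in_orbit[OF x] using g comp_homog[OF g(2)] ideal_0[OF mx_ideal[OF closed_ptsD[OF x(1)]]]
  by auto

text \<open>Homogeneous functions vanish simultaneously on a fibre, so the orbit ideals agree along
  it. Conversely, the unit ideal reveals which stable opens miss the orbit, and in a common stable
  open different fibres are separated by an invariant.\<close>

lemma orbit_eq_iff:
  assumes x: "x \<in> closed_pts" and x': "x' \<in> closed_pts"
  shows "orb x = orb x' \<longleftrightarrow> \<pi> x = \<pi> x'"
proof
  assume eq: "\<pi> x = \<pi> x'"
  note X = closed_ptsD[OF x] closed_ptsD[OF x']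
  show "orb x = orb x'"
  proof
    fix W show "orb x W = orb x' W"
    proof (cases "stable_affine X \<rho> W")
      case True
      have mem: "x \<in> W \<longleftrightarrow> x' \<in> W"
        using stable_fibre_mem[OF x True _ X(2)] stable_fibre_mem[OF x' True _ X(1)] eq by auto
      show ?thesis
      proof (cases "x \<in> W")
        case xW: True
        then have x'W: "x' \<in> W" using mem by blast
        have "wcomp m f \<in> mx x \<longleftrightarrow> wcomp m f \<in> mx x'" if "f \<in> sec X W" for m f
        proof -
          have "wcomp m f \<in> sec X W" using gradedD[OF stable_graded[OF True] that] .
          then have "wcomp m f \<in> Ay (\<pi> x)" "wcomp m f \<in> Ay (\<pi> x')"
            using stable_Ay[OF x True xW] stable_Ay[OF x' True x'W] by auto
          then show ?thesis
            using Ay_mx_fibre[OF X(1) X(2) eq[symmetric] _ homog_comp] Ay_mx_fibre[OF X(2) X(1) eq _ homog_comp] by blast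
        qed
        then show ?thesis using in_orbit[OF x True xW] in_orbit[OF x' True x'W] by auto
      next
        case False
        then show ?thesis using mem by (simp add: orbit_def)
      qed
    qed (simp add: orbit_def)
  qed
next
  assume eq: "orb x = orb x'"
  obtain V where V: "affine_open Y V" "\<pi> x \<in> V" using Y.affine_cover pi_points closed_ptsD[OF x] by blast
  have W: "stable_affine X \<rho> (pre V)" and xW: "x \<in> pre V" using pre_stable V closed_ptsD[OF x] by (auto simp: in_pre)
  have x'W: "x' \<in> pre V" using one_in_orbit[OF x W] one_in_orbit[OF x' W] xW unfolding eq by blast
  show "\<pi> x = \<pi> x'"
  proof (rule ccontr)
    assume "\<pi> x \<noteq> \<pi> x'"
    then obtain g where g: "g \<in> sec X (pre V)" "homog 0 g" "g \<in> mx x" "g \<notin> mx x'"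
      using separating_invariant[OF W xW x x'W] by blast
    then show False using invariant_in_orbit[OF x W xW g(1,2)] invariant_in_orbit[OF x' W x'W g(1,2)] unfolding eq by blast
  qed
qed

lemma stable_cover: "z \<in> points X \<Longrightarrow> \<exists>W. stable_affine X \<rho> W \<and> z \<in> W"
  using Y.affine_cover[OF pi_points] pre_stable by (meson in_pre)

text \<open>A stable neighbourhood of \<open>z\<close> either misses \<open>x\<close>, and the ideal
  is the unit ideal, or carries an invariant that vanishes at \<open>x\<close> and is a unit at
  \<open>z\<close>.\<close>

lemma orbit_divisor_off:
  assumes x: "x \<in> closed_pts" and z: "z \<in> points X" and ne: "\<pi> x \<noteq> \<pi> z"
  shows "orb_div x z = stalk_units X z"
proof -
  note S = stalk_subring[OF z]
  have one: "ideal_gen (st z) (orb x W) = ideal_gen (st z) {1}" if W: "stable_affine X \<rho> W" "z \<in> W" for W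
  proof -
    have sub: "sec X W \<subseteq> st z" by (rule affine_sec_stalk[OF stable_affine_open[OF W(1)] W(2)])
    have "\<exists>u\<in>lunits (st z). u \<in> orb x W"
    proof (cases "x \<in> W")
      case False
      then show ?thesis using one_in_orbit[OF x W(1)] lunits_1[OF S] by blast
    next
      case True
      obtain g where g: "g \<in> sec X W" "homog 0 g" "g \<in> mx x" "g \<notin> mx z"
        using separating_invariant[OF W(1) True x W(2) ne] by blast
      have "g \<in> lunits (st z)" using g(1,4) sub by (auto simp: lmax_def)
      then show ?thesis using invariant_in_orbit[OF x W(1) True g(1,2)] g(3) by blast
    qed
    then obtain u where u: "u \<in> lunits (st z)" "1 * u \<in> orb x W" by auto
    show ?thesis
    proof (rule ideal_gen_principal[OF S subring_1[OF S] _ u])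
      fix s assume "s \<in> orb x W"
      then have "s \<in> st z" using W(1) sub by (auto simp: orbit_def)
      then show "\<exists>a\<in>st z. s = 1 * a" by simp
    qed
  qed
  have "orb_div x z = {f. ideal_gen (st z) {f} = ideal_gen (st z) {1} \<and> f \<noteq> 0}"
    unfolding orbit_divisor_def using one stable_cover[OF z] by auto
  also have "\<dots> = lunits (st z)" using ideal_gen_single_eq_iff[OF S subring_1[OF S] one_neq_zero[symmetric, THEN not_sym]] by auto
  finally show ?thesis by (simp add: stalk_units_eq)
qed

end

context closed_fibre
begin

text \<open>Components of functions in the orbit ideal are divisible by \<open>t\<close> in
  \<open>R\<close>. As \<open>t\<close> need not be a section of the stable open \<open>W\<close>,
  its place is taken by its product with a component of a denominator that is a unit at
  \<open>x\<close>.\<close>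

lemma orbit_divisor_fibre:
  assumes x': "x' \<in> points X" "\<pi> x' = \<pi> x"
  shows "orb_div x' x = multiples x t"
proof -
  note S = stalk_subring[OF xX]
  have x'c: "x' \<in> closed_pts" by (rule fibre_closed[OF x(1) x'(1) x'(2)[symmetric]])
  have tst: "t \<in> st x" using tR Rst by blast
  have eq: "ideal_gen (st x) (orb x' W) = ideal_gen (st x) {t}" if W: "stable_affine X \<rho> W" "x \<in> W" for W
  proof -
    note Wa = stable_affine_open[OF W(1)] and G = gradedD[OF stable_graded[OF W(1)]]
    have x'W: "x' \<in> W" by (rule stable_fibre[OF W refl x'])
    have sub: "sec X W \<subseteq> R" by (rule stable_in_R[OF W refl])
    obtain a b where ab: "a \<in> sec X W" "b \<in> sec X W" "b \<notin> mx x" "b * t = a"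
      using affine_stalkE[OF Wa W(2) tst] by metis
    obtain m where m: "wcomp m b \<notin> mx x" using stable_comp_sub[OF W ab(2,3)] by blast
    have "wcomp (m + d) (t * b) = t * wcomp m b" using comp_mult_homog[OF t(4), of "m + d" b] by simp
    then have tb: "t * wcomp m b = wcomp (m + d) a" using ab(4) by (simp add: mult.commute)
    have bst: "wcomp m b \<in> st x" using G[OF ab(2)] sub Rst by blast
    have u: "wcomp m b \<in> lunits (st x)" using m bst by (simp add: lmax_def)
    have aW: "wcomp (m + d) a \<in> sec X W" by (rule G[OF ab(1)])
    have "t * wcomp m b \<in> mx x" by (rule ideal_mult_right[OF M bst t(2)])
    then have "wcomp (m + d) a \<in> mx x'"
      unfolding tb by (rule Ay_mx_fibre[OF xX x' subsetD[OF sub aW] homog_comp])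
    then have "wcomp n (wcomp (m + d) a) \<in> mx x'" for n
      using ideal_0[OF mx_ideal[OF x'(1)]] by (simp add: comp_comp)
    then have "t * wcomp m b \<in> orb x' W" unfolding tb in_orbit[OF x'c W(1) x'W] using aW by blast
    with u show ?thesis
    proof (rule ideal_gen_principal[OF S tst, rotated])
      fix s assume "s \<in> orb x' W"
      then have s: "s \<in> sec X W" "\<And>m. wcomp m s \<in> mx x'" unfolding in_orbit[OF x'c W(1) x'W] by auto
      have "wcomp n s / t \<in> R" for n
      proof -
        have sR: "wcomp n s \<in> R" using G[OF s(1)] sub by blast
        then have "wcomp n s \<in> Ay (\<pi> x')" by (simp add: x'(2))
        then have "wcomp n s \<in> mx x" by (rule Ay_mx_fibre[OF x'(1) xX x'(2)[symmetric] _ homog_comp s(2)])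
        then show ?thesis by (rule t(5)[OF sR homog_comp])
      qed
      then have "(\<Sum>n\<in>UNIV. wcomp n s / t) \<in> R" by (intro subring_sum[OF R])
      then have "s / t \<in> R" by (simp add: comp_sum flip: sum_divide_distrib)
      then show "\<exists>a\<in>st x. s = t * a" using Rst t(3) by (intro bexI[of _ "s / t"]) auto
    qed
  qed
  have "orb_div x' x = {f. ideal_gen (st x) {f} = ideal_gen (st x) {t} \<and> f \<noteq> 0}"
    unfolding orbit_divisor_def using eq stable_cover[OF xX] by auto
  also have "\<dots> = multiples x t"
    unfolding ideal_gen_single_eq_iff[OF S tst t(3)] stalk_units_eq by blast
  finally show ?thesis .
qed

lemma stab_trivial:
  assumes "\<And>m. \<exists>v\<in>U. homog m v"
  shows "stab x = 1"
proof -
  have "nmul 1 d \<in> H" using assms by (auto simp: H_def)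
  then have "\<not> 1 < e" using e(3)[of 1] by auto
  then show ?thesis using e(1) stab_order_eq by simp
qed

end

section \<open>Assembly of the divisor formula\<close>

context quotient_curve
begin

lemma local_equation:
  assumes z: "z \<in> closed_pts"
  shows "\<exists>t. t \<in> st z \<and> t \<noteq> 0 \<and>
    sec_div z = multiples z (t ^ (stab z - 1)) \<and>
    (\<forall>x\<in>points X. \<pi> x = \<pi> z \<longrightarrow> orb_div x z = multiples z t)"
proof -
  obtain V where "closed_fibre \<iota> \<rho> X Y \<pi> V z" using closed_fibre_exists[OF z] by blast
  then interpret F: closed_fibre \<iota> \<rho> X Y \<pi> V z .
  show ?thesis
  proof (intro exI[of _ F.t] conjI ballI impI)
    show "F.t \<in> st z" using F.tR F.Rst by blast
    show "F.t \<noteq> 0" by (rule F.t(3))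
    show "sec_div z = multiples z (F.t ^ (stab z - 1))"
      using F.section_divisor_local by (simp only: F.stab_order_eq)
    show "x \<in> points X \<Longrightarrow> \<pi> x = \<pi> z \<Longrightarrow> orb_div x z = multiples z F.t" for x
      by (rule F.orbit_divisor_fibre)
  qed
qed

text \<open>The group of degrees of homogeneous units depends only on the ring
  \<open>Ay (\<pi> x)\<close>, hence so does the stabilizer ideal.\<close>

lemma stab_order_fibre:
  assumes x: "x \<in> closed_pts" and x': "x' \<in> closed_pts" and eq: "\<pi> x = \<pi> x'"
  shows "stab x = stab x'"
proof -
  obtain V where "closed_fibre \<iota> \<rho> X Y \<pi> V x" using closed_fibre_exists[OF x] by blast
  then interpret F: closed_fibre \<iota> \<rho> X Y \<pi> V x .
  obtain V' where "closed_fibre \<iota> \<rho> X Y \<pi> V' x'" using closed_fibre_exists[OF x'] by blast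
  then interpret F': closed_fibre \<iota> \<rho> X Y \<pi> V' x' .
  show ?thesis unfolding stab_order_def F.stab_ideal_eq F'.stab_ideal_eq F.H_def F'.H_def eq ..
qed

lemma stab_order_pos:
  assumes x: "x \<in> closed_pts"
  shows "stab x \<ge> 1"
proof -
  obtain V where "closed_fibre \<iota> \<rho> X Y \<pi> V x" using closed_fibre_exists[OF x] by blast
  then interpret F: closed_fibre \<iota> \<rho> X Y \<pi> V x .
  show ?thesis using F.e(1) by (simp add: F.stab_order_eq)
qed

text \<open>Pick one nonzero homogeneous section in each of the finitely many degrees. Away from
  finitely many points all of them are units, and then the stabilizer is trivial.\<close>

lemma finite_stabilizers: "finite {x \<in> closed_pts. 1 < stab x}"
proof -
  obtain V0 where V0: "affine_open Y V0" using Y.affine_cover pi_points[OF gen(1)] by blast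
  obtain \<tau> where \<tau>: "\<And>m. \<tau> m \<in> sec X (pre V0)" "\<And>m. \<tau> m \<noteq> 0" "\<And>m. homog m (\<tau> m)"
    using homog_section[OF V0] by metis
  have ne: "nonempty_open X (pre V0)" by (rule affine_nonempty[OF pre_affine[OF V0]])
  have "pre V0 \<subseteq> points X" "pre V0 \<noteq> {}" using ne by (auto simp: in_pre nonempty_open_def)
  then have "finite (points X - pre V0)" using open_iff_cofinite ne by (simp add: nonempty_open_def)
  then have fin: "finite ((points X - pre V0) \<union> (\<Union>m\<in>UNIV. {z \<in> points X. \<tau> m \<notin> lunits (st z)}))"
    by (intro finite_UnI finite_UN_I finite_nonunits[OF \<tau>(2)]) simp_all
  show ?thesis
  proof (rule finite_subset[OF _ fin], rule subsetI, rule ccontr)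
    fix x assume x1: "x \<in> {x \<in> closed_pts. 1 < stab x}"
      and bad: "x \<notin> (points X - pre V0) \<union> (\<Union>m\<in>UNIV. {z \<in> points X. \<tau> m \<notin> lunits (st z)})"
    then have x: "x \<in> closed_pts" "1 < stab x" by auto
    note xX = closed_ptsD[OF x(1)]
    have xV: "x \<in> pre V0" and u: "\<And>m. \<tau> m \<in> lunits (st x)" using bad xX by auto
    obtain V where "closed_fibre \<iota> \<rho> X Y \<pi> V x" using closed_fibre_exists[OF x(1)] by blast
    then interpret F: closed_fibre \<iota> \<rho> X Y \<pi> V x .
    have "\<tau> m \<in> Ay (\<pi> x)" for m using Ay_sec[OF Y.affine_nonempty[OF V0]] xV \<tau>(1) by (auto simp: in_pre)
    then have "\<tau> m \<in> lunits (Ay (\<pi> x))" for m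
      using Ay_unit[OF xX _ \<tau>(3)] u by (simp add: lmax_def)
    then have "stab x = 1" using F.stab_trivial \<tau>(3) by blast
    then show False using x(2) by simp
  qed
qed

lemma generator_gen:
  assumes V: "affine_open Y V" and W: "W \<in> codifferent V"
  shows "codifferent_generator V gen W \<longleftrightarrow> W \<noteq> 0"
  using V W gen_affine[OF pre_affine[OF V]] by (auto simp: codifferent_generator_def gen(2) in_pre)

lemma section_divisor_gen: "sec_div gen = stalk_units X gen"
proof -
  obtain V where V: "affine_open Y V" using Y.affine_cover pi_points[OF gen(1)] by blast
  have "codifferent_generator V gen 1" using generator_gen[OF V one_codifferent[OF V]] by simp
  then have "f \<in> sec_div gen" if "f \<in> stalk_units X gen" for f
    unfolding section_divisor_eq[OF gen(1)] using that by (intro CollectI exI[of _ V] exI[of _ 1] exI[of _ f]) simp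
  moreover have "f \<noteq> 0" if "f \<in> sec_div gen" for f
    using that unfolding section_divisor_eq[OF gen(1)] by (auto simp: codifferent_generator_def stalk_units_def)
  ultimately show ?thesis by (auto simp: gen_units)
qed

lemma points_cases: "z \<in> points X \<Longrightarrow> z = gen \<or> z \<in> closed_pts"
  by (auto simp: closed_pts_def)

lemma invertible: "omega_invertible X Y \<pi>"
  unfolding omega_invertible_def
proof
  fix z assume z: "z \<in> points X"
  have "\<exists>V W. codifferent_generator V z W"
  proof (cases "z = gen")
    case True
    obtain V where V: "affine_open Y V" using Y.affine_cover pi_points[OF gen(1)] by blast
    then show ?thesis using True generator_gen[OF V one_codifferent[OF V]] by auto
  next
    case False
    then have "z \<in> closed_pts" using points_cases[OF z] by blast
    then obtain V where V: "closed_fibre \<iota> \<rho> X Y \<pi> V z" using closed_fibre_exists by blast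
    show ?thesis using closed_fibre.generator_exists[OF V] by blast
  qed
  then show "\<exists>V u. omega_generator X Y \<pi> V z u" using omega_generator_iff[OF z] by blast
qed

lemma effectiveI:
  assumes D: "\<And>x. x \<in> points X \<Longrightarrow> \<exists>e\<in>st x. e \<noteq> 0 \<and> D x = multiples x e"
    and fin: "finite {x \<in> points X. D x \<noteq> stalk_units X x}"
  shows "effective_cartier_divisor X D"
  unfolding effective_cartier_divisor_def
proof
  show "cartier_divisor X D" using D by (intro cartier_divisorI fin) blast
  show "\<forall>x\<in>points X. D x \<subseteq> stalk X x"
  proof
    fix x assume x: "x \<in> points X"
    obtain e where "e \<in> st x" "D x = multiples x e" using D[OF x] by blast
    then show "D x \<subseteq> st x" using subring_mult[OF stalk_subring[OF x]] by (auto simp: stalk_units_def)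
  qed
qed

lemma section_effective: "effective_cartier_divisor X (sec_div)"
proof (rule effectiveI)
  fix z assume z: "z \<in> points X"
  show "\<exists>e\<in>st z. e \<noteq> 0 \<and> sec_div z = multiples z e"
  proof (cases "z = gen")
    case True
    then show ?thesis using section_divisor_gen subring_1[OF stalk_subring[OF z]] by (intro bexI[of _ 1]) auto
  next
    case False
    then obtain t where "t \<in> st z" "t \<noteq> 0"
      "sec_div z = multiples z (t ^ (stab z - 1))"
      using local_equation points_cases[OF z] by blast
    then show ?thesis using subring_power[OF stalk_subring[OF z]]
      by (intro bexI[of _ "t ^ (stab z - 1)"]) auto
  qed
next
  show "finite {z \<in> points X. sec_div z \<noteq> stalk_units X z}"
  proof (rule finite_subset[OF _ finite_stabilizers], rule subsetI)
    fix z assume z: "z \<in> {z \<in> points X. sec_div z \<noteq> stalk_units X z}"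
    then have zc: "z \<in> closed_pts" using points_cases section_divisor_gen by blast
    have "stab z \<noteq> 1"
    proof
      assume "stab z = 1"
      then have "sec_div z = stalk_units X z" using local_equation[OF zc] by auto
      then show False using z by simp
    qed
    then show "z \<in> {x \<in> closed_pts. 1 < stab x}" using zc stab_order_pos[OF zc] by simp
  qed
qed

lemma orbit_effective:
  assumes x: "x \<in> closed_pts"
  shows "effective_cartier_divisor X (orb_div x)"
proof (rule effectiveI)
  note xX = closed_ptsD[OF x]
  fix z assume z: "z \<in> points X"
  show "\<exists>e\<in>st z. e \<noteq> 0 \<and> orb_div x z = multiples z e"
  proof (cases "\<pi> x = \<pi> z")
    case True
    then have "z \<in> closed_pts" by (rule fibre_closed[OF x z])
    then obtain t where t: "t \<in> st z" "t \<noteq> 0"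
      "\<forall>x\<in>points X. \<pi> x = \<pi> z \<longrightarrow> orb_div x z = multiples z t"
      by (elim local_equation[THEN exE] conjE)
    show ?thesis using t(1,2) t(3)[rule_format, OF xX True] by (intro bexI[of _ t] conjI)
  next
    case False
    then show ?thesis using orbit_divisor_off[OF x z] subring_1[OF stalk_subring[OF z]] by (intro bexI[of _ 1]) auto
  qed
next
  note xX = closed_ptsD[OF x]
  obtain V where V: "affine_open Y V" "\<pi> x \<in> V" using Y.affine_cover pi_points[OF xX] by blast
  then have xV: "x \<in> pre V" using xX by (simp add: in_pre)
  obtain g where g: "g \<in> sec Y V" "g \<in> mx x" "g \<noteq> 0" using closed_invariant[OF V(1) xV x] by blast
  have gst: "g \<in> Y.st (\<pi> x)" using g(1) Y.affine_sec_stalk[OF V] by blast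
  show "finite {z \<in> points X. orb_div x z \<noteq> stalk_units X z}"
  proof (rule finite_subset[OF _ finite_nonunits[OF g(3)]], rule subsetI)
    fix z assume "z \<in> {z \<in> points X. orb_div x z \<noteq> stalk_units X z}"
    then have z: "z \<in> points X" "\<pi> x = \<pi> z" using orbit_divisor_off[OF x] by auto
    have "g \<in> mx z" using fibre_mx[OF xX z gst] g(2) by blast
    then show "z \<in> {z \<in> points X. g \<notin> lunits (st z)}" using z(1) by (simp add: lmax_def)
  qed
qed

text \<open>At a closed point \<open>z\<close> a single summand is visible, that of the
  representative of its orbit; both sides are then powers of the same local equation. At
  \<open>gen\<close> everything is trivial.\<close>

lemma divisor_formula:
  assumes T: "T \<subseteq> closed_pts" and bij: "bij_betw (orb) T (orb ` closed_pts)" and z: "z \<in> points X"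
  shows "sec_div z =
    divisor_sum X {x \<in> T. 1 < stab x} (\<lambda>x. stab x - 1) (orb_div) z"
proof -
  let ?S = "{x \<in> T. 1 < stab x}" and ?n = "\<lambda>x. stab x - 1"
  have fin: "finite ?S" by (rule finite_subset[OF _ finite_stabilizers]) (use T in blast)
  show ?thesis
  proof (cases "z = gen")
    case True
    have off: "orb_div x z = multiples z 1" if "x \<in> ?S" for x
    proof -
      have xc: "x \<in> closed_pts" using that T by blast
      have "\<pi> x \<noteq> \<pi> z" using fibre_closed[OF xc z] True by (auto simp: closed_pts_def)
      then show ?thesis using orbit_divisor_off[OF xc z] by simp
    qed
    show ?thesis
      using divisor_sum_cosets[where D = "orb_div" and E = "\<lambda>_. 1" and n = ?n, OF z fin off]
      by (simp add: True section_divisor_gen)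
  next
    case False
    then have zc: "z \<in> closed_pts" using points_cases[OF z] by blast
    obtain t where t: "sec_div z = multiples z (t ^ ?n z)"
      "\<forall>x\<in>points X. \<pi> x = \<pi> z \<longrightarrow> orb_div x z = multiples z t"
      using local_equation[OF zc] by (elim exE conjE)
    have "orb z \<in> orb ` T" using bij zc by (auto simp: bij_betw_def)
    then obtain x0 where x0: "x0 \<in> T" "orb x0 = orb z" by (auto simp: image_iff)
    have x0c: "x0 \<in> closed_pts" using x0(1) T by blast
    have pi0: "\<pi> x0 = \<pi> z" using orbit_eq_iff[OF x0c zc] x0(2) by blast
    have inj: "inj_on (orb) T" using bij by (simp add: bij_betw_def)
    have uniq: "x = x0" if x: "x \<in> T" "\<pi> x = \<pi> z" for x
    proof -
      have "orb x = orb x0" using orbit_eq_iff[of x x0] x T x0c pi0 by auto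
      then show ?thesis using inj x(1) x0(1) by (auto dest: inj_onD)
    qed
    \<comment> \<open>Local equations at \<open>z\<close>: the orbits of the other representatives
      do not pass through \<open>z\<close>, so 1 serves for them.\<close>
    define E where "E x = (if x = x0 then t else 1)" for x
    have D: "orb_div x z = multiples z (E x)" if "x \<in> ?S" for x
    proof (cases "x = x0")
      case True
      then show ?thesis using t(2)[rule_format, OF closed_ptsD[OF x0c] pi0] by (simp add: E_def)
    next
      case False
      have xc: "x \<in> closed_pts" using that T by blast
      have "\<pi> x \<noteq> \<pi> z" using uniq False that by blast
      then show ?thesis using orbit_divisor_off[OF xc z] False by (simp add: E_def)
    qed
    have nz: "?n z = ?n x0" using stab_order_fibre[OF x0c zc pi0] by simp
    have "(\<Prod>x\<in>?S. E x ^ ?n x) = (\<Prod>x\<in>?S. if x = x0 then t ^ ?n x0 else 1)"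
      by (rule prod.cong) (auto simp: E_def)
    also have "\<dots> = (if x0 \<in> ?S then t ^ ?n x0 else 1)" using fin by (simp add: prod.delta)
    \<comment> \<open>If \<open>x0\<close> has trivial stabilizer it is left out of the index set,
      but then the exponent is zero and the power is 1 as well.\<close>
    also have "\<dots> = t ^ ?n x0" using x0(1) stab_order_pos[OF x0c] by auto
    finally have "(\<Prod>x\<in>?S. E x ^ ?n x) = t ^ ?n z" using nz by simp
    then show ?thesis
      using divisor_sum_cosets[where D = "orb_div" and E = E and n = ?n, OF z fin D] t(1) by simp
  qed
qed

end

theorem theorem2:
  fixes \<iota> :: "'k::alg_closed_field \<Rightarrow> 'f::field"
    and \<rho> :: "'f \<Rightarrow> ('m::{ab_group_add,finite} \<Rightarrow>\<^sub>0 'f)"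
    and X :: "('x, 'f) ischeme"
    and Y :: "('y, 'f) ischeme"
    and \<pi> :: "'x \<Rightarrow> 'y"
  assumes "CHAR('k) > 0"
    and "curve \<iota> X"
    and "G_variety \<iota> X \<rho>"
    and "G_normal \<iota> X \<rho>"
    and "faithful_action \<iota> \<rho>"
    and "is_quotient \<iota> X \<rho> Y \<pi>"
  shows "omega_invertible X Y \<pi> \<and>
    omega_linearization X \<rho> Y \<pi> (omega_coaction X \<rho> \<pi>) \<and>
    trace_invariant X Y \<pi> (omega_coaction X \<rho> \<pi>) \<and>
    (\<exists>s. invariant_projection X \<rho> Y \<pi> s \<and>
      (\<forall>s'. invariant_projection X \<rho> Y \<pi> s' \<longrightarrow> s' = s) \<and>
      invariant_section X Y \<pi> (omega_coaction X \<rho> \<pi>) s \<and>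
      effective_cartier_divisor X (section_divisor X Y \<pi> s) \<and>
      (\<forall>R. R \<subseteq> rational_points \<iota> X \<and>
           bij_betw (orbit \<iota> X \<rho>) R (orbit \<iota> X \<rho> ` rational_points \<iota> X) \<longrightarrow>
        (\<forall>x\<in>R. effective_cartier_divisor X (orbit_divisor \<iota> X \<rho> x)) \<and>
        finite {x \<in> R. 1 < stab_order \<iota> X \<rho> x} \<and>
        (\<forall>z\<in>points X. section_divisor X Y \<pi> s z =
           divisor_sum X {x \<in> R. 1 < stab_order \<iota> X \<rho> x}
             (\<lambda>x. stab_order \<iota> X \<rho> x - 1) (orbit_divisor \<iota> X \<rho>) z)))"
proof -
  interpret quotient_curve \<iota> \<rho> X Y \<pi> using assms(2-6) by (rule quotient_curve.intro)
  show ?thesis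
    unfolding rational_points_eq
    by (intro conjI exI[of _ "wcomp 0"] allI impI ballI invertible linearization trace projection projection_unique
      invariant_proj_section section_effective)
      (assumption | (rule orbit_effective, blast) | (rule finite_subset[OF _ finite_stabilizers], blast) |
        (elim conjE, rule divisor_formula))+
qed

end
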